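(* Let $F$ be a field of characteristic zero, $UT_2$ the algebra of $2\times 2$ upper triangular matrices over $F$, and $\delta$ the inner derivation of $UT_2$ given by $\delta(a)=2^{-1}[e_{12},a]$ for all $a\in UT_2$, where $e_{12}$ is the matrix unit. Let $L=F\delta$ be the one-dimensional Lie algebra spanned by $\delta$ and let $UT_2^\delta$ denote $UT_2$ regarded as an $L$-algebra. Then: (1) $\mathrm{Id}^L(UT_2^\delta)=\langle [x,y][z,w],\ [x,y]^\delta,\ x^\delta[y,z],\ x^\delta y^\delta,\ x^{\delta^2}\rangle_{T_L}$; (2) $c_n^L(UT_2^\delta)=2^{n-1}n+1$ for all $n\geq 1$; (3) if $\chi_n^L(UT_2^\delta)=\sum_{\lambda\vdash n}m_\lambda^\delta\chi_\lambda$ is the $n$th differential cocharacter of $UT_2^\delta$ ($n\ge 1$), then $$m_\lambda^\delta=\begin{cases} n+1, & \text{if } \lambda=(n),\\ 2(q+1), & \text{if } \lambda=(p+q,p) \text{ with } p\geq 1,\ q\geq 0,\\ q+1, & \text{if } \lambda=(p+q,p,1) \text{ with } p\ge 1,\ q\ge 0,\\ 0, & \text{in all other cases.}\end{cases}$$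
   Context: An $L$-algebra is an associative algebra $A$ over $F$ on which a Lie algebra $L$ acts by derivations; the action extends to the universal enveloping algebra $U(L)$, products acting by composition, i.e. $(gh)(a)=g(h(a))$. Fix a basis $\mathcal B\ni 1$ of $U(L)$. $F\langle X|L\rangle$ is the free associative algebra (without constant terms) on the free generators $x_j^{h}$, $h\in\mathcal B$, $j\in\mathbb N$; one writes $x_j=x_j^1$ and extends $x_j^h$ linearly to all $h\in U(L)$. $U(L)$ acts on it with each $\gamma\in L$ acting as the derivation with $\gamma(x_j^h)=x_j^{\gamma h}$; for a polynomial $f$ and $h\in U(L)$, $f^h=h(f)$. Elements are differential polynomials; $f(x_1,\dots,x_n)$ is a differential identity of $A$ if it vanishes under all substitutions $x_i\mapsto a_i\in A$ (with $x_i^h\mapsto h(a_i)$). $\mathrm{Id}^L(A)$ is the set of differential identities of $A$. A $T_L$-ideal is a two-sided ideal of $F\langle X|L\rangle$ stable under the $U(L)$-action and under all substitutions $x_j\mapsto g_j\in F\langle X|L\rangle$ (with $x_j^h\mapsto h(g_j)$); $\langle S\rangle_{T_L}$ is the $T_L$-ideal generated by $S$. Letters $x,y,z,w$ denote distinct variables of $X=\{x_1,x_2,\dots\}$, and $[a,b]=ab-ba$. $P_n^L=\mathrm{span}_F\{x_{\sigma(1)}^{h_1}\cdots x_{\sigma(n)}^{h_n}\mid \sigma\in S_n,\ h_i\in\mathcal B\}$ is the space of multilinear differential polynomials in $x_1,\dots,x_n$, with $S_n$ acting by $\sigma(x_i^h)=x_{\sigma(i)}^h$. The $n$th differential codimension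 is $c_n^L(A)=\dim_F P_n^L/(P_n^L\cap \mathrm{Id}^L(A))$ and the $n$th differential cocharacter $\chi_n^L(A)$ is the $S_n$-character of this quotient. For $\lambda\vdash n$, $\chi_\lambda$ is the irreducible $S_n$-character associated to $\lambda$. *)

theory Defs
  imports
    "HOL-Analysis.Cartesian_Space"
    "HOL-Library.Poly_Mapping"
    "HOL-Combinatorics.Permutations"
begin

text \<open>
  Words form the free monoid, written additively, so that finitely supported functions on words
  carry the convolution product of \<^theory>\<open>HOL-Library.Poly_Mapping\<close> and thus form the free
  unital associative algebra.
\<close>

datatype 'g fword = FWord (letters: "'g list")

instantiation fword :: (type) monoid_add
begin

definition "0 = FWord []"
definition "u + v = FWord (letters u @ letters v)"

instance
  by standard (auto simp: zero_fword_def plus_fword_def)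

end

type_synonym ('g, 'a) free_alg = "'g fword \<Rightarrow>\<^sub>0 'a"

definition smul :: "'a::comm_ring_1 \<Rightarrow> ('k \<Rightarrow>\<^sub>0 'a) \<Rightarrow> ('k \<Rightarrow>\<^sub>0 'a)"
  where "smul c f = Poly_Mapping.map (\<lambda>d. c * d) f"

definition letter :: "'g \<Rightarrow> ('g, 'a::comm_ring_1) free_alg"
  where "letter g = Poly_Mapping.single (FWord [g]) 1"

text \<open>The free unital algebra on a set of letters, and the same without constant terms.\<close>

definition free1 :: "'g set \<Rightarrow> ('g, 'a::comm_ring_1) free_alg set"
  where "free1 G = {f. \<forall>w\<in>Poly_Mapping.keys f. set (letters w) \<subseteq> G}"

definition free0 :: "'g set \<Rightarrow> ('g, 'a::comm_ring_1) free_alg set"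
  where "free0 G = {f \<in> free1 G. Poly_Mapping.lookup f (FWord []) = 0}"

definition comm :: "'r::ring \<Rightarrow> 'r \<Rightarrow> 'r"
  where "comm a b = a * b - b * a"

text \<open>Two-sided ideals (linear subspaces included) of a subalgebra \<open>A\<close> of an algebra.\<close>

definition alg_ideal :: "('a \<Rightarrow> 'r \<Rightarrow> 'r) \<Rightarrow> 'r::ring set \<Rightarrow> 'r set \<Rightarrow> bool"
  where "alg_ideal sc A I \<longleftrightarrow>
    I \<subseteq> A \<and> 0 \<in> I \<and> (\<forall>x\<in>I. \<forall>y\<in>I. x + y \<in> I) \<and> (\<forall>c. \<forall>x\<in>I. sc c x \<in> I) \<and>
    (\<forall>x\<in>I. \<forall>a\<in>A. a * x \<in> I \<and> x * a \<in> I)"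

text \<open>
  A quotient \<open>V/W\<close> is handled through representatives: \<open>B\<close> is a (possibly infinite) subset of \<open>V\<close>
  whose classes form a basis of \<open>V/W\<close>. For an infinite-dimensional quotient \<open>quot_dim\<close> and
  \<open>quot_trace\<close> are \<open>0\<close>; otherwise they do not depend on the chosen basis.
\<close>

definition represents ::
    "('a \<Rightarrow> 'v \<Rightarrow> 'v) \<Rightarrow> 'v::ab_group_add set \<Rightarrow> 'v set \<Rightarrow> 'v \<Rightarrow> ('v \<Rightarrow>\<^sub>0 'a::comm_ring_1) \<Rightarrow> bool"
  where "represents sc W B v c \<longleftrightarrow>
    Poly_Mapping.keys c \<subseteq> B \<and>
    v - (\<Sum>b\<in>Poly_Mapping.keys c. sc (Poly_Mapping.lookup c b) b) \<in> W"

definition quot_basis ::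
    "('a::comm_ring_1 \<Rightarrow> 'v \<Rightarrow> 'v) \<Rightarrow> 'v::ab_group_add set \<Rightarrow> 'v set \<Rightarrow> 'v set \<Rightarrow> bool"
  where "quot_basis sc V W B \<longleftrightarrow> B \<subseteq> V \<and> (\<forall>v\<in>V. \<exists>!c. represents sc W B v c)"

definition quot_coords ::
    "('a::comm_ring_1 \<Rightarrow> 'v \<Rightarrow> 'v) \<Rightarrow> 'v::ab_group_add set \<Rightarrow> 'v set \<Rightarrow> 'v \<Rightarrow> ('v \<Rightarrow>\<^sub>0 'a)"
  where "quot_coords sc W B v = (THE c. represents sc W B v c)"

definition quot_dim ::
    "('a::comm_ring_1 \<Rightarrow> 'v \<Rightarrow> 'v) \<Rightarrow> 'v::ab_group_add set \<Rightarrow> 'v set \<Rightarrow> nat"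
  where "quot_dim sc V W = card (SOME B. quot_basis sc V W B)"

text \<open>Trace of the endomorphism of \<open>V/W\<close> induced by \<open>f\<close>.\<close>

definition quot_trace ::
    "('a::comm_ring_1 \<Rightarrow> 'v \<Rightarrow> 'v) \<Rightarrow> 'v::ab_group_add set \<Rightarrow> 'v set \<Rightarrow> ('v \<Rightarrow> 'v) \<Rightarrow> 'a"
  where "quot_trace sc V W f =
    (let B = (SOME B. quot_basis sc V W B)
     in \<Sum>b\<in>B. Poly_Mapping.lookup (quot_coords sc W B (f b)) b)"

definition derivation :: "('a \<Rightarrow> 'b \<Rightarrow> 'b) \<Rightarrow> ('b::ring \<Rightarrow> 'b) \<Rightarrow> bool"
  where "derivation sc d \<longleftrightarrow>
    (\<forall>a b. d (a + b) = d a + d b) \<and> (\<forall>c a. d (sc c a) = sc c (d a)) \<and>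
    (\<forall>a b. d (a * b) = d a * b + a * d b)"

definition lie_bracket :: "('b::ring \<Rightarrow> 'b) \<Rightarrow> ('b \<Rightarrow> 'b) \<Rightarrow> ('b \<Rightarrow> 'b)"
  where "lie_bracket d e = (\<lambda>a. d (e a) - e (d a))"

definition lie_algebra_of_derivations :: "('a \<Rightarrow> 'b \<Rightarrow> 'b) \<Rightarrow> ('b::ring \<Rightarrow> 'b) set \<Rightarrow> bool"
  where "lie_algebra_of_derivations sc L \<longleftrightarrow>
    (\<forall>d\<in>L. derivation sc d) \<and> (\<lambda>a. 0) \<in> L \<and>
    (\<forall>d\<in>L. \<forall>e\<in>L. \<forall>k l. (\<lambda>a. sc k (d a) + sc l (e a)) \<in> L) \<and>
    (\<forall>d\<in>L. \<forall>e\<in>L. lie_bracket d e \<in> L)"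

text \<open>
  \<open>U(L)\<close> is presented with the elements of \<open>L\<close> as generators, subject to the linear relations of
  \<open>L\<close> and to \<open>de - ed = [d,e]\<close>. Its elements are given by representatives in the free algebra
  \<open>free1 L\<close>, modulo the ideal \<open>env_ideal sc L\<close>.
\<close>

definition env_rels ::
    "('a::field \<Rightarrow> 'b \<Rightarrow> 'b) \<Rightarrow> ('b::ring \<Rightarrow> 'b) set \<Rightarrow> ('b \<Rightarrow> 'b, 'a) free_alg set"
  where "env_rels sc L =
    {letter (\<lambda>a. sc k (d a) + sc l (e a)) - (smul k (letter d) + smul l (letter e))
      | k l d e. d \<in> L \<and> e \<in> L} \<union>
    {comm (letter d) (letter e) - letter (lie_bracket d e) | d e. d \<in> L \<and> e \<in> L}"

definition env_ideal ::
    "('a::field \<Rightarrow> 'b \<Rightarrow> 'b) \<Rightarrow> ('b::ring \<Rightarrow> 'b) set \<Rightarrow> ('b \<Rightarrow> 'b, 'a) free_alg set"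
  where "env_ideal sc L = \<Inter>{I. alg_ideal smul (free1 L) I \<and> env_rels sc L \<subseteq> I}"

definition env_basis ::
    "('a::field \<Rightarrow> 'b \<Rightarrow> 'b) \<Rightarrow> ('b::ring \<Rightarrow> 'b) set \<Rightarrow> ('b \<Rightarrow> 'b, 'a) free_alg set \<Rightarrow> bool"
  where "env_basis sc L B \<longleftrightarrow> quot_basis smul (free1 L) (env_ideal sc L) B"

text \<open>
  Extension of an action of the elements of \<open>L\<close> on a vector space to \<open>U(L)\<close>, products acting by
  composition.
\<close>

definition env_act ::
    "('d \<Rightarrow> 'v \<Rightarrow> 'v) \<Rightarrow> ('a \<Rightarrow> 'v \<Rightarrow> 'v) \<Rightarrow> ('d, 'a::comm_ring_1) free_alg \<Rightarrow> 'v \<Rightarrow> 'v::ab_group_add"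
  where "env_act act sc h v =
    (\<Sum>w\<in>Poly_Mapping.keys h. sc (Poly_Mapping.lookup h w) (foldr act (letters w) v))"

text \<open>
  The free generator \<open>x\<^sub>j\<^sup>b\<close>, for \<open>b\<close> in the chosen basis of \<open>U(L)\<close>, is the letter \<open>(j, b)\<close>.
\<close>

type_synonym ('b, 'a) dpoly = "(nat \<times> ('b \<Rightarrow> 'b, 'a) free_alg, 'a) free_alg"

context
  fixes sc :: "'a::field \<Rightarrow> 'b::ring_1 \<Rightarrow> 'b"
    and L :: "('b \<Rightarrow> 'b) set"
    and B :: "('b \<Rightarrow> 'b, 'a) free_alg set"
begin

definition dpolys :: "('b, 'a) dpoly set"
  where "dpolys = free0 (UNIV \<times> B)"

text \<open>\<open>x\<^sub>j\<^sup>h\<close> for an arbitrary \<open>h\<close> in \<open>U(L)\<close>, by linear extension.\<close>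

definition dvar :: "nat \<Rightarrow> ('b \<Rightarrow> 'b, 'a) free_alg \<Rightarrow> ('b, 'a) dpoly"
  where "dvar j h =
    (let c = quot_coords smul (env_ideal sc L) B h
     in \<Sum>b\<in>Poly_Mapping.keys c. smul (Poly_Mapping.lookup c b) (letter (j, b)))"

text \<open>The derivation of the free algebra with \<open>x\<^sub>j\<^sup>h \<mapsto> x\<^sub>j\<^sup>\<gamma>\<^sup>h\<close>.\<close>

fun der_word ::
    "('b \<Rightarrow> 'b) \<Rightarrow> (nat \<times> ('b \<Rightarrow> 'b, 'a) free_alg) list \<Rightarrow> ('b, 'a) dpoly"
  where
    "der_word \<gamma> [] = 0"
  | "der_word \<gamma> ((j, b) # w) =
      dvar j (letter \<gamma> * b) * Poly_Mapping.single (FWord w) 1 + letter (j, b) * der_word \<gamma> w"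

definition dpoly_der :: "('b \<Rightarrow> 'b) \<Rightarrow> ('b, 'a) dpoly \<Rightarrow> ('b, 'a) dpoly"
  where "dpoly_der \<gamma> f =
    (\<Sum>w\<in>Poly_Mapping.keys f. smul (Poly_Mapping.lookup f w) (der_word \<gamma> (letters w)))"

text \<open>\<open>f\<^sup>h\<close>\<close>

definition dpoly_act :: "('b \<Rightarrow> 'b, 'a) free_alg \<Rightarrow> ('b, 'a) dpoly \<Rightarrow> ('b, 'a) dpoly"
  where "dpoly_act h f = env_act dpoly_der smul h f"

text \<open>Substitutions \<open>x\<^sub>j\<^sup>h \<mapsto> h(g\<^sub>j)\<close> with values in \<open>F\<langle>X|L\<rangle>\<close>, respectively in the \<open>L\<close>-algebra.\<close>

definition dsubst :: "(nat \<Rightarrow> ('b, 'a) dpoly) \<Rightarrow> ('b, 'a) dpoly \<Rightarrow> ('b, 'a) dpoly"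
  where "dsubst g f =
    (\<Sum>w\<in>Poly_Mapping.keys f. smul (Poly_Mapping.lookup f w)
       (prod_list (map (\<lambda>(j, b). dpoly_act b (g j)) (letters w))))"

definition deval :: "(nat \<Rightarrow> 'b) \<Rightarrow> ('b, 'a) dpoly \<Rightarrow> 'b"
  where "deval a f =
    (\<Sum>w\<in>Poly_Mapping.keys f. sc (Poly_Mapping.lookup f w)
       (prod_list (map (\<lambda>(j, b). env_act (\<lambda>\<gamma>. \<gamma>) sc b (a j)) (letters w))))"

definition diff_ids :: "('b, 'a) dpoly set"
  where "diff_ids = {f \<in> dpolys. \<forall>a. deval a f = 0}"

definition T_ideal :: "('b, 'a) dpoly set \<Rightarrow> bool"
  where "T_ideal I \<longleftrightarrow>
    alg_ideal smul dpolys I \<and>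
    (\<forall>h\<in>free1 L. \<forall>f\<in>I. dpoly_act h f \<in> I) \<and>
    (\<forall>g. (\<forall>j. g j \<in> dpolys) \<longrightarrow> (\<forall>f\<in>I. dsubst g f \<in> I))"

definition T_ideal_gen :: "('b, 'a) dpoly set \<Rightarrow> ('b, 'a) dpoly set"
  where "T_ideal_gen S = \<Inter>{I. T_ideal I \<and> S \<subseteq> I}"

definition multilinear :: "nat \<Rightarrow> ('b, 'a) dpoly set"
  where "multilinear n = module.span smul
    {prod_list (map (\<lambda>i. letter (\<sigma> i, h i)) [1..<Suc n]) | \<sigma> h.
       \<sigma> permutes {1..n} \<and> (\<forall>i\<in>{1..n}. h i \<in> B)}"

text \<open>The renaming \<open>x\<^sub>j\<^sup>h \<mapsto> x\<^sub>\<sigma>\<^sub>(\<^sub>j\<^sub>)\<^sup>h\<close>.\<close>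

definition dpoly_perm :: "(nat \<Rightarrow> nat) \<Rightarrow> ('b, 'a) dpoly \<Rightarrow> ('b, 'a) dpoly"
  where "dpoly_perm \<sigma> f =
    (\<Sum>w\<in>Poly_Mapping.keys f.
       Poly_Mapping.single (FWord (map (\<lambda>(j, b). (\<sigma> j, b)) (letters w))) (Poly_Mapping.lookup f w))"

definition codimension :: "nat \<Rightarrow> nat"
  where "codimension n = quot_dim smul (multilinear n) (multilinear n \<inter> diff_ids)"

definition cocharacter :: "nat \<Rightarrow> (nat \<Rightarrow> nat) \<Rightarrow> 'a"
  where "cocharacter n \<sigma> =
    quot_trace smul (multilinear n) (multilinear n \<inter> diff_ids) (dpoly_perm \<sigma>)"

end

definition partitions :: "nat \<Rightarrow> nat list set"
  where "partitions n = {\<mu>. sorted_wrt (\<ge>) \<mu> \<and> (\<forall>k\<in>set \<mu>. 1 \<le> k) \<and> sum_list \<mu> = n}"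

text \<open>
  The tableau of shape \<open>\<mu>\<close> filled with \<open>1, \<dots>, n\<close> row by row; rows and columns are
  numbered from \<open>0\<close>.
\<close>

definition tableau :: "nat list \<Rightarrow> nat \<Rightarrow> nat \<Rightarrow> nat"
  where "tableau \<mu> i j = sum_list (take i \<mu>) + j + 1"

definition tab_row :: "nat list \<Rightarrow> nat \<Rightarrow> nat set"
  where "tab_row \<mu> i = {tableau \<mu> i j | j. i < length \<mu> \<and> j < \<mu> ! i}"

definition tab_col :: "nat list \<Rightarrow> nat \<Rightarrow> nat set"
  where "tab_col \<mu> j = {tableau \<mu> i j | i. i < length \<mu> \<and> j < \<mu> ! i}"

definition row_group :: "nat list \<Rightarrow> (nat \<Rightarrow> nat) set"
  where "row_group \<mu> = {\<rho>. \<rho> permutes {1..sum_list \<mu>} \<and> (\<forall>i. \<rho> ` tab_row \<mu> i = tab_row \<mu> i)}"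

definition col_group :: "nat list \<Rightarrow> (nat \<Rightarrow> nat) set"
  where "col_group \<mu> = {\<kappa>. \<kappa> permutes {1..sum_list \<mu>} \<and> (\<forall>j. \<kappa> ` tab_col \<mu> j = tab_col \<mu> j)}"

text \<open>
  Elements of the group algebra are finitely supported functions on permutations;
  \<open>perm_lmult \<sigma>\<close> is left multiplication by the group element \<open>\<sigma>\<close>.
\<close>

definition young_symmetrizer :: "nat list \<Rightarrow> (nat \<Rightarrow> nat) \<Rightarrow>\<^sub>0 'a::comm_ring_1"
  where "young_symmetrizer \<mu> =
    (\<Sum>\<rho>\<in>row_group \<mu>. \<Sum>\<kappa>\<in>col_group \<mu>. Poly_Mapping.single (\<rho> \<circ> \<kappa>) (of_int (sign \<kappa>)))"

definition perm_lmult ::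
    "(nat \<Rightarrow> nat) \<Rightarrow> ((nat \<Rightarrow> nat) \<Rightarrow>\<^sub>0 'a) \<Rightarrow> ((nat \<Rightarrow> nat) \<Rightarrow>\<^sub>0 'a::comm_ring_1)"
  where "perm_lmult \<sigma> f =
    (\<Sum>\<tau>\<in>Poly_Mapping.keys f. Poly_Mapping.single (\<sigma> \<circ> \<tau>) (Poly_Mapping.lookup f \<tau>))"

text \<open>The minimal left ideal generated by the Young symmetrizer, and its character.\<close>

definition specht_module :: "nat list \<Rightarrow> ((nat \<Rightarrow> nat) \<Rightarrow>\<^sub>0 'a::comm_ring_1) set"
  where "specht_module \<mu> = module.span smul
    {perm_lmult \<sigma> (young_symmetrizer \<mu>) | \<sigma>. \<sigma> permutes {1..sum_list \<mu>}}"

definition irr_char :: "nat list \<Rightarrow> (nat \<Rightarrow> nat) \<Rightarrow> 'a::field"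
  where "irr_char \<mu> \<sigma> = quot_trace smul (specht_module \<mu>) {0} (perm_lmult \<sigma>)"

typedef (overloaded) 'a ut2 = "{M :: ('a::field)^2^2. M $ 2 $ 1 = 0}"
  by (rule exI[of _ 0]) simp

setup_lifting type_definition_ut2

instantiation ut2 :: (field) ring_1
begin

lift_definition zero_ut2 :: "'a ut2" is 0 by simp
lift_definition one_ut2 :: "'a ut2" is "mat 1" by (simp add: mat_def)
lift_definition plus_ut2 :: "'a ut2 \<Rightarrow> 'a ut2 \<Rightarrow> 'a ut2" is "(+)" by simp
lift_definition minus_ut2 :: "'a ut2 \<Rightarrow> 'a ut2 \<Rightarrow> 'a ut2" is "(-)" by simp
lift_definition uminus_ut2 :: "'a ut2 \<Rightarrow> 'a ut2" is uminus by simp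
lift_definition times_ut2 :: "'a ut2 \<Rightarrow> 'a ut2 \<Rightarrow> 'a ut2" is "(**)"
  by (simp add: matrix_matrix_mult_def sum_2)

instance
proof
  fix a b c :: "'a ut2"
  show "a + b + c = a + (b + c)" by transfer (simp add: add.assoc)
  show "a + b = b + a" by transfer (simp add: add.commute)
  show "0 + a = a" by transfer simp
  show "- a + a = 0" by transfer simp
  show "a - b = a + - b" by transfer simp
  show "a * b * c = a * (b * c)" by transfer (simp add: matrix_mul_assoc)
  show "1 * a = a" by transfer simp
  show "a * 1 = a" by transfer simp
  show "(a + b) * c = a * c + b * c"
    by transfer (simp add: vec_eq_iff matrix_matrix_mult_def sum.distrib algebra_simps)
  show "a * (b + c) = a * b + a * c" by transfer (simp add: matrix_add_ldistrib)
  show "(0 :: 'a ut2) \<noteq> 1" by transfer (auto simp: vec_eq_iff mat_def)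
qed

end

lift_definition ut2_scale :: "'a::field \<Rightarrow> 'a ut2 \<Rightarrow> 'a ut2" is "\<lambda>c M. \<chi> i j. c * M $ i $ j"
  by simp

lift_definition e12 :: "'a::field ut2" is "\<chi> i j. if i = 1 \<and> j = 2 then 1 else 0"
  by simp

definition ut2_delta :: "'a::field ut2 \<Rightarrow> 'a ut2"
  where "ut2_delta a = ut2_scale (inverse 2) (comm e12 a)"

definition ut2_L :: "('a::field ut2 \<Rightarrow> 'a ut2) set"
  where "ut2_L = {\<lambda>a. ut2_scale c (ut2_delta a) | c. True}"

lemma ut2_scale_simps:
  "ut2_scale c (a + b) = ut2_scale c a + ut2_scale c b"
  "ut2_scale (c + d) a = ut2_scale c a + ut2_scale d a"
  "ut2_scale c (ut2_scale d a) = ut2_scale (c * d) a"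
  "ut2_scale c a * b = ut2_scale c (a * b)"
  "a * ut2_scale c b = ut2_scale c (a * b)"
  "ut2_scale 0 a = 0"
  by (transfer, simp add: vec_eq_iff matrix_matrix_mult_def sum_distrib_left algebra_simps)+

lemma ut2_scale_diff: "ut2_scale c (a - b) = ut2_scale c a - ut2_scale c b"
  by (transfer, simp add: vec_eq_iff algebra_simps)

lemma lie_algebra_of_derivations_ut2_L: "lie_algebra_of_derivations ut2_scale ut2_L"
proof -
  have der: "derivation ut2_scale (\<lambda>a. ut2_scale c (ut2_delta a))" for c :: 'a
    unfolding derivation_def ut2_delta_def comm_def
    by (auto simp: ut2_scale_simps ut2_scale_diff algebra_simps)
  have "(\<lambda>a. ut2_scale k (d a) + ut2_scale l (e a)) \<in> ut2_L"
    if de: "d \<in> ut2_L" "e \<in> ut2_L" for d e and k l :: 'a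
  proof -
    obtain p q where "d = (\<lambda>a. ut2_scale p (ut2_delta a))" "e = (\<lambda>a. ut2_scale q (ut2_delta a))"
      using de by (auto simp: ut2_L_def)
    then have "(\<lambda>a. ut2_scale k (d a) + ut2_scale l (e a)) =
        (\<lambda>a. ut2_scale (k * p + l * q) (ut2_delta a))"
      by (simp add: ut2_scale_simps)
    then show ?thesis unfolding ut2_L_def by blast
  qed
  moreover have zero: "(\<lambda>a. 0) \<in> (ut2_L :: ('a ut2 \<Rightarrow> 'a ut2) set)"
    unfolding ut2_L_def by (auto intro!: exI[of _ 0] simp: ut2_scale_simps)
  moreover have "lie_bracket d e \<in> ut2_L" if de: "d \<in> ut2_L" "e \<in> ut2_L"
    for d e :: "'a ut2 \<Rightarrow> 'a ut2"
  proof -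
    obtain p q where "d = (\<lambda>a. ut2_scale p (ut2_delta a))" "e = (\<lambda>a. ut2_scale q (ut2_delta a))"
      using de by (auto simp: ut2_L_def)
    then have "lie_bracket d e = (\<lambda>a. 0)"
      by (simp add: lie_bracket_def ut2_delta_def comm_def ut2_scale_simps ut2_scale_diff
          algebra_simps)
    then show ?thesis using zero by simp
  qed
  ultimately show ?thesis
    using der by (auto simp: lie_algebra_of_derivations_def ut2_L_def)
qed

end

theory Submission
  imports Defs "HOL-Combinatorics.Cycles"
begin

text \<open>
  Over triangular matrices a differential polynomial is determined by two ordinary polynomials.
  Put \<open>u\<^sub>j\<close>, \<open>v\<^sub>j\<close>, \<open>w\<^sub>j\<close> for the entries \<open>(1,1)\<close>, \<open>(2,2)\<close>, \<open>(1,2)\<close> of the matrix substituted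
  for \<open>x\<^sub>j\<close>; the derivation has square zero and sends such a matrix to half of \<open>v\<^sub>j - u\<^sub>j\<close> times
  \<open>e\<^sub>1\<^sub>2\<close>. A multilinear polynomial of degree \<open>n\<close> is an identity exactly if the generic entries
  \<open>(1,1)\<close> and \<open>(1,2)\<close> of its value vanish (\<open>pval_E\<close>).

  Modulo the \<open>T\<close>-ideal of the five relations every polynomial is a combination of sorted words, of
  sorted commutator-like differences and of derivatives of sorted words, with coefficients that are
  coefficients of the two generic entries (\<open>normal_form\<close>). An identity has zero entries, hence lies in
  the ideal, and this is part one.

  For the multilinear part the monomials of the entry \<open>(1,2)\<close> correspond to colourings of
  \<open>{1..n}\<close> by the tags \<open>0, 1, 2\<close> of \<open>u, v, w\<close>, where \<open>2\<close> occurs at most once. Think of the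
  colourings without \<open>2\<close> as the vertices of a cube and of those with one \<open>2\<close> as its edges. The normal
  forms together with the coefficient functionals are not a basis with its dual basis, but they
  form a frame, from which traces and dimensions can be read off (\<open>quot_trace_frame\<close>). In the trace of a
  permutation the contributions of the vertices cancel against correction terms of the edges
  (\<open>edge_vertex_bijection\<close>), and what remains is the permutation character on one point and the edges
  of the cube (\<open>trace_sum\<close>). There are \<open>2 ^ (n - 1) * n\<close> edges.

  The multiplicities of the irreducible characters in this permutation character are found by
  applying Young symmetrizers to functions on colourings, one family of shapes at a time
  (\<open>two_row_multiplicity\<close>, \<open>three_row_multiplicity\<close>, \<open>one_row_multiplicity\<close>,
  \<open>other_shape_multiplicity\<close>). Orthogonality of Young symmetrizers and Specht characters
  (\<open>esym_irr_char\<close>) makes the multiplicities unique, and the expansion of class functions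
  (\<open>class_function_expansion\<close>) shows that they do describe the character.
\<close>


section \<open>Linear extension\<close>

definition lext :: "('a::comm_ring_1 \<Rightarrow> 'v \<Rightarrow> 'v) \<Rightarrow> ('k \<Rightarrow> 'v) \<Rightarrow> ('k \<Rightarrow>\<^sub>0 'a) \<Rightarrow> 'v::ab_group_add"
  where "lext sc g f = (\<Sum>k\<in>Poly_Mapping.keys f. sc (Poly_Mapping.lookup f k) (g k))"

lemma lookup_smul [simp]: "Poly_Mapping.lookup (smul c f) k = c * Poly_Mapping.lookup f k"
  by (simp add: smul_def Poly_Mapping.map.rep_eq when_def)

lemma keys_smul: "Poly_Mapping.keys (smul c f) \<subseteq> Poly_Mapping.keys f"
  by (auto simp: in_keys_iff)

lemma smul_single [simp]: "smul c (Poly_Mapping.single k d) = Poly_Mapping.single k (c * d)"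
  by (rule poly_mapping_eqI) (simp add: lookup_single when_def)

lemma smul_zero [simp]: "smul c 0 = 0"
  by (rule poly_mapping_eqI) simp

lemma vector_space_smul: "vector_space (smul :: 'a::field \<Rightarrow> ('k \<Rightarrow>\<^sub>0 'a) \<Rightarrow> ('k \<Rightarrow>\<^sub>0 'a))"
  by unfold_locales (auto intro!: poly_mapping_eqI simp: lookup_add algebra_simps)

interpretation smul: vector_space "smul :: 'a::field \<Rightarrow> ('k \<Rightarrow>\<^sub>0 'a) \<Rightarrow> ('k \<Rightarrow>\<^sub>0 'a)"
  by (rule vector_space_smul)

lemma smul_mult_left: "smul c f * g = smul c (f * (g :: 'g::monoid_add \<Rightarrow>\<^sub>0 'a::comm_ring_1))"
proof -
  have *: "smul c h = Poly_Mapping.single 0 c * h" for h :: "'g \<Rightarrow>\<^sub>0 'a"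
    by (simp add: smul_def mult_map_scale_conv_mult)
  show ?thesis by (simp add: * mult.assoc)
qed

lemma free_induct [case_names zero add]:
  assumes "P 0" "\<And>f k c. P f \<Longrightarrow> P (Poly_Mapping.single k c + f)"
  shows "P (f :: 'k \<Rightarrow>\<^sub>0 'a::comm_ring_1)"
proof (induction f rule: update_induct)
  case (update f a b)
  have "Poly_Mapping.update a b f = Poly_Mapping.single a b + f"
    by (rule poly_mapping_eqI)
      (use update in \<open>auto simp: lookup_update lookup_add lookup_single in_keys_iff when_def\<close>)
  with assms(2) update show ?case by simp
qed (use assms in \<open>simp_all\<close>)

lemma smul_mult_right: "f * smul c g = smul c (f * (g :: 'g::monoid_add \<Rightarrow>\<^sub>0 'a::comm_ring_1))"
proof -
  have *: "smul c (f + g) = smul c f + smul c g" for f g :: "'g \<Rightarrow>\<^sub>0 'a"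
    by (rule poly_mapping_eqI) (simp add: lookup_add algebra_simps)
  have single: "Poly_Mapping.single k d * smul c g = smul c (Poly_Mapping.single k d * g)" for k d
    by (induction g rule: free_induct) (simp_all add: mult_single mult.left_commute * distrib_left)
  show ?thesis
    by (induction f rule: free_induct) (simp_all add: single * distrib_right)
qed

context module
begin

lemma lext_superset:
  assumes "finite A" "Poly_Mapping.keys f \<subseteq> A"
  shows "lext scale g f = (\<Sum>k\<in>A. Poly_Mapping.lookup f k *s g k)"
  unfolding lext_def
  by (rule sum.mono_neutral_left) (use assms in \<open>auto simp: in_keys_iff\<close>)

lemma lext_add: "lext scale g (f + h) = lext scale g f + lext scale g h"
proof -
  let ?A = "Poly_Mapping.keys f \<union> Poly_Mapping.keys h"
  have "Poly_Mapping.keys (f + h) \<subseteq> ?A" by (rule keys_add)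
  then show ?thesis
    by (simp add: lext_superset[of ?A] lookup_add scale_left_distrib sum.distrib)
qed

lemma lext_smul: "lext scale g (smul c f) = c *s lext scale g f"
  by (simp add: lext_superset[of "Poly_Mapping.keys f"] keys_smul scale_sum_right)

lemma lext_zero [simp]: "lext scale g 0 = 0"
  by (simp add: lext_def)

lemma lext_uminus: "lext scale g (- f) = - lext scale g f"
  by (simp add: lext_def keys_minus sum_negf)

lemma lext_diff: "lext scale g (f - h) = lext scale g f - lext scale g h"
  using lext_add[of g f "- h"] by (simp add: lext_uminus)

lemma lext_single [simp]: "lext scale g (Poly_Mapping.single k c) = c *s g k"
  by (simp add: lext_def)

lemma lext_sum: "lext scale g (sum f A) = (\<Sum>i\<in>A. lext scale g (f i))"
  by (induction A rule: infinite_finite_induct) (simp_all add: lext_add)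

lemma lext_linear_combination:
  "lext scale g (\<Sum>i\<in>A. smul (c i) (f i)) = (\<Sum>i\<in>A. c i *s lext scale g (f i))"
  by (simp add: lext_sum lext_smul)

lemma lext_plus_fun: "lext scale (\<lambda>k. g k + h k) f = lext scale g f + lext scale h f"
  by (simp add: lext_def scale_right_distrib sum.distrib)

lemma lext_scale_fun: "lext scale (\<lambda>k. c *s g k) f = c *s lext scale g f"
  by (simp add: lext_def scale_sum_right mult.commute)

lemma lext_cong: "(\<And>k. k \<in> Poly_Mapping.keys f \<Longrightarrow> g k = h k) \<Longrightarrow> lext scale g f = lext scale h f"
  by (simp add: lext_def)

end

lemma lext_compose:
  assumes "module sc" "module sc'"
    and "\<And>u v. F (u + v) = F u + F v" "\<And>c v. F (sc c v) = sc' c (F v)"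
  shows "F (lext sc g (f :: 'k \<Rightarrow>\<^sub>0 'a::comm_ring_1)) = lext sc' (\<lambda>k. F (g k)) f"
proof -
  have "F 0 = 0" using assms(3)[of 0 0] by simp
  then have "F (sum h A) = (\<Sum>x\<in>A. F (h x))" for h and A :: "'k set"
    by (induction A rule: infinite_finite_induct) (simp_all add: assms(3))
  then show ?thesis unfolding lext_def by (simp add: assms(4))
qed

lemma lext_smul_letters: "lext smul (\<lambda>k. Poly_Mapping.single k (1::'a::field)) f = f"
  by (induction f rule: free_induct) (simp_all add: smul.lext_add)

section \<open>Quotients, frames and traces\<close>

locale quotient_space = vector_space sc
  for sc :: "'a::field \<Rightarrow> 'v::ab_group_add \<Rightarrow> 'v" +
  fixes V W :: "'v set"
  assumes V: "subspace V" and W: "subspace W" and WV: "W \<subseteq> V"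
begin

definition functional :: "('v \<Rightarrow> 'a) \<Rightarrow> bool"
  where "functional \<phi> \<longleftrightarrow> (\<forall>u\<in>V. \<forall>v\<in>V. \<phi> (u + v) = \<phi> u + \<phi> v) \<and>
     (\<forall>c. \<forall>v\<in>V. \<phi> (sc c v) = c * \<phi> v) \<and> (\<forall>w\<in>W. \<phi> w = 0)"

definition frame :: "'i set \<Rightarrow> ('i \<Rightarrow> 'v) \<Rightarrow> ('i \<Rightarrow> 'v \<Rightarrow> 'a) \<Rightarrow> bool"
  where "frame J b \<phi> \<longleftrightarrow> finite J \<and> (\<forall>i\<in>J. b i \<in> V) \<and> (\<forall>i\<in>J. functional (\<phi> i)) \<and>
     (\<forall>v\<in>V. v - (\<Sum>i\<in>J. sc (\<phi> i v) (b i)) \<in> W)"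

definition endo :: "('v \<Rightarrow> 'v) \<Rightarrow> bool"
  where "endo f \<longleftrightarrow> (\<forall>u\<in>V. \<forall>v\<in>V. f (u + v) = f u + f v) \<and>
     (\<forall>c. \<forall>v\<in>V. f (sc c v) = sc c (f v)) \<and> (\<forall>v\<in>V. f v \<in> V) \<and> (\<forall>w\<in>W. f w \<in> W)"

lemma functional_sum:
  assumes "functional \<phi>" "\<And>i. i \<in> J \<Longrightarrow> b i \<in> V"
  shows "\<phi> (\<Sum>i\<in>J. sc (c i) (b i)) = (\<Sum>i\<in>J. c i * \<phi> (b i))"
  using assms(2)
proof (induction J rule: infinite_finite_induct)
  case (insert i J)
  then have "(\<Sum>i\<in>J. sc (c i) (b i)) \<in> V" "sc (c i) (b i) \<in> V"
    by (auto intro!: subspace_sum[OF V] subspace_scale[OF V])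
  with insert assms(1) show ?case by (simp add: functional_def)
qed (use assms(1) subspace_0[OF W] in \<open>auto simp: functional_def\<close>)

lemma functional_cong:
  assumes "functional \<phi>" "u \<in> V" "v \<in> V" "u - v \<in> W"
  shows "\<phi> u = \<phi> v"
proof -
  have "\<phi> (v + (u - v)) = \<phi> v + \<phi> (u - v)"
    using assms WV by (unfold functional_def) blast
  with assms show ?thesis by (simp add: functional_def)
qed

lemma frame_combination:
  assumes "frame J b \<phi>" "finite J" "v \<in> V" "functional \<psi>"
  shows "\<psi> v = (\<Sum>i\<in>J. \<phi> i v * \<psi> (b i))"
proof -
  have b: "\<And>i. i \<in> J \<Longrightarrow> b i \<in> V" using assms by (simp add: frame_def)
  have "\<psi> v = \<psi> (\<Sum>i\<in>J. sc (\<phi> i v) (b i))"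
    using assms by (intro functional_cong subspace_sum[OF V] subspace_scale[OF V])
      (auto simp: frame_def)
  also have "\<dots> = (\<Sum>i\<in>J. \<phi> i v * \<psi> (b i))"
    by (rule functional_sum) (use assms b in auto)
  finally show ?thesis .
qed

lemma functional_endo: "functional \<phi> \<Longrightarrow> endo f \<Longrightarrow> functional (\<lambda>v. \<phi> (f v))"
  by (simp add: functional_def endo_def)

text \<open>
  Both sums equal the double sum over pairs of indices; this is the usual invariance of the trace, which uses only that each family reproduces every vector, not that it is independent.
\<close>

lemma frame_trace_unique:
  assumes fr: "frame J b \<phi>" "frame K b' \<phi>'" and f: "endo f"
  shows "(\<Sum>i\<in>J. \<phi> i (f (b i))) = (\<Sum>l\<in>K. \<phi>' l (f (b' l)))"
proof -
  have J: "finite J" "finite K" and b: "\<And>i. i \<in> J \<Longrightarrow> b i \<in> V" "\<And>k. k \<in> K \<Longrightarrow> b' k \<in> V"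
    and ftl: "\<And>i. i \<in> J \<Longrightarrow> functional (\<phi> i)" "\<And>k. k \<in> K \<Longrightarrow> functional (\<phi>' k)"
    using fr by (auto simp: frame_def)
  have "(\<Sum>i\<in>J. \<phi> i (f (b i))) = (\<Sum>i\<in>J. \<Sum>k\<in>K. \<phi>' k (b i) * \<phi> i (f (b' k)))"
    using frame_combination[OF fr(2) J(2) b(1) functional_endo[OF ftl(1) f]] by simp
  also have "\<dots> = (\<Sum>k\<in>K. \<Sum>i\<in>J. \<phi> i (f (b' k)) * \<phi>' k (b i))"
    by (subst sum.swap) (simp add: mult.commute)
  also have "\<dots> = (\<Sum>l\<in>K. \<phi>' l (f (b' l)))"
  proof (rule sum.cong[OF refl])
    fix k assume k: "k \<in> K"
    have "f (b' k) \<in> V" using f b(2)[OF k] by (simp add: endo_def)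
    then show "(\<Sum>i\<in>J. \<phi> i (f (b' k)) * \<phi>' k (b i)) = \<phi>' k (f (b' k))"
      using frame_combination[OF fr(1) J(1) _ ftl(2)[OF k]] by simp
  qed
  finally show ?thesis .
qed

lemma represents_iff: "represents sc W B v c \<longleftrightarrow>
    Poly_Mapping.keys c \<subseteq> B \<and> v - lext sc (\<lambda>b. b) c \<in> W"
  by (simp add: represents_def lext_def)

lemma represents_add:
  assumes "represents sc W B u c" "represents sc W B v d"
  shows "represents sc W B (u + v) (c + d)"
proof -
  have "(u - lext sc (\<lambda>b. b) c) + (v - lext sc (\<lambda>b. b) d) \<in> W"
    using assms by (intro subspace_add[OF W]) (auto simp: represents_iff)
  then show ?thesis using assms keys_add[of c d]
    by (auto simp: represents_iff lext_add algebra_simps)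
qed

lemma represents_smul:
  assumes "represents sc W B u c"
  shows "represents sc W B (sc k u) (smul k c)"
proof -
  have "sc k (u - lext sc (\<lambda>b. b) c) \<in> W"
    using assms by (intro subspace_scale[OF W]) (auto simp: represents_iff)
  then show ?thesis using assms keys_smul[of k c]
    by (auto simp: represents_iff lext_smul scale_right_diff_distrib)
qed

lemma represents_sum:
  assumes "\<And>i. i \<in> J \<Longrightarrow> represents sc W B (u i) (c i)"
  shows "represents sc W B (sum u J) (sum c J)"
  using assms
proof (induction J rule: infinite_finite_induct)
  case (insert i J)
  then show ?case by (simp add: represents_add)
qed (use subspace_0[OF W] in \<open>auto simp: represents_iff\<close>)

lemma represents_cong:
  assumes "represents sc W B u c" "u - v \<in> W"
  shows "represents sc W B v c"
proof -
  have "(u - lext sc (\<lambda>b. b) c) - (u - v) \<in> W"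
    by (rule subspace_diff[OF W]) (use assms in \<open>auto simp: represents_iff\<close>)
  then show ?thesis using assms by (simp add: represents_iff)
qed

lemma represents_self: "b \<in> B \<Longrightarrow> represents sc W B b (Poly_Mapping.single b 1)"
  using subspace_0[OF W] by (simp add: represents_iff)

context
  fixes B assumes B: "quot_basis sc V W B"
begin

lemma quot_basis_subset: "B \<subseteq> V"
  using B by (simp add: quot_basis_def)

lemma represents_quot_coords: "v \<in> V \<Longrightarrow> represents sc W B v (quot_coords sc W B v)"
  using B unfolding quot_basis_def quot_coords_def by (metis theI')

lemma quot_coords_eq: "represents sc W B v c \<Longrightarrow> v \<in> V \<Longrightarrow> quot_coords sc W B v = c"
  using B represents_quot_coords[of v] unfolding quot_basis_def by metis

lemma quot_coords_add:
  "u \<in> V \<Longrightarrow> v \<in> V \<Longrightarrow>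
    quot_coords sc W B (u + v) = quot_coords sc W B u + quot_coords sc W B v"
  by (rule quot_coords_eq)
    (auto intro!: represents_add represents_quot_coords subspace_add[OF V])

lemma quot_coords_scale:
  "v \<in> V \<Longrightarrow> quot_coords sc W B (sc c v) = smul c (quot_coords sc W B v)"
  by (rule quot_coords_eq)
    (auto intro!: represents_smul represents_quot_coords subspace_scale[OF V])

lemma quot_coords_cong:
  "u \<in> V \<Longrightarrow> v \<in> V \<Longrightarrow> u - v \<in> W \<Longrightarrow> quot_coords sc W B u = quot_coords sc W B v"
  by (metis represents_cong represents_quot_coords quot_coords_eq)

lemma quot_coords_basis: "b \<in> B \<Longrightarrow> quot_coords sc W B b = Poly_Mapping.single b 1"
  using quot_basis_subset by (intro quot_coords_eq represents_self) auto

lemma quot_coords_zero: "w \<in> W \<Longrightarrow> quot_coords sc W B w = 0"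
  using WV by (intro quot_coords_eq) (auto simp: represents_iff)

lemma quot_basis_frame:
  assumes "finite B"
  shows "frame B (\<lambda>b. b) (\<lambda>b v. Poly_Mapping.lookup (quot_coords sc W B v) b)"
proof -
  have "v - (\<Sum>i\<in>B. sc (Poly_Mapping.lookup (quot_coords sc W B v) i) i) \<in> W" if "v \<in> V" for v
    using represents_quot_coords[OF that] assms
    by (auto simp: represents_iff lext_superset[of B])
  with assms show ?thesis using quot_basis_subset
    by (auto simp: frame_def functional_def quot_coords_add lookup_add quot_coords_scale quot_coords_zero)
qed

text \<open>
  A basis element occurs in its own expansion through the frame, hence in the coordinates of one of the finitely many frame vectors.
\<close>

lemma frame_finite_basis:
  assumes fr: "frame J b \<phi>"
  shows "finite B"
proof -
  let ?B = "\<Union>i\<in>J. Poly_Mapping.keys (quot_coords sc W B (b i))"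
  have J: "finite J" and bV: "\<And>i. i \<in> J \<Longrightarrow> b i \<in> V" using fr by (auto simp: frame_def)
  have "B \<subseteq> ?B"
  proof
    fix x assume x: "x \<in> B"
    then have xV: "x \<in> V" using quot_basis_subset by auto
    let ?c = "\<Sum>i\<in>J. smul (\<phi> i x) (quot_coords sc W B (b i))"
    have "represents sc W B (\<Sum>i\<in>J. sc (\<phi> i x) (b i)) ?c"
      by (intro represents_sum represents_smul represents_quot_coords bV)
    moreover have "(\<Sum>i\<in>J. sc (\<phi> i x) (b i)) - x \<in> W"
      using fr xV subspace_neg[OF W, of "x - (\<Sum>i\<in>J. sc (\<phi> i x) (b i))"] by (simp add: frame_def)
    ultimately have "represents sc W B x ?c" by (rule represents_cong)
    then have "?c = Poly_Mapping.single x 1"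
      using quot_coords_eq[OF _ xV] quot_coords_basis[OF x] by metis
    then have "Poly_Mapping.lookup ?c x \<noteq> 0" by simp
    then have "(\<Sum>i\<in>J. \<phi> i x * Poly_Mapping.lookup (quot_coords sc W B (b i)) x) \<noteq> 0"
      by (simp add: lookup_sum)
    then obtain i where "i \<in> J" "Poly_Mapping.lookup (quot_coords sc W B (b i)) x \<noteq> 0"
      by (metis (no_types, lifting) mult_eq_0_iff sum.neutral)
    then show "x \<in> ?B" by (auto simp: in_keys_iff)
  qed
  then show ?thesis using J by (auto intro: finite_subset)
qed

end

lemma frame_ex_quot_basis:
  assumes fr: "frame J b \<phi>"
  shows "\<exists>B. quot_basis sc V W B"
proof -
  define spans where "spans T \<longleftrightarrow> T \<subseteq> V \<and> finite T \<and> (\<forall>v\<in>V. \<exists>c. represents sc W T v c)" for T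
  have J: "finite J" and bV: "\<And>i. i \<in> J \<Longrightarrow> b i \<in> V" using fr by (auto simp: frame_def)
  have "spans (b ` J)"
    unfolding spans_def
  proof (intro conjI ballI)
    fix v assume v: "v \<in> V"
    have "represents sc W (b ` J) (\<Sum>i\<in>J. sc (\<phi> i v) (b i))
        (\<Sum>i\<in>J. smul (\<phi> i v) (Poly_Mapping.single (b i) 1))"
      by (intro represents_sum represents_smul represents_self) auto
    moreover have "(\<Sum>i\<in>J. sc (\<phi> i v) (b i)) - v \<in> W"
      using fr v subspace_neg[OF W, of "v - (\<Sum>i\<in>J. sc (\<phi> i v) (b i))"] by (simp add: frame_def)
    ultimately show "\<exists>c. represents sc W (b ` J) v c" by (blast intro: represents_cong)
  qed (use J bV in auto)
  then obtain T where T: "spans T" and least: "\<And>T'. spans T' \<Longrightarrow> card T \<le> card T'"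
    using ex_has_least_nat[of spans "b ` J" card] by blast
  have "c = d" if v: "v \<in> V" and c: "represents sc W T v c" and d: "represents sc W T v d" for v c d
  proof (rule ccontr)
    assume "c \<noteq> d"
    define r where "r = c - d"
    have "r \<noteq> 0" using \<open>c \<noteq> d\<close> by (simp add: r_def)
    then obtain s where s: "Poly_Mapping.lookup r s \<noteq> 0"
      by (metis lookup_zero poly_mapping_eqI)
    have rT: "Poly_Mapping.keys r \<subseteq> T"
      using c d keys_diff[of c d] by (auto simp: r_def represents_iff)
    have rW: "lext sc (\<lambda>b. b) r \<in> W"
    proof -
      have "(v - lext sc (\<lambda>b. b) d) - (v - lext sc (\<lambda>b. b) c) \<in> W"
        by (rule subspace_diff[OF W]) (use c d in \<open>auto simp: represents_iff\<close>)
      then show ?thesis by (simp add: r_def lext_diff)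
    qed
    have "s \<in> T" using s rT by (auto simp: in_keys_iff)
    have "spans (T - {s})"
      unfolding spans_def
    proof (intro conjI ballI)
      fix v assume "v \<in> V"
      then obtain e where e: "represents sc W T v e" using T by (auto simp: spans_def)
      define e' where "e' = e - smul (Poly_Mapping.lookup e s / Poly_Mapping.lookup r s) r"
      have "Poly_Mapping.lookup e' s = 0" using s by (simp add: e'_def lookup_minus)
      moreover have "Poly_Mapping.keys e' \<subseteq> T"
        using e rT keys_diff[of e "smul (Poly_Mapping.lookup e s / Poly_Mapping.lookup r s) r"]
          keys_smul[of "Poly_Mapping.lookup e s / Poly_Mapping.lookup r s" r]
        by (auto simp: e'_def represents_iff)
      ultimately have "Poly_Mapping.keys e' \<subseteq> T - {s}" by (auto simp: in_keys_iff)
      moreover have "v - lext sc (\<lambda>b. b) e' \<in> W"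
      proof -
        have "(v - lext sc (\<lambda>b. b) e) + sc (Poly_Mapping.lookup e s / Poly_Mapping.lookup r s) (lext sc (\<lambda>b. b) r) \<in> W"
          using e rW by (intro subspace_add[OF W] subspace_scale[OF W]) (auto simp: represents_iff)
        then show ?thesis by (simp add: e'_def lext_diff lext_smul algebra_simps)
      qed
      ultimately show "\<exists>c. represents sc W (T - {s}) v c" by (auto simp: represents_iff)
    qed (use T in \<open>auto simp: spans_def\<close>)
    then have "card T \<le> card (T - {s})" by (rule least)
    with \<open>s \<in> T\<close> T show False unfolding spans_def by (metis card_Diff1_less not_le)
  qed
  with T have "quot_basis sc V W T" unfolding quot_basis_def spans_def by blast
  then show ?thesis ..
qed

theorem quot_trace_frame:
  assumes fr: "frame J b \<phi>" and f: "endo f"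
  shows "quot_trace sc V W f = (\<Sum>i\<in>J. \<phi> i (f (b i)))"
proof -
  define B where "B = (SOME B. quot_basis sc V W B)"
  have B: "quot_basis sc V W B"
    unfolding B_def using frame_ex_quot_basis[OF fr] by (rule someI_ex)
  have "frame B (\<lambda>b. b) (\<lambda>b v. Poly_Mapping.lookup (quot_coords sc W B v) b)"
    using quot_basis_frame[OF B] frame_finite_basis[OF B fr] by simp
  from frame_trace_unique[OF fr this f] show ?thesis
    by (simp add: quot_trace_def Let_def B_def)
qed

theorem quot_dim_frame:
  assumes fr: "frame J b \<phi>"
  shows "of_nat (quot_dim sc V W) = (\<Sum>i\<in>J. \<phi> i (b i))"
proof -
  define B where "B = (SOME B. quot_basis sc V W B)"
  have B: "quot_basis sc V W B"
    unfolding B_def using frame_ex_quot_basis[OF fr] by (rule someI_ex)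
  have "frame B (\<lambda>b. b) (\<lambda>b v. Poly_Mapping.lookup (quot_coords sc W B v) b)"
    using quot_basis_frame[OF B] frame_finite_basis[OF B fr] by simp
  moreover have "endo (\<lambda>v. v)" by (simp add: endo_def)
  ultimately have "(\<Sum>i\<in>J. \<phi> i (b i)) = (\<Sum>b\<in>B. Poly_Mapping.lookup (quot_coords sc W B b) b)"
    by (rule frame_trace_unique[OF fr])
  also have "\<dots> = of_nat (card B)" by (simp add: quot_coords_basis[OF B])
  finally show ?thesis by (simp add: quot_dim_def B_def)
qed

end


section \<open>Free algebras and their representations\<close>

abbreviation word :: "'g list \<Rightarrow> ('g, 'a::comm_ring_1) free_alg"
  where "word u \<equiv> Poly_Mapping.single (FWord u) 1"

lemma word_append: "word (u @ v) = word u * word v"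
  by (simp add: mult_single plus_fword_def)

lemma word_Nil: "word [] = 1"
  by (simp flip: zero_fword_def single_one)

lemma word_Cons: "word (g # u) = letter g * word u"
  using word_append[of "[g]" u] by (simp add: letter_def)

lemma letters_plus [simp]: "letters (u + v) = letters u @ letters v"
  by (simp add: plus_fword_def)

lemma letters_zero [simp]: "letters 0 = []"
  by (simp add: zero_fword_def)

lemma lext_times:
  fixes sc :: "'a::comm_ring_1 \<Rightarrow> 'v::ring \<Rightarrow> 'v" and g :: "'k::monoid_add \<Rightarrow> 'v"
  assumes m: "module sc" and sc: "\<And>c a b. sc c a * b = sc c (a * b)" "\<And>c a b. a * sc c b = sc c (a * b)"
    and g: "\<And>u v. g (u + v) = g u * g v"
  shows "lext sc g (f * h) = lext sc g f * lext sc g h"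
proof -
  interpret module sc by (rule m)
  have "lext sc g (Poly_Mapping.single k c * h) = sc c (g k) * lext sc g h" for k c
    by (induction h rule: free_induct)
      (simp_all add: distrib_left lext_add mult_single g sc mult.commute)
  then show ?thesis
    by (induction f rule: free_induct) (simp_all add: distrib_right lext_add)
qed

lemma lext_times_left:
  assumes "module sc"
  shows "lext sc g (h * k) = lext sc (\<lambda>u. lext sc g (Poly_Mapping.single u 1 * k)) (h :: 'k::monoid_add \<Rightarrow>\<^sub>0 'a::field)"
proof -
  interpret module sc by (rule assms)
  show ?thesis
  proof (induction h rule: free_induct)
    case (add f u c)
    have "Poly_Mapping.single u c * k = smul c (Poly_Mapping.single u 1 * k)"
      by (simp flip: smul_mult_left)
    then have "lext sc g (Poly_Mapping.single u c * k) = sc c (lext sc g (Poly_Mapping.single u 1 * k))"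
      by (simp only: lext_smul)
    then show ?case by (simp only: distrib_right lext_add lext_single add.IH)
  qed simp
qed

lemma free1_word: "word u \<in> free1 G \<longleftrightarrow> set u \<subseteq> G"
  by (simp add: free1_def)

lemma free1_letter: "g \<in> G \<Longrightarrow> letter g \<in> free1 G"
  by (simp add: free1_def letter_def)

lemma free1_one: "1 \<in> free1 G"
  by (simp add: free1_def flip: zero_fword_def)

lemma free1_times: "f \<in> free1 G \<Longrightarrow> h \<in> free1 G \<Longrightarrow> f * h \<in> free1 G"
  using keys_mult[of f h] by (fastforce simp: free1_def)

lemma subspace_free1: "smul.subspace (free1 G :: ('g, 'a::field) free_alg set)"
proof (rule smul.subspaceI)
  fix x y :: "('g, 'a) free_alg" and c :: 'a
  assume x: "x \<in> free1 G"
  then show "smul c x \<in> free1 G" using keys_smul[of c x] by (auto simp: free1_def)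
  assume "y \<in> free1 G"
  with x show "x + y \<in> free1 G" using keys_add[of x y] by (auto simp: free1_def)
qed (simp add: free1_def)

lemma free1_induct [consumes 1, case_names one lmult add smul]:
  fixes f :: "('g, 'a::field) free_alg"
  assumes f: "f \<in> free1 G" and one: "P 1" and lmult: "\<And>g f. g \<in> G \<Longrightarrow> f \<in> free1 G \<Longrightarrow> P f \<Longrightarrow> P (letter g * f)"
    and add: "\<And>h k. h \<in> free1 G \<Longrightarrow> k \<in> free1 G \<Longrightarrow> P h \<Longrightarrow> P k \<Longrightarrow> P (h + k)"
    and smul: "\<And>c h. h \<in> free1 G \<Longrightarrow> P h \<Longrightarrow> P (smul c h)"
  shows "P f"
proof -
  define V where "V = {f \<in> free1 G. P f}"
  have "smul 0 1 \<in> V" unfolding V_def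
    using smul[OF free1_one one, of 0] smul.subspace_0[OF subspace_free1] by simp
  then have "smul.subspace V"
    by (intro smul.subspaceI) (auto simp: V_def intro: add smul smul.subspace_add[OF subspace_free1]
        smul.subspace_scale[OF subspace_free1])
  moreover have "word u \<in> V" if "set u \<subseteq> G" for u
    using that
  proof (induction u)
    case Nil
    then show ?case using one free1_one by (simp add: V_def word_Nil)
  next
    case (Cons g u)
    then show ?case by (simp add: V_def word_Cons lmult free1_times free1_letter)
  qed
  then have "Poly_Mapping.single k 1 \<in> V" if "k \<in> Poly_Mapping.keys f" for k
    using that f by (cases k) (auto simp: free1_def)
  ultimately have "lext smul (\<lambda>k. Poly_Mapping.single k 1) f \<in> V"
    unfolding lext_def by (intro smul.subspace_sum smul.subspace_scale)
  then show ?thesis by (simp add: lext_smul_letters V_def)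
qed

lemma free0_word: "word u \<in> free0 G \<longleftrightarrow> set u \<subseteq> G \<and> u \<noteq> []"
  by (auto simp: free0_def free1_def lookup_single when_def)

lemma lookup_times_Nil:
  "Poly_Mapping.lookup (f * h) (FWord []) = Poly_Mapping.lookup f (FWord []) * Poly_Mapping.lookup (h :: ('g, 'a::field) free_alg) (FWord [])"
proof -
  have "lext (*) (\<lambda>w. if w = 0 then 1 else 0) f = Poly_Mapping.lookup f (FWord [])" for f :: "('g, 'a) free_alg"
    by (simp add: lext_def in_keys_iff if_distrib[of "\<lambda>x. _ * x"] cong: if_cong flip: zero_fword_def)
  moreover have "(u + v = 0) = (u = 0 \<and> v = 0)" for u v :: "'g fword"
    by (cases u, cases v) (simp add: plus_fword_def zero_fword_def)
  then have "lext (*) (\<lambda>w :: 'g fword. if w = 0 then 1 else 0) (f * h)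
      = lext (*) (\<lambda>w. if w = 0 then 1 else 0) f * lext (*) (\<lambda>w. if w = 0 then 1 else (0 :: 'a)) h"
    by (intro lext_times) (auto simp: algebra_simps module_def)
  ultimately show ?thesis by simp
qed

lemma subspace_free0: "smul.subspace (free0 G :: ('g, 'a::field) free_alg set)"
  using subspace_free1[of G, where 'a = 'a]
  unfolding smul.subspace_def free0_def by (auto simp: lookup_add)

lemma free0_times: "f \<in> free0 G \<Longrightarrow> h \<in> free1 G \<Longrightarrow> f * (h :: ('g, 'a::field) free_alg) \<in> free0 G"
  "f \<in> free1 G \<Longrightarrow> h \<in> free0 G \<Longrightarrow> f * h \<in> free0 G"
  by (auto simp: free0_def free1_times lookup_times_Nil)

lemma free0_free1: "f \<in> free0 G \<Longrightarrow> f \<in> free1 G"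
  by (simp add: free0_def)

lemma free0_lext:
  fixes f :: "('g, 'a::field) free_alg"
  assumes "smul.subspace S" "f \<in> free1 G" "\<And>u. set u \<subseteq> G \<Longrightarrow> Poly_Mapping.lookup f (FWord u) \<noteq> 0 \<Longrightarrow> g (FWord u) \<in> S"
  shows "lext smul g f \<in> (S :: ('k \<Rightarrow>\<^sub>0 'a) set)"
  unfolding lext_def
proof (intro smul.subspace_sum[OF assms(1)] smul.subspace_scale[OF assms(1)])
  fix w assume w: "w \<in> Poly_Mapping.keys f"
  then show "g w \<in> S" using assms(3)[of "letters w"] assms(2) by (auto simp: free1_def in_keys_iff)
qed

text \<open>Actions of products are compositions.\<close>

lemma env_act_lext: "env_act act sc h v = lext sc (\<lambda>w. foldr act (letters w) v) h"
  by (simp add: env_act_def lext_def)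

lemma foldr_linear:
  assumes "module sc" "\<And>\<gamma> u v. \<gamma> \<in> set w \<Longrightarrow> act \<gamma> (u + v) = act \<gamma> u + act \<gamma> v"
    "\<And>\<gamma> c v. \<gamma> \<in> set w \<Longrightarrow> act \<gamma> (sc c v) = sc c (act \<gamma> v)"
  shows "foldr act w (u + v) = foldr act w u + foldr act w v" "foldr act w (sc c v) = sc c (foldr act w v)"
  using assms(2,3) by (induction w) simp_all

lemma env_act_times:
  fixes sc :: "'a::field \<Rightarrow> 'v::ab_group_add \<Rightarrow> 'v" and h k :: "('d, 'a) free_alg"
  assumes m: "module sc" and lin: "\<And>\<gamma> u v. \<gamma> \<in> L \<Longrightarrow> act \<gamma> (u + v) = act \<gamma> u + act \<gamma> v"
    "\<And>\<gamma> c v. \<gamma> \<in> L \<Longrightarrow> act \<gamma> (sc c v) = sc c (act \<gamma> v)" and h: "h \<in> free1 L"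
  shows "env_act act sc (h * k) v = env_act act sc h (env_act act sc k v)"
proof -
  interpret module sc by (rule m)
  have "lext sc (\<lambda>w. foldr act (letters w) v) (Poly_Mapping.single u 1 * k)
      = foldr act (letters u) (lext sc (\<lambda>w. foldr act (letters w) v) k)" if u: "u \<in> Poly_Mapping.keys h" for u
  proof -
    have u': "set (letters u) \<subseteq> L" using u h by (auto simp: free1_def)
    have lin': "foldr act (letters u) (a + b) = foldr act (letters u) a + foldr act (letters u) b" for a b
      by (rule foldr_linear(1)[OF m]; rule lin; rule subsetD[OF u'])
    have lin'': "foldr act (letters u) (sc c a) = sc c (foldr act (letters u) a)" for a c
      by (rule foldr_linear(2)[OF m]; rule lin; rule subsetD[OF u'])
    have "lext sc (\<lambda>w. foldr act (letters w) v) (Poly_Mapping.single u 1 * k) = lext sc (\<lambda>w. foldr act (letters u) (foldr act (letters w) v)) k"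
      by (induction k rule: free_induct) (simp_all add: distrib_left lext_add mult_single)
    also have "\<dots> = foldr act (letters u) (lext sc (\<lambda>w. foldr act (letters w) v) k)"
      using lext_compose[where F = "foldr act (letters u)", OF m m lin' lin'', of "\<lambda>w. foldr act (letters w) v" k] by simp
    finally show ?thesis .
  qed
  then show ?thesis
    unfolding env_act_lext lext_times_left[OF m, of _ h] by (intro lext_cong)
qed

lemma env_act_linear:
  assumes m: "module sc" and lin: "\<And>\<gamma> u v. \<gamma> \<in> L \<Longrightarrow> act \<gamma> (u + v) = act \<gamma> u + act \<gamma> v"
    "\<And>\<gamma> c v. \<gamma> \<in> L \<Longrightarrow> act \<gamma> (sc c v) = sc c (act \<gamma> v)" and h: "h \<in> free1 L"
  shows "env_act act sc h (u + v) = env_act act sc h u + env_act act sc h v"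
    "env_act act sc h (sc c v) = sc c (env_act act sc h v)"
proof -
  interpret module sc by (rule m)
  have *: "foldr act (letters w) (u + v) = foldr act (letters w) u + foldr act (letters w) v \<and>
    foldr act (letters w) (sc c v) = sc c (foldr act (letters w) v)" if "w \<in> Poly_Mapping.keys h" for w
  proof -
    have sub: "set (letters w) \<subseteq> L" using h that by (auto simp: free1_def)
    have "foldr act (letters w) (u + v) = foldr act (letters w) u + foldr act (letters w) v"
      by (rule foldr_linear(1)[OF m]; rule lin; rule subsetD[OF sub])
    moreover have "foldr act (letters w) (sc c v) = sc c (foldr act (letters w) v)"
      by (rule foldr_linear(2)[OF m]; rule lin; rule subsetD[OF sub])
    ultimately show ?thesis ..
  qed
  show "env_act act sc h (u + v) = env_act act sc h u + env_act act sc h v"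
    unfolding env_act_lext lext_plus_fun[symmetric] by (rule lext_cong) (simp add: *)
  show "env_act act sc h (sc c v) = sc c (env_act act sc h v)"
    unfolding env_act_lext lext_scale_fun[symmetric] by (rule lext_cong) (simp add: *)
qed

section \<open>Triangular matrices and the derivation\<close>

lift_definition ent11 :: "'a::field ut2 \<Rightarrow> 'a" is "\<lambda>M. M $ 1 $ 1" .
lift_definition ent12 :: "'a::field ut2 \<Rightarrow> 'a" is "\<lambda>M. M $ 1 $ 2" .
lift_definition ent22 :: "'a::field ut2 \<Rightarrow> 'a" is "\<lambda>M. M $ 2 $ 2" .
lift_definition mk_ut2 :: "'a::field \<Rightarrow> 'a \<Rightarrow> 'a \<Rightarrow> 'a ut2"
  is "\<lambda>u v w. \<chi> i j. if i = 1 then (if j = 1 then u else w) else (if j = 1 then 0 else v)" by simp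

lemma ut2_eq_iff: "A = B \<longleftrightarrow> ent11 A = ent11 B \<and> ent12 A = ent12 B \<and> ent22 A = ent22 B"
  by transfer (auto simp: vec_eq_iff forall_2)

lemma ent_mk [simp]: "ent11 (mk_ut2 u v w) = u" "ent22 (mk_ut2 u v w) = v" "ent12 (mk_ut2 u v w) = w"
  by (transfer, simp)+

lemma ent_ring [simp]:
  "ent11 (A + B) = ent11 A + ent11 B" "ent12 (A + B) = ent12 A + ent12 B" "ent22 (A + B) = ent22 A + ent22 B"
  "ent11 (A - B) = ent11 A - ent11 B" "ent12 (A - B) = ent12 A - ent12 B" "ent22 (A - B) = ent22 A - ent22 B"
  "ent11 0 = 0" "ent12 0 = 0" "ent22 0 = 0" "ent11 1 = 1" "ent12 1 = 0" "ent22 1 = 1"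
  "ent11 (A * B) = ent11 A * ent11 B" "ent22 (A * B) = ent22 A * ent22 B"
  "ent12 (A * B) = ent11 A * ent12 B + ent12 A * ent22 B"
  "ent11 (ut2_scale c A) = c * ent11 A" "ent12 (ut2_scale c A) = c * ent12 A" "ent22 (ut2_scale c A) = c * ent22 A"
  by (transfer, simp add: matrix_matrix_mult_def sum_2 mat_def)+

lemma ent_e12 [simp]: "ent11 e12 = 0" "ent12 e12 = 1" "ent22 e12 = 0"
  by (transfer, simp)+

lemma ent_delta [simp]: "ent11 (ut2_delta A) = 0" "ent22 (ut2_delta A) = 0"
  "ent12 (ut2_delta A) = inverse 2 * (ent22 A - ent11 A)"
  by (simp_all add: ut2_delta_def comm_def)

lemma module_ut2: "module (ut2_scale :: 'a::field \<Rightarrow> _)"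
  by unfold_locales (simp_all add: ut2_eq_iff algebra_simps)

interpretation ut2: module "ut2_scale :: 'a::field \<Rightarrow> 'a ut2 \<Rightarrow> 'a ut2"
  by (rule module_ut2)

definition kap :: "('a::field ut2 \<Rightarrow> 'a ut2) \<Rightarrow> 'a"
  where "kap d = 2 * ent12 (d (mk_ut2 0 1 0))"

lemma ut2_L_eq: "d \<in> ut2_L \<Longrightarrow> d = (\<lambda>a. ut2_scale (kap d) (ut2_delta a :: 'a::field_char_0 ut2))"
proof -
  assume "d \<in> ut2_L"
  then obtain c where d: "d = (\<lambda>a. ut2_scale c (ut2_delta a))" by (auto simp: ut2_L_def)
  have "kap d = c" by (simp add: d kap_def)
  then show ?thesis using d by simp
qed

lemma delta_in_L: "(ut2_delta :: 'a::field ut2 \<Rightarrow> _) \<in> ut2_L"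
  unfolding ut2_L_def by (auto intro!: exI[of _ 1] simp: ut2_eq_iff fun_eq_iff)

lemma L_linear: "d \<in> ut2_L \<Longrightarrow> d (u + v) = d u + (d v :: 'a::field_char_0 ut2)"
  "d \<in> ut2_L \<Longrightarrow> d (ut2_scale c v) = ut2_scale c (d v)"
  by (auto simp: ut2_L_def ut2_eq_iff field_simps)

abbreviation eact :: "('a::field ut2 \<Rightarrow> 'a ut2, 'a) free_alg \<Rightarrow> 'a ut2 \<Rightarrow> 'a ut2"
  where "eact \<equiv> env_act (\<lambda>\<gamma>. \<gamma>) ut2_scale"

definition eps0 :: "('a::field ut2 \<Rightarrow> 'a ut2, 'a) free_alg \<Rightarrow> 'a"
  where "eps0 h = Poly_Mapping.lookup h (FWord [])"

definition eps1 :: "('a::field ut2 \<Rightarrow> 'a ut2, 'a) free_alg \<Rightarrow> 'a"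
  where "eps1 h = lext (*) (\<lambda>w. case letters w of [d] \<Rightarrow> kap d | _ \<Rightarrow> 0) h"

lemma module_mult: "module ((*) :: 'a::field \<Rightarrow> 'a \<Rightarrow> 'a)"
  by unfold_locales (simp_all add: algebra_simps)

text \<open>
  Two derivations of the Lie algebra compose to zero, since each maps into the multiples of the corner unit, which it kills. So only the constant and the linear part of an enveloping element act.
\<close>

lemma eact_formula:
  assumes "h \<in> free1 (ut2_L :: ('a::field_char_0 ut2 \<Rightarrow> 'a ut2) set)"
  shows "eact h a = ut2_scale (eps0 h) a + ut2_scale (eps1 h) (ut2_delta a)"
proof -
  let ?e0 = "\<lambda>w. if w = 0 then 1 else 0 :: 'a" and ?e1 = "\<lambda>w. case letters w of [d] \<Rightarrow> kap d | _ \<Rightarrow> (0 :: 'a)"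
  have nil: "d (d' x) = 0" if "d \<in> ut2_L" "d' \<in> ut2_L" for d d' and x :: "'a ut2"
    by (subst ut2_L_eq[OF that(1)], subst ut2_L_eq[OF that(2)]) (simp add: ut2_eq_iff)
  have "foldr (\<lambda>\<gamma>. \<gamma>) (letters w) a = ut2_scale (?e0 w) a + ut2_scale (?e1 w) (ut2_delta a)"
    if w: "w \<in> Poly_Mapping.keys h" for w
  proof -
    have L: "set (letters w) \<subseteq> ut2_L" using assms w by (auto simp: free1_def)
    obtain ds where ds: "w = FWord ds" by (cases w)
    consider "ds = []" | d where "ds = [d]" | d d' ds' where "ds = d # d' # ds'"
      by (cases ds; cases "tl ds") auto
    then show ?thesis
    proof cases
      case 1
      then show ?thesis by (simp add: ds zero_fword_def ut2_eq_iff)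
    next
      case 2
      then have "d a = ut2_scale (kap d) (ut2_delta a)" using L ds ut2_L_eq[of d] by (metis fword.sel list.set_intros(1) subsetD)
      with 2 show ?thesis by (simp add: ds zero_fword_def ut2_eq_iff)
    next
      case 3
      then show ?thesis using nil[of d d'] L by (simp add: ds zero_fword_def ut2_eq_iff)
    qed
  qed
  then have "eact h a = lext ut2_scale (\<lambda>w. ut2_scale (?e0 w) a + ut2_scale (?e1 w) (ut2_delta a)) h"
    unfolding env_act_lext by (rule ut2.lext_cong)
  also have "\<dots> = ut2_scale (lext (*) ?e0 h) a + ut2_scale (lext (*) ?e1 h) (ut2_delta a)"
    unfolding ut2.lext_plus_fun
    by (simp add: lext_def ut2.scale_sum_left)
  also have "lext (*) ?e0 h = eps0 h"
    by (simp add: lext_def eps0_def in_keys_iff if_distrib[of "\<lambda>x. _ * x"] cong: if_cong flip: zero_fword_def)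
  finally show ?thesis by (simp add: eps1_def)
qed

section \<open>The enveloping algebra\<close>

lemma lie_in_L:
  assumes "d \<in> ut2_L" "e \<in> (ut2_L :: ('a::field ut2 \<Rightarrow> 'a ut2) set)"
  shows "(\<lambda>a. ut2_scale k (d a) + ut2_scale l (e a)) \<in> ut2_L" "lie_bracket d e \<in> ut2_L"
  using lie_algebra_of_derivations_ut2_L assms by (auto simp: lie_algebra_of_derivations_def)

lemma env_rels_free1: "env_rels ut2_scale ut2_L \<subseteq> free1 (ut2_L :: ('a::field ut2 \<Rightarrow> 'a ut2) set)"
  unfolding env_rels_def comm_def
  by (auto intro!: smul.subspace_diff[OF subspace_free1] smul.subspace_add[OF subspace_free1]
      smul.subspace_scale[OF subspace_free1] free1_letter free1_times lie_in_L)

lemma alg_ideal_env_ideal: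
  "alg_ideal smul (free1 (ut2_L :: ('a::field ut2 \<Rightarrow> 'a ut2) set)) (env_ideal ut2_scale ut2_L)"
proof -
  let ?F = "{I. alg_ideal smul (free1 ut2_L :: ('a ut2 \<Rightarrow> 'a ut2, 'a) free_alg set) I \<and> env_rels ut2_scale ut2_L \<subseteq> I}"
  have "alg_ideal smul (free1 ut2_L) (free1 ut2_L :: ('a ut2 \<Rightarrow> 'a ut2, 'a) free_alg set)"
    unfolding alg_ideal_def
    by (auto intro: smul.subspace_0[OF subspace_free1] smul.subspace_add[OF subspace_free1]
        smul.subspace_scale[OF subspace_free1] free1_times)
  then have "free1 ut2_L \<in> ?F" using env_rels_free1 by simp
  then have sub: "\<Inter> ?F \<subseteq> free1 ut2_L" by blast
  show ?thesis
    unfolding env_ideal_def alg_ideal_def[of smul "free1 ut2_L" "\<Inter> ?F"]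
  proof (intro conjI ballI allI sub)
    show "0 \<in> \<Inter> ?F" by (auto simp: alg_ideal_def)
    fix x c assume x: "x \<in> \<Inter> ?F"
    show "smul c x \<in> \<Inter> ?F" using x by (auto simp: alg_ideal_def)
    fix y assume "y \<in> \<Inter> ?F"
    then show "x + y \<in> \<Inter> ?F" using x by (auto simp: alg_ideal_def)
  next
    fix x a :: "('a ut2 \<Rightarrow> 'a ut2, 'a) free_alg" assume x: "x \<in> \<Inter> ?F" and a: "a \<in> free1 ut2_L"
    show "a * x \<in> \<Inter> ?F" "x * a \<in> \<Inter> ?F" using x a by (auto simp: alg_ideal_def)
  qed
qed

lemma env_ideal_least:
  "alg_ideal smul (free1 ut2_L) I \<Longrightarrow> env_rels ut2_scale ut2_L \<subseteq> I \<Longrightarrow> env_ideal ut2_scale ut2_L \<subseteq> I"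
  unfolding env_ideal_def by blast

lemma env_rels_env_ideal: "env_rels ut2_scale ut2_L \<subseteq> env_ideal ut2_scale ut2_L"
  unfolding env_ideal_def by blast

lemma quotient_space_env:
  "quotient_space smul (free1 (ut2_L :: ('a::field ut2 \<Rightarrow> 'a ut2) set)) (env_ideal ut2_scale ut2_L)"
proof (unfold_locales)
  show "smul.subspace (free1 ut2_L :: ('a ut2 \<Rightarrow> 'a ut2, 'a) free_alg set)" by (rule subspace_free1)
  show "smul.subspace (env_ideal ut2_scale (ut2_L :: ('a ut2 \<Rightarrow> 'a ut2) set))"
    using alg_ideal_env_ideal by (intro smul.subspaceI) (auto simp: alg_ideal_def)
  show "env_ideal ut2_scale ut2_L \<subseteq> (free1 ut2_L :: ('a ut2 \<Rightarrow> 'a ut2, 'a) free_alg set)"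
    using alg_ideal_env_ideal by (auto simp: alg_ideal_def)
qed

lemma eact_times:
  fixes h :: "('a::field_char_0 ut2 \<Rightarrow> 'a ut2, 'a) free_alg"
  assumes "h \<in> free1 ut2_L"
  shows "eact (h * k) a = eact h (eact k a)"
  by (rule env_act_times[OF module_ut2 _ _ assms]) (auto simp: L_linear)

lemma eact_linear:
  fixes h :: "('a::field_char_0 ut2 \<Rightarrow> 'a ut2, 'a) free_alg"
  assumes "h \<in> free1 ut2_L"
  shows "eact h (u + v) = eact h u + eact h v" "eact h (ut2_scale c v) = ut2_scale c (eact h v)"
  by (rule env_act_linear[OF module_ut2 _ _ assms]; simp add: L_linear)+

lemma eact_arg: "eact (f + g) a = eact f a + eact g a" "eact (smul c f) a = ut2_scale c (eact f a)"
  "eact (f - g) a = eact f a - eact g a" "eact 0 a = 0"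
  by (simp_all add: env_act_lext ut2.lext_add ut2.lext_smul ut2.lext_diff)

lemma eact_letter: "eact (letter \<gamma>) a = \<gamma> (a :: 'a::field ut2)"
  by (simp add: env_act_lext letter_def ut2_eq_iff)

lemma eact_env_ideal:
  assumes "h \<in> env_ideal ut2_scale (ut2_L :: ('a::field_char_0 ut2 \<Rightarrow> 'a ut2) set)"
  shows "eact h a = 0"
proof -
  let ?I = "{h \<in> free1 (ut2_L :: ('a ut2 \<Rightarrow> 'a ut2) set). \<forall>a. eact h a = 0}"
  have z: "eact h 0 = 0" if "h \<in> free1 ut2_L" for h :: "('a ut2 \<Rightarrow> 'a ut2, 'a) free_alg"
    using eact_linear(1)[OF that, of 0 0] by simp
  have "alg_ideal smul (free1 ut2_L) ?I"
    unfolding alg_ideal_def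
    by (auto simp: eact_arg eact_times z smul.subspace_0[OF subspace_free1]
        intro: smul.subspace_add[OF subspace_free1] smul.subspace_scale[OF subspace_free1] free1_times)
  moreover have "env_rels ut2_scale ut2_L \<subseteq> ?I"
  proof
    fix x :: "('a ut2 \<Rightarrow> 'a ut2, 'a) free_alg" assume x: "x \<in> env_rels ut2_scale ut2_L"
    then have "x \<in> free1 ut2_L" using env_rels_free1 by blast
    moreover have "eact x a = 0" for a
      using x unfolding env_rels_def comm_def
      by (auto simp: eact_arg eact_letter eact_times[OF free1_letter] lie_bracket_def)
    ultimately show "x \<in> ?I" by blast
  qed
  ultimately show ?thesis using env_ideal_least assms by blast
qed


section \<open>Differential polynomials\<close>

locale env_based =
  fixes B :: "('a::field_char_0 ut2 \<Rightarrow> 'a ut2, 'a) free_alg set"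
  assumes basis: "env_basis ut2_scale ut2_L B" and one_B: "1 \<in> B"
begin

sublocale env: quotient_space smul "free1 ut2_L :: ('a ut2 \<Rightarrow> 'a ut2, 'a) free_alg set" "env_ideal ut2_scale ut2_L"
  by (rule quotient_space_env)

abbreviation U :: "('a ut2 \<Rightarrow> 'a ut2, 'a) free_alg set" where "U \<equiv> free1 ut2_L"
abbreviation EI :: "('a ut2 \<Rightarrow> 'a ut2, 'a) free_alg set" where "EI \<equiv> env_ideal ut2_scale ut2_L"
abbreviation \<Delta> :: "('a ut2 \<Rightarrow> 'a ut2, 'a) free_alg" where "\<Delta> \<equiv> letter ut2_delta"
abbreviation dv where "dv \<equiv> dvar ut2_scale ut2_L B"
abbreviation DP where "DP \<equiv> dpolys B"
abbreviation DP1 :: "('a ut2, 'a) dpoly set" where "DP1 \<equiv> free1 (UNIV \<times> B)"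
abbreviation der where "der \<equiv> dpoly_der ut2_scale ut2_L B"
abbreviation dact where "dact \<equiv> dpoly_act ut2_scale ut2_L B"
abbreviation dsub where "dsub \<equiv> dsubst ut2_scale ut2_L B"
abbreviation dev :: "(nat \<Rightarrow> 'a ut2) \<Rightarrow> ('a ut2, 'a) dpoly \<Rightarrow> 'a ut2" where "dev \<equiv> deval ut2_scale"

lemma qb: "quot_basis smul U EI B"
  using basis by (simp add: env_basis_def)

lemma B_U: "B \<subseteq> U"
  using env.quot_basis_subset[OF qb] .

lemma Delta_U: "\<Delta> \<in> U" "1 \<in> U"
  using delta_in_L by (auto intro: free1_letter free1_one)

lemma dv_lext: "dv j h = lext smul (\<lambda>b. letter (j, b)) (quot_coords smul EI B h)"
  by (simp add: dvar_def lext_def Let_def)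

lemma dv_add: "h \<in> U \<Longrightarrow> k \<in> U \<Longrightarrow> dv j (h + k) = dv j h + dv j k"
  by (simp add: dv_lext env.quot_coords_add[OF qb] smul.lext_add)

lemma dv_smul: "h \<in> U \<Longrightarrow> dv j (smul c h) = smul c (dv j h)"
  by (simp add: dv_lext env.quot_coords_scale[OF qb] smul.lext_smul)

lemma dv_zero: "h \<in> EI \<Longrightarrow> dv j h = 0"
  by (simp add: dv_lext env.quot_coords_zero[OF qb])

lemma dv_cong: "h \<in> U \<Longrightarrow> k \<in> U \<Longrightarrow> h - k \<in> EI \<Longrightarrow> dv j h = dv j k"
  by (simp add: dv_lext env.quot_coords_cong[OF qb])

lemma dv_basis: "b \<in> B \<Longrightarrow> dv j b = letter (j, b)"
  by (simp add: dv_lext env.quot_coords_basis[OF qb])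

lemma dv_one: "dv j 1 = letter (j, 1)"
  by (rule dv_basis[OF one_B])

lemma dv_lext_U:
  assumes "\<And>k. k \<in> Poly_Mapping.keys f \<Longrightarrow> g k \<in> U"
  shows "dv j (lext smul g f) = lext smul (\<lambda>k. dv j (g k)) f"
proof -
  have "dv j (\<Sum>k\<in>K. smul (c k) (g k)) = (\<Sum>k\<in>K. smul (c k) (dv j (g k)))"
    if "finite K" "\<And>k. k \<in> K \<Longrightarrow> g k \<in> U" for K and c :: "_ \<Rightarrow> 'a"
    using that
  proof (induction K rule: finite_induct)
    case (insert k K)
    then have "(\<Sum>k\<in>K. smul (c k) (g k)) \<in> U" "g k \<in> U"
      by (auto intro!: smul.subspace_sum[OF subspace_free1] smul.subspace_scale[OF subspace_free1])
    then show ?case using insert by (simp add: dv_add dv_smul smul.subspace_scale[OF subspace_free1])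
  qed (use dv_zero[OF smul.subspace_0[OF env.W]] in simp)
  then show ?thesis using assms by (simp add: lext_def)
qed

lemma quot_coords_keys: "h \<in> U \<Longrightarrow> Poly_Mapping.keys (quot_coords smul EI B h) \<subseteq> B"
  "h \<in> U \<Longrightarrow> h - lext smul (\<lambda>b. b) (quot_coords smul EI B h) \<in> EI"
  using env.represents_quot_coords[OF qb] by (auto simp: env.represents_iff)

lemma DP_eq: "DP = free0 (UNIV \<times> B)"
  by (simp add: dpolys_def)

lemma subspace_DP: "smul.subspace DP"
  unfolding DP_eq by (rule subspace_free0)

lemma DP_DP1: "f \<in> DP \<Longrightarrow> f \<in> DP1"
  by (simp add: DP_eq free0_free1)

lemma DP_times: "f \<in> DP \<Longrightarrow> h \<in> DP1 \<Longrightarrow> f * h \<in> DP" "f \<in> DP1 \<Longrightarrow> h \<in> DP \<Longrightarrow> f * h \<in> DP"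
  by (simp_all add: DP_eq free0_times)

lemma DP_closed: "f \<in> DP \<Longrightarrow> g \<in> DP \<Longrightarrow> f * g \<in> DP" "f \<in> DP \<Longrightarrow> g \<in> DP \<Longrightarrow> f + g \<in> DP"
  "f \<in> DP \<Longrightarrow> g \<in> DP \<Longrightarrow> f - g \<in> DP" "f \<in> DP \<Longrightarrow> smul c f \<in> DP" "0 \<in> DP"
  using DP_times DP_DP1 subspace_DP
  by (auto intro: smul.subspace_add smul.subspace_diff smul.subspace_scale smul.subspace_0)

lemma DP_comm: "f \<in> DP \<Longrightarrow> g \<in> DP \<Longrightarrow> comm f g \<in> DP"
  by (simp add: comm_def DP_closed)

lemma DP_word: "word u \<in> DP \<longleftrightarrow> snd ` set u \<subseteq> B \<and> u \<noteq> []"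
  by (auto simp: DP_eq free0_word)

lemma DP1_word: "word u \<in> DP1 \<longleftrightarrow> snd ` set u \<subseteq> B"
  by (auto simp: free1_word)

lemma DP_letter: "b \<in> B \<Longrightarrow> letter (j, b) \<in> DP"
  using DP_word[of "[(j, b)]"] by (simp add: letter_def)

lemma dv_DP: "h \<in> U \<Longrightarrow> dv j h \<in> DP"
  unfolding dv_lext lext_def
  using quot_coords_keys(1)[of h] by (intro smul.subspace_sum[OF subspace_DP] smul.subspace_scale[OF subspace_DP] DP_letter) auto

subsection \<open>The derivations\<close>

lemma der_lext: "der \<gamma> f = lext smul (\<lambda>w. der_word ut2_scale ut2_L B \<gamma> (letters w)) f"
  by (simp add: dpoly_der_def lext_def)

lemma der_linear: "der \<gamma> (f + g) = der \<gamma> f + der \<gamma> g" "der \<gamma> (smul c f) = smul c (der \<gamma> f)"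
  "der \<gamma> (f - g) = der \<gamma> f - der \<gamma> g" "der \<gamma> 0 = 0" "der \<gamma> (- f) = - der \<gamma> f"
  by (simp_all add: der_lext smul.lext_add smul.lext_smul smul.lext_diff smul.lext_uminus)

lemma der_word_append: "der_word ut2_scale ut2_L B \<gamma> (u @ v)
    = der_word ut2_scale ut2_L B \<gamma> u * word v + word u * der_word ut2_scale ut2_L B \<gamma> v"
proof (induction u)
  case (Cons l u)
  obtain j b where "l = (j, b)" by (cases l)
  then show ?case using Cons
    by (simp add: distrib_left distrib_right word_Cons word_append mult.assoc add.assoc)
qed (simp add: word_Nil)

lemma der_times: "der \<gamma> (f * g) = der \<gamma> f * g + f * der \<gamma> g"
proof -
  have 1: "der \<gamma> (Poly_Mapping.single u c * g) = der \<gamma> (Poly_Mapping.single u c) * g + Poly_Mapping.single u c * der \<gamma> g" for u c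
  proof (induction g rule: free_induct)
    case (add g v d)
    have "der \<gamma> (Poly_Mapping.single u c * Poly_Mapping.single v d)
        = der \<gamma> (Poly_Mapping.single u c) * Poly_Mapping.single v d + Poly_Mapping.single u c * der \<gamma> (Poly_Mapping.single v d)"
    proof -
      have s: "Poly_Mapping.single u c = smul c (word (letters u))" "Poly_Mapping.single v d = smul d (word (letters v))"
        by simp_all
      show ?thesis
        unfolding s smul_mult_left smul_mult_right der_linear word_append[symmetric]
        by (simp add: der_lext der_word_append smul_mult_left smul_mult_right smul.scale_right_distrib mult.commute del: smul_single)
    qed
    with add show ?case by (simp add: distrib_left der_linear del: mult_single)
  qed (simp add: der_linear)
  show ?thesis
    by (induction f rule: free_induct) (simp_all add: der_linear distrib_right 1)
qed

lemma der_one: "der \<gamma> 1 = 0"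
  by (simp add: der_lext flip: word_Nil)

lemma der_letter: "der \<gamma> (letter (j, b)) = dv j (letter \<gamma> * b)"
  by (simp add: der_lext letter_def word_Nil)

lemma der_dv:
  assumes "\<gamma> \<in> ut2_L" "h \<in> U"
  shows "der \<gamma> (dv j h) = dv j (letter \<gamma> * h)"
proof -
  let ?c = "quot_coords smul EI B h"
  have bU: "letter \<gamma> * b \<in> U" if "b \<in> Poly_Mapping.keys ?c" for b
    using that quot_coords_keys(1)[OF assms(2)] B_U assms(1) by (auto intro: free1_times free1_letter)
  have "der \<gamma> (dv j h) = lext smul (\<lambda>b. der \<gamma> (letter (j, b))) ?c"
    unfolding dv_lext by (rule lext_compose[OF smul.module_axioms smul.module_axioms]) (simp_all add: der_linear)
  also have "\<dots> = dv j (lext smul (\<lambda>b. letter \<gamma> * b) ?c)"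
    unfolding der_letter by (rule dv_lext_U[symmetric]) (rule bU)
  also have "lext smul (\<lambda>b. letter \<gamma> * b) ?c = letter \<gamma> * lext smul (\<lambda>b. b) ?c"
    by (simp add: lext_def sum_distrib_left smul_mult_right)
  also have "dv j \<dots> = dv j (letter \<gamma> * h)"
  proof (rule dv_cong)
    have l: "letter \<gamma> \<in> U" using assms(1) by (rule free1_letter)
    have "lext smul (\<lambda>b. b) ?c \<in> U" unfolding lext_def
      using quot_coords_keys(1)[OF assms(2)] B_U
      by (intro smul.subspace_sum[OF subspace_free1] smul.subspace_scale[OF subspace_free1]) auto
    then show "letter \<gamma> * lext smul (\<lambda>b. b) ?c \<in> U" "letter \<gamma> * h \<in> U"
      using l assms(2) by (auto intro: free1_times)
    have "letter \<gamma> * (h - lext smul (\<lambda>b. b) ?c) \<in> EI"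
      using quot_coords_keys(2)[OF assms(2)] alg_ideal_env_ideal l by (auto simp: alg_ideal_def)
    then have "smul (- 1) (letter \<gamma> * (h - lext smul (\<lambda>b. b) ?c)) \<in> EI" by (rule smul.subspace_scale[OF env.W])
    then show "letter \<gamma> * lext smul (\<lambda>b. b) ?c - letter \<gamma> * h \<in> EI"
      by (simp add: right_diff_distrib)
  qed
  finally show ?thesis .
qed

lemma der_word_DP:
  assumes "\<gamma> \<in> ut2_L" "snd ` set u \<subseteq> B"
  shows "der_word ut2_scale ut2_L B \<gamma> u \<in> DP"
  using assms(2)
proof (induction u)
  case (Cons l u)
  obtain j b where l: "l = (j, b)" by (cases l)
  have "letter \<gamma> * b \<in> U" using assms(1) Cons.prems B_U l by (auto intro: free1_times free1_letter)
  then have "dv j (letter \<gamma> * b) * word u \<in> DP" using Cons.prems by (intro DP_times dv_DP) (auto simp: DP1_word)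
  moreover have "letter (j, b) * der_word ut2_scale ut2_L B \<gamma> u \<in> DP"
    using Cons l by (intro DP_closed DP_letter) auto
  ultimately show ?case by (simp add: l DP_closed)
qed (simp add: DP_closed)

lemma der_DP: "\<gamma> \<in> ut2_L \<Longrightarrow> f \<in> DP1 \<Longrightarrow> der \<gamma> f \<in> DP"
  unfolding der_lext
proof (rule free0_lext[OF subspace_DP])
  fix u :: "(nat \<times> _) list" assume "\<gamma> \<in> ut2_L" "set u \<subseteq> UNIV \<times> B"
  then show "der_word ut2_scale ut2_L B \<gamma> (letters (FWord u)) \<in> DP" by (auto intro!: der_word_DP)
qed

lemma module_smul: "module (smul :: 'a \<Rightarrow> ('k \<Rightarrow>\<^sub>0 'a) \<Rightarrow> _)"
  by (rule smul.module_axioms)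

lemma dact_env_act: "dact h f = env_act der smul h f"
  by (simp add: dpoly_act_def)

lemma dact_times: "h \<in> U \<Longrightarrow> dact (h * k) f = dact h (dact k f)"
  unfolding dact_env_act by (rule env_act_times[OF module_smul]) (auto simp: der_linear)

lemma dact_linear: "h \<in> U \<Longrightarrow> dact h (f + g) = dact h f + dact h g" "h \<in> U \<Longrightarrow> dact h (smul c f) = smul c (dact h f)"
  unfolding dact_env_act by (rule env_act_linear[OF module_smul]; simp add: der_linear)+

lemma dact_arg: "dact (h + k) f = dact h f + dact k f" "dact (smul c h) f = smul c (dact h f)"
  "dact (h - k) f = dact h f - dact k f" "dact 0 f = 0"
  by (simp_all add: dact_env_act env_act_lext smul.lext_add smul.lext_smul smul.lext_diff)

lemma dact_one: "dact 1 f = f"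
  by (simp add: dact_env_act env_act_lext flip: word_Nil)

lemma dact_letter: "dact (letter \<gamma>) f = der \<gamma> f"
  by (simp add: dact_env_act env_act_lext letter_def)

lemma dact_dv: "h \<in> U \<Longrightarrow> k \<in> U \<Longrightarrow> dact h (dv j k) = dv j (h * k)"
proof (induction h rule: free1_induct)
  case (lmult \<gamma> h)
  then have "letter \<gamma> \<in> U" by (intro free1_letter)
  with lmult show ?case
    by (simp add: dact_times dact_letter der_dv free1_times mult.assoc)
qed (simp_all add: dact_one dact_arg distrib_right dv_add free1_times smul_mult_left dv_smul)

lemma dact_DP: "h \<in> U \<Longrightarrow> f \<in> DP \<Longrightarrow> dact h f \<in> DP"
proof (induction h rule: free1_induct)
  case (lmult \<gamma> h)
  then have "letter \<gamma> \<in> U" by (intro free1_letter)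
  with lmult show ?case by (simp add: dact_times dact_letter der_DP DP_DP1)
qed (simp_all add: dact_one dact_arg DP_closed)

lemma der_cong_L:
  assumes d: "d \<in> ut2_L" and f: "f \<in> DP1"
  shows "der d f = smul (kap d) (der ut2_delta f)"
proof -
  have rel: "letter d - smul (kap d) \<Delta> \<in> EI"
  proof -
    have "d = (\<lambda>a. ut2_scale (kap d) (ut2_delta a) + ut2_scale 0 (ut2_delta a))"
      using ut2_L_eq[OF d] by (simp add: ut2.scale_zero_left)
    then have "letter d - (smul (kap d) \<Delta> + smul 0 \<Delta>)
        = letter (\<lambda>a. ut2_scale (kap d) (ut2_delta a) + ut2_scale 0 (ut2_delta a)) - (smul (kap d) \<Delta> + smul 0 \<Delta>)"
      by (rule arg_cong)
    then have "letter d - (smul (kap d) \<Delta> + smul 0 \<Delta>) \<in> env_rels ut2_scale ut2_L"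
      unfolding env_rels_def using delta_in_L by blast
    then show ?thesis using env_rels_env_ideal by auto
  qed
  have dv: "dv j (letter d * b) = smul (kap d) (dv j (\<Delta> * b))" if b: "b \<in> B" for j b
  proof -
    have bU: "b \<in> U" using b B_U by blast
    have "dv j (letter d * b) = dv j (smul (kap d) (\<Delta> * b))"
    proof (rule dv_cong)
      have "(letter d - smul (kap d) \<Delta>) * b \<in> EI"
        using alg_ideal_env_ideal rel bU by (auto simp: alg_ideal_def)
      then show "letter d * b - smul (kap d) (\<Delta> * b) \<in> EI" by (simp add: left_diff_distrib smul_mult_left)
    qed (use d bU Delta_U in \<open>auto intro: free1_times free1_letter smul.subspace_scale[OF subspace_free1]\<close>)
    then show ?thesis using bU Delta_U by (simp add: dv_smul free1_times)
  qed
  have "der_word ut2_scale ut2_L B d u = smul (kap d) (der_word ut2_scale ut2_L B ut2_delta u)"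
    if "snd ` set u \<subseteq> B" for u
    using that
  proof (induction u)
    case (Cons l u)
    obtain j b where "l = (j, b)" by (cases l)
    then show ?case using Cons by (simp add: dv smul_mult_left smul_mult_right smul.scale_right_distrib)
  qed simp
  then have "lext smul (\<lambda>w. der_word ut2_scale ut2_L B d (letters w)) f
      = lext smul (\<lambda>w. smul (kap d) (der_word ut2_scale ut2_L B ut2_delta (letters w))) f"
  proof (intro smul.lext_cong)
    fix k assume "k \<in> Poly_Mapping.keys f"
    then have "set (letters k) \<subseteq> UNIV \<times> B" using f unfolding free1_def by blast
    then have "snd ` set (letters k) \<subseteq> B" by auto
    then show "der_word ut2_scale ut2_L B d (letters k) = smul (kap d) (der_word ut2_scale ut2_L B ut2_delta (letters k))"
      by fact
  qed
  then show ?thesis by (simp add: der_lext smul.lext_scale_fun)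
qed

text \<open>
  The action on differential polynomials factors through the enveloping algebra: the elements that act as zero after arbitrary multiplication form an ideal containing the defining relations.
\<close>

lemma dact_env_ideal:
  assumes "h \<in> EI" "f \<in> DP"
  shows "dact h f = 0"
proof -
  let ?I = "{h \<in> U. \<forall>f\<in>DP. dact h f = 0}"
  have z: "dact h 0 = 0" if "h \<in> U" for h
    using dact_linear(1)[OF that, of 0 0] by simp
  have "alg_ideal smul U ?I"
    unfolding alg_ideal_def
    by (auto simp: dact_arg dact_times dact_DP z smul.subspace_0[OF subspace_free1]
        intro: smul.subspace_add[OF subspace_free1] smul.subspace_scale[OF subspace_free1] free1_times)
  moreover have "env_rels ut2_scale ut2_L \<subseteq> ?I"
  proof
    fix x :: "('a ut2 \<Rightarrow> 'a ut2, 'a) free_alg" assume x: "x \<in> env_rels ut2_scale ut2_L"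
    then have "x \<in> U" using env_rels_free1 by blast
    moreover have "dact x f = 0" if f: "f \<in> DP" for f
      using x unfolding env_rels_def
    proof (elim UnE CollectE exE conjE)
      fix k l d e assume "x = letter (\<lambda>a. ut2_scale k (d a) + ut2_scale l (e a)) - (smul k (letter d) + smul l (letter e))"
        "d \<in> ut2_L" "e \<in> ut2_L"
      moreover have "kap (\<lambda>a. ut2_scale k (d a) + ut2_scale l (e a)) = k * kap d + l * kap e"
        by (simp add: kap_def algebra_simps)
      ultimately show ?thesis using f
        by (simp add: dact_arg dact_letter der_cong_L[of d] der_cong_L[of e] lie_in_L DP_DP1
            der_cong_L[of "\<lambda>a. ut2_scale k (d a) + ut2_scale l (e a)"] smul.scale_left_distrib)
    next
      fix d e assume x: "x = comm (letter d) (letter e) - letter (lie_bracket d e)" and de: "d \<in> ut2_L" "e \<in> ut2_L"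
      obtain k l where de': "d = (\<lambda>a. ut2_scale k (ut2_delta a))" "e = (\<lambda>a. ut2_scale l (ut2_delta a))"
        using de by (auto simp: ut2_L_def)
      have "lie_bracket d e = (\<lambda>a. 0)"
        unfolding lie_bracket_def de' by (simp add: ut2_eq_iff fun_eq_iff)
      then have "kap (lie_bracket d e) = 0" by (simp add: kap_def)
      then have "der (lie_bracket d e) f = 0" using de f by (simp add: der_cong_L[OF lie_in_L(2)] DP_DP1)
      then show ?thesis using de f unfolding x comm_def
        by (simp add: dact_arg dact_times free1_letter dact_letter der_cong_L[of d] der_cong_L[of e] DP_DP1 der_DP
            der_linear delta_in_L mult.commute)
    qed
    ultimately show "x \<in> ?I" by blast
  qed
  ultimately show ?thesis using env_ideal_least assms by blast
qed

subsection \<open>Substitution and evaluation\<close>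

lemma dsub_lext: "dsub g f = lext smul (\<lambda>w. prod_list (map (\<lambda>(j, b). dact b (g j)) (letters w))) f"
  by (simp add: dsubst_def lext_def)

lemma dsub_linear: "dsub g (f + h) = dsub g f + dsub g h" "dsub g (smul c f) = smul c (dsub g f)"
  "dsub g (f - h) = dsub g f - dsub g h"
  by (simp_all add: dsub_lext smul.lext_add smul.lext_smul smul.lext_diff)

lemma dsub_times: "dsub g (f * h) = dsub g f * dsub g h"
  unfolding dsub_lext by (rule lext_times[OF module_smul]) (simp_all add: smul_mult_left smul_mult_right)

lemma dsub_comm: "dsub g (comm f h) = comm (dsub g f) (dsub g h)"
  by (simp add: comm_def dsub_linear dsub_times)

lemma dsub_letter: "dsub g (letter (j, b)) = dact b (g j)"
  by (simp add: dsub_lext letter_def)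

lemma dsub_dv:
  assumes "g j \<in> DP" "h \<in> U"
  shows "dsub g (dv j h) = dact h (g j)"
proof -
  let ?c = "quot_coords smul EI B h"
  have "dsub g (dv j h) = lext smul (\<lambda>b. dsub g (letter (j, b))) ?c"
    unfolding dv_lext by (rule lext_compose[OF module_smul module_smul]) (simp_all add: dsub_linear)
  also have "\<dots> = dact (lext smul (\<lambda>b. b) ?c) (g j)"
    unfolding dsub_letter
    by (rule lext_compose[where F = "\<lambda>h. dact h (g j)", OF module_smul module_smul, symmetric]) (simp_all add: dact_arg)
  also have "\<dots> = dact h (g j)"
    using dact_env_ideal[OF quot_coords_keys(2)[OF assms(2)] assms(1)] by (simp add: dact_arg)
  finally show ?thesis .
qed

lemma dsub_DP:
  assumes "\<And>j. g j \<in> DP" "f \<in> DP"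
  shows "dsub g f \<in> DP"
  unfolding dsub_lext
proof (rule free0_lext[OF subspace_DP DP_DP1[OF assms(2)]])
  fix u assume u: "set u \<subseteq> UNIV \<times> B" "Poly_Mapping.lookup f (FWord u) \<noteq> 0"
  have "u \<noteq> []" using u(2) assms(2) by (auto simp: DP_eq free0_def)
  then have "prod_list (map (\<lambda>(j, b). dact b (g j)) u) \<in> DP"
    using u(1)
  proof (induction u rule: list_nonempty_induct)
    case (single x)
    then show ?case using assms(1) B_U by (cases x) (auto intro: dact_DP)
  next
    case (cons x xs)
    then show ?case using assms(1) B_U by (cases x) (auto intro!: DP_closed(1) dact_DP)
  qed
  then show "prod_list (map (\<lambda>(j, b). dact b (g j)) (letters (FWord u))) \<in> DP" by simp
qed

lemma dev_lext: "dev a f = lext ut2_scale (\<lambda>w. prod_list (map (\<lambda>(j, b). eact b (a j)) (letters w))) f"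
  by (simp add: deval_def lext_def)

lemma dev_linear: "dev a (f + h) = dev a f + dev a h" "dev a (smul c f) = ut2_scale c (dev a f)"
  "dev a (f - h) = dev a f - dev a h" "dev a 0 = 0"
  by (simp_all add: dev_lext ut2.lext_add ut2.lext_smul ut2.lext_diff)

lemma dev_times: "dev a (f * h) = dev a f * dev a h"
  unfolding dev_lext by (rule lext_times[OF module_ut2]) (simp_all add: ut2_scale_simps)

lemma dev_comm: "dev g (comm f h) = comm (dev g f) (dev g h)"
  by (simp add: comm_def dev_linear dev_times)

lemma dev_letter: "dev a (letter (j, b)) = eact b (a j)"
  by (simp add: dev_lext letter_def ut2_eq_iff)

lemma dev_dv:
  assumes "h \<in> U"
  shows "dev a (dv j h) = eact h (a j)"
proof -
  let ?c = "quot_coords smul EI B h"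
  have "dev a (dv j h) = lext ut2_scale (\<lambda>b. dev a (letter (j, b))) ?c"
    unfolding dv_lext by (rule lext_compose[OF module_smul module_ut2]) (simp_all add: dev_linear)
  also have "\<dots> = eact (lext smul (\<lambda>b. b) ?c) (a j)"
    unfolding dev_letter
    by (rule lext_compose[where F = "\<lambda>h. eact h (a j)", OF module_smul module_ut2, symmetric]) (simp_all add: eact_arg)
  also have "\<dots> = eact h (a j)"
    using eact_env_ideal[OF quot_coords_keys(2)[OF assms]] by (simp add: eact_arg)
  finally show ?thesis .
qed

lemma dev_one: "dev a 1 = 1"
  by (simp add: dev_lext ut2_eq_iff flip: word_Nil)

lemma L_derivation: "\<gamma> \<in> ut2_L \<Longrightarrow> \<gamma> (A * C) = \<gamma> A * C + A * \<gamma> (C :: 'a ut2)"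
  using lie_algebra_of_derivations_ut2_L by (auto simp: lie_algebra_of_derivations_def derivation_def)

lemma dev_der:
  assumes "\<gamma> \<in> ut2_L" "f \<in> DP1"
  shows "dev a (der \<gamma> f) = \<gamma> (dev a f)"
  using assms(2)
proof (induction f rule: free1_induct)
  case one
  have "\<gamma> 1 = 0" using assms(1) by (auto simp: ut2_L_def ut2_eq_iff)
  then show ?case by (simp add: der_one dev_one dev_linear)
next
  case (lmult l f)
  then obtain j b where l: "l = (j, b)" "b \<in> B" by auto
  have "b \<in> U" "letter \<gamma> \<in> U" using l B_U assms(1) by (auto intro: free1_letter)
  then have "dev a (der \<gamma> (letter (j, b))) = \<gamma> (dev a (letter (j, b)))"
    by (simp add: der_letter dev_letter dev_dv free1_times eact_times eact_letter)
  then show ?case using lmult by (simp add: l der_times dev_linear dev_times L_derivation[OF assms(1)])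
qed (simp_all add: der_linear dev_linear L_linear[OF assms(1)])

lemma dev_dact: "h \<in> U \<Longrightarrow> f \<in> DP \<Longrightarrow> dev a (dact h f) = eact h (dev a f)"
proof (induction h rule: free1_induct)
  case one
  have "eact 1 A = A" for A :: "'a ut2"
    by (simp add: env_act_lext ut2_eq_iff flip: word_Nil)
  then show ?case by (simp add: dact_one)
next
  case (lmult \<gamma> h)
  then have "letter \<gamma> \<in> U" by (intro free1_letter)
  with lmult show ?case
    by (simp add: dact_times dact_letter dev_der dact_DP DP_DP1 eact_times eact_letter)
qed (simp_all add: dact_arg dev_linear eact_arg)

lemma dev_dsub:
  assumes "\<And>j. g j \<in> DP" "f \<in> DP1"
  shows "dev a (dsub g f) = dev (\<lambda>j. dev a (g j)) f"
  using assms(2)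
proof (induction f rule: free1_induct)
  case one
  have "dsub g 1 = 1" by (simp add: dsub_lext flip: word_Nil)
  then show ?case by (simp add: dev_one)
next
  case (lmult l f)
  then obtain j b where l: "l = (j, b)" "b \<in> B" by auto
  have "b \<in> U" using l B_U by blast
  then show ?case using lmult l assms(1) by (simp add: dsub_times dev_times dsub_letter dev_letter dev_dact)
qed (simp_all add: dsub_linear dev_linear)

abbreviation Ids :: "('a ut2, 'a) dpoly set" where "Ids \<equiv> diff_ids ut2_scale B"

lemma Ids_iff: "f \<in> Ids \<longleftrightarrow> f \<in> DP \<and> (\<forall>a. dev a f = 0)"
  by (simp add: diff_ids_def)

lemma T_ideal_Ids: "T_ideal ut2_scale ut2_L B Ids"
  unfolding T_ideal_def
proof (intro conjI ballI allI impI)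
  show "alg_ideal smul DP Ids"
    unfolding alg_ideal_def by (auto simp: Ids_iff DP_closed dev_linear dev_times ut2.scale_zero_right)
next
  fix h f assume h: "h \<in> U" and f: "f \<in> Ids"
  have "eact h 0 = 0" using eact_linear(1)[OF h, of 0 0] by simp
  then show "dact h f \<in> Ids" using f h by (simp add: Ids_iff dact_DP dev_dact)
next
  fix g :: "nat \<Rightarrow> ('a ut2, 'a) dpoly" and f assume "\<forall>j. g j \<in> DP" "f \<in> Ids"
  then show "dsub g f \<in> Ids" by (simp add: Ids_iff dsub_DP dev_dsub DP_DP1)
qed

end


section \<open>Generic evaluation\<close>

type_synonym mono = "(nat \<times> nat) multiset"

definition mval :: "(nat \<times> nat \<Rightarrow> 'a::field) \<Rightarrow> mono \<Rightarrow> 'a"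
  where "mval a m = prod_mset (image_mset a m)"

lemma mval_add [simp]: "mval a (m + m') = mval a m * mval a m'"
  by (simp add: mval_def)

lemma mval_empty [simp]: "mval a {#} = 1"
  by (simp add: mval_def)

lemma mval_zero [simp]: "mval a 0 = 1"
  using mval_empty by (simp del: mval_empty add: mval_def)

lemma mval_sing [simp]: "mval a {#x#} = a x"
  by (simp add: mval_def)

lemma mval_times: "mval (\<lambda>x. a x * b x) m = mval a m * mval b m"
  by (induction m) (simp_all add: mval_def mult_ac)

text \<open>
  Doubling one variable that separates two monomials multiplies them by different powers of two, so that a combination of the two evaluations eliminates one of them.
\<close>

lemma monomials_independent:
  fixes c :: "mono \<Rightarrow> 'a::field_char_0"
  assumes "finite M" "\<And>a. (\<Sum>m\<in>M. c m * mval a m) = 0" "m \<in> M"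
  shows "c m = 0"
  using assms
proof (induction M arbitrary: c m rule: finite_induct)
  case (insert m0 M)
  have zero: "c m1 = 0" if m1: "m1 \<in> M" for m1
  proof -
    from m1 insert.hyps(2) have "m0 \<noteq> m1" by blast
    then obtain z where z: "count m0 z \<noteq> count m1 z" by (metis multiset_eqI)
    define b :: "nat \<times> nat \<Rightarrow> 'a" where "b x = (if x = z then 2 else 1)" for x
    have b: "mval b m = 2 ^ count m z" for m
      by (induction m) (simp_all add: mval_def b_def)
    have "(\<Sum>m\<in>M. (c m * (2 ^ count m z - 2 ^ count m0 z)) * mval a m) = 0" for a
    proof -
      have "(\<Sum>m\<in>insert m0 M. c m * mval (\<lambda>x. a x * b x) m) - 2 ^ count m0 z * (\<Sum>m\<in>insert m0 M. c m * mval a m) = 0"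
        using insert.prems(1) by simp
      moreover have "(\<Sum>m\<in>insert m0 M. c m * mval (\<lambda>x. a x * b x) m) - 2 ^ count m0 z * (\<Sum>m\<in>insert m0 M. c m * mval a m)
        = (\<Sum>m\<in>insert m0 M. (c m * (2 ^ count m z - 2 ^ count m0 z)) * mval a m)"
        by (simp add: mval_times b sum_distrib_left sum_subtractf[symmetric] algebra_simps del: sum.insert)
      ultimately show ?thesis using insert.hyps by simp
    qed
    from insert.IH[OF this m1] have "c m1 * (2 ^ count m1 z - 2 ^ count m0 z) = 0" .
    moreover have "(2 :: 'a) ^ count m1 z \<noteq> 2 ^ count m0 z"
    proof
      assume "(2 :: 'a) ^ count m1 z = 2 ^ count m0 z"
      then have "of_nat (2 ^ count m1 z) = (of_nat (2 ^ count m0 z) :: 'a)" by simp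
      then have "(2 :: nat) ^ count m1 z = 2 ^ count m0 z" by (rule of_nat_eq_iff[THEN iffD1])
      with z show False by simp
    qed
    ultimately show ?thesis by simp
  qed
  have "(\<Sum>m\<in>insert m0 M. c m * mval (\<lambda>_. 1) m) = 0" by (rule insert.prems(1))
  moreover have "mval (\<lambda>_. 1 :: 'a) m = 1" for m by (simp add: mval_def)
  ultimately have "c m0 = 0" using insert.hyps zero by simp
  with zero insert.prems(2) show ?case by blast
qed simp

type_synonym 'a poly3 = "mono \<Rightarrow>\<^sub>0 'a"

definition pval :: "(nat \<times> nat \<Rightarrow> 'a::field) \<Rightarrow> 'a poly3 \<Rightarrow> 'a"
  where "pval a = lext (*) (mval a)"

lemma pval_ring [simp]: "pval a (p + q) = pval a p + pval a q" "pval a (p * q) = pval a p * pval a q"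
  "pval a (smul c p) = c * pval a p" "pval a (p - q) = pval a p - pval a q" "pval a 0 = 0" "pval a 1 = 1"
  "pval a (Poly_Mapping.single m c) = c * mval a m"
proof -
  show "pval a (p * q) = pval a p * pval a q"
    unfolding pval_def by (rule lext_times[OF module_mult]) (simp_all add: mult_ac)
  show "pval a 1 = 1" by (simp add: pval_def flip: single_one)
qed (simp_all add: pval_def vector_space_over_itself.lext_add vector_space_over_itself.lext_smul vector_space_over_itself.lext_diff)

lemma pval_prod_list [simp]: "pval a (prod_list xs) = prod_list (map (pval a) xs)"
  by (induction xs) simp_all

lemma pval_zero_imp_zero:
  assumes "\<And>a. pval a p = 0"
  shows "p = (0 :: 'a::field_char_0 poly3)"
proof (rule poly_mapping_eqI)
  fix m
  show "Poly_Mapping.lookup p m = Poly_Mapping.lookup 0 m"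
  proof (cases "m \<in> Poly_Mapping.keys p")
    case True
    have "Poly_Mapping.lookup p m = 0"
      by (rule monomials_independent[OF finite_keys _ True]) (use assms in \<open>simp add: pval_def lext_def\<close>)
    then show ?thesis by simp
  qed (simp add: in_keys_iff)
qed

definition uu :: "nat \<Rightarrow> 'a::field poly3" where "uu j = Poly_Mapping.single {#(j, 0)#} 1"
definition vv :: "nat \<Rightarrow> 'a::field poly3" where "vv j = Poly_Mapping.single {#(j, 1)#} 1"
definition ww :: "nat \<Rightarrow> 'a::field poly3" where "ww j = Poly_Mapping.single {#(j, 2)#} 1"

type_synonym 'a gen = "nat \<times> ('a ut2 \<Rightarrow> 'a ut2, 'a) free_alg"

definition g11 :: "'a::field gen \<Rightarrow> 'a poly3" where "g11 l = smul (eps0 (snd l)) (uu (fst l))"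
definition g22 :: "'a::field gen \<Rightarrow> 'a poly3" where "g22 l = smul (eps0 (snd l)) (vv (fst l))"
definition g12 :: "'a::field gen \<Rightarrow> 'a poly3"
  where "g12 l = smul (eps0 (snd l)) (ww (fst l)) + smul (eps1 (snd l) * inverse 2) (vv (fst l) - uu (fst l))"

fun w12 :: "'a::field gen list \<Rightarrow> 'a poly3" where
  "w12 [] = 0"
| "w12 (l # u) = g11 l * w12 u + g12 l * prod_list (map g22 u)"

lemma w12_snoc: "w12 (u @ [l]) = prod_list (map g11 u) * g12 l + w12 u * g22 l"
  by (induction u) (simp_all add: algebra_simps)

definition E11 :: "('a::field ut2, 'a) dpoly \<Rightarrow> 'a poly3"
  where "E11 = lext smul (\<lambda>w. prod_list (map g11 (letters w)))"

definition E12 :: "('a::field ut2, 'a) dpoly \<Rightarrow> 'a poly3"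
  where "E12 = lext smul (\<lambda>w. w12 (letters w))"

lemma E_linear: "E11 (f + g) = E11 f + E11 g" "E12 (f + g) = E12 f + E12 g"
  "E11 (f - g) = E11 f - E11 g" "E12 (f - g) = E12 f - E12 g"
  "E11 (smul c f) = smul c (E11 f)" "E12 (smul c f) = smul c (E12 f)"
  "E11 0 = 0" "E12 0 = 0"
  by (simp_all add: E11_def E12_def smul.lext_add smul.lext_diff smul.lext_smul)

lemma E11_word: "E11 (word u) = prod_list (map g11 u)"
  and E12_word: "E12 (word u) = w12 u"
  by (simp_all add: E11_def E12_def)

definition part :: "nat \<Rightarrow> mono \<Rightarrow> nat multiset"
  where "part t m = image_mset fst (filter_mset (\<lambda>z. snd z = t) m)"

context env_based
begin

text \<open>
  The generic matrices of which the polynomials are the entries specialize to every family of matrices.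
\<close>

lemma pval_E:
  fixes a :: "nat \<times> nat \<Rightarrow> 'a" and f :: "('a ut2, 'a) dpoly"
  assumes "f \<in> DP1"
  defines "A \<equiv> \<lambda>j. mk_ut2 (a (j, 0)) (a (j, 1)) (a (j, 2))"
  shows "pval a (E11 f) = ent11 (dev A f)" "pval a (E12 f) = ent12 (dev A f)"
proof -
  have gen: "ent11 (eact b (A j)) = pval a (g11 (j, b))" "ent22 (eact b (A j)) = pval a (g22 (j, b))"
    "ent12 (eact b (A j)) = pval a (g12 (j, b))" if "b \<in> B" for b j
    using that B_U by (simp_all add: eact_formula subset_iff A_def g11_def g22_def g12_def uu_def vv_def ww_def)
  have w: "pval a (prod_list (map g11 u)) = ent11 (dev A (word u)) \<and>
      pval a (prod_list (map g22 u)) = ent22 (dev A (word u)) \<and> pval a (w12 u) = ent12 (dev A (word u))"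
    if "snd ` set u \<subseteq> B" for u :: "'a gen list"
    using that
  proof (induction u)
    case Nil
    then show ?case by (simp add: word_Nil dev_one)
  next
    case (Cons l u)
    obtain j b where "l = (j, b)" by (cases l)
    then show ?case using Cons by (simp add: word_Cons dev_times dev_letter gen)
  qed
  have sub: "snd ` set (letters k) \<subseteq> B" if "k \<in> Poly_Mapping.keys f" for k
  proof -
    have "set (letters k) \<subseteq> UNIV \<times> B" using that assms(1) unfolding free1_def by blast
    then show ?thesis by auto
  qed
  have f: "dev A f = lext ut2_scale (\<lambda>k. dev A (word (letters k))) f"
    using lext_compose[where F = "dev A", OF module_smul module_ut2, of "\<lambda>k. word (letters k)" f] lext_smul_letters[of f]
    by (simp add: dev_linear)
  have "pval a (E11 f) = lext (*) (\<lambda>k. pval a (prod_list (map g11 (letters k)))) f"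
    unfolding E11_def by (rule lext_compose[OF module_smul module_mult]) (simp_all del: pval_prod_list)
  also have "\<dots> = lext (*) (\<lambda>k. ent11 (dev A (word (letters k)))) f"
    using w sub by (intro vector_space_over_itself.lext_cong) blast
  also have "\<dots> = ent11 (dev A f)"
    unfolding f by (rule lext_compose[OF module_ut2 module_mult, symmetric]) simp_all
  finally show "pval a (E11 f) = ent11 (dev A f)" .
  have "pval a (E12 f) = lext (*) (\<lambda>k. pval a (w12 (letters k))) f"
    unfolding E12_def by (rule lext_compose[OF module_smul module_mult]) simp_all
  also have "\<dots> = lext (*) (\<lambda>k. ent12 (dev A (word (letters k)))) f"
    using w sub by (intro vector_space_over_itself.lext_cong) blast
  also have "\<dots> = ent12 (dev A f)"
    unfolding f by (rule lext_compose[OF module_ut2 module_mult, symmetric]) simp_all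
  finally show "pval a (E12 f) = ent12 (dev A f)" .
qed

lemma E_Ids: "f \<in> Ids \<Longrightarrow> E11 f = 0 \<and> E12 f = 0"
  by (intro conjI pval_zero_imp_zero) (simp_all add: pval_E DP_DP1 Ids_iff)

subsection \<open>Normal forms\<close>

definition xw :: "nat list \<Rightarrow> ('a ut2, 'a) dpoly"
  where "xw l = word (map (\<lambda>j. (j, 1)) l)"

lemma xw_append: "xw (l @ m) = xw l * xw m"
  by (simp add: xw_def word_append)

lemma xw_Nil [simp]: "xw [] = 1"
  by (simp add: xw_def word_Nil)

lemma xw_Cons: "xw (j # l) = xw [j] * xw l"
  using xw_append[of "[j]" l] by simp

lemma xw_DP1: "xw l \<in> DP1"
  by (auto simp: xw_def DP1_word one_B)

lemma xw_DP: "l \<noteq> [] \<Longrightarrow> xw l \<in> DP"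
  by (auto simp: xw_def DP_word one_B)

definition sw :: "nat multiset \<Rightarrow> ('a ut2, 'a) dpoly"
  where "sw M = xw (sorted_list_of_multiset M)"

lemma sw_empty [simp]: "sw {#} = 1"
  by (simp add: sw_def)

abbreviation D :: "('a ut2, 'a) dpoly \<Rightarrow> ('a ut2, 'a) dpoly" where "D \<equiv> der ut2_delta"

text \<open>
  The tag two marks the place of a commutator, and its absence a derivative. The factor makes the leading coefficient of the corner entry equal to one.
\<close>

definition nf12 :: "mono \<Rightarrow> ('a ut2, 'a) dpoly"
  where "nf12 m = (case sorted_list_of_multiset (part 2 m) of
      [] \<Rightarrow> smul (- 2) (D (sw (part 0 m)) * sw (part 1 m))
    | [k] \<Rightarrow> (sw (part 0 m) * xw [k] - sw (part 0 m + {#k#})) * sw (part 1 m)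
    | _ \<Rightarrow> 0)"

definition N11 :: "'a poly3 \<Rightarrow> ('a ut2, 'a) dpoly"
  where "N11 = lext smul (\<lambda>m. sw (part 0 m))"

definition N12 :: "'a poly3 \<Rightarrow> ('a ut2, 'a) dpoly"
  where "N12 = lext smul nf12"

lemma N_linear: "N11 (p + q) = N11 p + N11 q" "N12 (p + q) = N12 p + N12 q" "N12 (p - q) = N12 p - N12 q"
  "N11 (smul c p) = smul c (N11 p)" "N12 (smul c p) = smul c (N12 p)" "N11 0 = 0" "N12 0 = 0"
  "N11 (Poly_Mapping.single m c) = smul c (sw (part 0 m))" "N12 (Poly_Mapping.single m c) = smul c (nf12 m)"
  by (simp_all add: N11_def N12_def smul.lext_add smul.lext_smul smul.lext_diff)

end

locale ideal_with_relations = env_based B for B :: "('a::field_char_0 ut2 \<Rightarrow> 'a ut2, 'a) free_alg set" +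
  fixes I :: "('a ut2, 'a) dpoly set"
  assumes ideal: "alg_ideal smul (dpolys B) I"
    and cc: "\<And>f g h k. f \<in> dpolys B \<Longrightarrow> g \<in> dpolys B \<Longrightarrow> h \<in> dpolys B \<Longrightarrow> k \<in> dpolys B \<Longrightarrow> comm f g * comm h k \<in> I"
    and Dc: "\<And>f g. f \<in> dpolys B \<Longrightarrow> g \<in> dpolys B \<Longrightarrow> der ut2_delta (comm f g) \<in> I"
    and dc: "\<And>f g h. f \<in> dpolys B \<Longrightarrow> g \<in> dpolys B \<Longrightarrow> h \<in> dpolys B \<Longrightarrow> der ut2_delta f * comm g h \<in> I"
    and dd: "\<And>f g. f \<in> dpolys B \<Longrightarrow> g \<in> dpolys B \<Longrightarrow> der ut2_delta f * der ut2_delta g \<in> I"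
    and D2: "\<And>j. dvar ut2_scale ut2_L B j (letter ut2_delta * letter ut2_delta) \<in> I"
    and act_closed: "\<And>h f. h \<in> free1 ut2_L \<Longrightarrow> f \<in> I \<Longrightarrow> dpoly_act ut2_scale ut2_L B h f \<in> I"
begin

lemma subspace_I: "smul.subspace I"
  using ideal by (intro smul.subspaceI) (auto simp: alg_ideal_def)

lemma I_closed: "f \<in> I \<Longrightarrow> g \<in> I \<Longrightarrow> f + g \<in> I" "f \<in> I \<Longrightarrow> g \<in> I \<Longrightarrow> f - g \<in> I" "f \<in> I \<Longrightarrow> smul c f \<in> I" "0 \<in> I"
  "f \<in> I \<Longrightarrow> g \<in> DP \<Longrightarrow> f * g \<in> I" "f \<in> I \<Longrightarrow> g \<in> DP \<Longrightarrow> g * f \<in> I" "f \<in> I \<Longrightarrow> f \<in> DP"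
  using subspace_I ideal
  by (auto intro: smul.subspace_add smul.subspace_diff smul.subspace_scale smul.subspace_0 simp: alg_ideal_def)

lemma D_DP: "f \<in> DP1 \<Longrightarrow> D f \<in> DP"
  by (rule der_DP[OF delta_in_L])

lemma I_xw: "f \<in> I \<Longrightarrow> f * xw l \<in> I" "f \<in> I \<Longrightarrow> xw l * f \<in> I"
  by (cases "l = []"; auto intro: I_closed xw_DP)+

definition Q :: "('a ut2, 'a) dpoly set"
  where "Q = {z \<in> DP. (\<forall>f\<in>DP. \<forall>g\<in>DP. z * comm f g \<in> I) \<and> (\<forall>f\<in>DP. z * D f \<in> I)}"

lemma QI: "z \<in> DP \<Longrightarrow> (\<And>f g. f \<in> DP \<Longrightarrow> g \<in> DP \<Longrightarrow> z * comm f g \<in> I) \<Longrightarrow> (\<And>f. f \<in> DP \<Longrightarrow> z * D f \<in> I) \<Longrightarrow> z \<in> Q"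
  by (simp add: Q_def)

lemma QD: "z \<in> Q \<Longrightarrow> z \<in> DP" "z \<in> Q \<Longrightarrow> f \<in> DP \<Longrightarrow> g \<in> DP \<Longrightarrow> z * comm f g \<in> I" "z \<in> Q \<Longrightarrow> f \<in> DP \<Longrightarrow> z * D f \<in> I"
  by (simp_all add: Q_def)

lemma subspace_Q: "smul.subspace Q"
  by (rule smul.subspaceI) (auto simp: Q_def DP_closed I_closed distrib_right smul_mult_left)

lemma Q_left: "z \<in> Q \<Longrightarrow> t \<in> DP \<Longrightarrow> t * z \<in> Q"
  by (rule QI) (simp_all add: DP_closed QD(1) mult.assoc I_closed(6) QD(2,3))

lemma Q_right:
  assumes z: "z \<in> Q" and t: "t \<in> DP"
  shows "z * t \<in> Q"
proof (rule QI)
  show "z * t \<in> DP" using z t by (auto intro: DP_closed QD)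
next
  fix f g assume fg: "f \<in> DP" "g \<in> DP"
  have "z * t * comm f g = z * comm (t * f) g - z * comm t g * f"
    by (simp add: comm_def algebra_simps)
  moreover have "z * comm (t * f) g \<in> I" "z * comm t g * f \<in> I"
    using z t fg by (auto intro: QD I_closed DP_closed)
  ultimately show "z * t * comm f g \<in> I" by (simp add: I_closed)
next
  fix f assume f: "f \<in> DP"
  have "z * t * D f = z * D (t * f) - z * D t * f"
    by (simp add: der_times algebra_simps)
  moreover have "z * D (t * f) \<in> I" "z * D t * f \<in> I"
    using z t f by (auto intro: QD I_closed DP_closed)
  ultimately show "z * t * D f \<in> I" by (simp add: I_closed)
qed

lemma Q_xw: "z \<in> Q \<Longrightarrow> z * xw l \<in> Q" "z \<in> Q \<Longrightarrow> xw l * z \<in> Q"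
  by (cases "l = []"; auto intro: Q_left Q_right xw_DP)+

lemma D_Q: "f \<in> DP \<Longrightarrow> D f \<in> Q"
  by (rule QI) (auto intro: D_DP DP_DP1 dc dd)

lemma comm_Q:
  assumes fg: "f \<in> DP" "g \<in> DP"
  shows "comm f g \<in> Q"
proof (rule QI)
  show "comm f g * D h \<in> I" if h: "h \<in> DP" for h
  proof -
    have "comm f g * D h = D (comm f (g * h)) - D (comm f g) * h - D g * comm f h - g * D (comm f h)"
      by (simp add: comm_def der_times der_linear algebra_simps)
    moreover have "D (comm f (g * h)) \<in> I" "D (comm f g) * h \<in> I" "D g * comm f h \<in> I" "g * D (comm f h) \<in> I"
      using fg h by (auto intro: Dc dc I_closed DP_closed)
    ultimately show ?thesis by (simp add: I_closed)
  qed
qed (use fg in \<open>auto intro: cc DP_comm\<close>)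

definition P :: "('a ut2, 'a) dpoly set"
  where "P = {z \<in> Q. D z \<in> I \<and> (\<forall>q\<in>Q. q * z \<in> I)}"

lemma subspace_P: "smul.subspace P"
  using subspace_Q by (auto simp: P_def smul.subspace_def der_linear I_closed distrib_left smul_mult_right)

lemma P_left:
  assumes "z \<in> P" "t \<in> DP"
  shows "t * z \<in> P"
proof -
  have "D t * z \<in> I" "t * D z \<in> I" using assms D_Q[OF assms(2)] by (auto simp: P_def intro: I_closed)
  then have "D (t * z) \<in> I" by (simp add: der_times I_closed)
  moreover have "q * (t * z) \<in> I" if "q \<in> Q" for q
    using Q_right[OF that assms(2)] assms(1) by (simp add: P_def flip: mult.assoc)
  ultimately show ?thesis using assms Q_left by (simp add: P_def)
qed

lemma P_right:
  assumes "z \<in> P" "t \<in> DP"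
  shows "z * t \<in> P"
proof -
  have "D z * t \<in> I" "z * D t \<in> I" using assms by (auto simp: P_def intro: I_closed QD)
  then have "D (z * t) \<in> I" by (simp add: der_times I_closed)
  moreover have "q * (z * t) \<in> I" if "q \<in> Q" for q
    using assms that I_closed(5)[of "q * z" t] by (simp add: P_def flip: mult.assoc)
  ultimately show ?thesis using assms Q_right by (simp add: P_def)
qed

lemma P_xw: "z \<in> P \<Longrightarrow> z * xw l \<in> P" "z \<in> P \<Longrightarrow> xw l * z \<in> P"
  by (cases "l = []"; auto intro: P_left P_right xw_DP)+

lemma comm_P: "f \<in> DP \<Longrightarrow> g \<in> DP \<Longrightarrow> comm f g \<in> P"
  by (simp add: P_def comm_Q Dc QD)

lemma insort_P: "xw (j # l) - xw (insort j l) \<in> P"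
proof (induction l)
  case Nil
  then show ?case by (simp add: smul.subspace_0[OF subspace_P])
next
  case (Cons y l)
  show ?case
  proof (cases "j \<le> y")
    case True
    then show ?thesis by (simp add: smul.subspace_0[OF subspace_P])
  next
    case False
    have "xw (j # y # l) - xw (y # insort j l) = comm (xw [j]) (xw [y]) * xw l + xw [y] * (xw (j # l) - xw (insort j l))"
      by (subst (1 2 3 4) xw_Cons) (simp add: xw_Cons[of y l] comm_def algebra_simps)
    moreover have "comm (xw [j]) (xw [y]) * xw l \<in> P" "xw [y] * (xw (j # l) - xw (insort j l)) \<in> P"
      using Cons.IH by (auto intro: P_xw comm_P xw_DP)
    ultimately show ?thesis using False by (simp add: smul.subspace_add[OF subspace_P])
  qed
qed

lemma sort_P: "xw l - sw (mset l) \<in> P"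
proof (induction l)
  case Nil
  then show ?case by (simp add: smul.subspace_0[OF subspace_P])
next
  case (Cons j l)
  have "xw (j # l) - sw (mset (j # l)) = xw [j] * (xw l - sw (mset l)) + (xw (j # sort l) - xw (insort j (sort l)))"
    by (simp add: sw_def right_diff_distrib xw_Cons[of j l] xw_Cons[of j "sort l"])
  then show ?case using Cons.IH P_xw(2)[of "xw l - sw (mset l)" "[j]"] insort_P[of j "sort l"]
    by (simp add: smul.subspace_add[OF subspace_P])
qed

lemma sw_step_P: "sw M * xw [j] - sw (M + {#j#}) \<in> P"
  using sort_P[of "sorted_list_of_multiset M @ [j]"] by (simp add: sw_def xw_append)

lemma sw_xw: "z \<in> Q \<Longrightarrow> z * sw M \<in> Q" "z \<in> I \<Longrightarrow> z * sw M \<in> I" "z \<in> I \<Longrightarrow> sw M * z \<in> I"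
  by (simp_all add: sw_def Q_xw I_xw)

text \<open>
  Derivatives and commutators lie in the left annihilator, modulo the ideal, of all commutators and derivatives; behind such a factor, words may be sorted freely.
\<close>

lemma D_sw_Q: "D (sw M) \<in> Q"
proof (cases "M = {#}")
  case False
  then have "sorted_list_of_multiset M \<noteq> []" by (metis mset.simps(1) mset_sorted_list_of_multiset)
  then show ?thesis by (simp add: sw_def D_Q xw_DP)
qed (simp add: der_one smul.subspace_0[OF subspace_Q])

lemma nf12_cases:
  obtains z where "z \<in> Q" "nf12 m = z * sw (part 1 m)" "\<And>j. nf12 (m + {#(j, 1)#}) = z * sw (part 1 m + {#j#})"
proof -
  have parts: "part 0 (m + {#(j, 1)#}) = part 0 m" "part 2 (m + {#(j, 1)#}) = part 2 m"
    "part 1 (m + {#(j, 1)#}) = part 1 m + {#j#}" for j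
    by (simp_all add: part_def)
  consider "sorted_list_of_multiset (part 2 m) = []" | k where "sorted_list_of_multiset (part 2 m) = [k]"
    | k l ks where "sorted_list_of_multiset (part 2 m) = k # l # ks"
    by (metis list.exhaust)
  then show thesis
  proof cases
    case 1
    show thesis
    proof (rule that[of "smul (- 2) (D (sw (part 0 m)))"])
      show "smul (- 2) (D (sw (part 0 m))) \<in> Q" by (rule smul.subspace_scale[OF subspace_Q D_sw_Q])
    qed (unfold nf12_def parts 1, simp_all only: list.case smul_mult_left)
  next
    case 2
    show thesis
    proof (rule that[of "sw (part 0 m) * xw [k] - sw (part 0 m + {#k#})"])
      show "sw (part 0 m) * xw [k] - sw (part 0 m + {#k#}) \<in> Q" using sw_step_P by (simp add: P_def)
    qed (unfold nf12_def parts 2, simp_all only: list.case)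
  next
    case 3
    show thesis
      by (rule that[of 0], rule smul.subspace_0[OF subspace_Q], unfold nf12_def parts 3, simp_all)
  qed
qed

lemma N12_Q: "N12 p \<in> Q"
proof -
  have "nf12 m \<in> Q" for m by (rule nf12_cases[of m]) (simp add: sw_xw)
  then show ?thesis unfolding N12_def lext_def
    by (intro smul.subspace_sum[OF subspace_Q] smul.subspace_scale[OF subspace_Q])
qed

lemma N12_times_x: "N12 p * xw [j] - N12 (p * vv j) \<in> I"
proof (induction p rule: free_induct)
  case zero
  then show ?case by (simp add: N_linear I_closed)
next
  case (add p m c)
  have "nf12 m * xw [j] - nf12 (m + {#(j, 1)#}) \<in> I"
  proof (rule nf12_cases[of m])
    fix z assume z: "z \<in> Q" "nf12 m = z * sw (part 1 m)" "\<And>j. nf12 (m + {#(j, 1)#}) = z * sw (part 1 m + {#j#})"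
    have "z * (sw (part 1 m) * xw [j] - sw (part 1 m + {#j#})) \<in> I"
      using sw_step_P z(1) by (simp add: P_def)
    then show ?thesis unfolding z(2,3) by (simp add: right_diff_distrib mult.assoc)
  qed
  then have "smul c (nf12 m * xw [j] - nf12 (m + {#(j, 1)#})) \<in> I" by (rule I_closed)
  from I_closed(1)[OF this add] show ?case
    by (simp add: vv_def distrib_right mult_single N_linear smul_mult_left algebra_simps)
qed

lemma dv_mod:
  assumes "h \<in> U"
  shows "dv j h - (smul (eps0 h) (xw [j]) + smul (eps1 h) (D (xw [j]))) \<in> I"
proof -
  have x: "xw [j] = dv j 1" by (simp add: xw_def dv_one letter_def)
  have Dx: "D (xw [j]) = dv j \<Delta>" using der_dv[OF delta_in_L Delta_U(2)] by (simp add: x)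
  have dmult: "dv j (letter d * h) = smul (kap d) (dv j (\<Delta> * h))" if "d \<in> ut2_L" "h \<in> U" for d h
  proof -
    have "dv j (letter d * h) = der d (dv j h)" using that by (simp add: der_dv)
    also have "\<dots> = smul (kap d) (D (dv j h))" by (rule der_cong_L[OF that(1) DP_DP1[OF dv_DP[OF that(2)]]])
    also have "D (dv j h) = dv j (\<Delta> * h)" by (rule der_dv[OF delta_in_L that(2)])
    finally show ?thesis .
  qed
  define W where "W = {h \<in> U. dv j h - (smul (eps0 h) (dv j 1) + smul (eps1 h) (dv j \<Delta>)) \<in> I}"
  have eps_lin: "eps0 (f + g) = eps0 f + eps0 g" "eps1 (f + g) = eps1 f + eps1 g"
    "eps0 (smul c f) = c * eps0 f" "eps1 (smul c f) = c * eps1 f" for f g :: "('a ut2 \<Rightarrow> 'a ut2, 'a) free_alg" and c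
    by (simp_all add: eps0_def eps1_def lookup_add vector_space_over_itself.lext_add vector_space_over_itself.lext_smul)
  have "dv j 0 = 0" using dv_zero[OF smul.subspace_0[OF env.W]] .
  then have "smul.subspace W"
  proof (intro smul.subspaceI)
    show "0 \<in> W" using \<open>dv j 0 = 0\<close> smul.subspace_0[OF subspace_free1, of ut2_L]
      by (simp add: W_def eps0_def eps1_def I_closed)
    fix f g c assume f: "f \<in> W"
    have "smul c (dv j f - (smul (eps0 f) (dv j 1) + smul (eps1 f) (dv j \<Delta>))) \<in> I"
      by (rule I_closed(3)) (use f in \<open>simp add: W_def\<close>)
    then show "smul c f \<in> W" using f
      by (simp add: W_def eps_lin dv_smul smul.subspace_scale[OF subspace_free1] smul.scale_right_diff_distrib smul.scale_right_distrib)
    assume g: "g \<in> W"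
    have "(dv j f - (smul (eps0 f) (dv j 1) + smul (eps1 f) (dv j \<Delta>))) + (dv j g - (smul (eps0 g) (dv j 1) + smul (eps1 g) (dv j \<Delta>))) \<in> I"
      by (rule I_closed(1)) (use f g in \<open>simp_all add: W_def\<close>)
    then show "f + g \<in> W" using f g
      by (simp add: W_def eps_lin dv_add smul.subspace_add[OF subspace_free1] smul.scale_left_distrib algebra_simps)
  qed
  moreover have "word u \<in> W" if u: "set u \<subseteq> ut2_L" for u
  proof -
    have uU: "word u \<in> U" using u by (simp add: free1_word)
    have e: "eps0 (word u) = (if u = [] then 1 else 0)" "eps1 (word u) = (case u of [d] \<Rightarrow> kap d | _ \<Rightarrow> 0)"
      by (auto simp: eps0_def eps1_def lookup_single when_def)
    consider "u = []" | d where "u = [d]" | ds d d' where "u = ds @ [d, d']"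
      by (metis append.assoc append_Cons append_Nil rev_exhaust)
    then show ?thesis
    proof cases
      case 1
      then show ?thesis using uU e by (simp add: W_def I_closed word_Nil)
    next
      case 2
      then have "dv j (word u) = smul (kap d) (dv j \<Delta>)"
        using dmult[of d 1] u Delta_U by (simp add: word_Cons word_Nil)
      then show ?thesis using uU e 2 by (simp add: W_def I_closed)
    next
      case 3
      have dsU: "word ds \<in> U" using u 3 by (simp add: free1_word)
      have L: "d \<in> ut2_L" "d' \<in> ut2_L" using u 3 by auto
      have "dv j (letter d * (letter d' * 1)) = smul (kap d) (smul (kap d') (dv j (\<Delta> * \<Delta>)))"
      proof -
        have l: "letter d' \<in> U" using L by (intro free1_letter)
        have "dv j (letter d * letter d') = smul (kap d) (dv j (\<Delta> * letter d'))" using L l by (simp add: dmult)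
        also have "dv j (\<Delta> * letter d') = D (dv j (letter d' * 1))"
          using der_dv[OF delta_in_L l, of j] by simp
        also have "\<dots> = smul (kap d') (D (dv j (\<Delta> * 1)))" using L Delta_U by (simp only: dmult der_linear)
        also have "D (dv j (\<Delta> * 1)) = dv j (\<Delta> * \<Delta>)" using der_dv[OF delta_in_L Delta_U(1), of j] by simp
        finally show ?thesis by simp
      qed
      then have "dv j (letter d * letter d') \<in> I" using D2 by (simp add: I_closed)
      then have "dact (word ds) (dv j (letter d * letter d')) \<in> I" using dsU by (rule act_closed[rotated])
      moreover have "letter d * letter d' \<in> U" using L by (intro free1_times free1_letter)
      ultimately have "dv j (word u) \<in> I"
        using dsU 3 by (simp add: dact_dv word_append word_Cons word_Nil)
      moreover have "eps0 (word u) = 0" "eps1 (word u) = 0"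
        unfolding e using 3 by (auto split: list.split simp: append_eq_Cons_conv)
      ultimately show ?thesis using uU by (simp add: W_def)
    qed
  qed
  then have "Poly_Mapping.single k 1 \<in> W" if "k \<in> Poly_Mapping.keys h" for k
    using that assms by (cases k) (auto simp: free1_def)
  ultimately have "lext smul (\<lambda>k. Poly_Mapping.single k 1) h \<in> W"
    unfolding lext_def by (intro smul.subspace_sum smul.subspace_scale)
  then show ?thesis unfolding Dx unfolding x by (simp add: lext_smul_letters W_def)
qed

lemma prod_g11: "prod_list (map g11 u) = Poly_Mapping.single (mset (map (\<lambda>l. (fst l, 0)) u)) (prod_list (map (\<lambda>l. eps0 (snd l)) u))"
  by (induction u) (simp_all add: g11_def uu_def mult_single mult.commute flip: single_one)

lemma part0_mset: "part 0 (mset (map (\<lambda>l. (fst l, 0)) u)) = mset (map fst u)"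
  by (induction u) (simp_all add: part_def)

lemma part_other_mset: "t \<noteq> 0 \<Longrightarrow> part t (mset (map (\<lambda>l. (fst l, 0)) u)) = {#}"
  by (induction u) (simp_all add: part_def)

text \<open>
  The last letter is peeled off. A letter behind a normal form is absorbed by sorting, because the normal form already contains a commutator or a derivative; the sorted word in front produces the new commutator.
\<close>

theorem word_normal_form:
  assumes "snd ` set u \<subseteq> B"
  shows "word u - (N11 (E11 (word u)) + N12 (E12 (word u))) \<in> I"
  using assms
proof (induction u rule: rev_induct)
  case Nil
  have "N11 1 = smul 1 (sw (part 0 0))" using N_linear(8)[of 0 1] by (simp only: single_one)
  then have "N11 1 = 1" by (simp add: part_def)
  then show ?case unfolding E11_word E12_word by (simp add: N_linear(7) word_Nil I_closed(4))
next
  case (snoc l u)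
  obtain j b where l: "l = (j, b)" by (cases l)
  have b: "b \<in> B" "b \<in> U" using snoc.prems l B_U by auto
  define e0 e1 c M p where "e0 = eps0 b" and "e1 = eps1 b" and "c = prod_list (map (\<lambda>l. eps0 (snd l)) u)"
    and "M = mset (map fst u)" and "p = w12 u"
  define m where "m = mset (map (\<lambda>l :: 'a gen. (fst l, 0 :: nat)) u)"
  have g: "prod_list (map g11 u) = Poly_Mapping.single m c" by (simp add: prod_g11 m_def c_def)
  have pm: "part 0 m = M" "part 1 m = {#}" "part 2 m = {#}"
    by (simp_all add: m_def M_def part_other_mset part0_mset del: mset_map)
  have R: "N11 (E11 (word u)) + N12 (E12 (word u)) = smul c (sw M) + N12 p"
    by (simp add: E11_word E12_word g N_linear pm p_def)
  let ?R = "smul c (sw M) + N12 p" and ?x = "xw [j]"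
  have x_DP: "?x \<in> DP" by (simp add: xw_DP)
  have Dx_DP: "D ?x \<in> DP" by (rule D_DP[OF DP_DP1[OF x_DP]])
  let ?y = "smul e0 ?x + smul e1 (D ?x)"
  have y: "letter (j, b) - ?y \<in> I" using dv_mod[OF b(2), of j] b(1) by (simp add: dv_basis e0_def e1_def)
  have step1: "word u * letter (j, b) - ?R * letter (j, b) \<in> I"
    using I_closed(5)[OF snoc.IH DP_letter[OF b(1), of j]] snoc.prems R by (simp add: left_diff_distrib)
  have step2: "?R * letter (j, b) - ?R * ?y \<in> I"
  proof -
    have "smul c (sw M * (letter (j, b) - ?y)) + N12 p * (letter (j, b) - ?y) \<in> I"
      using y QD(1)[OF N12_Q, of p] by (intro I_closed(1,3) sw_xw(3) I_closed(6))
    then show ?thesis by (simp add: distrib_right right_diff_distrib smul_mult_left smul.scale_right_diff_distrib algebra_simps)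
  qed
  have tgt: "N11 (E11 (word (u @ [l]))) + N12 (E12 (word (u @ [l])))
      = smul (c * e0) (sw (M + {#j#})) + smul (c * e0) (sw M * ?x - sw (M + {#j#}))
        + smul (c * e1) (D (sw (M + {#j#})) - D (sw M) * ?x) + smul e0 (N12 (p * vv j))"
  proof -
    have "g11 l = Poly_Mapping.single {#(j, 0)#} e0" "g22 l = smul e0 (vv j)"
      "g12 l = Poly_Mapping.single {#(j, 2)#} e0 + (Poly_Mapping.single {#(j, 1)#} (e1 * inverse 2) - Poly_Mapping.single {#(j, 0)#} (e1 * inverse 2))"
      by (simp_all add: l g11_def g22_def g12_def uu_def ww_def vv_def e0_def e1_def smul.scale_right_diff_distrib)
    then have E: "E11 (word (u @ [l])) = Poly_Mapping.single (m + {#(j, 0)#}) (c * e0)"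
      "E12 (word (u @ [l])) = Poly_Mapping.single (m + {#(j, 2)#}) (c * e0)
        + (Poly_Mapping.single (m + {#(j, 1)#}) (c * (e1 * inverse 2)) - Poly_Mapping.single (m + {#(j, 0)#}) (c * (e1 * inverse 2)))
        + smul e0 (p * vv j)"
      by (simp_all add: E11_word E12_word w12_snoc g mult_single distrib_left right_diff_distrib smul_mult_right p_def)
    have parts: "part t (add_mset (j, s) m) = (if s = t then part t m + {#j#} else part t m)" for s t
      by (simp add: part_def)
    have "sw {#j#} = ?x" by (simp add: sw_def)
    then have nf: "nf12 (m + {#(j, 2)#}) = sw M * ?x - sw (M + {#j#})"
      "nf12 (m + {#(j, 1)#}) = smul (- 2) (D (sw M) * ?x)"
      "nf12 (m + {#(j, 0)#}) = smul (- 2) (D (sw (M + {#j#})))"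
      by (simp_all add: nf12_def parts pm pm[simplified])
    have p0: "part 0 (m + {#(j, 0)#}) = M + {#j#}" by (simp add: parts pm)
    show ?thesis
      unfolding E N_linear nf p0
      by (simp add: smul.scale_right_diff_distrib mult.assoc)
  qed
  have Dsw: "sw M * D ?x = D (sw M * ?x) - D (sw M) * ?x" by (simp add: der_times)
  have step3: "?R * ?y - (N11 (E11 (word (u @ [l]))) + N12 (E12 (word (u @ [l])))) \<in> I"
  proof -
    have "?R * ?y - (N11 (E11 (word (u @ [l]))) + N12 (E12 (word (u @ [l]))))
      = smul (c * e1) (D (sw M * ?x - sw (M + {#j#}))) + smul e0 (N12 p * ?x - N12 (p * vv j)) + smul e1 (N12 p * D ?x)"
      unfolding tgt
      by (simp add: distrib_left distrib_right smul_mult_left smul_mult_right Dsw der_linear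
          smul.scale_right_distrib smul.scale_right_diff_distrib) (simp add: algebra_simps)
    moreover have "D (sw M * ?x - sw (M + {#j#})) \<in> I" using sw_step_P by (simp add: P_def)
    moreover have "N12 p * D ?x \<in> I" using QD(3)[OF N12_Q x_DP] .
    ultimately show ?thesis using N12_times_x by (simp add: I_closed)
  qed
  have telescope: "(r - s) + (s - t) + (t - q) = r - q" for r s t q :: "('a ut2, 'a) dpoly" by simp
  have "word (u @ [l]) = word u * (letter (j, b) :: ('a ut2, 'a) dpoly)" by (simp add: word_append l letter_def)
  then show ?case
    using I_closed(1)[OF I_closed(1)[OF step1 step2] step3] unfolding telescope by (simp only:)
qed

text \<open>
  Both sides are linear, so that words suffice.
\<close>

theorem normal_form:
  assumes "f \<in> DP1"
  shows "f - (N11 (E11 f) + N12 (E12 f)) \<in> I"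
  using assms
proof -
  let ?F = "\<lambda>f. f - (N11 (E11 f) + N12 (E12 f))"
  have "lext smul (\<lambda>k. ?F (word (letters k))) f \<in> I"
    unfolding lext_def
  proof (intro smul.subspace_sum[OF subspace_I] smul.subspace_scale[OF subspace_I] word_normal_form)
    fix k assume "k \<in> Poly_Mapping.keys f"
    then have "set (letters k) \<subseteq> UNIV \<times> B" using assms unfolding free1_def by blast
    then show "snd ` set (letters k) \<subseteq> B" by auto
  qed
  moreover have "?F (lext smul (\<lambda>k. word (letters k)) f) = lext smul (\<lambda>k. ?F (word (letters k))) f"
    by (rule lext_compose[OF module_smul module_smul])
      (simp_all add: E_linear N_linear smul.scale_right_diff_distrib smul.scale_right_distrib)
  moreover have "lext smul (\<lambda>k. word (letters k)) f = f" using lext_smul_letters[of f] by simp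
  ultimately show ?thesis by simp
qed

corollary Ids_subset: "Ids \<subseteq> I"
proof
  fix f assume f: "f \<in> Ids"
  then have "f \<in> DP1" by (simp add: Ids_iff DP_DP1)
  from normal_form[OF this] E_Ids[OF f] show "f \<in> I" by (simp add: N_linear)
qed

end

context env_based
begin

abbreviation rels :: "nat \<Rightarrow> nat \<Rightarrow> nat \<Rightarrow> nat \<Rightarrow> ('a ut2, 'a) dpoly set"
  where "rels x y z w \<equiv> {comm (dv x 1) (dv y 1) * comm (dv z 1) (dv w 1), dact \<Delta> (comm (dv x 1) (dv y 1)),
    dv x \<Delta> * comm (dv y 1) (dv z 1), dv x \<Delta> * dv y \<Delta>, dv x (\<Delta> * \<Delta>)}"

lemma DD_U: "\<Delta> * \<Delta> \<in> U"
  using Delta_U by (intro free1_times)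

lemma rels_Ids: "rels x y z w \<subseteq> Ids"
proof -
  have e: "eact 1 A = A" "eact \<Delta> A = ut2_delta A" "eact (\<Delta> * \<Delta>) A = ut2_delta (ut2_delta A)" for A
    using eact_times[OF Delta_U(1), of \<Delta>] by (simp_all add: eact_letter) (simp add: env_act_lext ut2_eq_iff flip: word_Nil)
  show ?thesis
    using Delta_U DD_U
    by (auto simp: Ids_iff dev_times dev_comm dev_dv dev_dact DP_comm dv_DP dact_DP e DP_closed
        ut2_eq_iff comm_def[of _ "_ :: 'a ut2"])
qed

text \<open>
  Substituting arbitrary polynomials for the four variables turns the five generators into relations between all polynomials.
\<close>

lemma ideal_with_relationsI:
  assumes T: "T_ideal ut2_scale ut2_L B I" and S: "rels x y z w \<subseteq> I" and dist: "distinct [x, y, z, w]"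
  shows "ideal_with_relations B I"
proof -
  have sub: "dsub g f \<in> I" if "\<And>j. g j \<in> DP" "f \<in> I" for g f
    using T that by (simp add: T_ideal_def)
  define G where "G f g h k j = (if j = x then f else if j = y then g else if j = z then h else k)"
    for f g h k :: "('a ut2, 'a) dpoly" and j
  have G: "G f g h k x = f" "G f g h k y = g" "G f g h k z = h" "G f g h k w = k" for f g h k
    using dist by (auto simp: G_def)
  have GD: "G f g h k j \<in> DP" if "f \<in> DP" "g \<in> DP" "h \<in> DP" "k \<in> DP" for f g h k j
    using that by (simp add: G_def)
  have Ddv: "D (dv j 1) = dv j \<Delta>" for j using der_dv[OF delta_in_L Delta_U(2)] by simp
  have dv_DP': "dv j 1 \<in> DP" for j using Delta_U by (simp add: dv_DP)
  show ?thesis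
  proof unfold_locales
    show "alg_ideal smul DP I" using T by (simp add: T_ideal_def)
    show "dact h f \<in> I" if "h \<in> U" "f \<in> I" for h f using T that by (simp add: T_ideal_def)
    show "comm f g * comm h k \<in> I" if "f \<in> DP" "g \<in> DP" "h \<in> DP" "k \<in> DP" for f g h k
      using sub[of "G f g h k" "comm (dv x 1) (dv y 1) * comm (dv z 1) (dv w 1)"] S that Delta_U
      by (simp add: GD dsub_times dsub_comm dsub_dv G dact_one)
    show "D (comm f g) \<in> I" if "f \<in> DP" "g \<in> DP" for f g
    proof -
      have "dact \<Delta> (comm (dv x 1) (dv y 1)) = comm (dv x \<Delta>) (dv y 1) + comm (dv x 1) (dv y \<Delta>)"
        by (simp add: dact_letter comm_def der_linear der_times Ddv algebra_simps)
      then have "dsub (G f g f f) (dact \<Delta> (comm (dv x 1) (dv y 1))) = comm (D f) g + comm f (D g)"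
        using that Delta_U by (simp add: dsub_linear dsub_comm dsub_dv GD G dact_one dact_letter)
      also have "\<dots> = D (comm f g)" by (simp add: comm_def der_linear der_times algebra_simps)
      finally show ?thesis using sub[of "G f g f f" "dact \<Delta> (comm (dv x 1) (dv y 1))"] S that by (simp add: GD)
    qed
    show "D f * comm g h \<in> I" if "f \<in> DP" "g \<in> DP" "h \<in> DP" for f g h
      using sub[of "G f g h h" "dv x \<Delta> * comm (dv y 1) (dv z 1)"] S that Delta_U
      by (simp add: GD dsub_times dsub_comm dsub_dv G dact_one dact_letter)
    show "D f * D g \<in> I" if "f \<in> DP" "g \<in> DP" for f g
      using sub[of "G f g g g" "dv x \<Delta> * dv y \<Delta>"] S that Delta_U
      by (simp add: GD dsub_times dsub_dv G dact_letter)
    show "dv j (\<Delta> * \<Delta>) \<in> I" for j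
      using sub[of "\<lambda>_. dv j 1" "dv x (\<Delta> * \<Delta>)"] S Delta_U DD_U by (simp add: dv_DP' dsub_dv dact_dv)
  qed
qed

theorem identities:
  assumes "distinct [x, y, z, w]"
  shows "Ids = T_ideal_gen ut2_scale ut2_L B (rels x y z w)"
proof
  show "Ids \<subseteq> T_ideal_gen ut2_scale ut2_L B (rels x y z w)"
    unfolding T_ideal_gen_def
    using ideal_with_relations.Ids_subset[OF ideal_with_relationsI[OF _ _ assms]] by blast
  show "T_ideal_gen ut2_scale ut2_L B (rels x y z w) \<subseteq> Ids"
    unfolding T_ideal_gen_def using T_ideal_Ids rels_Ids by blast
qed

end


section \<open>The trace on multilinear polynomials modulo identities\<close>

definition mon :: "nat \<Rightarrow> (nat \<Rightarrow> nat) \<Rightarrow> mono"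
  where "mon n c = image_mset (\<lambda>j. (j, c j)) (mset_set {1..n})"

text \<open>
  The vertices and edges of the cube with coordinates indexed by the variables; the value two marks the direction of an edge.
\<close>

definition lattice_colourings :: "nat \<Rightarrow> (nat \<Rightarrow> nat) set"
  where "lattice_colourings n = {c. (\<forall>x. x \<notin> {1..n} \<longrightarrow> c x = 0) \<and> (\<forall>x. c x \<le> 2) \<and>
    (\<forall>i j. c i = 2 \<longrightarrow> c j = 2 \<longrightarrow> i = j)}"

definition edge_colourings :: "nat \<Rightarrow> (nat \<Rightarrow> nat) set"
  where "edge_colourings n = {c \<in> lattice_colourings n. \<exists>x. c x = 2}"

definition vertex_colourings :: "nat \<Rightarrow> (nat \<Rightarrow> nat) set"
  where "vertex_colourings n = {c \<in> lattice_colourings n. \<forall>x. c x \<noteq> 2}"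

lemma finite_lattice_colourings: "finite (lattice_colourings n)"
proof (rule finite_subset)
  show "lattice_colourings n \<subseteq> {c. \<forall>x. (x \<in> {1..n} \<longrightarrow> c x \<in> {..2}) \<and> (x \<notin> {1..n} \<longrightarrow> c x = 0)}"
    by (auto simp: lattice_colourings_def)
  show "finite {c :: nat \<Rightarrow> nat. \<forall>x. (x \<in> {1..n} \<longrightarrow> c x \<in> {..2}) \<and> (x \<notin> {1..n} \<longrightarrow> c x = 0)}"
    by (rule finite_set_of_finite_funs) auto
qed

lemma lattice_split: "lattice_colourings n = edge_colourings n \<union> vertex_colourings n"
  "edge_colourings n \<inter> vertex_colourings n = {}"
  by (auto simp: edge_colourings_def vertex_colourings_def)

lemma finite_edge_vertex: "finite (edge_colourings n)" "finite (vertex_colourings n)"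
  using finite_lattice_colourings[of n] lattice_split(1)[of n] by simp_all

lemma lattice_out: "c \<in> lattice_colourings n \<Longrightarrow> x \<notin> {1..n} \<Longrightarrow> c x = 0"
  unfolding lattice_colourings_def by blast

lemma lattice_comp:
  assumes "c \<in> lattice_colourings n" "\<sigma> permutes {1..n}"
  shows "c \<circ> \<sigma> \<in> lattice_colourings n"
proof -
  have "c (\<sigma> x) = 0" if "x \<notin> {1..n}" for x
    using lattice_out[OF assms(1)] permutes_in_image[OF assms(2), of x] that by blast
  moreover have "i = j" if "c (\<sigma> i) = 2" "c (\<sigma> j) = 2" for i j
  proof -
    have "\<sigma> i = \<sigma> j" using assms(1) that unfolding lattice_colourings_def by blast
    then show ?thesis using permutes_inj[OF assms(2)] by (simp add: inj_eq)
  qed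
  ultimately show ?thesis using assms(1) unfolding lattice_colourings_def comp_apply by blast
qed

lemma edge_comp: "c \<in> edge_colourings n \<Longrightarrow> \<sigma> permutes {1..n} \<Longrightarrow> c \<circ> \<sigma> \<in> edge_colourings n"
  unfolding edge_colourings_def using lattice_comp permutes_surj[of \<sigma> "{1..n}"]
  by (auto simp: surj_def) metis

lemma mon_inj:
  assumes "c \<in> lattice_colourings n" "d \<in> lattice_colourings n" "mon n c = mon n d"
  shows "c = d"
proof
  fix x
  show "c x = d x"
  proof (cases "x \<in> {1..n}")
    case True
    then have "(x, c x) \<in># mon n c" by (simp add: mon_def)
    then have "(x, c x) \<in># mon n d" by (simp only: assms(3))
    then show ?thesis by (auto simp: mon_def)
  qed (use lattice_out assms in metis)
qed


lemma part_mon: "part t (mon n c) = mset_set {j \<in> {1..n}. c j = t}"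
  by (simp add: part_def mon_def filter_mset_image_mset comp_def image_mset.compositionality)

lemma mon_perm:
  assumes "\<sigma> permutes {1..n}"
  shows "mon n c = image_mset (map_prod \<sigma> id) (mon n (c \<circ> \<sigma>))"
proof -
  have "image_mset \<sigma> (mset_set {1..n}) = mset_set {1..n}"
    using image_mset_mset_set[of \<sigma> "{1..n}"] permutes_image[OF assms] permutes_inj_on[OF assms] by simp
  then have "mon n c = image_mset (\<lambda>j. (j, c j)) (image_mset \<sigma> (mset_set {1..n}))" by (simp add: mon_def)
  then show ?thesis by (simp add: mon_def image_mset.compositionality comp_def)
qed

text \<open>
  Multilinearity means that every variable index occurs once, so that a monomial is the graph of its tags.
\<close>

lemma colouring_of_monomial:
  assumes m: "image_mset fst m = mset_set {1..n}" and le: "\<forall>z\<in>#m. snd z \<le> 2"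
    and two: "size (filter_mset (\<lambda>z. snd z = 2) m) \<le> 1"
  shows "\<exists>c\<in>lattice_colourings n. m = mon n c"
proof -
  define c where "c j = (if j \<in> {1..n} then SOME t. (j, t) \<in># m else 0)" for j
  have c: "(j, c j) \<in># m" if "j \<in> {1..n}" for j
  proof -
    have "j \<in># image_mset fst m" using that by (simp add: m)
    then obtain t where "(j, t) \<in># m" by auto
    then show ?thesis using that someI[of "\<lambda>t. (j, t) \<in># m" t] by (simp add: c_def)
  qed
  have uniq: "z = (fst z, c (fst z))" if z: "z \<in># m" for z
  proof (rule ccontr)
    assume ne: "z \<noteq> (fst z, c (fst z))"
    have "fst z \<in># image_mset fst m" using z by simp
    then have fz: "fst z \<in> {1..n}" by (simp add: m)
    obtain m' where m': "m = add_mset z m'" using multi_member_split[OF z] by blast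
    have in': "(fst z, c (fst z)) \<in># m'" 
    proof -
      have "(fst z, c (fst z)) = z \<or> (fst z, c (fst z)) \<in># m'" using c[OF fz] unfolding m' by (simp only: insert_iff set_mset_add_mset_insert)
      then show ?thesis using ne[symmetric] by blast
    qed
    obtain m'' where m'': "m' = add_mset (fst z, c (fst z)) m''" using multi_member_split[OF in'] by blast
    have "count (image_mset fst m) (fst z) \<ge> 2" unfolding m' m'' by simp
    then show False unfolding m using fz by simp
  qed
  have "mon n c = image_mset (\<lambda>j. (j, c j)) (image_mset fst m)" by (simp add: mon_def m)
  also have "\<dots> = image_mset (\<lambda>z. z) m"
    unfolding image_mset.compositionality using uniq by (intro image_mset_cong) simp
  finally have eq: "m = mon n c" by simp
  have "c x \<le> 2" for x
  proof (cases "x \<in> {1..n}")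
    case True
    then show ?thesis using bspec[OF le c[of x]] by simp
  next
    case False
    then have "c x = 0" unfolding c_def by (rule if_not_P)
    then show ?thesis by simp
  qed
  moreover have "i = j" if "c i = 2" "c j = 2" for i j
  proof -
    let ?F = "filter_mset (\<lambda>z. snd z = 2) m"
    have out: "c x = 0" if "x \<notin> {1..n}" for x using that unfolding c_def by (rule if_not_P)
    have ij: "i \<in> {1..n}" "j \<in> {1..n}" using that out[of i] out[of j] by fastforce+
    have F2: "(i, 2) \<in># ?F" "(j, 2) \<in># ?F" using c[OF ij(1)] c[OF ij(2)] that by simp_all
    obtain F where F: "?F = add_mset (i, 2) F" using multi_member_split[OF F2(1)] by blast
    then have "F = {#}" using two by simp
    with F F2(2) show ?thesis by simp
  qed
  moreover have "c x = 0" if "x \<notin> {1..n}" for x using that unfolding c_def by (rule if_not_P)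
  ultimately have "c \<in> lattice_colourings n" unfolding lattice_colourings_def by blast
  with eq show ?thesis by blast
qed

lemma keys_times:
  fixes p q :: "'a::field poly3"
  assumes "m \<in> Poly_Mapping.keys (p * q)"
  obtains a b where "a \<in> Poly_Mapping.keys p" "b \<in> Poly_Mapping.keys q" "m = a + b"
proof -
  have "m \<in> {a + b | a b. a \<in> Poly_Mapping.keys p \<and> b \<in> Poly_Mapping.keys q}"
    using assms keys_mult by (rule rev_subsetD)
  then show ?thesis using that by (elim CollectE exE conjE)
qed

lemma keys_gen: "m \<in> Poly_Mapping.keys (g11 l) \<Longrightarrow> m = {#(fst l, 0)#}"
  "m \<in> Poly_Mapping.keys (g22 l) \<Longrightarrow> m = {#(fst l, 1)#}"
  by (auto simp: g11_def g22_def uu_def vv_def split: if_splits)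

lemma keys_g12:
  assumes "m \<in> Poly_Mapping.keys (g12 l)"
  shows "\<exists>t\<le>2. m = {#(fst l, t)#}"
proof -
  let ?w = "smul (eps0 (snd l)) (ww (fst l)) :: 'a poly3" and ?d = "vv (fst l) - uu (fst l) :: 'a poly3"
  have "m \<in> Poly_Mapping.keys ?w \<or> m \<in> Poly_Mapping.keys (smul (eps1 (snd l) * inverse 2) ?d)"
    using assms keys_add[of ?w "smul (eps1 (snd l) * inverse 2) ?d"] unfolding g12_def by blast
  then have "m \<in> Poly_Mapping.keys ?w \<or> m \<in> Poly_Mapping.keys ?d"
    using keys_smul[of "eps1 (snd l) * inverse 2" ?d] by blast
  then have "m \<in> Poly_Mapping.keys ?w \<or> m \<in> Poly_Mapping.keys (vv (fst l) :: 'a poly3) \<or> m \<in> Poly_Mapping.keys (uu (fst l) :: 'a poly3)"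
    using keys_diff[of "vv (fst l) :: 'a poly3" "uu (fst l)"] by blast
  then have "m \<in> {{#(fst l, 0)#}, {#(fst l, 1)#}, {#(fst l, 2)#}}"
    by (auto simp: uu_def vv_def ww_def split: if_splits)
  then show ?thesis by auto
qed

lemma keys_prod_gen: "m \<in> Poly_Mapping.keys (prod_list (map g11 u)) \<Longrightarrow> m = image_mset (\<lambda>j. (j, 0)) (mset (map fst u))"
  "m \<in> Poly_Mapping.keys (prod_list (map g22 u)) \<Longrightarrow> m = image_mset (\<lambda>j. (j, 1)) (mset (map fst u))"
proof (induction u arbitrary: m)
  case (Cons l u)
  {
    case 1
    then have "m \<in> Poly_Mapping.keys (g11 l * prod_list (map g11 u))" by simp
    then obtain a b where "a \<in> Poly_Mapping.keys (g11 l)" "b \<in> Poly_Mapping.keys (prod_list (map g11 u))" "m = a + b"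
      by (rule keys_times)
    then show ?case using Cons.IH(1)[of b] keys_gen(1)[of a l] by simp
  next
    case 2
    then have "m \<in> Poly_Mapping.keys (g22 l * prod_list (map g22 u))" by simp
    then obtain a b where "a \<in> Poly_Mapping.keys (g22 l)" "b \<in> Poly_Mapping.keys (prod_list (map g22 u))" "m = a + b"
      by (rule keys_times)
    then show ?case using Cons.IH(2)[of b] keys_gen(2)[of a l] by simp
  }
qed (simp_all flip: single_one)

text \<open>
  A product of triangular matrices has entries in the corner that choose the off-diagonal entry of exactly one factor or, through the derivation, a diagonal one.
\<close>

lemma keys_w12:
  assumes "m \<in> Poly_Mapping.keys (w12 u)"
  shows "image_mset fst m = mset (map fst u) \<and> (\<forall>z\<in>#m. snd z \<le> 2) \<and> size (filter_mset (\<lambda>z. snd z = 2) m) \<le> 1"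
  using assms
proof (induction u arbitrary: m)
  case (Cons l u)
  from Cons.prems consider "m \<in> Poly_Mapping.keys (g11 l * w12 u)" | "m \<in> Poly_Mapping.keys (g12 l * prod_list (map g22 u))"
    using keys_add[of "g11 l * w12 u" "g12 l * prod_list (map g22 u)"] by auto
  then show ?case
  proof cases
    case 1
    then obtain a b where a: "a \<in> Poly_Mapping.keys (g11 l)" and b: "b \<in> Poly_Mapping.keys (w12 u)" "m = a + b"
      by (rule keys_times)
    then show ?thesis using Cons.IH[OF b(1)] keys_gen(1)[OF a] by simp
  next
    case 2
    then obtain a b where ab: "a \<in> Poly_Mapping.keys (g12 l)" "b \<in> Poly_Mapping.keys (prod_list (map g22 u))" "m = a + b"
      by (rule keys_times)
    obtain t where t: "t \<le> 2" "m = {#(fst l, t)#} + image_mset (\<lambda>j. (j, 1)) (mset (map fst u))"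
      using ab(3) keys_g12[OF ab(1)] keys_prod_gen(2)[OF ab(2)] by blast
    define R where "R = image_mset (\<lambda>j. (j, 1 :: nat)) (mset (map fst u))"
    have "image_mset fst R = mset (map fst u)" "\<forall>z\<in>#R. snd z \<le> 2" and R2: "filter_mset (\<lambda>z. snd z = 2) R = {#}"
      by (simp_all add: R_def image_mset.compositionality comp_def filter_mset_image_mset)
    moreover have "size (filter_mset (\<lambda>z. snd z = 2) m) \<le> 1"
      unfolding t(2) R_def[symmetric] filter_union_mset R2 by (simp split: if_splits)
    ultimately show ?thesis using t(1) unfolding t(2) R_def[symmetric] by simp
  qed
qed simp

lemma lookup_single_times:
  fixes p :: "'a::field poly3"
  shows "Poly_Mapping.lookup (Poly_Mapping.single a 1 * p) (a + m) = Poly_Mapping.lookup p m"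
    and "\<not> a \<subseteq># m \<Longrightarrow> Poly_Mapping.lookup (Poly_Mapping.single a 1 * p) m = 0"
proof -
  show "Poly_Mapping.lookup (Poly_Mapping.single a 1 * p) (a + m) = Poly_Mapping.lookup p m"
    by (induction p rule: free_induct) (simp_all add: distrib_left lookup_add mult_single lookup_single when_def)
  assume "\<not> a \<subseteq># m"
  then have "a + k \<noteq> m" for k by auto
  then show "Poly_Mapping.lookup (Poly_Mapping.single a 1 * p) m = 0"
    by (induction p rule: free_induct) (simp_all add: distrib_left lookup_add mult_single lookup_single when_def)
qed

subsection \<open>Staircase colourings of a word\<close>

fun staircase :: "(nat \<Rightarrow> nat) \<Rightarrow> nat list \<Rightarrow> bool" where
  "staircase c [] = False"
| "staircase c (x # l) = (c x = 0 \<and> staircase c l \<or> c x = 2 \<and> (\<forall>j\<in>set l. c j = 1))"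

lemma staircase_append: "(\<And>j. j \<in> set l \<Longrightarrow> c j = 0) \<Longrightarrow> c k = 2 \<Longrightarrow> (\<And>j. j \<in> set r \<Longrightarrow> c j = 1) \<Longrightarrow> staircase c (l @ k # r)"
  by (induction l) simp_all

text \<open>
  Along a word, a staircase is a run of zeros, a single two and a run of ones, so that the number of zeros determines it.
\<close>

lemma staircase_determined:
  assumes "staircase c l" "staircase d l" "card {j \<in> set l. c j = 0} = card {j \<in> set l. d j = 0}" "distinct l" "j \<in> set l"
  shows "c j = d j"
  using assms
proof (induction l)
  case (Cons x l)
  have card: "card {j \<in> set (x # l). e j = 0} = of_bool (e x = 0) + card {j \<in> set l. e j = 0}" for e :: "nat \<Rightarrow> nat"
  proof (cases "e x = 0")
    case True
    then have "{j \<in> set (x # l). e j = 0} = insert x {j \<in> set l. e j = 0}" by auto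
    then show ?thesis using True Cons.prems(4) by simp
  next
    case False
    then have "{j \<in> set (x # l). e j = 0} = {j \<in> set l. e j = 0}" by auto
    then show ?thesis using False by simp
  qed
  have none: "card {j \<in> set l. e j = 0} = 0" if "\<forall>j\<in>set l. e j = 1" for e :: "nat \<Rightarrow> nat"
    using that by auto
  show ?case
  proof (cases "c x = 0")
    case c: True
    then have "d x = 0" using Cons.prems(2,3) none[of d] unfolding card by (cases "d x = 0") auto
    then show ?thesis using c Cons unfolding card by auto
  next
    case c: False
    then have "d x \<noteq> 0" using Cons.prems(1,3) none[of c] unfolding card by (cases "d x = 0") auto
    then show ?thesis using c Cons.prems by auto
  qed
qed simp

definition ones :: "(nat \<Rightarrow> nat) \<Rightarrow> nat \<Rightarrow> nat"
  where "ones c j = of_bool (c j = 1)"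

text \<open>
  The edge on which the sorted word has its border: the largest index that is not a one becomes the direction.
\<close>

definition last_edge :: "nat \<Rightarrow> (nat \<Rightarrow> nat) \<Rightarrow> nat \<Rightarrow> nat"
  where "last_edge n e j = (if j \<in> {1..n} \<and> e j \<noteq> 1
     then (if j = last (sorted_list_of_set {j \<in> {1..n}. e j \<noteq> 1}) then 2 else 0) else e j)"

definition all_ones :: "nat \<Rightarrow> nat \<Rightarrow> nat"
  where "all_ones n j = of_bool (j \<in> {1..n})"

lemma vertex_values:
  assumes "e \<in> vertex_colourings n"
  shows "e j = 0 \<or> e j = 1" "j \<notin> {1..n} \<Longrightarrow> e j = 0"
proof -
  have "e j \<le> 2" "e j \<noteq> 2" using assms unfolding vertex_colourings_def lattice_colourings_def by blast+
  then show "e j = 0 \<or> e j = 1" by linarith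
  show "j \<notin> {1..n} \<Longrightarrow> e j = 0" using assms lattice_out unfolding vertex_colourings_def by blast
qed

lemma all_ones_vertex: "all_ones n \<in> vertex_colourings n"
  by (auto simp: vertex_colourings_def lattice_colourings_def all_ones_def)

lemma ones_edge:
  assumes "c \<in> edge_colourings n"
  shows "ones c \<in> vertex_colourings n" "ones c \<noteq> all_ones n"
proof -
  have c: "c \<in> lattice_colourings n" and "\<exists>k. c k = 2" using assms by (auto simp: edge_colourings_def)
  then obtain k where k: "c k = 2" by blast
  then have "k \<in> {1..n}" using lattice_out[OF c, of k] by auto
  with k have "ones c k \<noteq> all_ones n k" by (simp add: ones_def all_ones_def)
  then show "ones c \<noteq> all_ones n" by auto
  show "ones c \<in> vertex_colourings n"
    using lattice_out[OF c] by (auto simp: vertex_colourings_def lattice_colourings_def ones_def)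
qed

lemma last_edge_props:
  assumes e: "e \<in> vertex_colourings n" "e \<noteq> all_ones n"
  defines "T \<equiv> {j \<in> {1..n}. e j \<noteq> 1}"
  shows "last_edge n e \<in> edge_colourings n" "ones (last_edge n e) = e"
    "\<exists>l. sorted_list_of_set T = l @ [last (sorted_list_of_set T)]" "last (sorted_list_of_set T) \<in> T"
proof -
  have fT: "finite T" by (simp add: T_def)
  have "T \<noteq> {}"
  proof
    assume "T = {}"
    then have "e j = all_ones n j" for j
      using vertex_values[OF e(1), of j] by (cases "j \<in> {1..n}") (auto simp: T_def all_ones_def)
    with e(2) show False by auto
  qed
  then have ne: "sorted_list_of_set T \<noteq> []" using fT by simp
  then show "\<exists>l. sorted_list_of_set T = l @ [last (sorted_list_of_set T)]"
    by (metis append_butlast_last_id)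
  have "last (sorted_list_of_set T) \<in> set (sorted_list_of_set T)" using ne by (rule last_in_set)
  then show k: "last (sorted_list_of_set T) \<in> T" using fT by simp
  then have k2: "last_edge n e (last (sorted_list_of_set T)) = 2" by (simp add: last_edge_def T_def)
  have "last_edge n e j \<le> 2" for j using vertex_values(1)[OF e(1), of j] by (auto simp: last_edge_def)
  moreover have "last_edge n e j = 0" if "j \<notin> {1..n}" for j using vertex_values(2)[OF e(1) that] that by (auto simp: last_edge_def)
  moreover have "j = last (sorted_list_of_set T)" if "last_edge n e j = 2" for j
    using that vertex_values(1)[OF e(1), of j] by (auto simp: last_edge_def T_def split: if_splits)
  ultimately show "last_edge n e \<in> edge_colourings n"
    unfolding edge_colourings_def lattice_colourings_def using k2 by blast
  show "ones (last_edge n e) = e"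
  proof
    fix j show "ones (last_edge n e) j = e j"
      using vertex_values[OF e(1), of j] by (auto simp: ones_def last_edge_def)
  qed
qed

text \<open>
  An edge on the left is determined by its set of ones, which the permutation fixes; conversely every fixed vertex except the all-ones one has a last edge, whose translate is the required edge.
\<close>

lemma edge_vertex_bijection:
  assumes \<sigma>: "\<sigma> permutes {1..n}"
  shows "card {c \<in> edge_colourings n. c \<circ> \<sigma> = last_edge n (ones c)} = card ({e \<in> vertex_colourings n. e \<circ> \<sigma> = e} - {all_ones n})"
proof (rule bij_betw_same_card[of ones], rule bij_betwI[where g = "\<lambda>e. last_edge n e \<circ> inv \<sigma>"])
  have inv: "f \<circ> \<sigma> \<circ> inv \<sigma> = f" "f \<circ> inv \<sigma> \<circ> \<sigma> = f" for f :: "nat \<Rightarrow> nat"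
    using permutes_inv_o[OF \<sigma>] by (simp_all add: comp_assoc)
  have on: "ones (c \<circ> \<tau>) = ones c \<circ> \<tau>" for c \<tau> by (rule ext) (simp add: ones_def)
  have fixed: "ones c \<circ> \<sigma> = ones c" if "c \<in> edge_colourings n" "c \<circ> \<sigma> = last_edge n (ones c)" for c
    using last_edge_props(2)[OF ones_edge[OF that(1)]] on[of c \<sigma>] that(2) by simp
  show "ones \<in> {c \<in> edge_colourings n. c \<circ> \<sigma> = last_edge n (ones c)} \<rightarrow> {e \<in> vertex_colourings n. e \<circ> \<sigma> = e} - {all_ones n}"
    using fixed ones_edge by auto
  have round_trip: "ones (last_edge n e \<circ> inv \<sigma>) = e" if "e \<in> {e \<in> vertex_colourings n. e \<circ> \<sigma> = e} - {all_ones n}" for e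
  proof -
    have "ones (last_edge n e \<circ> inv \<sigma>) = e \<circ> inv \<sigma>" using last_edge_props(2)[of e n] that by (simp add: on)
    also have "\<dots> = e \<circ> \<sigma> \<circ> inv \<sigma>" using that by simp
    finally show ?thesis by (simp only: inv)
  qed
  show "(\<lambda>e. last_edge n e \<circ> inv \<sigma>) \<in> {e \<in> vertex_colourings n. e \<circ> \<sigma> = e} - {all_ones n} \<rightarrow> {c \<in> edge_colourings n. c \<circ> \<sigma> = last_edge n (ones c)}"
  proof
    fix e assume e: "e \<in> {e \<in> vertex_colourings n. e \<circ> \<sigma> = e} - {all_ones n}"
    have "last_edge n e \<circ> inv \<sigma> \<in> edge_colourings n"
      using e by (intro edge_comp permutes_inv[OF \<sigma>] last_edge_props(1)) auto
    then show "last_edge n e \<circ> inv \<sigma> \<in> {c \<in> edge_colourings n. c \<circ> \<sigma> = last_edge n (ones c)}"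
      using round_trip[OF e] by (simp add: inv)
  qed
  show "last_edge n (ones c) \<circ> inv \<sigma> = c" if "c \<in> {c \<in> edge_colourings n. c \<circ> \<sigma> = last_edge n (ones c)}" for c
  proof -
    have "last_edge n (ones c) \<circ> inv \<sigma> = c \<circ> \<sigma> \<circ> inv \<sigma>" using that by simp
    then show ?thesis by (simp only: inv)
  qed
  show "ones (last_edge n e \<circ> inv \<sigma>) = e" if "e \<in> {e \<in> vertex_colourings n. e \<circ> \<sigma> = e} - {all_ones n}" for e
    using round_trip[OF that] .
qed

subsection \<open>Renaming variables\<close>

definition rename :: "(nat \<Rightarrow> nat) \<Rightarrow> 'a::field poly3 \<Rightarrow> 'a poly3"
  where "rename \<sigma> = lext smul (\<lambda>m. Poly_Mapping.single (image_mset (map_prod \<sigma> id) m) 1)"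

lemma lookup_rename:
  assumes "inj \<sigma>"
  shows "Poly_Mapping.lookup (rename \<sigma> p) (image_mset (map_prod \<sigma> id) m) = Poly_Mapping.lookup p m"
proof -
  have "inj (map_prod \<sigma> (id :: nat \<Rightarrow> nat))" using assms by (simp add: prod.inj_map)
  then have "inj (image_mset (map_prod \<sigma> (id :: nat \<Rightarrow> nat)))" by (rule multiset.inj_map)
  then have "(image_mset (map_prod \<sigma> id) k = image_mset (map_prod \<sigma> id) m) = (k = m)" for k :: mono
    by (rule inj_eq)
  then show ?thesis unfolding rename_def
    by (induction p rule: free_induct) (simp_all add: smul.lext_add lookup_add lookup_single when_def)
qed

lemma pval_rename: "pval a (rename \<sigma> p) = pval (a \<circ> map_prod \<sigma> id) p"
  unfolding rename_def pval_def[of "a \<circ> map_prod \<sigma> id"]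
  by (induction p rule: free_induct)
    (simp_all add: smul.lext_add vector_space_over_itself.lext_add pval_def[symmetric] mval_def image_mset.compositionality comp_def id_def)

lemma sum_of_bool_card: "finite A \<Longrightarrow> (\<Sum>x\<in>A. of_bool (P x)) = (of_nat (card {x \<in> A. P x}) :: 'a::field)"
  by (simp add: of_bool_def flip: sum.inter_filter)


context env_based
begin

definition multi :: "nat multiset \<Rightarrow> ('a ut2, 'a) dpoly set"
  where "multi M = {f \<in> DP1. \<forall>w\<in>Poly_Mapping.keys f. mset (map fst (letters w)) = M}"

lemma subspace_multi: "smul.subspace (multi M)"
proof (rule smul.subspaceI)
  fix x y :: "('a ut2, 'a) dpoly" and c :: 'a
  assume x: "x \<in> multi M"
  show "smul c x \<in> multi M"
    using x keys_smul[of c x] smul.subspace_scale[OF subspace_free1] by (auto simp: multi_def)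
  assume "y \<in> multi M"
  with x show "x + y \<in> multi M"
    using keys_add[of x y] smul.subspace_add[OF subspace_free1] by (fastforce simp: multi_def)
qed (use smul.subspace_0[OF subspace_free1] in \<open>simp add: multi_def\<close>)

lemma multi_word: "snd ` set u \<subseteq> B \<Longrightarrow> word u \<in> multi (mset (map fst u))"
  by (simp add: multi_def DP1_word)

lemma multi_times:
  assumes "f \<in> multi M" "g \<in> multi N"
  shows "f * g \<in> multi (M + N)"
proof -
  have "mset (map fst (letters w)) = M + N" if "w \<in> Poly_Mapping.keys (f * g)" for w
  proof -
    have "w \<in> {a + b | a b. a \<in> Poly_Mapping.keys f \<and> b \<in> Poly_Mapping.keys g}"
      using that keys_mult by (rule rev_subsetD)
    then obtain a b where ab: "w = a + b" "a \<in> Poly_Mapping.keys f" "b \<in> Poly_Mapping.keys g" by blast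
    have "mset (map fst (letters a)) = M" "mset (map fst (letters b)) = N"
      using assms ab by (simp_all add: multi_def del: mset_map)
    then show ?thesis by (simp add: ab(1))
  qed
  then show ?thesis using assms free1_times by (auto simp: multi_def simp del: mset_map)
qed

lemma multi_lext:
  assumes "f \<in> DP1" "\<And>u. snd ` set u \<subseteq> B \<Longrightarrow> FWord u \<in> Poly_Mapping.keys f \<Longrightarrow> g (FWord u) \<in> multi M"
  shows "lext smul g f \<in> multi M"
  unfolding lext_def
proof (intro smul.subspace_sum[OF subspace_multi] smul.subspace_scale[OF subspace_multi])
  fix w assume w: "w \<in> Poly_Mapping.keys f"
  then have "set (letters w) \<subseteq> UNIV \<times> B" using assms(1) by (auto simp: free1_def)
  then have "snd ` set (letters w) \<subseteq> B" by auto
  then show "g w \<in> multi M" using assms(2)[of "letters w"] w by simp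
qed

lemma multi_dv:
  assumes "h \<in> U"
  shows "dv j h \<in> multi {#j#}"
  unfolding dv_lext lext_def
proof (intro smul.subspace_sum[OF subspace_multi] smul.subspace_scale[OF subspace_multi])
  fix b assume "b \<in> Poly_Mapping.keys (quot_coords smul EI B h)"
  then have "b \<in> B" using quot_coords_keys(1)[OF assms] by blast
  then show "letter (j, b) \<in> multi {#j#}" using multi_word[of "[(j, b)]"] by (simp add: letter_def)
qed

lemma multi_D:
  assumes "f \<in> multi M"
  shows "D f \<in> multi M"
  unfolding der_lext
proof (rule multi_lext)
  show "f \<in> DP1" using assms by (simp add: multi_def)
  have *: "der_word ut2_scale ut2_L B ut2_delta u \<in> multi (mset (map fst u))" if "snd ` set u \<subseteq> B" for u
    using that
  proof (induction u)
    case Nil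
    then show ?case using smul.subspace_0[OF subspace_multi] by simp
  next
    case (Cons l u)
    obtain j b where l: "l = (j, b)" by (cases l)
    have b: "b \<in> B" and u: "snd ` set u \<subseteq> B" using Cons.prems by (auto simp: l)
    have "\<Delta> * b \<in> U" using b B_U Delta_U(1) by (intro free1_times) auto
    then have 1: "dv j (\<Delta> * b) * word u \<in> multi ({#j#} + mset (map fst u))"
      by (intro multi_times multi_dv multi_word u)
    have "letter (j, b) \<in> multi {#j#}" using multi_word[of "[(j, b)]"] b by (simp add: letter_def)
    then have 2: "letter (j, b) * der_word ut2_scale ut2_L B ut2_delta u \<in> multi ({#j#} + mset (map fst u))"
      by (rule multi_times[OF _ Cons.IH[OF u]])
    show ?case using smul.subspace_add[OF subspace_multi 1 2] by (simp add: l)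
  qed
  fix u assume "snd ` set u \<subseteq> B" "FWord u \<in> Poly_Mapping.keys f"
  then have "mset (map fst u) = M" using assms by (force simp: multi_def simp del: mset_map)
  then show "der_word ut2_scale ut2_L B ut2_delta (letters (FWord u)) \<in> multi M"
    using *[OF \<open>snd ` set u \<subseteq> B\<close>] by (simp del: mset_map)
qed

lemma multi_xw: "xw l \<in> multi (mset l)"
  using multi_word[of "map (\<lambda>j. (j, 1)) l"] one_B by (force simp: xw_def comp_def)

lemma multi_sw: "sw M \<in> multi M"
  using multi_xw[of "sorted_list_of_multiset M"] by (simp add: sw_def)

text \<open>
  A word is multilinear if its variables form a permutation of the first ones; stated with multisets, this is compatible with products and derivations.
\<close>

lemma multilinear_eq: "multilinear B n = multi (mset_set {1..n})"
proof
  have pl: "prod_list (map (\<lambda>i. letter (\<sigma> i, h i)) xs) = (word (map (\<lambda>i. (\<sigma> i, h i)) xs) :: ('a ut2, 'a) dpoly)"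
    for \<sigma> :: "nat \<Rightarrow> nat" and h :: "nat \<Rightarrow> ('a ut2 \<Rightarrow> 'a ut2, 'a) free_alg" and xs
    by (induction xs) (simp_all add: word_Nil word_Cons)
  have upt: "mset [1..<Suc n] = mset_set {1..n}" by (simp add: atLeastLessThanSuc_atLeastAtMost del: upt_Suc)
  show "multilinear B n \<subseteq> multi (mset_set {1..n})"
    unfolding multilinear_def
  proof (rule smul.span_minimal[OF _ subspace_multi], safe)
    fix \<sigma> :: "nat \<Rightarrow> nat" and h :: "nat \<Rightarrow> ('a ut2 \<Rightarrow> 'a ut2, 'a) free_alg"
    assume \<sigma>: "\<sigma> permutes {1..n}" and h: "\<forall>i\<in>{1..n}. h i \<in> B"
    let ?u = "map (\<lambda>i. (\<sigma> i, h i)) [1..<Suc n]"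
    have "mset (map fst ?u) = image_mset \<sigma> (mset [1..<Suc n])" by (simp add: comp_def)
    also have "\<dots> = mset_set {1..n}"
      unfolding upt using image_mset_mset_set[of \<sigma> "{1..n}"] permutes_image[OF \<sigma>] permutes_inj_on[OF \<sigma>] by simp
    finally have "mset (map fst ?u) = mset_set {1..n}" .
    moreover have "snd ` set ?u \<subseteq> B" using h by auto
    ultimately show "prod_list (map (\<lambda>i. letter (\<sigma> i, h i)) [1..<Suc n]) \<in> multi (mset_set {1..n})"
      unfolding pl using multi_word[of ?u] by (simp only:)
  qed
  show "multi (mset_set {1..n}) \<subseteq> multilinear B n"
  proof
    fix f assume f: "f \<in> multi (mset_set {1..n})"
    have "Poly_Mapping.single w 1 \<in> multilinear B n" if w: "w \<in> Poly_Mapping.keys f" for w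
    proof -
      define u where "u = letters w"
      have m: "mset (map fst u) = mset_set {1..n}" using f w unfolding multi_def u_def by blast
      have "set u \<subseteq> UNIV \<times> B" using f w unfolding multi_def free1_def u_def by blast
      then have sB: "snd (u ! i) \<in> B" if "i < length u" for i
        using nth_mem[OF that] by (metis mem_Sigma_iff prod.collapse subsetD)
      have set: "set (map fst u) = {1..n}" using arg_cong[OF m, of set_mset] by simp
      have len: "length u = n" using arg_cong[OF m, of size] by simp
      have dist: "distinct (map fst u)" 
      proof (rule card_distinct)
        show "card (set (map fst u)) = length (map fst u)" unfolding set by (simp add: len)
      qed
      define \<tau> where "\<tau> i = (if i \<in> {1..n} then fst (u ! (i - 1)) else i)" for i
      have "bij_betw (\<lambda>i. map fst u ! i) {..<n} {1..n}"
        using bij_betw_nth[OF dist, of "{..<n}" "{1..n}"] set len by simp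
      moreover have "bij_betw (\<lambda>i. i - 1) {1..n} {..<n}"
        by (rule bij_betwI[where g = Suc]) auto
      ultimately have "bij_betw ((\<lambda>i. map fst u ! i) \<circ> (\<lambda>i. i - 1)) {1..n} {1..n}"
        by (intro bij_betw_trans)
      then have "bij_betw \<tau> {1..n} {1..n}"
        by (rule bij_betw_cong[THEN iffD1, rotated]) (auto simp: \<tau>_def len)
      then have "\<tau> permutes {1..n}" by (rule bij_imp_permutes) (auto simp: \<tau>_def)
      moreover have "map (\<lambda>i. (\<tau> i, snd (u ! (i - 1)))) [1..<Suc n] = u"
        by (rule nth_equalityI) (auto simp: len \<tau>_def simp del: upt_Suc)
      then have "prod_list (map (\<lambda>i. letter (\<tau> i, snd (u ! (i - 1)))) [1..<Suc n]) = (word u :: ('a ut2, 'a) dpoly)"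
        by (simp only: pl)
      moreover have "\<forall>i\<in>{1..n}. snd (u ! (i - 1)) \<in> B" using sB len by auto
      ultimately have "word u \<in> multilinear B n"
        unfolding multilinear_def
        by (intro smul.span_base CollectI exI[of _ \<tau>] exI[of _ "\<lambda>i. snd (u ! (i - 1))"] conjI) simp_all
      then show ?thesis by (simp add: u_def)
    qed
    then have "lext smul (\<lambda>w. Poly_Mapping.single w 1) f \<in> multilinear B n"
      unfolding lext_def multilinear_def by (intro smul.span_sum smul.span_scale)
    then show "f \<in> multilinear B n" by (simp add: lext_smul_letters)
  qed
qed

lemma dperm_lext: "dpoly_perm \<sigma> f = lext smul (\<lambda>w. word (map (\<lambda>(j, b). (\<sigma> j, b)) (letters w))) (f :: ('a ut2, 'a) dpoly)"
  by (simp add: dpoly_perm_def lext_def)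

lemma dperm_multi:
  assumes \<sigma>: "\<sigma> permutes {1..n}" and f: "f \<in> multi (mset_set {1..n})"
  shows "dpoly_perm \<sigma> f \<in> multi (mset_set {1..n})"
  unfolding dperm_lext
proof (rule multi_lext)
  show "f \<in> DP1" using f by (simp add: multi_def)
  fix u assume u: "snd ` set u \<subseteq> B" "FWord u \<in> Poly_Mapping.keys f"
  let ?v = "map (\<lambda>(j, b). (\<sigma> j, b)) u"
  have "mset (map fst u) = mset_set {1..n}" using f u(2) by (force simp: multi_def simp del: mset_map)
  moreover have "mset (map fst ?v) = image_mset \<sigma> (mset (map fst u))"
    by (simp add: image_mset.compositionality comp_def case_prod_unfold)
  ultimately have "mset (map fst ?v) = mset_set {1..n}"
    using image_mset_mset_set[of \<sigma> "{1..n}"] permutes_image[OF \<sigma>] permutes_inj_on[OF \<sigma>] by (simp del: mset_map)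
  moreover have "snd ` set ?v \<subseteq> B" using u(1) by auto
  ultimately show "word (map (\<lambda>(j, b). (\<sigma> j, b)) (letters (FWord u))) \<in> multi (mset_set {1..n})"
    using multi_word[of ?v] by (simp del: mset_map)
qed

lemma dev_word: "dev a (word u) = prod_list (map (\<lambda>(j, b). eact b (a j)) u)"
  by (simp add: dev_lext ut2_eq_iff)

lemma dev_dperm: "dev a (dpoly_perm \<sigma> f) = dev (a \<circ> \<sigma>) f"
proof -
  have "dev a (dpoly_perm \<sigma> f) = lext ut2_scale (\<lambda>w. dev a (word (map (\<lambda>(j, b). (\<sigma> j, b)) (letters w)))) f"
    unfolding dperm_lext by (rule lext_compose[OF module_smul module_ut2]) (simp_all add: dev_linear)
  also have "\<dots> = dev (a \<circ> \<sigma>) f"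
    unfolding dev_lext[of "a \<circ> \<sigma>"] dev_word by (simp add: comp_def case_prod_unfold)
  finally show ?thesis .
qed

lemma E_dperm:
  assumes f: "f \<in> DP1" "dpoly_perm \<sigma> f \<in> DP1"
  shows "E11 (dpoly_perm \<sigma> f) = rename \<sigma> (E11 f)" "E12 (dpoly_perm \<sigma> f) = rename \<sigma> (E12 f)"
proof -
  have "E11 (dpoly_perm \<sigma> f) - rename \<sigma> (E11 f) = 0"
    by (rule pval_zero_imp_zero) (simp add: pval_rename pval_E[OF f(1)] pval_E[OF f(2)] dev_dperm comp_def)
  then show "E11 (dpoly_perm \<sigma> f) = rename \<sigma> (E11 f)" by simp
  have "E12 (dpoly_perm \<sigma> f) - rename \<sigma> (E12 f) = 0"
    by (rule pval_zero_imp_zero) (simp add: pval_rename pval_E[OF f(1)] pval_E[OF f(2)] dev_dperm comp_def)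
  then show "E12 (dpoly_perm \<sigma> f) = rename \<sigma> (E12 f)" by simp
qed

lemma eps_one: "eps0 (1 :: ('a ut2 \<Rightarrow> 'a ut2, 'a) free_alg) = 1" "eps1 (1 :: ('a ut2 \<Rightarrow> 'a ut2, 'a) free_alg) = 0"
  by (simp_all add: eps0_def eps1_def zero_fword_def flip: word_Nil)

lemma g_one: "g11 (j, 1 :: ('a ut2 \<Rightarrow> 'a ut2, 'a) free_alg) = Poly_Mapping.single {#(j, 0)#} 1"
  "g22 (j, 1 :: ('a ut2 \<Rightarrow> 'a ut2, 'a) free_alg) = Poly_Mapping.single {#(j, 1)#} 1"
  "g12 (j, 1 :: ('a ut2 \<Rightarrow> 'a ut2, 'a) free_alg) = Poly_Mapping.single {#(j, 2)#} 1"
  by (simp_all add: g11_def g22_def g12_def uu_def vv_def ww_def eps_one)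

lemma prod_g22_one: "prod_list (map (\<lambda>j. g22 (j, 1 :: ('a ut2 \<Rightarrow> 'a ut2, 'a) free_alg)) l)
    = Poly_Mapping.single (image_mset (\<lambda>j. (j, 1)) (mset l)) 1"
  by (induction l) (simp_all add: g_one mult_single)

text \<open>
  The corner entry of a product of generic matrices is the sum over the positions of the off-diagonal factor, which are the staircases of the word.
\<close>

lemma E12_xw:
  assumes "distinct l"
  shows "Poly_Mapping.lookup (E12 (xw l)) (image_mset (\<lambda>j. (j, c j)) (mset l)) = of_bool (staircase c l)"
proof -
  have "Poly_Mapping.lookup (w12 (map (\<lambda>j. (j, 1 :: ('a ut2 \<Rightarrow> 'a ut2, 'a) free_alg)) l)) (image_mset (\<lambda>j. (j, c j)) (mset l)) = of_bool (staircase c l)"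
    using assms
  proof (induction l)
    case (Cons x l)
    let ?M = "image_mset (\<lambda>j. (j, c j)) (mset l)" and ?W = "w12 (map (\<lambda>j. (j, 1 :: ('a ut2 \<Rightarrow> 'a ut2, 'a) free_alg)) l)"
    let ?N = "image_mset (\<lambda>j. (j, 1)) (mset l)"
    have x: "x \<notin> set l" using Cons.prems by simp
    have 1: "Poly_Mapping.lookup (Poly_Mapping.single {#(x, 0)#} 1 * ?W) (add_mset (x, c x) ?M) = of_bool (c x = 0 \<and> staircase c l)"
    proof (cases "c x = 0")
      case True
      then show ?thesis using lookup_single_times(1)[of "{#(x, 0)#}" ?W ?M] Cons by simp
    next
      case False
      then have nsub: "\<not> {#(x, 0)#} \<subseteq># add_mset (x, c x) ?M" using x by auto
      show ?thesis unfolding lookup_single_times(2)[OF nsub] using False by simp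
    qed
    have "add_mset (x, 2) ?N = add_mset (x, c x) ?M \<longleftrightarrow> c x = 2 \<and> (\<forall>j\<in>set l. c j = 1)"
    proof
      assume eq: "add_mset (x, 2) ?N = add_mset (x, c x) ?M"
      have "(x, 2) \<in># add_mset (x, c x) ?M" unfolding eq[symmetric] by simp
      then have cx: "c x = 2" using x by auto
      then have "?N = ?M" using eq by simp
      have "c j = 1" if "j \<in> set l" for j
      proof -
        have "(j, c j) \<in># ?M" using that by simp
        then have "(j, c j) \<in># ?N" by (simp only: \<open>?N = ?M\<close>)
        then show ?thesis by auto
      qed
      with cx show "c x = 2 \<and> (\<forall>j\<in>set l. c j = 1)" by blast
    next
      assume "c x = 2 \<and> (\<forall>j\<in>set l. c j = 1)"
      then show "add_mset (x, 2) ?N = add_mset (x, c x) ?M" by (auto intro: image_mset_cong)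
    qed
    then have 2: "Poly_Mapping.lookup (Poly_Mapping.single (add_mset (x, 2) ?N) (1 :: 'a)) (add_mset (x, c x) ?M) = of_bool (c x = 2 \<and> (\<forall>j\<in>set l. c j = 1))"
      by (simp add: lookup_single when_def)
    have "w12 (map (\<lambda>j. (j, 1 :: ('a ut2 \<Rightarrow> 'a ut2, 'a) free_alg)) (x # l)) = Poly_Mapping.single {#(x, 0)#} 1 * ?W + Poly_Mapping.single (add_mset (x, 2) ?N) 1"
      using prod_g22_one[of l] by (simp add: g_one mult_single comp_def)
    moreover have "image_mset (\<lambda>j. (j, c j)) (mset (x # l)) = add_mset (x, c x) ?M" by simp
    ultimately show ?case by (simp only: lookup_add 1 2) auto
  qed simp
  then show ?thesis by (simp add: xw_def E12_word)
qed

lemma E11_xw: "E11 (xw l) = Poly_Mapping.single (image_mset (\<lambda>j. (j, 0)) (mset l)) 1"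
  unfolding xw_def E11_word by (induction l) (simp_all add: g_one mult_single)

text \<open>
  The normal form of an edge is a difference of two words. Among the monomials with the prescribed number of zeros, each word contributes only the one whose two comes at the border between its two blocks: the edge itself, and for the sorted word the last edge.
\<close>

lemma E12_edge:
  assumes c: "c \<in> edge_colourings n" and d: "d \<in> edge_colourings n"
    and z: "card {j \<in> {1..n}. d j = 0} = card {j \<in> {1..n}. c j = 0}"
  shows "Poly_Mapping.lookup (E12 (nf12 (mon n c))) (mon n d) = of_bool (d = c) - of_bool (d = last_edge n (ones c))"
proof -
  let ?T0 = "{j \<in> {1..n}. c j = 0}" and ?T1 = "{j \<in> {1..n}. c j = 1}"
  have cl: "c \<in> lattice_colourings n" and dl: "d \<in> lattice_colourings n" using c d by (auto simp: edge_colourings_def)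
  obtain k where k: "c k = 2" using c by (auto simp: edge_colourings_def)
  have kn: "k \<in> {1..n}" using lattice_out[OF cl, of k] k by auto
  have uk: "c j = 2 \<longleftrightarrow> j = k" for j using cl k unfolding lattice_colourings_def by blast
  have cle: "c j = 0 \<or> c j = 1 \<or> c j = 2" for j
  proof -
    have "c j \<le> 2" using cl unfolding lattice_colourings_def by blast
    then show ?thesis by linarith
  qed
  have T2: "{j \<in> {1..n}. c j = 2} = {k}" using kn by (auto simp: uk)
  define T where "T = {j \<in> {1..n}. ones c j \<noteq> 1}"
  have T: "T = insert k ?T0" unfolding T_def ones_def
  proof (rule set_eqI)
    fix j show "j \<in> {j \<in> {1..n}. of_bool (c j = 1) \<noteq> (1 :: nat)} \<longleftrightarrow> j \<in> insert k ?T0"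
      using cle[of j] uk[of j] kn k by (cases "j = k") auto
  qed
  define l1 where "l1 = sorted_list_of_set ?T0 @ k # sorted_list_of_set ?T1"
  define l2 where "l2 = sorted_list_of_set T @ sorted_list_of_set ?T1"
  have part2: "part 2 (mon n c) = {#k#}" unfolding part_mon T2 by simp
  have fin: "finite ?T0" "finite ?T1" "finite T" by (simp_all add: T_def)
  have "mset_set T = mset_set ?T0 + {#k#}" unfolding T using k by (subst mset_set.insert) auto
  then have sT: "sw (part 0 (mon n c) + {#k#}) = xw (sorted_list_of_set T)"
    unfolding sw_def part_mon by (simp only: sorted_list_of_mset_set flip: \<open>mset_set T = mset_set ?T0 + {#k#}\<close>)
  have "nf12 (mon n c) = (sw (part 0 (mon n c)) * xw [k] - sw (part 0 (mon n c) + {#k#})) * sw (part 1 (mon n c))"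
    unfolding nf12_def part2 by simp
  also have "\<dots> = xw l1 - xw l2"
    unfolding sT unfolding sw_def part_mon l1_def l2_def sorted_list_of_mset_set xw_append xw_Cons[of k "sorted_list_of_set ?T1"]
    by (simp add: algebra_simps)
  finally have nf: "nf12 (mon n c) = xw l1 - xw l2" .
  have cover: "{1..n} = insert k ?T0 \<union> ?T1"
  proof (rule set_eqI)
    fix j show "j \<in> {1..n} \<longleftrightarrow> j \<in> insert k ?T0 \<union> ?T1"
      using cle[of j] uk[of j] kn by (cases "j = k") auto
  qed
  have "set l1 = insert k ?T0 \<union> ?T1" "set l2 = T \<union> ?T1" using fin unfolding l1_def l2_def by simp_all
  then have set: "set l1 = {1..n}" "set l2 = {1..n}" unfolding T cover[symmetric] .
  have "T \<inter> ?T1 = {}" by (auto simp: T_def ones_def)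
  then have dist: "distinct l1" "distinct l2" unfolding l1_def l2_def using fin k by auto
  have ms: "mset l1 = mset_set {1..n}" "mset l2 = mset_set {1..n}"
    using mset_set_set[OF dist(1)] mset_set_set[OF dist(2)] set by simp_all
  have look: "Poly_Mapping.lookup (E12 (nf12 (mon n c))) (mon n d) = of_bool (staircase d l1) - of_bool (staircase d l2)"
    using E12_xw[OF dist(1), of d, unfolded ms] E12_xw[OF dist(2), of d, unfolded ms]
    unfolding nf E_linear lookup_minus unfolding mon_def by simp
  define e where "e = last_edge n (ones c)"
  note P = last_edge_props[OF ones_edge[OF c], folded T_def]
  have el: "e \<in> lattice_colourings n" using P(1) by (simp add: e_def edge_colourings_def)
  have st1: "staircase c l1" unfolding l1_def using k fin by (intro staircase_append) auto
  obtain l where l: "sorted_list_of_set T = l @ [last (sorted_list_of_set T)]" using P(3) by blast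
  have "distinct (l @ [last (sorted_list_of_set T)])" unfolding l[symmetric] by simp
  then have ln: "last (sorted_list_of_set T) \<notin> set l" by simp
  have lT: "set l \<subseteq> T" using l fin(3) by (metis Un_upper1 set_append set_sorted_list_of_set)
  have e_eq: "e j = (if j \<in> T then (if j = last (sorted_list_of_set T) then 2 else 0) else ones c j)" for j
    by (simp add: e_def last_edge_def T_def)
  have "staircase e (l @ last (sorted_list_of_set T) # sorted_list_of_set ?T1)"
  proof (rule staircase_append)
    show "e j = 0" if "j \<in> set l" for j using that ln lT by (auto simp: e_eq)
    show "e (last (sorted_list_of_set T)) = 2" using P(4) by (simp add: e_eq)
    show "e j = 1" if "j \<in> set (sorted_list_of_set ?T1)" for j using that by (simp add: e_eq T_def ones_def)
  qed
  then have st2: "staircase e l2" unfolding l2_def by (subst l) simp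
  have "{j \<in> {1..n}. e j = 0} = T - {last (sorted_list_of_set T)}"
    by (auto simp: e_eq T_def)
  then have "card {j \<in> {1..n}. e j = 0} = card T - 1" using P(4) fin by simp
  also have "\<dots> = card ?T0" using k by (simp add: T)
  finally have ce: "card {j \<in> {1..n}. e j = 0} = card ?T0" .
  have d_eqI: "d = f" if "f \<in> lattice_colourings n" "\<And>j. j \<in> {1..n} \<Longrightarrow> d j = f j" for f
  proof
    fix x show "d x = f x"
    proof (cases "x \<in> {1..n}")
      case False
      then show ?thesis using lattice_out[OF dl] lattice_out[OF that(1)] by simp
    qed (rule that(2))
  qed
  have "d = c" if st: "staircase d l1"
  proof (rule d_eqI[OF cl])
    show "d j = c j" if "j \<in> {1..n}" for j
      by (rule staircase_determined[OF st st1, unfolded set, OF z dist(1) that])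
  qed
  then have i1: "staircase d l1 \<longleftrightarrow> d = c" using st1 by blast
  have "d = e" if st: "staircase d l2"
  proof (rule d_eqI[OF el])
    show "d j = e j" if "j \<in> {1..n}" for j
      by (rule staircase_determined[OF st st2, unfolded set, OF z[folded ce] dist(2) that])
  qed
  then have i2: "staircase d l2 \<longleftrightarrow> d = e" using st2 by blast
  show ?thesis unfolding look i1 i2 e_def ..
qed

lemma dev_xw: "ent11 (dev A (xw l)) = prod_list (map (\<lambda>j. ent11 (A j)) l)"
  "ent22 (dev A (xw l)) = prod_list (map (\<lambda>j. ent22 (A j)) l)"
  using eact_formula[OF Delta_U(2)] by (induction l) (simp_all add: xw_def dev_word eps_one)

text \<open>
  The derivation contributes the difference of the diagonal entries, up to the normalizing factor in the normal form.
\<close>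

lemma E12_vertex:
  assumes e: "e \<in> vertex_colourings n"
  shows "E12 (nf12 (mon n e)) = Poly_Mapping.single (mon n e) 1 - Poly_Mapping.single (mon n (all_ones n)) 1"
proof -
  let ?T0 = "{j \<in> {1..n}. e j = 0}" and ?T1 = "{j \<in> {1..n}. e j = 1}"
  have "e j \<noteq> 2" for j using vertex_values(1)[OF e, of j] by auto
  then have "{j \<in> {1..n}. e j = 2} = {}" by simp
  then have part2: "part 2 (mon n e) = {#}" unfolding part_mon by (simp only: mset_set.empty)
  let ?f = "xw (sorted_list_of_set ?T0)" and ?g = "xw (sorted_list_of_set ?T1)"
  have nf: "nf12 (mon n e) = smul (- 2) (D ?f * ?g)"
    unfolding nf12_def part2 unfolding sw_def part_mon sorted_list_of_mset_set by simp
  have DP: "smul (- 2) (D ?f * ?g) \<in> DP1"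
    by (intro smul.subspace_scale[OF subspace_free1] free1_times xw_DP1 DP_DP1 der_DP[OF delta_in_L])
  have U: "{1..n} = ?T0 \<union> ?T1" "?T0 \<inter> ?T1 = {}" using vertex_values(1)[OF e] by auto
  have pm: "mval a (mon n c) = (\<Prod>j\<in>{1..n}. a (j, c j))" for a :: "nat \<times> nat \<Rightarrow> 'a" and c
    by (simp add: mval_def mon_def image_mset.compositionality comp_def prod_unfold_prod_mset)
  have split: "(\<Prod>j\<in>{1..n}. h j) = (\<Prod>j\<in>?T0. h j) * (\<Prod>j\<in>?T1. h j)" for h :: "nat \<Rightarrow> 'a"
    by (subst U(1), rule prod.union_disjoint) (use U(2) in auto)
  have "E12 (nf12 (mon n e)) - (Poly_Mapping.single (mon n e) 1 - Poly_Mapping.single (mon n (all_ones n)) 1) = 0"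
  proof (rule pval_zero_imp_zero)
    fix a :: "nat \<times> nat \<Rightarrow> 'a"
    define A where "A = (\<lambda>j. mk_ut2 (a (j, 0)) (a (j, 1)) (a (j, 2)))"
    have pl: "prod_list (map h (sorted_list_of_set S)) = (\<Prod>j\<in>S. h j)" if "finite S" for h :: "nat \<Rightarrow> 'a" and S
      using that prod.distinct_set_conv_list[of "sorted_list_of_set S" h] by simp
    have "pval a (E12 (nf12 (mon n e))) = ent12 (dev A (smul (- 2) (D ?f * ?g)))"
      unfolding nf A_def by (rule pval_E(2)[OF DP])
    also have "\<dots> = (ent11 (dev A ?f) - ent22 (dev A ?f)) * ent22 (dev A ?g)"
      unfolding dev_linear ent_ring dev_times dev_der[OF delta_in_L xw_DP1] ent_delta by (simp add: algebra_simps)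
    also have "\<dots> = ((\<Prod>j\<in>?T0. a (j, 0)) - (\<Prod>j\<in>?T0. a (j, 1))) * (\<Prod>j\<in>?T1. a (j, 1))"
      by (simp add: dev_xw pl A_def)
    also have "\<dots> = mval a (mon n e) - mval a (mon n (all_ones n))"
      unfolding pm split by (simp add: all_ones_def algebra_simps)
    finally show "pval a (E12 (nf12 (mon n e)) - (Poly_Mapping.single (mon n e) 1 - Poly_Mapping.single (mon n (all_ones n)) 1)) = 0"
      by simp
  qed
  then show ?thesis by simp
qed


lemma ideal_Ids: "ideal_with_relations B Ids"
  by (rule ideal_with_relationsI[OF T_ideal_Ids rels_Ids[of 0 1 2 3]]) simp

lemma multi_DP:
  assumes "1 \<le> n" "f \<in> multi (mset_set {1..n})"
  shows "f \<in> DP"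
proof -
  have "FWord [] \<notin> Poly_Mapping.keys f"
  proof
    assume "FWord [] \<in> Poly_Mapping.keys f"
    then have "mset (map fst (letters (FWord [] :: 'a gen fword))) = mset_set {1..n}" using assms(2) unfolding multi_def by blast
    then have "mset_set {1..n} = {#}" by simp
    then show False using assms(1) by (simp add: mset_set_empty_iff)
  qed
  then show ?thesis using assms(2) by (simp add: DP_eq free0_def multi_def in_keys_iff)
qed

lemma nf12_multi: "nf12 m \<in> multi (part 0 m + part 2 m + part 1 m)"
proof -
  have p2: "part 2 m = mset (sorted_list_of_multiset (part 2 m))" by simp
  note sub = smul.subspace_diff[OF subspace_multi] smul.subspace_scale[OF subspace_multi]
  consider "sorted_list_of_multiset (part 2 m) = []" | k where "sorted_list_of_multiset (part 2 m) = [k]"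
    | k l ks where "sorted_list_of_multiset (part 2 m) = k # l # ks"
    by (metis neq_Nil_conv)
  then show ?thesis
  proof cases
    case 1
    then have p: "part 2 m = {#}" using p2 by simp
    have "nf12 m = smul (- 2) (D (sw (part 0 m)) * sw (part 1 m))" unfolding nf12_def 1 by simp
    moreover have "smul (- 2) (D (sw (part 0 m)) * sw (part 1 m)) \<in> multi (part 0 m + part 1 m)"
      by (intro sub(2) multi_times multi_D multi_sw)
    ultimately show ?thesis unfolding p by simp
  next
    case (2 k)
    then have p: "part 2 m = {#k#}" using p2 by simp
    have xk: "xw [k] \<in> multi {#k#}" using multi_xw[of "[k]"] by simp
    have "(sw (part 0 m) * xw [k] - sw (part 0 m + {#k#})) * sw (part 1 m) \<in> multi (part 0 m + {#k#} + part 1 m)"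
      by (intro multi_times sub(1) multi_sw xk)
    moreover have "nf12 m = (sw (part 0 m) * xw [k] - sw (part 0 m + {#k#})) * sw (part 1 m)"
      unfolding nf12_def 2 by simp
    ultimately show ?thesis unfolding p by simp
  next
    case 3
    then show ?thesis using smul.subspace_0[OF subspace_multi] by (simp add: nf12_def)
  qed
qed

lemma nf12_mon_multi:
  assumes "c \<in> lattice_colourings n"
  shows "nf12 (mon n c) \<in> multi (mset_set {1..n})"
proof -
  have "c j \<le> 2" for j using assms unfolding lattice_colourings_def by blast
  then have "c j = 0 \<or> c j = 2 \<or> c j = 1" for j by (metis One_nat_def le_Suc_eq le_zero_eq numeral_2_eq_2)
  then have "{1..n} = {j \<in> {1..n}. c j = 0} \<union> {j \<in> {1..n}. c j = 2} \<union> {j \<in> {1..n}. c j = 1}" by blast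
  then have "mset_set {1..n} = mset_set ({j \<in> {1..n}. c j = 0} \<union> {j \<in> {1..n}. c j = 2} \<union> {j \<in> {1..n}. c j = 1})" by (rule arg_cong)
  also have "\<dots> = part 0 (mon n c) + part 2 (mon n c) + part 1 (mon n c)"
    unfolding part_mon by (subst mset_set_Union; (subst mset_set_Union)?; auto)
  finally show ?thesis using nf12_multi[of "mon n c"] by simp
qed

lemma keys_lext:
  fixes g :: "'k \<Rightarrow> 'a poly3"
  assumes "m \<in> Poly_Mapping.keys (lext smul g f)"
  shows "\<exists>k\<in>Poly_Mapping.keys f. m \<in> Poly_Mapping.keys (g k)"
proof (rule ccontr)
  assume "\<not> ?thesis"
  then have "Poly_Mapping.lookup (g k) m = 0" if "k \<in> Poly_Mapping.keys f" for k
    using that by (auto simp: in_keys_iff)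
  then have "Poly_Mapping.lookup (lext smul g f) m = 0" by (simp add: lext_def lookup_sum)
  with assms show False by (simp add: in_keys_iff)
qed

lemma keys_E:
  assumes f: "f \<in> multi (mset_set {1..n})"
  shows "Poly_Mapping.keys (E11 f) \<subseteq> {mon n (\<lambda>_. 0)}" "Poly_Mapping.keys (E12 f) \<subseteq> mon n ` lattice_colourings n"
proof -
  have w: "mset (map fst (letters w)) = mset_set {1..n}" if "w \<in> Poly_Mapping.keys f" for w
    using f that unfolding multi_def by blast
  show "Poly_Mapping.keys (E11 f) \<subseteq> {mon n (\<lambda>_. 0)}"
  proof
    fix m assume "m \<in> Poly_Mapping.keys (E11 f)"
    then obtain k where k: "k \<in> Poly_Mapping.keys f" "m \<in> Poly_Mapping.keys (prod_list (map g11 (letters k)))"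
      unfolding E11_def using keys_lext by blast
    show "m \<in> {mon n (\<lambda>_. 0)}" using keys_prod_gen(1)[OF k(2)] w[OF k(1)] by (simp add: mon_def del: mset_map)
  qed
  show "Poly_Mapping.keys (E12 f) \<subseteq> mon n ` lattice_colourings n"
  proof
    fix m assume "m \<in> Poly_Mapping.keys (E12 f)"
    then obtain k where k: "k \<in> Poly_Mapping.keys f" "m \<in> Poly_Mapping.keys (w12 (letters k))"
      unfolding E12_def using keys_lext by blast
    have "\<exists>c\<in>lattice_colourings n. m = mon n c"
      using keys_w12[OF k(2)] unfolding w[OF k(1)] by (intro colouring_of_monomial) blast+
    then show "m \<in> mon n ` lattice_colourings n" by blast
  qed
qed

definition coord :: "nat \<Rightarrow> (nat \<Rightarrow> nat) option \<Rightarrow> ('a ut2, 'a) dpoly \<Rightarrow> 'a"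
  where "coord n i f = (case i of None \<Rightarrow> Poly_Mapping.lookup (E11 f) (mon n (\<lambda>_. 0))
    | Some c \<Rightarrow> Poly_Mapping.lookup (E12 f) (mon n c))"

definition normal_poly :: "nat \<Rightarrow> (nat \<Rightarrow> nat) option \<Rightarrow> ('a ut2, 'a) dpoly"
  where "normal_poly n i = (case i of None \<Rightarrow> sw (mset_set {1..n}) | Some c \<Rightarrow> nf12 (mon n c))"

lemma coord_linear: "coord n i (f + g) = coord n i f + coord n i g" "coord n i (smul c f) = c * coord n i f"
  "f \<in> Ids \<Longrightarrow> coord n i f = 0"
  using E_Ids[of f] by (cases i; simp add: coord_def E_linear lookup_add)+

lemma quotient_multi: "quotient_space smul (multi M) (multi M \<inter> Ids)"
proof -
  interpret r: ideal_with_relations B Ids by (rule ideal_Ids)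
  show ?thesis
    by (intro quotient_space.intro quotient_space_axioms.intro vector_space_smul subspace_multi
        smul.subspace_inter r.subspace_I) simp
qed

text \<open>
  This rephrases the normal form theorem: the coefficients of the generic entries are functionals modulo identities and reproduce every multilinear polynomial.
\<close>

lemma frame_multi:
  assumes n: "1 \<le> n"
  shows "quotient_space.frame smul (multi (mset_set {1..n})) (multi (mset_set {1..n}) \<inter> Ids)
    (insert None (Some ` lattice_colourings n)) (normal_poly n) (coord n)"
proof -
  interpret r: ideal_with_relations B Ids by (rule ideal_Ids)
  interpret q: quotient_space smul "multi (mset_set {1..n})" "multi (mset_set {1..n}) \<inter> Ids" by (rule quotient_multi)
  let ?J = "insert None (Some ` lattice_colourings n)" and ?V = "multi (mset_set {1..n})"
  have b: "normal_poly n i \<in> ?V" if "i \<in> ?J" for i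
    using that multi_sw nf12_mon_multi by (auto simp: normal_poly_def)
  have "v - (\<Sum>i\<in>?J. smul (coord n i v) (normal_poly n i)) \<in> ?V \<inter> Ids" if v: "v \<in> ?V" for v
  proof
    have "N12 (E12 v) = (\<Sum>m\<in>mon n ` lattice_colourings n. smul (Poly_Mapping.lookup (E12 v) m) (nf12 m))"
      unfolding N12_def using keys_E(2)[OF v] finite_lattice_colourings by (intro smul.lext_superset) simp_all
    also have "\<dots> = (\<Sum>c\<in>lattice_colourings n. smul (Poly_Mapping.lookup (E12 v) (mon n c)) (nf12 (mon n c)))"
      by (subst sum.reindex) (auto intro!: inj_onI mon_inj)
    finally have 2: "N12 (E12 v) = (\<Sum>c\<in>lattice_colourings n. smul (coord n (Some c) v) (normal_poly n (Some c)))"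
      by (simp add: coord_def normal_poly_def)
    have "N11 (E11 v) = (\<Sum>m\<in>{mon n (\<lambda>_. 0)}. smul (Poly_Mapping.lookup (E11 v) m) (sw (part 0 m)))"
      unfolding N11_def using keys_E(1)[OF v] by (intro smul.lext_superset) simp_all
    moreover have "part 0 (mon n (\<lambda>_. 0)) = mset_set {1..n}"
      unfolding part_mon by (rule arg_cong[of _ _ mset_set]) auto
    ultimately have 1: "N11 (E11 v) = smul (coord n None v) (normal_poly n None)"
      by (simp add: coord_def normal_poly_def)
    have "(\<Sum>i\<in>?J. smul (coord n i v) (normal_poly n i)) = N11 (E11 v) + N12 (E12 v)"
      unfolding 1 2 using finite_lattice_colourings[of n] by (subst sum.insert) (auto simp: sum.reindex)
    then show "v - (\<Sum>i\<in>?J. smul (coord n i v) (normal_poly n i)) \<in> Ids"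
      using r.normal_form[of v] v by (simp add: multi_def)
    show "v - (\<Sum>i\<in>?J. smul (coord n i v) (normal_poly n i)) \<in> ?V"
      using b by (intro smul.subspace_diff[OF subspace_multi v] smul.subspace_sum[OF subspace_multi] smul.subspace_scale[OF subspace_multi])
  qed
  then show ?thesis
    unfolding q.frame_def q.functional_def using b finite_lattice_colourings[of n] by (auto simp: coord_linear)
qed

text \<open>
  Renaming the variables acts on the generic entries by permuting monomials, so that a diagonal coefficient is the coefficient of a normal form at a permuted monomial. Edges contribute their fixed points minus the corrections, vertices their fixed points minus the all-ones vertex, and the sorted word contributes one.
\<close>

lemma trace_sum:
  assumes \<sigma>: "\<sigma> permutes {1..n}"
  shows "(\<Sum>i\<in>insert None (Some ` lattice_colourings n). coord n i (dpoly_perm \<sigma> (normal_poly n i)))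
    = of_nat (Suc (card {c \<in> edge_colourings n. c \<circ> \<sigma> = c}))"
proof -
  have inj: "inj \<sigma>" using permutes_inj[OF \<sigma>] .
  have in': "dpoly_perm \<sigma> f \<in> DP1" "f \<in> DP1" if "f \<in> multi (mset_set {1..n})" for f
    using dperm_multi[OF \<sigma> that] that by (simp_all add: multi_def)
  have some: "coord n (Some c) (dpoly_perm \<sigma> (normal_poly n (Some c))) = Poly_Mapping.lookup (E12 (nf12 (mon n c))) (mon n (c \<circ> \<sigma>))"
    if "c \<in> lattice_colourings n" for c
    using E_dperm(2)[OF in'(2,1)[OF nf12_mon_multi[OF that]]] lookup_rename[OF inj]
    by (simp add: coord_def normal_poly_def mon_perm[OF \<sigma>, of c])
  have "E11 (sw (mset_set {1..n})) = Poly_Mapping.single (mon n (\<lambda>_. 0)) 1"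
    unfolding sw_def E11_xw mset_sorted_list_of_multiset mon_def ..
  moreover have "image_mset (map_prod \<sigma> id) (mon n (\<lambda>_. 0)) = mon n (\<lambda>_. 0)"
    using mon_perm[OF \<sigma>, of "\<lambda>_. 0"] by (simp add: comp_def)
  then have "Poly_Mapping.lookup (rename \<sigma> p) (mon n (\<lambda>_. 0)) = Poly_Mapping.lookup p (mon n (\<lambda>_. 0))" for p :: "'a poly3"
    using lookup_rename[OF inj, of p "mon n (\<lambda>_. 0)"] by simp
  ultimately have none: "coord n None (dpoly_perm \<sigma> (normal_poly n None)) = 1"
    unfolding coord_def normal_poly_def option.case E_dperm(1)[OF in'(2,1)[OF multi_sw]] by simp
  let ?E = "edge_colourings n" and ?V = "vertex_colourings n"
  have zeros: "card {j \<in> {1..n}. (c \<circ> \<sigma>) j = 0} = card {j \<in> {1..n}. c j = 0}" for c :: "nat \<Rightarrow> nat"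
  proof (rule bij_betw_same_card[of \<sigma>], rule bij_betwI[where g = "inv \<sigma>"])
    show "\<sigma> \<in> {j \<in> {1..n}. (c \<circ> \<sigma>) j = 0} \<rightarrow> {j \<in> {1..n}. c j = 0}"
      using permutes_in_image[OF \<sigma>] by simp
    show "inv \<sigma> \<in> {j \<in> {1..n}. c j = 0} \<rightarrow> {j \<in> {1..n}. (c \<circ> \<sigma>) j = 0}"
      using permutes_in_image[OF permutes_inv[OF \<sigma>]] permutes_inverses(1)[OF \<sigma>] by simp
  qed (use permutes_inverses[OF \<sigma>] in simp_all)
  have edges: "(\<Sum>c\<in>?E. Poly_Mapping.lookup (E12 (nf12 (mon n c))) (mon n (c \<circ> \<sigma>)))
      = of_nat (card {c \<in> ?E. c \<circ> \<sigma> = c}) - of_nat (card {c \<in> ?E. c \<circ> \<sigma> = last_edge n (ones c)})"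
  proof -
    have "(\<Sum>c\<in>?E. Poly_Mapping.lookup (E12 (nf12 (mon n c))) (mon n (c \<circ> \<sigma>)))
        = (\<Sum>c\<in>?E. of_bool (c \<circ> \<sigma> = c) - of_bool (c \<circ> \<sigma> = last_edge n (ones c)))"
      by (rule sum.cong[OF refl E12_edge[OF _ edge_comp[OF _ \<sigma>] zeros]])
    also have "\<dots> = of_nat (card {c \<in> ?E. c \<circ> \<sigma> = c}) - of_nat (card {c \<in> ?E. c \<circ> \<sigma> = last_edge n (ones c)})"
      by (simp only: sum_subtractf sum_of_bool_card[OF finite_edge_vertex(1)])
    finally show ?thesis .
  qed
  have ones\<sigma>: "all_ones n \<circ> \<tau> = all_ones n" if "\<tau> permutes {1..n}" for \<tau>
    using permutes_in_image[OF that] by (auto simp: all_ones_def fun_eq_iff)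
  have vert: "Poly_Mapping.lookup (E12 (nf12 (mon n e))) (mon n (e \<circ> \<sigma>)) = of_bool (e \<circ> \<sigma> = e) - of_bool (e = all_ones n)"
    if e: "e \<in> ?V" for e
  proof -
    have L: "e \<in> lattice_colourings n" "e \<circ> \<sigma> \<in> lattice_colourings n" "all_ones n \<in> lattice_colourings n"
      using e all_ones_vertex lattice_comp[OF _ \<sigma>] by (auto simp: vertex_colourings_def)
    have "mon n e = mon n (e \<circ> \<sigma>) \<longleftrightarrow> e \<circ> \<sigma> = e" using mon_inj[OF L(1,2)] by (metis)
    moreover have "mon n (all_ones n) = mon n (e \<circ> \<sigma>) \<longleftrightarrow> e \<circ> \<sigma> = all_ones n" using mon_inj[OF L(3,2)] by metis
    moreover have "e \<circ> \<sigma> = all_ones n \<longleftrightarrow> e = all_ones n"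
    proof
      assume "e \<circ> \<sigma> = all_ones n"
      then have "e \<circ> \<sigma> \<circ> inv \<sigma> = all_ones n" using ones\<sigma>[OF permutes_inv[OF \<sigma>]] by simp
      then show "e = all_ones n" using permutes_inv_o(1)[OF \<sigma>] by (simp add: comp_assoc)
    qed (simp add: ones\<sigma>[OF \<sigma>])
    ultimately show ?thesis unfolding E12_vertex[OF e] by (simp add: lookup_minus lookup_single when_def)
  qed
  have "{e \<in> ?V. e = all_ones n} = {all_ones n}" using all_ones_vertex by auto
  then have single: "card {e \<in> ?V. e = all_ones n} = 1" by (metis is_singletonI is_singleton_altdef)
  have verts: "(\<Sum>e\<in>?V. Poly_Mapping.lookup (E12 (nf12 (mon n e))) (mon n (e \<circ> \<sigma>)))
      = of_nat (card {e \<in> ?V. e \<circ> \<sigma> = e}) - 1"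
  proof -
    have "(\<Sum>e\<in>?V. Poly_Mapping.lookup (E12 (nf12 (mon n e))) (mon n (e \<circ> \<sigma>)))
        = (\<Sum>e\<in>?V. of_bool (e \<circ> \<sigma> = e) - of_bool (e = all_ones n))"
      by (rule sum.cong[OF refl vert])
    also have "\<dots> = of_nat (card {e \<in> ?V. e \<circ> \<sigma> = e}) - of_nat (card {e \<in> ?V. e = all_ones n})"
      by (simp only: sum_subtractf sum_of_bool_card[OF finite_edge_vertex(2)])
    finally show ?thesis unfolding single of_nat_1 .
  qed
  have "card {e \<in> ?V. e \<circ> \<sigma> = e} = Suc (card ({e \<in> ?V. e \<circ> \<sigma> = e} - {all_ones n}))"
    using all_ones_vertex ones\<sigma>[OF \<sigma>] finite_edge_vertex(2)[of n] by (intro card.remove) auto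
  then have vc: "(of_nat (card {e \<in> ?V. e \<circ> \<sigma> = e}) :: 'a) = 1 + of_nat (card {c \<in> ?E. c \<circ> \<sigma> = last_edge n (ones c)})"
    by (simp add: edge_vertex_bijection[OF \<sigma>])
  have "(\<Sum>i\<in>insert None (Some ` lattice_colourings n). coord n i (dpoly_perm \<sigma> (normal_poly n i)))
      = 1 + (\<Sum>c\<in>lattice_colourings n. Poly_Mapping.lookup (E12 (nf12 (mon n c))) (mon n (c \<circ> \<sigma>)))"
    using finite_lattice_colourings[of n] by (subst sum.insert) (auto simp: sum.reindex none some)
  also have "\<dots> = of_nat (Suc (card {c \<in> ?E. c \<circ> \<sigma> = c}))"
    unfolding lattice_split(1) sum.union_disjoint[OF finite_edge_vertex lattice_split(2)] edges verts by (simp add: vc)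
  finally show ?thesis .
qed

theorem cocharacter_edges:
  assumes n: "1 \<le> n" and \<sigma>: "\<sigma> permutes {1..n}"
  shows "cocharacter ut2_scale B n \<sigma> = of_nat (Suc (card {c \<in> edge_colourings n. c \<circ> \<sigma> = c}))"
proof -
  interpret q: quotient_space smul "multi (mset_set {1..n})" "multi (mset_set {1..n}) \<inter> Ids" by (rule quotient_multi)
  have lin: "dpoly_perm \<sigma> (f + g) = dpoly_perm \<sigma> f + dpoly_perm \<sigma> g" "dpoly_perm \<sigma> (smul c f) = smul c (dpoly_perm \<sigma> f)"
    for f g :: "('a ut2, 'a) dpoly" and c
    by (simp_all add: dperm_lext smul.lext_add smul.lext_smul)
  have ids: "dpoly_perm \<sigma> f \<in> Ids" if "f \<in> multi (mset_set {1..n})" "f \<in> Ids" for f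
    using that dperm_multi[OF \<sigma> that(1)] multi_DP[OF n] by (simp add: Ids_iff dev_dperm)
  have "q.endo (dpoly_perm \<sigma>)" unfolding q.endo_def using dperm_multi[OF \<sigma>] ids lin by blast
  from q.quot_trace_frame[OF frame_multi[OF n] this] show ?thesis
    unfolding cocharacter_def multilinear_eq trace_sum[OF \<sigma>] .
qed

theorem codimension_edges:
  assumes n: "1 \<le> n"
  shows "codimension ut2_scale B n = Suc (card (edge_colourings n))"
proof -
  interpret q: quotient_space smul "multi (mset_set {1..n})" "multi (mset_set {1..n}) \<inter> Ids" by (rule quotient_multi)
  have "map (\<lambda>(j, b). (id j, b)) u = u" for u :: "'a gen list" by (induction u) auto
  then have "dpoly_perm id f = f" for f :: "('a ut2, 'a) dpoly" by (simp add: dperm_lext lext_smul_letters)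
  then have "(of_nat (codimension ut2_scale B n) :: 'a) = of_nat (Suc (card (edge_colourings n)))"
    using q.quot_dim_frame[OF frame_multi[OF n]] trace_sum[OF permutes_id, of n]
    unfolding codimension_def multilinear_eq by simp
  then show ?thesis by (simp only: of_nat_eq_iff)
qed

end

text \<open>
  An edge is given by its direction and by the set of ones among the other points.
\<close>

lemma card_edge_colourings: "card (edge_colourings n) = 2 ^ (n - 1) * n"
proof -
  define g where "g = (\<lambda>(k :: nat, S) j. if j = k then 2 else of_bool (j \<in> S) :: nat)"
  let ?P = "SIGMA k:{1..n}. Pow ({1..n} - {k})"
  have "inj_on g ?P"
  proof (rule inj_onI, safe)
    fix k S k' S' assume *: "g (k, S) = g (k', S')" "k \<in> {1..n}" "S \<subseteq> {1..n} - {k}" "S' \<subseteq> {1..n} - {k'}"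
    have "g (k', S') k = 2" unfolding *(1)[symmetric] by (simp add: g_def)
    then show k: "k = k'" by (simp add: g_def of_bool_def split: if_splits)
    have "x \<in> S \<longleftrightarrow> x \<in> S'" for x
    proof (cases "x = k")
      case True
      have "k \<notin> S" "k \<notin> S'" using *(3,4) unfolding k by blast+
      then show ?thesis using True by simp
    next
      case False
      have "g (k, S) x = g (k, S') x" using fun_cong[OF *(1), of x] unfolding k .
      then show ?thesis using False by (simp add: g_def of_bool_def split: if_splits)
    qed
    then show "x \<in> S \<Longrightarrow> x \<in> S'" "x \<in> S' \<Longrightarrow> x \<in> S" for x by blast+
  qed
  moreover have "g ` ?P = edge_colourings n"
  proof
    show "g ` ?P \<subseteq> edge_colourings n"
      by (auto simp: g_def of_bool_def edge_colourings_def lattice_colourings_def split: if_splits)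
    show "edge_colourings n \<subseteq> g ` ?P"
    proof
      fix c assume c: "c \<in> edge_colourings n"
      then have cl: "c \<in> lattice_colourings n" and "\<exists>k. c k = 2" by (auto simp: edge_colourings_def)
      then obtain k where k: "c k = 2" by blast
      have kn: "k \<in> {1..n}" using lattice_out[OF cl, of k] k by auto
      have "c j = g (k, {j \<in> {1..n}. c j = 1}) j" for j
      proof -
        have "c j \<le> 2" "c j = 2 \<longrightarrow> j = k" using cl k unfolding lattice_colourings_def by blast+
        then have "c j = 0 \<or> c j = 1 \<or> j = k" by linarith
        then show ?thesis using lattice_out[OF cl, of j] k by (auto simp: g_def)
      qed
      then have "c = g (k, {j \<in> {1..n}. c j = 1})" by (rule ext)
      moreover have "(k, {j \<in> {1..n}. c j = 1}) \<in> ?P" using kn k by auto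
      ultimately show "c \<in> g ` ?P" by (rule image_eqI)
    qed
  qed
  ultimately have "card (edge_colourings n) = card ?P" by (metis card_image)
  also have "\<dots> = (\<Sum>k\<in>{1..n}. 2 ^ (n - 1))" by (simp add: card_Pow)
  finally show ?thesis by simp
qed


section \<open>The group algebra of finitary permutations\<close>

typedef fperm = "{f :: nat \<Rightarrow> nat. permutation f}" morphisms app Fperm
  by (rule exI[of _ id]) (simp add: permutation_id)

setup_lifting type_definition_fperm

instantiation fperm :: group_add
begin

lift_definition zero_fperm :: fperm is id by (rule permutation_id)
lift_definition plus_fperm :: "fperm \<Rightarrow> fperm \<Rightarrow> fperm" is "(\<circ>)" by (rule permutation_compose)
lift_definition uminus_fperm :: "fperm \<Rightarrow> fperm" is inv by (rule permutation_inverse)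
definition minus_fperm :: "fperm \<Rightarrow> fperm \<Rightarrow> fperm" where "minus_fperm p q = p + - q"

instance
proof
  fix p q r :: fperm
  show "p + q + r = p + (q + r)" by transfer (simp add: comp_assoc)
  show "0 + p = p" by transfer simp
  show "p + 0 = p" by transfer simp
  show "- p + p = 0" by transfer (simp add: permutation_bijective bij_is_inj)
  show "p + - q = p - q" by (simp add: minus_fperm_def)
qed

end

lemma bij_app: "bij (app p)"
  using app[of p] by (simp add: permutation_bijective)

definition Sym :: "nat \<Rightarrow> fperm set"
  where "Sym n = {p. app p permutes {1..n}}"

lemma app_Fperm: "\<sigma> permutes {1..n} \<Longrightarrow> app (Fperm \<sigma>) = \<sigma>" for n :: nat
  by (rule Fperm_inverse) (auto simp: permutation_permutes)

lemma bij_betw_app_Sym: "bij_betw app (Sym n) {\<sigma>. \<sigma> permutes {1..n}}"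
  by (rule bij_betwI[where g = Fperm]) (auto simp: Sym_def app_Fperm app_inverse)

lemma finite_Sym [simp]: "finite (Sym n)"
  using bij_betw_finite[OF bij_betw_app_Sym] by (simp add: finite_permutations)

lemma Sym_zero [simp]: "0 \<in> Sym n"
  by (simp add: Sym_def zero_fperm.rep_eq permutes_id)

lemma Sym_plus: "p \<in> Sym n \<Longrightarrow> q \<in> Sym n \<Longrightarrow> p + q \<in> Sym n"
  by (simp add: Sym_def plus_fperm.rep_eq permutes_compose)

lemma Sym_uminus: "p \<in> Sym n \<Longrightarrow> - p \<in> Sym n"
  by (simp add: Sym_def uminus_fperm.rep_eq permutes_inv)

lemma Sym_uminus_iff [simp]: "- p \<in> Sym n \<longleftrightarrow> p \<in> Sym n"
  using Sym_uminus[of p n] Sym_uminus[of "- p" n] by auto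

lemma app_plus: "app (p + q) x = app p (app q x)"
  by (simp add: plus_fperm.rep_eq)

lemma app_uminus [simp]: "app (- p) (app p x) = x" "app p (app (- p) x) = x"
  using app_plus[of "- p" p x] app_plus[of p "- p" x] by (simp_all add: zero_fperm.rep_eq)

lemma Sym_app_in: "p \<in> Sym n \<Longrightarrow> app p x \<in> {1..n} \<longleftrightarrow> x \<in> {1..n}"
  unfolding Sym_def using permutes_in_image[of "app p" "{1..n}" x] by simp

definition psign :: "fperm \<Rightarrow> 'a::comm_ring_1"
  where "psign p = of_int (sign (app p))"

lemma psign_plus: "psign (p + q) = psign p * psign q"
  using app[of p] app[of q]
  by (simp add: psign_def plus_fperm.rep_eq sign_compose)

lemma psign_zero [simp]: "psign 0 = 1"
  by (simp add: psign_def zero_fperm.rep_eq sign_id)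

lemma psign_uminus [simp]: "psign (- p) = psign p"
  using app[of p] by (simp add: psign_def uminus_fperm.rep_eq sign_inverse)

lemma psign_square [simp]: "psign p * psign p = 1"
  using psign_plus[of p "- p"] by (metis psign_uminus psign_zero right_minus)

type_synonym 'a galg = "fperm \<Rightarrow>\<^sub>0 'a"

abbreviation gel :: "fperm \<Rightarrow> 'a::comm_ring_1 galg" where "gel p \<equiv> Poly_Mapping.single p 1"

lemma lookup_gel_times: "Poly_Mapping.lookup (gel p * x) q = Poly_Mapping.lookup x (- p + q)"
proof (induction x rule: free_induct)
  case (add x k c)
  have "p + k = q \<longleftrightarrow> k = - p + q" by (auto simp: add.assoc[symmetric])
  with add show ?case by (simp add: distrib_left lookup_add mult_single lookup_single when_def)
qed simp

lemma lookup_times_gel: "Poly_Mapping.lookup (x * gel p) q = Poly_Mapping.lookup x (q - p)"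
proof (induction x rule: free_induct)
  case (add x k c)
  have "k + p = q \<longleftrightarrow> k = q - p" by (metis add_diff_cancel diff_add_cancel)
  with add show ?case by (simp add: distrib_right lookup_add mult_single lookup_single when_def)
qed simp

lemma galg_expand:
  fixes x :: "'a::field galg"
  assumes "finite A" "Poly_Mapping.keys x \<subseteq> A"
  shows "x = (\<Sum>p\<in>A. smul (Poly_Mapping.lookup x p) (gel p))"
  using lext_smul_letters[of x] smul.lext_superset[OF assms, of gel] by simp

lemma lookup_times_galg:
  fixes x y :: "'a::field galg"
  assumes "finite A" "Poly_Mapping.keys x \<subseteq> A"
  shows "Poly_Mapping.lookup (x * y) q
    = (\<Sum>p\<in>A. Poly_Mapping.lookup x p * Poly_Mapping.lookup y (- p + q))"
  by (subst galg_expand[OF assms])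
    (simp add: sum_distrib_right smul_mult_left lookup_sum lookup_gel_times del: smul_single)

definition galg_on :: "nat \<Rightarrow> 'a::field galg set"
  where "galg_on n = {x. Poly_Mapping.keys x \<subseteq> Sym n}"

lemma galg_on_times: "x \<in> galg_on n \<Longrightarrow> y \<in> galg_on n \<Longrightarrow> x * y \<in> galg_on n"
  unfolding galg_on_def using keys_mult[of x y] by (blast intro: Sym_plus)

lemma galg_on_gel: "p \<in> Sym n \<Longrightarrow> gel p \<in> galg_on n"
  by (simp add: galg_on_def)

lemma galg_on_single: "p \<in> Sym n \<Longrightarrow> Poly_Mapping.single p c \<in> galg_on n"
  by (auto simp: galg_on_def)

lemma galg_on_sum: "(\<And>i. i \<in> A \<Longrightarrow> f i \<in> galg_on n) \<Longrightarrow> sum f A \<in> galg_on n"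
  unfolding galg_on_def using keys_sum[of f A] by blast

definition star :: "'a::field galg \<Rightarrow> 'a galg"
  where "star = lext smul (\<lambda>p. gel (- p))"

lemma star_add: "star (x + y) = star x + star y"
  by (simp add: star_def smul.lext_add)

lemma star_single [simp]: "star (Poly_Mapping.single p c) = Poly_Mapping.single (- p) c"
  by (simp add: star_def)

lemma star_sum: "star (sum f A) = (\<Sum>i\<in>A. star (f i))"
  by (simp add: star_def smul.lext_sum)

lemma star_zero [simp]: "star 0 = 0"
  by (simp add: star_def)

lemma lookup_star: "Poly_Mapping.lookup (star x) p = Poly_Mapping.lookup x (- p)"
proof (induction x rule: free_induct)
  case (add f k c)
  have "- k = p \<longleftrightarrow> k = - p" by auto
  with add show ?case by (simp add: star_add lookup_add lookup_single when_def)
qed simp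

lemma star_times: "star (x * y) = star y * star x"
proof (induction x rule: free_induct)
  case (add f k c)
  have "star (Poly_Mapping.single k c * y) = star y * Poly_Mapping.single (- k) c"
    by (induction y rule: free_induct)
      (simp_all add: star_add distrib_left distrib_right mult_single minus_add mult.commute)
  with add show ?case by (simp add: star_add distrib_left distrib_right)
qed simp

section \<open>Row and column indices\<close>

fun rowi :: "nat list \<Rightarrow> nat \<Rightarrow> nat" where
  "rowi [] x = 0"
| "rowi (m # \<mu>) x = (if x \<le> m then 0 else Suc (rowi \<mu> (x - m)))"

fun coli :: "nat list \<Rightarrow> nat \<Rightarrow> nat" where
  "coli [] x = 0"
| "coli (m # \<mu>) x = (if x \<le> m then x - 1 else coli \<mu> (x - m))"

lemma tableau_Cons [simp]:
  "tableau (m # \<mu>) 0 j = j + 1" "tableau (m # \<mu>) (Suc i) j = m + tableau \<mu> i j"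
  by (simp_all add: tableau_def)

lemma tableau_rowi_coli:
  "x \<in> {1..sum_list \<mu>} \<Longrightarrow>
    rowi \<mu> x < length \<mu> \<and> coli \<mu> x < \<mu> ! rowi \<mu> x \<and> tableau \<mu> (rowi \<mu> x) (coli \<mu> x) = x"
proof (induction \<mu> arbitrary: x)
  case (Cons m \<mu>)
  show ?case
  proof (cases "x \<le> m")
    case False
    then have "x - m \<in> {1..sum_list \<mu>}" using Cons.prems by auto
    from Cons.IH[OF this] False show ?thesis by simp
  qed (use Cons.prems in auto)
qed simp

lemma tableau_in:
  "i < length \<mu> \<Longrightarrow> j < \<mu> ! i \<Longrightarrow>
    tableau \<mu> i j \<in> {1..sum_list \<mu>} \<and> rowi \<mu> (tableau \<mu> i j) = i \<and> coli \<mu> (tableau \<mu> i j) = j"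
proof (induction \<mu> arbitrary: i)
  case (Cons m \<mu>)
  show ?case
  proof (cases i)
    case (Suc i')
    then have "tableau \<mu> i' j \<in> {1..sum_list \<mu>} \<and> rowi \<mu> (tableau \<mu> i' j) = i' \<and> coli \<mu> (tableau \<mu> i' j) = j"
      using Cons by simp
    with Suc show ?thesis by simp
  qed (use Cons.prems in auto)
qed simp

lemma tab_row_eq: "tab_row \<mu> i = {x \<in> {1..sum_list \<mu>}. rowi \<mu> x = i}"
proof (intro set_eqI iffI)
  fix x assume "x \<in> tab_row \<mu> i"
  then obtain j where "x = tableau \<mu> i j" "i < length \<mu>" "j < \<mu> ! i" by (auto simp: tab_row_def)
  then show "x \<in> {x \<in> {1..sum_list \<mu>}. rowi \<mu> x = i}" using tableau_in[of i \<mu> j] by auto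
next
  fix x assume "x \<in> {x \<in> {1..sum_list \<mu>}. rowi \<mu> x = i}"
  then show "x \<in> tab_row \<mu> i" using tableau_rowi_coli[of x \<mu>] by (simp add: tab_row_def) metis
qed

lemma tab_col_eq: "tab_col \<mu> j = {x \<in> {1..sum_list \<mu>}. coli \<mu> x = j}"
proof (intro set_eqI iffI)
  fix x assume "x \<in> tab_col \<mu> j"
  then obtain i where "x = tableau \<mu> i j" "i < length \<mu>" "j < \<mu> ! i" by (auto simp: tab_col_def)
  then show "x \<in> {x \<in> {1..sum_list \<mu>}. coli \<mu> x = j}" using tableau_in[of i \<mu> j] by auto
next
  fix x assume "x \<in> {x \<in> {1..sum_list \<mu>}. coli \<mu> x = j}"
  then show "x \<in> tab_col \<mu> j" using tableau_rowi_coli[of x \<mu>] by (simp add: tab_col_def) metis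
qed

lemma cell_unique:
  assumes "x \<in> {1..sum_list \<mu>}" "y \<in> {1..sum_list \<mu>}" "rowi \<mu> x = rowi \<mu> y" "coli \<mu> x = coli \<mu> y"
  shows "x = y"
  using tableau_rowi_coli[OF assms(1)] tableau_rowi_coli[OF assms(2)] assms(3,4) by metis

lemma fibres_preserved_iff:
  fixes n :: nat and f :: "nat \<Rightarrow> nat"
  assumes "\<rho> permutes {1..n}"
  shows "(\<forall>i. \<rho> ` {x \<in> {1..n}. f x = i} = {x \<in> {1..n}. f x = i})
    \<longleftrightarrow> (\<forall>x\<in>{1..n}. f (\<rho> x) = f x)"
proof
  assume *: "\<forall>i. \<rho> ` {x \<in> {1..n}. f x = i} = {x \<in> {1..n}. f x = i}"
  show "\<forall>x\<in>{1..n}. f (\<rho> x) = f x"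
  proof
    fix x assume "x \<in> {1..n}"
    then have "\<rho> x \<in> \<rho> ` {y \<in> {1..n}. f y = f x}" by simp
    then show "f (\<rho> x) = f x" using * by auto
  qed
next
  assume *: "\<forall>x\<in>{1..n}. f (\<rho> x) = f x"
  show "\<forall>i. \<rho> ` {x \<in> {1..n}. f x = i} = {x \<in> {1..n}. f x = i}"
  proof
    fix i
    have "\<rho> ` {x \<in> {1..n}. f x = i} \<subseteq> {x \<in> {1..n}. f x = i}"
      using * permutes_in_image[OF assms] by auto
    moreover have "inj_on \<rho> {x \<in> {1..n}. f x = i}"
      using permutes_inj[OF assms] by (auto intro: inj_on_subset)
    ultimately show "\<rho> ` {x \<in> {1..n}. f x = i} = {x \<in> {1..n}. f x = i}"
      by (intro card_subset_eq) (auto simp: card_image)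
  qed
qed

lemma row_group_eq:
  "row_group \<mu> = {\<rho>. \<rho> permutes {1..sum_list \<mu>} \<and> (\<forall>x\<in>{1..sum_list \<mu>}. rowi \<mu> (\<rho> x) = rowi \<mu> x)}"
  unfolding row_group_def tab_row_eq using fibres_preserved_iff by blast

lemma col_group_eq:
  "col_group \<mu> = {\<rho>. \<rho> permutes {1..sum_list \<mu>} \<and> (\<forall>x\<in>{1..sum_list \<mu>}. coli \<mu> (\<rho> x) = coli \<mu> x)}"
  unfolding col_group_def tab_col_eq using fibres_preserved_iff by blast

definition fixing :: "nat \<Rightarrow> (nat \<Rightarrow> nat) \<Rightarrow> fperm set"
  where "fixing n f = {p \<in> Sym n. \<forall>x\<in>{1..n}. f (app p x) = f x}"

lemma fixing_sub: "fixing n f \<subseteq> Sym n"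
  by (auto simp: fixing_def)

lemma finite_fixing [simp]: "finite (fixing n f)"
  by (rule finite_subset[OF fixing_sub]) simp

lemma fixing_zero [simp]: "0 \<in> fixing n f"
  by (auto simp: fixing_def zero_fperm.rep_eq)

lemma fixing_plus: "p \<in> fixing n f \<Longrightarrow> q \<in> fixing n f \<Longrightarrow> p + q \<in> fixing n f"
  by (auto simp: fixing_def Sym_plus app_plus Sym_app_in[simplified])

lemma fixing_uminus: "p \<in> fixing n f \<Longrightarrow> - p \<in> fixing n f"
proof -
  assume p: "p \<in> fixing n f"
  then have "p \<in> Sym n" by (simp add: fixing_def)
  have "f (app (- p) x) = f x" if "x \<in> {1..n}" for x
  proof -
    have "app (- p) x \<in> {1..n}" using Sym_app_in[of "- p" n x] \<open>p \<in> Sym n\<close> that by simp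
    then have "f (app p (app (- p) x)) = f (app (- p) x)" using p unfolding fixing_def by blast
    then show ?thesis by simp
  qed
  with \<open>p \<in> Sym n\<close> show ?thesis by (simp add: fixing_def)
qed

lemma fixing_uminus_iff: "- p \<in> fixing n f \<longleftrightarrow> p \<in> fixing n f"
  using fixing_uminus[of p] fixing_uminus[of "- p"] by auto

lemma bij_betw_fixing_plus:
  assumes "p \<in> fixing n f"
  shows "bij_betw (\<lambda>q. p + q) (fixing n f) (fixing n f)" "bij_betw (\<lambda>q. q + p) (fixing n f) (fixing n f)"
proof -
  have m: "- p \<in> fixing n f" using assms by (rule fixing_uminus)
  show "bij_betw (\<lambda>q. p + q) (fixing n f) (fixing n f)"
    by (rule bij_betwI[where g = "\<lambda>q. - p + q"])
      (use m assms in \<open>simp_all add: fixing_plus add.assoc[symmetric] Pi_I\<close>)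
  show "bij_betw (\<lambda>q. q + p) (fixing n f) (fixing n f)"
    by (rule bij_betwI[where g = "\<lambda>q. q + - p"])
      (use m assms in \<open>simp_all add: fixing_plus add.assoc Pi_I del: add_uminus_conv_diff\<close>)
qed

lemma bij_betw_app_fixing:
  "bij_betw app (fixing n f) {\<rho>. \<rho> permutes {1..n} \<and> (\<forall>x\<in>{1..n}. f (\<rho> x) = f x)}"
  by (rule bij_betwI[where g = Fperm]) (auto simp: Sym_def fixing_def app_Fperm app_inverse)

section \<open>Young symmetrizers in the group algebra\<close>

definition rowsym :: "nat list \<Rightarrow> 'a::field galg"
  where "rowsym \<mu> = (\<Sum>p\<in>fixing (sum_list \<mu>) (rowi \<mu>). gel p)"

definition colsym :: "nat list \<Rightarrow> 'a::field galg"
  where "colsym \<mu> = (\<Sum>p\<in>fixing (sum_list \<mu>) (coli \<mu>). Poly_Mapping.single p (psign p))"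

definition esym :: "nat list \<Rightarrow> 'a::field galg"
  where "esym \<mu> = rowsym \<mu> * colsym \<mu>"

lemma gel_rowsym:
  assumes "p \<in> fixing (sum_list \<mu>) (rowi \<mu>)"
  shows "gel p * rowsym \<mu> = (rowsym \<mu> :: 'a::field galg)" "rowsym \<mu> * gel p = (rowsym \<mu> :: 'a::field galg)"
proof -
  let ?R = "fixing (sum_list \<mu>) (rowi \<mu>)"
  have "(\<Sum>q\<in>?R. gel (p + q) :: 'a galg) = (\<Sum>q\<in>?R. gel q)"
    by (rule sum.reindex_bij_betw[OF bij_betw_fixing_plus(1)[OF assms]])
  then show "gel p * rowsym \<mu> = (rowsym \<mu> :: 'a galg)"
    by (simp add: rowsym_def sum_distrib_left mult_single)
  have "(\<Sum>q\<in>?R. gel (q + p) :: 'a galg) = (\<Sum>q\<in>?R. gel q)"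
    by (rule sum.reindex_bij_betw[OF bij_betw_fixing_plus(2)[OF assms]])
  then show "rowsym \<mu> * gel p = (rowsym \<mu> :: 'a galg)"
    by (simp add: rowsym_def sum_distrib_right mult_single)
qed

lemma gel_colsym:
  assumes "p \<in> fixing (sum_list \<mu>) (coli \<mu>)"
  shows "gel p * colsym \<mu> = smul (psign p) (colsym \<mu> :: 'a::field galg)"
    "colsym \<mu> * gel p = smul (psign p) (colsym \<mu> :: 'a::field galg)"
proof -
  have 1: "smul (psign p) (Poly_Mapping.single (p + q) (psign (p + q))) = Poly_Mapping.single (p + q) (psign q)" 
    for q using psign_square[of p, where 'a = 'a] by (simp add: psign_plus mult.assoc[symmetric])
  have 2: "smul (psign p) (Poly_Mapping.single (q + p) (psign (q + p))) = Poly_Mapping.single (q + p) (psign q)" 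
    for q using psign_square[of p, where 'a = 'a] by (simp add: psign_plus mult.commute[of "psign q"] mult.assoc[symmetric])
  let ?C = "fixing (sum_list \<mu>) (coli \<mu>)" and ?h = "\<lambda>q. smul (psign p) (Poly_Mapping.single q (psign q)) :: 'a galg"
  have "gel p * colsym \<mu> = (\<Sum>q\<in>?C. ?h (p + q))"
    unfolding colsym_def sum_distrib_left mult_single mult_1 by (simp only: 1)
  also have "\<dots> = (\<Sum>q\<in>?C. ?h q)"
    by (rule sum.reindex_bij_betw[OF bij_betw_fixing_plus(1)[OF assms]])
  finally show "gel p * colsym \<mu> = smul (psign p) (colsym \<mu> :: 'a galg)"
    by (simp only: colsym_def smul.scale_sum_right)
  have "colsym \<mu> * gel p = (\<Sum>q\<in>?C. ?h (q + p))"
    unfolding colsym_def sum_distrib_right mult_single mult_1_right by (simp only: 2)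
  also have "\<dots> = (\<Sum>q\<in>?C. ?h q)"
    by (rule sum.reindex_bij_betw[OF bij_betw_fixing_plus(2)[OF assms]])
  finally show "colsym \<mu> * gel p = smul (psign p) (colsym \<mu> :: 'a galg)"
    by (simp only: colsym_def smul.scale_sum_right)
qed

lemma sym_galg_on: 
  "rowsym \<mu> \<in> galg_on (sum_list \<mu>)" "colsym \<mu> \<in> galg_on (sum_list \<mu>)" "esym \<mu> \<in> galg_on (sum_list \<mu>)"
proof -
  show "rowsym \<mu> \<in> galg_on (sum_list \<mu>)" "colsym \<mu> \<in> galg_on (sum_list \<mu>)"
    unfolding rowsym_def colsym_def using fixing_sub by (auto intro!: galg_on_sum galg_on_single)
  then show "esym \<mu> \<in> galg_on (sum_list \<mu>)" unfolding esym_def by (rule galg_on_times)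
qed

lemma fixing_row_col: "fixing (sum_list \<mu>) (rowi \<mu>) \<inter> fixing (sum_list \<mu>) (coli \<mu>) = {0}"
proof -
  have "p = 0" if p: "p \<in> fixing (sum_list \<mu>) (rowi \<mu>)" "p \<in> fixing (sum_list \<mu>) (coli \<mu>)" for p
  proof -
    have pS: "p \<in> Sym (sum_list \<mu>)" using p by (simp add: fixing_def)
    have "app p x = x" for x
    proof (cases "x \<in> {1..sum_list \<mu>}")
      case True
      have "app p x \<in> {1..sum_list \<mu>}" using Sym_app_in[OF pS, of x] True by blast
      moreover have "rowi \<mu> (app p x) = rowi \<mu> x" "coli \<mu> (app p x) = coli \<mu> x"
        using p True unfolding fixing_def by blast+
      ultimately show ?thesis using True by (blast intro: cell_unique)
    next
      case False
      then show ?thesis using pS by (simp add: Sym_def permutes_not_in)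
    qed
    then have "app p = app 0" by (simp add: zero_fperm.rep_eq fun_eq_iff)
    then show ?thesis by (simp only: app_inject)
  qed
  then show ?thesis by auto
qed

lemma lookup_esym_zero: "Poly_Mapping.lookup (esym \<mu> :: 'a::field galg) 0 = 1"
proof -
  let ?R = "fixing (sum_list \<mu>) (rowi \<mu>)" and ?C = "fixing (sum_list \<mu>) (coli \<mu>)"
  have "Poly_Mapping.lookup (gel p * colsym \<mu> :: 'a galg) 0 = (1 when p = 0)" if p: "p \<in> ?R" for p
  proof -
    have "Poly_Mapping.lookup (gel p * colsym \<mu> :: 'a galg) 0 = Poly_Mapping.lookup (colsym \<mu> :: 'a galg) (- p)"
      by (simp add: lookup_gel_times)
    also have "\<dots> = (\<Sum>q\<in>?C. if q = - p then psign q else 0)"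
      unfolding colsym_def lookup_sum lookup_single by (rule sum.cong) (auto simp: when_def)
    also have "\<dots> = (if - p \<in> ?C then psign (- p) else 0)"
      by simp
    also have "\<dots> = (if p = 0 then 1 else 0)"
    proof (cases "p = 0")
      case False
      then have "p \<notin> ?C" using p fixing_row_col[of \<mu>] by blast
      with False show ?thesis by (simp add: fixing_uminus_iff)
    qed simp
    finally show ?thesis by (simp add: when_def)
  qed
  then have "Poly_Mapping.lookup (esym \<mu> :: 'a galg) 0 = (\<Sum>p\<in>?R. if p = 0 then 1 else 0)"
    unfolding esym_def rowsym_def sum_distrib_right lookup_sum by (intro sum.cong) (auto simp: when_def)
  also have "\<dots> = 1" by simp
  finally show ?thesis .
qed


section \<open>Two tableaux\<close>

definition row_col_separated :: "nat list \<Rightarrow> nat list \<Rightarrow> (nat \<Rightarrow> nat) \<Rightarrow> bool"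
  where "row_col_separated \<nu> \<mu> h \<longleftrightarrow>
    inj_on (\<lambda>p. (rowi \<nu> p, coli \<mu> (h p))) {1..sum_list \<nu>}"

definition col_len :: "nat list \<Rightarrow> nat \<Rightarrow> nat"
  where "col_len \<mu> j = card {y \<in> {1..sum_list \<mu>}. coli \<mu> y = j}"

lemma downward_closed_eq:
  fixes S :: "nat set"
  assumes "finite S" "\<And>i j. j \<in> S \<Longrightarrow> i \<le> j \<Longrightarrow> i \<in> S"
  shows "S = {..<card S}"
proof (cases "S = {}")
  case False
  have "S = {..Max S}"
  proof (intro set_eqI iffI)
    fix x assume "x \<in> {..Max S}"
    then show "x \<in> S" using assms(2)[OF Max_in[OF assms(1) False]] by simp
  qed (use assms(1) in auto)
  then show ?thesis by (metis card_atMost lessThan_Suc_atMost)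
qed simp

lemma rowi_col:
  assumes "sorted_wrt (\<ge>) \<mu>"
  shows "bij_betw (rowi \<mu>) {y \<in> {1..sum_list \<mu>}. coli \<mu> y = j} {..<col_len \<mu> j}"
proof -
  let ?Y = "{y \<in> {1..sum_list \<mu>}. coli \<mu> y = j}"
  have inj: "inj_on (rowi \<mu>) ?Y"
    by (rule inj_onI) (auto intro: cell_unique)
  have img: "rowi \<mu> ` ?Y = {i. i < length \<mu> \<and> j < \<mu> ! i}"
  proof (intro set_eqI iffI)
    fix i assume "i \<in> rowi \<mu> ` ?Y"
    then show "i \<in> {i. i < length \<mu> \<and> j < \<mu> ! i}" using tableau_rowi_coli by fastforce
  next
    fix i assume "i \<in> {i. i < length \<mu> \<and> j < \<mu> ! i}"
    then have "tableau \<mu> i j \<in> ?Y" "rowi \<mu> (tableau \<mu> i j) = i" using tableau_in[of i \<mu> j] by auto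
    then show "i \<in> rowi \<mu> ` ?Y" by (metis imageI)
  qed
  have "rowi \<mu> ` ?Y = {..<card (rowi \<mu> ` ?Y)}"
  proof (rule downward_closed_eq)
    fix i i' assume i: "i' \<in> rowi \<mu> ` ?Y" "i \<le> i'"
    have "\<mu> ! i' \<le> \<mu> ! i" if "i < i'" using i that assms img by (auto simp: sorted_wrt_iff_nth_less)
    with i show "i \<in> rowi \<mu> ` ?Y" unfolding img by (cases "i = i'") auto
  qed simp
  moreover have "card (rowi \<mu> ` ?Y) = col_len \<mu> j" using inj by (simp add: card_image col_len_def)
  ultimately show ?thesis using inj by (auto simp: bij_betw_def)
qed

lemma card_first_rows:
  "card {p \<in> {1..sum_list \<mu>}. rowi \<mu> p < k} = sum_list (take k \<mu>)"
proof (induction \<mu> arbitrary: k)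
  case (Cons m \<mu>)
  show ?case
  proof (cases k)
    case (Suc k')
    have "{p \<in> {1..sum_list (m # \<mu>)}. rowi (m # \<mu>) p < k}
        = {1..m} \<union> (\<lambda>p. p + m) ` {p \<in> {1..sum_list \<mu>}. rowi \<mu> p < k'}" (is "?L = ?M \<union> ?N")
    proof (intro set_eqI iffI)
      fix x assume x: "x \<in> ?L"
      show "x \<in> ?M \<union> ?N"
      proof (cases "x \<le> m")
        case False
        then have "x - m \<in> {p \<in> {1..sum_list \<mu>}. rowi \<mu> p < k'}" "x = (x - m) + m"
          using x Suc by auto
        then show ?thesis by blast
      qed (use x in auto)
    qed (use Suc in auto)
    moreover have "card (?M \<union> ?N) = card ?M + card ?N"
      by (rule card_Un_disjoint) auto
    moreover have "card ?N = sum_list (take k' \<mu>)"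
      using Cons.IH[of k'] by (subst card_image) (auto simp: inj_on_def)
    ultimately show ?thesis using Suc by simp
  qed simp
qed simp

lemma coli_less: "y \<in> {1..sum_list \<mu>} \<Longrightarrow> coli \<mu> y < sum_list \<mu>"
proof -
  assume y: "y \<in> {1..sum_list \<mu>}"
  have "coli \<mu> y < \<mu> ! rowi \<mu> y" "rowi \<mu> y < length \<mu>" using tableau_rowi_coli[OF y] by auto
  then show ?thesis using elem_le_sum_list[of "rowi \<mu> y" \<mu>] by simp
qed

lemma card_by_fibres:
  assumes "finite A" "f ` A \<subseteq> {..<n::nat}"
  shows "card A = (\<Sum>j<n. card {p \<in> A. f p = j})"
proof -
  have "card A = card (\<Union>j\<in>{..<n}. {p \<in> A. f p = j})" using assms(2) by (intro arg_cong[of _ _ card]) auto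
  also have "\<dots> = (\<Sum>j<n. card {p \<in> A. f p = j})"
    by (rule card_UN_disjoint) (use assms(1) in auto)
  finally show ?thesis .
qed

lemma sum_min_col_len:
  assumes "sorted_wrt (\<ge>) \<mu>"
  shows "sum_list (take k \<mu>) = (\<Sum>j<sum_list \<mu>. min k (col_len \<mu> j))"
proof -
  let ?A = "{p \<in> {1..sum_list \<mu>}. rowi \<mu> p < k}"
  have "card {p \<in> ?A. coli \<mu> p = j} = min k (col_len \<mu> j)" for j
  proof -
    let ?Y = "{y \<in> {1..sum_list \<mu>}. coli \<mu> y = j}"
    have "rowi \<mu> ` {p \<in> ?A. coli \<mu> p = j} = {..<k} \<inter> rowi \<mu> ` ?Y" by auto
    also have "\<dots> = {..<min k (col_len \<mu> j)}"
      using bij_betw_imp_surj_on[OF rowi_col[OF assms]] by auto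
    finally have "card (rowi \<mu> ` {p \<in> ?A. coli \<mu> p = j}) = min k (col_len \<mu> j)" by simp
    moreover have "inj_on (rowi \<mu>) {p \<in> ?A. coli \<mu> p = j}"
      using bij_betw_imp_inj_on[OF rowi_col[OF assms, of j]] by (rule inj_on_subset) auto
    ultimately show ?thesis by (simp add: card_image)
  qed
  moreover have "card ?A = (\<Sum>j<sum_list \<mu>. card {p \<in> ?A. coli \<mu> p = j})"
    by (rule card_by_fibres) (use coli_less in auto)
  ultimately show ?thesis using card_first_rows[of \<mu> k] by simp
qed

context
  fixes \<nu> \<mu> :: "nat list" and h :: "nat \<Rightarrow> nat"
  assumes sorted: "sorted_wrt (\<ge>) \<mu>" and same: "sum_list \<nu> = sum_list \<mu>"
    and h: "h permutes {1..sum_list \<mu>}" and sep: "row_col_separated \<nu> \<mu> h"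
begin

lemma separated_fibre_le:
  "card {p \<in> {1..sum_list \<mu>}. rowi \<nu> p < k \<and> coli \<mu> (h p) = j} \<le> min k (col_len \<mu> j)"
proof -
  let ?B = "{p \<in> {1..sum_list \<mu>}. rowi \<nu> p < k \<and> coli \<mu> (h p) = j}"
  have "card ?B \<le> card {..<k}"
  proof (rule card_inj_on_le)
    show "inj_on (rowi \<nu>) ?B"
      using sep same unfolding row_col_separated_def inj_on_def by simp
  qed auto
  moreover have "card ?B \<le> card {y \<in> {1..sum_list \<mu>}. coli \<mu> y = j}"
  proof (rule card_inj_on_le)
    show "inj_on h ?B" using permutes_inj[OF h] by (auto intro: inj_on_subset)
    show "h ` ?B \<subseteq> {y \<in> {1..sum_list \<mu>}. coli \<mu> y = j}" using permutes_in_image[OF h] by auto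
  qed auto
  ultimately show ?thesis by (simp add: col_len_def)
qed

lemma first_rows_by_column:
  "sum_list (take k \<nu>) =
    (\<Sum>j<sum_list \<mu>. card {p \<in> {1..sum_list \<mu>}. rowi \<nu> p < k \<and> coli \<mu> (h p) = j})"
proof -
  let ?A = "{p \<in> {1..sum_list \<mu>}. rowi \<nu> p < k}"
  have "card ?A = (\<Sum>j<sum_list \<mu>. card {p \<in> ?A. coli \<mu> (h p) = j})"
    by (rule card_by_fibres) (use coli_less permutes_in_image[OF h] in auto)
  then show ?thesis using card_first_rows[of \<nu> k] same by (simp add: conj_assoc)
qed

lemma separated_dominates: "sum_list (take k \<nu>) \<le> sum_list (take k \<mu>)"
  unfolding first_rows_by_column sum_min_col_len[OF sorted]
  by (rule sum_mono) (rule separated_fibre_le)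

lemma separated_decompose:
  assumes "\<nu> = \<mu>"
  shows "\<exists>\<theta>. \<theta> permutes {1..sum_list \<mu>} \<and> (\<forall>p\<in>{1..sum_list \<mu>}. rowi \<mu> (\<theta> p) = rowi \<mu> p \<and>
    coli \<mu> (\<theta> p) = coli \<mu> (h p))"
proof -
  let ?n = "sum_list \<mu>"
  have eq: "card {p \<in> {1..?n}. rowi \<mu> p < k \<and> coli \<mu> (h p) = j} = min k (col_len \<mu> j)"
    if j: "j < ?n" for k j
  proof -
    have sums: "(\<Sum>j<?n. card {p \<in> {1..?n}. rowi \<mu> p < k \<and> coli \<mu> (h p) = j}) = (\<Sum>j<?n. min k (col_len \<mu> j))"
      using first_rows_by_column[of k] sum_min_col_len[OF sorted, of k] assms by simp
    have "card {p \<in> {1..?n}. rowi \<mu> p < k \<and> coli \<mu> (h p) = j} \<le> min k (col_len \<mu> j)" for j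
      using separated_fibre_le[of k j] assms by blast
    then show ?thesis by (rule sum_mono_inv[OF sums]) (use j in auto)
  qed
  have cell: "rowi \<mu> p < length \<mu> \<and> coli \<mu> (h p) < \<mu> ! rowi \<mu> p" if p: "p \<in> {1..?n}" for p
  proof -
    let ?i = "rowi \<mu> p" and ?j = "coli \<mu> (h p)"
    have j: "?j < ?n" using coli_less permutes_in_image[OF h] p by blast
    have "?i < col_len \<mu> ?j"
    proof (rule ccontr)
      assume "\<not> ?i < col_len \<mu> ?j"
      then have "card {q \<in> {1..?n}. rowi \<mu> q < ?i \<and> coli \<mu> (h q) = ?j}
          = card {q \<in> {1..?n}. rowi \<mu> q < Suc ?i \<and> coli \<mu> (h q) = ?j}"
        using eq[OF j] by simp
      then have "{q \<in> {1..?n}. rowi \<mu> q < ?i \<and> coli \<mu> (h q) = ?j}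
          = {q \<in> {1..?n}. rowi \<mu> q < Suc ?i \<and> coli \<mu> (h q) = ?j}"
        by (intro card_subset_eq) auto
      with p show False by blast
    qed
    then have "?i \<in> rowi \<mu> ` {y \<in> {1..?n}. coli \<mu> y = ?j}"
      unfolding bij_betw_imp_surj_on[OF rowi_col[OF sorted, of ?j]] lessThan_iff .
    then obtain y where y0: "?i = rowi \<mu> y" "y \<in> {y \<in> {1..?n}. coli \<mu> y = ?j}" by (rule imageE)
    note y = CollectD[OF y0(2), THEN conjunct1] CollectD[OF y0(2), THEN conjunct2] y0(1)[symmetric]
    have "rowi \<mu> y < length \<mu>" "coli \<mu> y < \<mu> ! rowi \<mu> y"
      using tableau_rowi_coli[OF y(1)] by blast+
    then show ?thesis by (simp only: y)
  qed
  define \<theta> where "\<theta> p = (if p \<in> {1..?n} then tableau \<mu> (rowi \<mu> p) (coli \<mu> (h p)) else p)" for p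
  have \<theta>: "\<theta> p \<in> {1..?n}" "rowi \<mu> (\<theta> p) = rowi \<mu> p" "coli \<mu> (\<theta> p) = coli \<mu> (h p)"
    if "p \<in> {1..?n}" for p
    using cell[OF that] tableau_in[of "rowi \<mu> p" \<mu> "coli \<mu> (h p)"] that by (auto simp: \<theta>_def)
  have inj: "inj_on \<theta> {1..?n}"
  proof (rule inj_onI)
    fix p q assume pq: "p \<in> {1..?n}" "q \<in> {1..?n}" "\<theta> p = \<theta> q"
    then have "(rowi \<mu> p, coli \<mu> (h p)) = (rowi \<mu> q, coli \<mu> (h q))" using \<theta> by metis
    then show "p = q" using sep pq assms unfolding row_col_separated_def by (auto dest: inj_onD)
  qed
  have "\<theta> ` {1..?n} = {1..?n}"
    by (rule card_subset_eq) (use \<theta>(1) inj in \<open>auto simp: card_image\<close>)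
  then have "bij_betw \<theta> {1..?n} {1..?n}" using inj by (simp add: bij_betw_def)
  then have "\<theta> permutes {1..?n}" by (rule bij_imp_permutes) (auto simp: \<theta>_def)
  then show ?thesis using \<theta> by blast
qed

end

lemma partial_sums_eq:
  assumes "\<And>k. sum_list (take k \<nu>) = sum_list (take k (\<mu> :: nat list))"
    "\<forall>k\<in>set \<nu>. 1 \<le> k" "\<forall>k\<in>set \<mu>. 1 \<le> k"
  shows "\<nu> = \<mu>"
  using assms
proof (induction \<nu> arbitrary: \<mu>)
  case Nil
  then show ?case using Nil(1)[of 1] by (cases \<mu>) auto
next
  case (Cons l \<nu>)
  show ?case
  proof (cases \<mu>)
    case Nil
    then show ?thesis using Cons.prems(1)[of 1] Cons.prems(2) by auto
  next
    case (Cons m \<mu>')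
    have "l = m" using Cons.prems(1)[of 1] Cons by simp
    moreover have "sum_list (take k \<nu>) = sum_list (take k \<mu>')" for k
      using Cons.prems(1)[of "Suc k"] Cons \<open>l = m\<close> by simp
    then have "\<nu> = \<mu>'"
      using Cons.prems(2,3) Cons by (intro Cons.IH) auto
    ultimately show ?thesis using Cons by simp
  qed
qed

definition transp :: "nat \<Rightarrow> nat \<Rightarrow> fperm"
  where "transp p q = Fperm (Transposition.transpose p q)"

lemma app_transp: "app (transp p q) = Transposition.transpose p q"
  unfolding transp_def by (rule Fperm_inverse) (simp add: permutation_swap_id)

lemma transp_fixing:
  assumes "p \<in> {1..n}" "q \<in> {1..n}" "f p = f q"
  shows "transp p q \<in> fixing n f"
  using assms by (auto simp: fixing_def Sym_def app_transp permutes_swap_id Transposition.transpose_def)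

lemma psign_transp: "p \<noteq> q \<Longrightarrow> psign (transp p q) = - 1"
  by (simp add: psign_def app_transp sign_swap_id)

lemma transp_conj: "transp (app x p) (app x q) = x + transp p q - x"
proof -
  have "app (transp (app x p) (app x q)) = app (x + transp p q - x)"
  proof
    fix y
    define z where "z = app (- x) y"
    have y: "y = app x z" by (simp add: z_def)
    show "app (transp (app x p) (app x q)) y = app (x + transp p q - x) y"
      unfolding diff_conv_add_uminus app_plus app_transp y app_uminus
      by (simp add: Transposition.transpose_def inj_eq[OF bij_is_inj[OF bij_app]])
  qed
  then show ?thesis by (simp only: app_inject)
qed

lemma eq_uminus_imp_zero: "x = - x \<Longrightarrow> x = (0 :: 'k \<Rightarrow>\<^sub>0 'a::field_char_0)"
proof (rule poly_mapping_eqI)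
  fix k
  assume "x = - x"
  then have "Poly_Mapping.lookup x k = - Poly_Mapping.lookup x k" by (metis lookup_uminus)
  then have "2 * Poly_Mapping.lookup x k = 0" by (simp only: mult_2 add_eq_0_iff2)
  then show "Poly_Mapping.lookup x k = Poly_Mapping.lookup 0 k" by simp
qed

lemma not_separated:
  assumes "\<not> row_col_separated \<nu> \<mu> (app (- x))" and x: "x \<in> Sym (sum_list \<mu>)"
    and same: "sum_list \<nu> = sum_list \<mu>"
  shows "rowsym \<nu> * gel x * colsym \<mu> = (0 :: 'a::field_char_0 galg)"
    and "colsym \<mu> * gel (- x) * rowsym \<nu> = (0 :: 'a::field_char_0 galg)"
proof -
  let ?n = "sum_list \<mu>"
  obtain p q where pq: "p \<in> {1..?n}" "q \<in> {1..?n}" "p \<noteq> q" "rowi \<nu> p = rowi \<nu> q"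
      "coli \<mu> (app (- x) p) = coli \<mu> (app (- x) q)"
    using assms(1) same unfolding row_col_separated_def inj_on_def by auto
  let ?t = "transp p q" and ?s = "transp (app (- x) p) (app (- x) q)"
  have t: "?t \<in> fixing (sum_list \<nu>) (rowi \<nu>)" using pq same by (intro transp_fixing) auto
  have "app (- x) p \<in> {1..?n}" "app (- x) q \<in> {1..?n}"
    using pq Sym_app_in[OF Sym_uminus[OF x]] by blast+
  then have s: "?s \<in> fixing ?n (coli \<mu>)" using pq by (intro transp_fixing)
  have s_eq: "?s = - x + ?t + x" using transp_conj[of "- x" p q] by (simp add: diff_conv_add_uminus del: add_uminus_conv_diff)
  have xs: "x + ?s = ?t + x" "?s + - x = - x + ?t" unfolding s_eq by (simp_all add: add.assoc[symmetric])
  have "app (- x) p \<noteq> app (- x) q" using pq(3) by (metis app_uminus(2))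
  then have sg: "psign ?s = (- 1 :: 'a)" by (rule psign_transp)
  have sm: "smul (- 1) y = - y" for y :: "'a galg" by (rule poly_mapping_eqI) simp
  have "rowsym \<nu> * gel x * colsym \<mu> = rowsym \<nu> * gel ?t * gel x * (colsym \<mu> :: 'a galg)" by (simp add: gel_rowsym(2)[OF t])
  also have "\<dots> = rowsym \<nu> * gel x * (gel ?s * colsym \<mu>)" by (simp add: mult.assoc mult_single[of ?t] mult_single xs flip: mult.assoc[of "gel x"])
  also have "\<dots> = - (rowsym \<nu> * gel x * colsym \<mu>)" by (simp add: gel_colsym[OF s] sg sm)
  finally show "rowsym \<nu> * gel x * colsym \<mu> = (0 :: 'a galg)" by (rule eq_uminus_imp_zero)
  have "colsym \<mu> * gel (- x) * rowsym \<nu> = colsym \<mu> * gel (- x) * (gel ?t * rowsym \<nu> :: 'a galg)" by (simp add: gel_rowsym(1)[OF t])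
  also have "\<dots> = (colsym \<mu> * gel ?s) * gel (- x) * rowsym \<nu>" by (simp add: mult.assoc mult_single xs(1) xs(2)[simplified] flip: mult.assoc[of "gel _"])
  also have "\<dots> = - (colsym \<mu> * gel (- x) * rowsym \<nu>)" by (simp add: gel_colsym[OF s] sg sm)
  finally show "colsym \<mu> * gel (- x) * rowsym \<nu> = (0 :: 'a galg)" by (rule eq_uminus_imp_zero)
qed

lemma separated_esym:
  assumes "row_col_separated \<mu> \<mu> (app (- x))" "x \<in> Sym (sum_list \<mu>)" "sorted_wrt (\<ge>) \<mu>"
  shows "\<exists>c. rowsym \<mu> * gel x * colsym \<mu> = smul c (esym \<mu> :: 'a::field galg)"
proof -
  let ?n = "sum_list \<mu>"
  have "app (- x) permutes {1..?n}" using assms(2) Sym_uminus[of x ?n] by (simp add: Sym_def)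
  from separated_decompose[OF assms(3) refl this assms(1) refl] obtain \<theta> where
    \<theta>: "\<theta> permutes {1..?n}" and rc: "\<forall>p\<in>{1..?n}. rowi \<mu> (\<theta> p) = rowi \<mu> p \<and> coli \<mu> (\<theta> p) = coli \<mu> (app (- x) p)"
    by blast
  let ?p = "Fperm \<theta>"
  have app: "app ?p = \<theta>" using \<theta> by (rule app_Fperm)
  have p: "?p \<in> fixing ?n (rowi \<mu>)" using \<theta> rc by (simp add: fixing_def Sym_def app)
  have "coli \<mu> (\<theta> (app x y)) = coli \<mu> y" if "y \<in> {1..?n}" for y
  proof -
    have "app x y \<in> {1..?n}" using that Sym_app_in[OF assms(2), of y] by blast
    then show ?thesis using rc by simp
  qed
  then have q: "?p + x \<in> fixing ?n (coli \<mu>)"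
    using \<theta> assms(2) by (auto simp: fixing_def app_plus app Sym_def intro!: Sym_plus[unfolded Sym_def, simplified])
  have "rowsym \<mu> * gel x * colsym \<mu> = rowsym \<mu> * gel (- ?p) * gel (?p + x) * colsym \<mu>"
    by (simp add: mult.assoc mult_single add.assoc[symmetric] flip: mult.assoc[of "gel _"])
  also have "\<dots> = rowsym \<mu> * smul (psign (?p + x)) (colsym \<mu>)"
    by (simp only: gel_rowsym(2)[OF fixing_uminus[OF p]] mult.assoc gel_colsym(1)[OF q])
  finally show ?thesis by (auto simp: smul_mult_right esym_def)
qed


lemma galg_sandwich_expand:
  fixes y :: "'a::field galg"
  assumes "y \<in> galg_on n"
  shows "a * y * b = (\<Sum>p\<in>Sym n. smul (Poly_Mapping.lookup y p) (a * gel p * b))"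
proof -
  have "y = (\<Sum>p\<in>Sym n. smul (Poly_Mapping.lookup y p) (gel p))"
    using assms by (intro galg_expand) (auto simp: galg_on_def)
  then have "a * y * b = a * (\<Sum>p\<in>Sym n. smul (Poly_Mapping.lookup y p) (gel p)) * b"
    by (rule arg_cong)
  then show ?thesis
    by (simp only: sum_distrib_left sum_distrib_right smul_mult_left smul_mult_right)
qed

lemma galg_on_linear_induct:
  assumes "y \<in> galg_on n" and "\<And>p. p \<in> Sym n \<Longrightarrow> rowsym \<nu> * gel p * colsym \<mu> = smul (c p) z"
  shows "rowsym \<nu> * y * colsym \<mu> = smul (\<Sum>p\<in>Sym n. Poly_Mapping.lookup y p * c p) (z :: 'a::field galg)"
proof -
  have "rowsym \<nu> * y * colsym \<mu>
      = (\<Sum>p\<in>Sym n. smul (Poly_Mapping.lookup y p) (rowsym \<nu> * gel p * colsym \<mu>))"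
    by (rule galg_sandwich_expand[OF assms(1)])
  also have "\<dots> = (\<Sum>p\<in>Sym n. smul (Poly_Mapping.lookup y p * c p) z)"
    by (intro sum.cong) (simp_all add: assms(2))
  finally show ?thesis by (simp add: smul.scale_sum_left)
qed

lemma rowsym_colsym_sandwich:
  assumes "\<mu> \<in> partitions n" "y \<in> galg_on n"
  shows "\<exists>c. rowsym \<mu> * y * colsym \<mu> = smul c (esym \<mu> :: 'a::field_char_0 galg)"
proof -
  have n: "sum_list \<mu> = n" and sorted: "sorted_wrt (\<ge>) \<mu>" using assms(1) by (auto simp: partitions_def)
  have "\<exists>c. rowsym \<mu> * gel x * colsym \<mu> = smul c (esym \<mu> :: 'a galg)" if "x \<in> Sym n" for x
  proof (cases "row_col_separated \<mu> \<mu> (app (- x))")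
    case True
    then show ?thesis using separated_esym[OF True _ sorted] that n by simp
  next
    case False
    then show ?thesis using not_separated(1)[OF False] that n by (auto intro: exI[of _ 0])
  qed
  then obtain c where "\<And>x. x \<in> Sym n \<Longrightarrow> rowsym \<mu> * gel x * colsym \<mu> = smul (c x) (esym \<mu> :: 'a galg)"
    by metis
  from galg_on_linear_induct[OF assms(2) this] show ?thesis by blast
qed

lemma esym_sandwich:
  assumes "\<mu> \<in> partitions n" "y \<in> galg_on n"
  shows "esym \<mu> * y * esym \<mu>
    = smul (Poly_Mapping.lookup (esym \<mu> * y * esym \<mu>) 0) (esym \<mu> :: 'a::field_char_0 galg)"
proof -
  have n: "sum_list \<mu> = n" using assms(1) by (auto simp: partitions_def)
  have "colsym \<mu> * y * rowsym \<mu> \<in> galg_on n" using assms sym_galg_on[of \<mu>] n by (metis galg_on_times)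
  from rowsym_colsym_sandwich[OF assms(1) this] obtain c where
    c: "rowsym \<mu> * (colsym \<mu> * y * rowsym \<mu>) * colsym \<mu> = smul c (esym \<mu> :: 'a galg)" by blast
  then have "esym \<mu> * y * esym \<mu> = smul c (esym \<mu>)" by (simp add: esym_def mult.assoc)
  then show ?thesis by (simp add: lookup_esym_zero)
qed

lemma esym_orthogonal:
  assumes "\<nu> \<in> partitions n" "\<mu> \<in> partitions n" "\<nu> \<noteq> \<mu>" "y \<in> galg_on n"
  shows "esym \<nu> * y * esym \<mu> = (0 :: 'a::field_char_0 galg)"
proof -
  have n: "sum_list \<mu> = n" "sum_list \<nu> = n" and sorted: "sorted_wrt (\<ge>) \<mu>" "sorted_wrt (\<ge>) \<nu>"
    and pos: "\<forall>k\<in>set \<mu>. 1 \<le> k" "\<forall>k\<in>set \<nu>. 1 \<le> k"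
    using assms by (auto simp: partitions_def)
  note on = sym_galg_on[of \<mu>, unfolded n] sym_galg_on[of \<nu>, unfolded n]
  consider "\<And>x. x \<in> Sym n \<Longrightarrow> \<not> row_col_separated \<nu> \<mu> (app (- x))"
    | "\<And>x. x \<in> Sym n \<Longrightarrow> \<not> row_col_separated \<mu> \<nu> (app (- x))"
  proof -
    have False if "x \<in> Sym n" "row_col_separated \<nu> \<mu> (app (- x))"
      "x' \<in> Sym n" "row_col_separated \<mu> \<nu> (app (- x'))" for x x'
    proof -
      have "app (- x) permutes {1..n}" "app (- x') permutes {1..n}"
        using that Sym_uminus by (auto simp: Sym_def)
      then have "sum_list (take k \<nu>) = sum_list (take k \<mu>)" for k
        using separated_dominates[of \<mu> \<nu> "app (- x)" k] separated_dominates[of \<nu> \<mu> "app (- x')" k]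
          n sorted that by (simp add: order.antisym)
      then have "\<nu> = \<mu>" using pos by (intro partial_sums_eq) auto
      with assms(3) show False ..
    qed
    then show thesis using that by blast
  qed
  then show ?thesis
  proof cases
    case 1
    then have "rowsym \<nu> * gel p * colsym \<mu> = smul 0 (0 :: 'a galg)" if "p \<in> Sym n" for p
      using not_separated(1)[of \<nu> \<mu> p] that n by simp
    from galg_on_linear_induct[OF _ this] have "rowsym \<nu> * z * colsym \<mu> = (0 :: 'a galg)"
      if "z \<in> galg_on n" for z using that by simp
    moreover have "colsym \<nu> * y * rowsym \<mu> \<in> galg_on n" using on assms(4) by (metis galg_on_times)
    ultimately have "rowsym \<nu> * (colsym \<nu> * y * rowsym \<mu>) * colsym \<mu> = 0" by blast
    then show ?thesis by (simp add: esym_def mult.assoc)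
  next
    case 2
    have zero: "colsym \<nu> * gel p * rowsym \<mu> = (0 :: 'a galg)" if "p \<in> Sym n" for p
      using not_separated(2)[of \<mu> \<nu> "- p"] 2[of "- p"] that n by simp
    have "colsym \<nu> * y * rowsym \<mu>
        = (\<Sum>p\<in>Sym n. smul (Poly_Mapping.lookup y p) (colsym \<nu> * gel p * rowsym \<mu>))"
      by (rule galg_sandwich_expand[OF assms(4)])
    also have "\<dots> = 0" using zero by (intro sum.neutral) simp
    finally have "rowsym \<nu> * (colsym \<nu> * y * rowsym \<mu>) * colsym \<mu> = 0" by simp
    then show ?thesis by (simp add: esym_def mult.assoc)
  qed
qed

definition hook_const :: "nat list \<Rightarrow> 'a::field"
  where "hook_const \<mu> = Poly_Mapping.lookup (esym \<mu> * esym \<mu> :: 'a galg) 0"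

lemma esym_square:
  assumes "\<mu> \<in> partitions n"
  shows "esym \<mu> * esym \<mu> = smul (hook_const \<mu>) (esym \<mu> :: 'a::field_char_0 galg)"
  using esym_sandwich[OF assms galg_on_gel[OF Sym_zero]] by (simp add: hook_const_def)

definition integral :: "'a::field galg \<Rightarrow> bool"
  where "integral x \<longleftrightarrow> (\<forall>p. Poly_Mapping.lookup x p \<in> \<int>)"

lemma integral_times: "integral x \<Longrightarrow> integral y \<Longrightarrow> integral (x * y)"
  unfolding integral_def
  by (auto simp: lookup_times_galg[OF finite_keys subset_refl] intro!: Ints_sum Ints_mult)

lemma integral_sym: "integral (rowsym \<mu>)" "integral (colsym \<mu>)"
  by (auto simp: integral_def rowsym_def colsym_def lookup_sum lookup_single when_def psign_def intro!: Ints_sum)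

lemma integral_square_nonzero:
  fixes x :: "'a::field_char_0 galg"
  assumes "integral x" "star x = x" "x \<noteq> 0"
  shows "x * x \<noteq> 0"
proof
  assume "x * x = 0"
  let ?K = "Poly_Mapping.keys x"
  have "\<forall>p. \<exists>z. Poly_Mapping.lookup x p = of_int z" using assms(1) by (auto simp: integral_def Ints_def)
  then obtain z where z: "\<And>p. Poly_Mapping.lookup x p = of_int (z p)" by metis
  have "0 = Poly_Mapping.lookup (x * x) 0" using \<open>x * x = 0\<close> by simp
  also have "\<dots> = (\<Sum>p\<in>?K. Poly_Mapping.lookup x p * Poly_Mapping.lookup x (- p))"
    by (subst lookup_times_galg[OF finite_keys subset_refl]) simp
  also have "\<dots> = (\<Sum>p\<in>?K. of_int (z p) * of_int (z p))"
    using lookup_star[of x] assms(2) z by simp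
  also have "\<dots> = of_int (\<Sum>p\<in>?K. z p * z p)" by simp
  finally have "(\<Sum>p\<in>?K. z p * z p) = 0" by (metis of_int_eq_0_iff)
  then have "\<forall>p\<in>?K. z p = 0" by (subst (asm) sum_nonneg_eq_0_iff) auto
  then have "Poly_Mapping.lookup x p = 0" for p using z by (cases "p \<in> ?K") (auto simp: in_keys_iff)
  then have "x = 0" by (intro poly_mapping_eqI) simp
  with assms(3) show False ..
qed

lemma star_sym: "star (rowsym \<mu>) = rowsym \<mu>" "star (colsym \<mu>) = colsym \<mu>"
proof -
  have bij: "bij_betw uminus (fixing n f) (fixing n f)" for n f
    by (rule bij_betwI[where g = uminus]) (auto simp: fixing_uminus)
  show "star (rowsym \<mu>) = rowsym \<mu>"
    unfolding rowsym_def star_sum star_single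
    by (rule sum.reindex_bij_betw[OF bij, of gel])
  have "star (colsym \<mu>) = (\<Sum>p\<in>fixing (sum_list \<mu>) (coli \<mu>). Poly_Mapping.single (- p) (psign (- p)))"
    unfolding colsym_def star_sum star_single by simp
  also have "\<dots> = colsym \<mu>"
    unfolding colsym_def by (rule sum.reindex_bij_betw[OF bij, of "\<lambda>p. Poly_Mapping.single p (psign p)"])
  finally show "star (colsym \<mu>) = colsym \<mu>" .
qed

lemma rowsym_square: "rowsym \<mu> * rowsym \<mu> = smul (of_nat (card (fixing (sum_list \<mu>) (rowi \<mu>)))) (rowsym \<mu> :: 'a::field galg)"
proof -
  let ?R = "fixing (sum_list \<mu>) (rowi \<mu>)"
  have "rowsym \<mu> * rowsym \<mu> = (\<Sum>p\<in>?R. gel p * rowsym \<mu> :: 'a galg)"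
    by (subst (1) rowsym_def) (simp add: sum_distrib_right)
  also have "\<dots> = (\<Sum>p\<in>?R. rowsym \<mu>)" by (intro sum.cong refl) (simp add: gel_rowsym)
  finally have *: "rowsym \<mu> * rowsym \<mu> = (\<Sum>p\<in>?R. rowsym \<mu> :: 'a galg)" .
  show ?thesis unfolding * by (rule smul.sum_constant_scale)
qed

lemma hook_const_nonzero:
  assumes "\<mu> \<in> partitions n"
  shows "hook_const \<mu> \<noteq> (0 :: 'a::field_char_0)"
proof
  assume "hook_const \<mu> = (0 :: 'a)"
  then have sq: "esym \<mu> * esym \<mu> = (0 :: 'a galg)" using esym_square[OF assms, where 'a = 'a] by simp
  let ?R = "fixing (sum_list \<mu>) (rowi \<mu>)"
  let ?x = "rowsym \<mu> * colsym \<mu> * rowsym \<mu> :: 'a galg"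
  have "?x * ?x = rowsym \<mu> * colsym \<mu> * (rowsym \<mu> * rowsym \<mu>) * colsym \<mu> * rowsym \<mu>"
    by (simp add: mult.assoc)
  also have "\<dots> = smul (of_nat (card ?R)) (esym \<mu> * esym \<mu> * rowsym \<mu>)"
    by (simp add: rowsym_square smul_mult_left smul_mult_right esym_def mult.assoc)
  also have "\<dots> = 0" by (simp add: sq)
  finally have "?x * ?x = 0" .
  moreover have "integral ?x" by (intro integral_times integral_sym)
  moreover have "star ?x = ?x" by (simp add: star_times star_sym mult.assoc)
  ultimately have "?x = 0" using integral_square_nonzero by blast
  have "Poly_Mapping.lookup (esym \<mu> * gel p :: 'a galg) 0 = 1" if p: "p \<in> ?R" for p
  proof -
    have "Poly_Mapping.lookup (esym \<mu> * gel p :: 'a galg) 0 = Poly_Mapping.lookup (gel p * esym \<mu> :: 'a galg) 0"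
      by (simp add: lookup_times_gel lookup_gel_times)
    also have "gel p * esym \<mu> = (esym \<mu> :: 'a galg)"
      by (simp add: esym_def gel_rowsym[OF p] flip: mult.assoc)
    finally show ?thesis by (simp add: lookup_esym_zero)
  qed
  then have "(\<Sum>p\<in>?R. Poly_Mapping.lookup (esym \<mu> * gel p :: 'a galg) 0) = of_nat (card ?R)" by simp
  moreover have "?x = (\<Sum>p\<in>?R. esym \<mu> * gel p)"
    by (subst (2) rowsym_def) (simp add: sum_distrib_left esym_def)
  ultimately have "Poly_Mapping.lookup ?x 0 = of_nat (card ?R)" by (simp add: lookup_sum)
  moreover have "card ?R \<noteq> 0" using fixing_zero[of "sum_list \<mu>" "rowi \<mu>"] by (metis card_0_eq empty_iff finite_fixing)
  ultimately show False using \<open>?x = 0\<close> by simp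
qed

section \<open>Characters of Specht modules\<close>

definition galg_fun :: "'a::field galg \<Rightarrow> ((nat \<Rightarrow> nat) \<Rightarrow>\<^sub>0 'a)"
  where "galg_fun = lext smul (\<lambda>p. Poly_Mapping.single (app p) 1)"

lemma lookup_galg_fun [simp]: "Poly_Mapping.lookup (galg_fun x) (app p) = Poly_Mapping.lookup x p"
proof (induction x rule: free_induct)
  case (add f k c)
  then show ?case
    by (simp add: galg_fun_def smul.lext_add lookup_add lookup_single when_def app_inject)
qed (simp add: galg_fun_def)

lemma perm_lmult_lext: "perm_lmult \<sigma> f = lext smul (\<lambda>\<tau>. Poly_Mapping.single (\<sigma> \<circ> \<tau>) 1) (f :: (nat \<Rightarrow> nat) \<Rightarrow>\<^sub>0 'a::field)"
  by (simp add: perm_lmult_def lext_def)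

lemma perm_lmult_smul: "perm_lmult \<sigma> (smul c f) = smul c (perm_lmult \<sigma> (f :: (nat \<Rightarrow> nat) \<Rightarrow>\<^sub>0 'a::field))"
  unfolding perm_lmult_lext by (rule smul.lext_smul)

lemma perm_lmult_galg_fun: "perm_lmult (app s) (galg_fun x) = galg_fun (gel s * x)"
proof (induction x rule: free_induct)
  case (add f k c)
  then show ?case
    by (simp add: perm_lmult_lext galg_fun_def smul.lext_add distrib_left mult_single plus_fperm.rep_eq)
qed (simp add: perm_lmult_lext galg_fun_def)

lemma bij_betw_app_row: "bij_betw app (fixing (sum_list \<mu>) (rowi \<mu>)) (row_group \<mu>)"
  and bij_betw_app_col: "bij_betw app (fixing (sum_list \<mu>) (coli \<mu>)) (col_group \<mu>)"
  unfolding row_group_eq col_group_eq by (rule bij_betw_app_fixing)+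

lemma young_symmetrizer_eq: "young_symmetrizer \<mu> = galg_fun (esym \<mu> :: 'a::field galg)"
proof -
  let ?R = "fixing (sum_list \<mu>) (rowi \<mu>)" and ?C = "fixing (sum_list \<mu>) (coli \<mu>)"
  have "young_symmetrizer \<mu> = (\<Sum>p\<in>?R. \<Sum>q\<in>?C. Poly_Mapping.single (app p \<circ> app q) (psign q :: 'a))"
    unfolding young_symmetrizer_def sum.reindex_bij_betw[OF bij_betw_app_row, symmetric]
      sum.reindex_bij_betw[OF bij_betw_app_col, symmetric] psign_def ..
  also have "\<dots> = galg_fun (\<Sum>p\<in>?R. \<Sum>q\<in>?C. Poly_Mapping.single (p + q) (psign q))"
    by (simp add: galg_fun_def smul.lext_sum plus_fperm.rep_eq)
  also have "(\<Sum>p\<in>?R. \<Sum>q\<in>?C. Poly_Mapping.single (p + q) (psign q)) = (esym \<mu> :: 'a galg)"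
    by (simp add: esym_def rowsym_def colsym_def sum_product mult_single)
  finally show ?thesis .
qed

lemma galg_fun_sum: "galg_fun (\<Sum>i\<in>A. smul (c i) (x i)) = (\<Sum>i\<in>A. smul (c i) (galg_fun (x i)))"
  unfolding galg_fun_def by (rule smul.lext_linear_combination)

lemma irr_char_formula:
  assumes \<mu>: "\<mu> \<in> partitions n" and t: "t \<in> Sym n"
  shows "irr_char \<mu> (app t) = inverse (hook_const \<mu>) *
    (\<Sum>s\<in>Sym n. Poly_Mapping.lookup (gel (t + s) * esym \<mu>) s :: 'a::field_char_0)"
proof -
  let ?h = "hook_const \<mu> :: 'a" and ?e = "esym \<mu> :: 'a galg"
  have n: "sum_list \<mu> = n" using \<mu> by (auto simp: partitions_def)
  let ?G = "{perm_lmult \<sigma> (young_symmetrizer \<mu> :: _ \<Rightarrow>\<^sub>0 'a) | \<sigma>. \<sigma> permutes {1..n}}"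
  have G: "?G = (\<lambda>s. galg_fun (gel s * ?e)) ` Sym n"
  proof -
    have "?G = (\<lambda>\<sigma>. perm_lmult \<sigma> (young_symmetrizer \<mu>)) ` {\<sigma>. \<sigma> permutes {1..n}}" by auto
    also have "\<dots> = (\<lambda>s. perm_lmult (app s) (young_symmetrizer \<mu>)) ` Sym n"
      unfolding bij_betw_imp_surj_on[OF bij_betw_app_Sym, symmetric] by (simp add: image_image)
    finally show ?thesis by (simp add: young_symmetrizer_eq perm_lmult_galg_fun)
  qed
  have spe: "specht_module \<mu> = smul.span ?G" unfolding specht_module_def n ..
  interpret Q: quotient_space smul "specht_module \<mu> :: (_ \<Rightarrow>\<^sub>0 'a) set" "{0}"
    by unfold_locales (auto simp: spe smul.subspace_span smul.span_zero smul.subspace_0 intro: smul.subspace_single_0)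
  define b where "b s = smul (inverse ?h) (galg_fun (gel s * ?e))" for s
  define \<phi> where "\<phi> s v = Poly_Mapping.lookup v (app s)" for s and v :: "_ \<Rightarrow>\<^sub>0 'a"
  have gen: "galg_fun (gel u * ?e) = (\<Sum>s\<in>Sym n. smul (\<phi> s (galg_fun (gel u * ?e))) (b s))" if u: "u \<in> Sym n" for u
  proof -
    let ?x = "gel u * ?e"
    have "?x \<in> galg_on n" using u sym_galg_on(3)[of \<mu>] n by (auto intro: galg_on_times galg_on_gel)
    note x = galg_sandwich_expand[OF this, of 1 ?e, simplified mult_1_left]
    have "?x = smul (inverse ?h) (?x * ?e)"
      using hook_const_nonzero[OF \<mu>, where 'a = 'a]
      by (simp add: mult.assoc esym_square[OF \<mu>] smul_mult_right)
    also note x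
    finally have "?x = (\<Sum>s\<in>Sym n. smul (Poly_Mapping.lookup ?x s * inverse ?h) (gel s * ?e))"
      by (simp only: smul.scale_sum_right smul.scale_scale mult.commute)
    from arg_cong[OF this, of galg_fun]
    have "galg_fun ?x = (\<Sum>s\<in>Sym n. smul (Poly_Mapping.lookup ?x s * inverse ?h) (galg_fun (gel s * ?e)))"
      by (simp only: galg_fun_sum)
    then show ?thesis unfolding \<phi>_def b_def lookup_galg_fun smul.scale_scale .
  qed
  have fr: "Q.frame (Sym n) b \<phi>"
    unfolding Q.frame_def
  proof (intro conjI ballI)
    fix s assume "s \<in> Sym n"
    then show "b s \<in> specht_module \<mu>"
      unfolding b_def spe G by (intro smul.span_scale[OF smul.span_base]) simp
    show "Q.functional (\<phi> s)" by (simp add: Q.functional_def \<phi>_def lookup_add)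
  next
    fix v :: "_ \<Rightarrow>\<^sub>0 'a" assume v: "v \<in> specht_module \<mu>"
    have "v = (\<Sum>s\<in>Sym n. smul (\<phi> s v) (b s))"
      using v unfolding spe G
    proof (induction rule: smul.span_induct_alt)
      case base
      then show ?case by (simp add: \<phi>_def)
    next
      case (step c x y)
      then have "x = (\<Sum>s\<in>Sym n. smul (\<phi> s x) (b s))" using gen by auto
      then have "smul c x + y = smul c (\<Sum>s\<in>Sym n. smul (\<phi> s x) (b s)) + (\<Sum>s\<in>Sym n. smul (\<phi> s y) (b s))"
        using step by simp
      also have "\<dots> = (\<Sum>s\<in>Sym n. smul (\<phi> s (smul c x + y)) (b s))"
        by (simp add: \<phi>_def lookup_add smul.scale_left_distrib sum.distrib smul.scale_sum_right)
      finally show ?case .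
    qed
    then show "v - (\<Sum>s\<in>Sym n. smul (\<phi> s v) (b s)) \<in> {0}" by simp
  qed simp
  have "Q.endo (perm_lmult (app t))"
    unfolding Q.endo_def
  proof (intro conjI ballI allI)
    fix v :: "_ \<Rightarrow>\<^sub>0 'a" assume v: "v \<in> specht_module \<mu>"
    then show "perm_lmult (app t) v \<in> specht_module \<mu>"
      unfolding spe G
    proof (induction rule: smul.span_induct_alt)
      case base
      then show ?case by (simp add: perm_lmult_lext smul.span_zero)
    next
      case (step c x y)
      then obtain s where s: "x = galg_fun (gel s * ?e)" "s \<in> Sym n" by auto
      have "perm_lmult (app t) x = galg_fun (gel (t + s) * ?e)"
        unfolding s perm_lmult_galg_fun by (simp add: mult_single flip: mult.assoc)
      then have "perm_lmult (app t) x \<in> (\<lambda>s. galg_fun (gel s * ?e)) ` Sym n" using t s Sym_plus by auto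
      then have "smul c (perm_lmult (app t) x) + perm_lmult (app t) y
          \<in> smul.span ((\<lambda>s. galg_fun (gel s * ?e)) ` Sym n)"
        by (intro smul.span_add[OF smul.span_scale[OF smul.span_base]] step)
      then show ?case by (simp only: perm_lmult_lext smul.lext_add smul.lext_smul)
    qed
  qed (auto simp: perm_lmult_lext smul.lext_add smul.lext_smul)
  from Q.quot_trace_frame[OF fr this]
  have "irr_char \<mu> (app t) = (\<Sum>s\<in>Sym n. \<phi> s (perm_lmult (app t) (b s)))"
    by (simp add: irr_char_def)
  moreover have "perm_lmult (app t) (b s) = smul (inverse ?h) (galg_fun (gel (t + s) * ?e))" for s
    unfolding b_def perm_lmult_smul perm_lmult_galg_fun by (simp add: mult_single flip: mult.assoc)
  ultimately show ?thesis by (simp add: \<phi>_def sum_distrib_left)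
qed

lemma irr_char_conj:
  assumes \<mu>: "\<mu> \<in> partitions n" and t: "t \<in> Sym n" and u: "u \<in> Sym n"
  shows "irr_char \<mu> (app (u + t - u)) = (irr_char \<mu> (app t) :: 'a::field_char_0)"
proof -
  let ?f = "\<lambda>s. Poly_Mapping.lookup (esym \<mu> :: 'a galg) (- s - t + s)"
  have ut: "u + t - u \<in> Sym n"
    using t u by (simp add: Sym_plus Sym_uminus diff_conv_add_uminus del: add_uminus_conv_diff)
  have bij: "bij_betw (\<lambda>s. - u + s) (Sym n) (Sym n)"
    by (rule bij_betwI[where g = "\<lambda>s. u + s"]) (use u in \<open>auto simp: Sym_plus Sym_uminus add.assoc[symmetric]\<close>)
  have "(\<Sum>s\<in>Sym n. Poly_Mapping.lookup (gel (u + t - u + s) * esym \<mu>) s) = (\<Sum>s\<in>Sym n. ?f (- u + s))"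
    by (intro sum.cong refl)
      (simp add: lookup_gel_times minus_add diff_conv_add_uminus add.assoc del: add_uminus_conv_diff)
  also have "\<dots> = (\<Sum>s\<in>Sym n. ?f s)" by (rule sum.reindex_bij_betw[OF bij])
  also have "\<dots> = (\<Sum>s\<in>Sym n. Poly_Mapping.lookup (gel (t + s) * esym \<mu>) s)"
    by (intro sum.cong refl)
      (simp add: lookup_gel_times minus_add diff_conv_add_uminus add.assoc del: add_uminus_conv_diff)
  finally show ?thesis by (simp add: irr_char_formula[OF \<mu>] t ut)
qed

theorem esym_irr_char:
  assumes \<nu>: "\<nu> \<in> partitions n" and \<mu>: "\<mu> \<in> partitions n"
  shows "(\<Sum>t\<in>Sym n. Poly_Mapping.lookup (esym \<nu>) t * irr_char \<mu> (app t))
    = (if \<nu> = \<mu> then hook_const \<mu> else 0 :: 'a::field_char_0)"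
proof -
  let ?h = "hook_const \<mu> :: 'a" and ?e = "esym \<mu> :: 'a galg" and ?x = "esym \<nu> :: 'a galg"
  have n: "sum_list \<mu> = n" "sum_list \<nu> = n" using \<mu> \<nu> by (auto simp: partitions_def)
  have on: "?x \<in> galg_on n" "?e \<in> galg_on n" using sym_galg_on(3) n by metis+
  have "(\<Sum>t\<in>Sym n. Poly_Mapping.lookup ?x t * irr_char \<mu> (app t))
      = inverse ?h * (\<Sum>t\<in>Sym n. \<Sum>s\<in>Sym n. Poly_Mapping.lookup ?x t * Poly_Mapping.lookup (gel (t + s) * ?e) s)"
    by (simp add: irr_char_formula[OF \<mu>] sum_distrib_left mult.left_commute)
  also have "(\<Sum>t\<in>Sym n. \<Sum>s\<in>Sym n. Poly_Mapping.lookup ?x t * Poly_Mapping.lookup (gel (t + s) * ?e) s)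
      = (\<Sum>s\<in>Sym n. Poly_Mapping.lookup (?x * gel s * ?e) s)"
  proof (subst sum.swap, rule sum.cong[OF refl])
    fix s
    have "?x * gel s * ?e = (\<Sum>t\<in>Sym n. smul (Poly_Mapping.lookup ?x t) (gel (t + s) * ?e))"
      using galg_sandwich_expand[OF on(1), of 1 "gel s * ?e"] by (simp add: mult_single flip: mult.assoc)
    then show "(\<Sum>t\<in>Sym n. Poly_Mapping.lookup ?x t * Poly_Mapping.lookup (gel (t + s) * ?e) s)
      = Poly_Mapping.lookup (?x * gel s * ?e) s" by (simp add: lookup_sum)
  qed
  also have "inverse ?h * \<dots> = (if \<nu> = \<mu> then ?h else 0)"
  proof (cases "\<nu> = \<mu>")
    case False
    then have "(\<Sum>s\<in>Sym n. Poly_Mapping.lookup (?x * gel s * ?e) s) = 0"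
      using esym_orthogonal[OF \<nu> \<mu> False galg_on_gel, where 'a = 'a] by (intro sum.neutral) simp
    with False show ?thesis by simp
  next
    case True
    have "(\<Sum>s\<in>Sym n. Poly_Mapping.lookup (?e * gel s * ?e) s)
        = (\<Sum>s\<in>Sym n. Poly_Mapping.lookup ?e s * Poly_Mapping.lookup (?e * gel s * ?e) 0)"
    proof (rule sum.cong[OF refl])
      fix s assume "s \<in> Sym n"
      from esym_sandwich[OF \<mu> galg_on_gel[OF this], where 'a = 'a]
      show "Poly_Mapping.lookup (?e * gel s * ?e) s = Poly_Mapping.lookup ?e s * Poly_Mapping.lookup (?e * gel s * ?e) 0"
        by (metis lookup_smul mult.commute)
    qed
    also have "\<dots> = Poly_Mapping.lookup (\<Sum>s\<in>Sym n. smul (Poly_Mapping.lookup ?e s) (?e * gel s * ?e)) 0"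
      by (simp add: lookup_sum)
    also have "(\<Sum>s\<in>Sym n. smul (Poly_Mapping.lookup ?e s) (?e * gel s * ?e)) = ?e * ?e * ?e"
      by (rule galg_sandwich_expand[OF on(2), symmetric])
    also have "Poly_Mapping.lookup (?e * ?e * ?e) 0 = ?h * ?h"
      by (simp add: esym_square[OF \<mu>] smul_mult_left lookup_esym_zero)
    finally show ?thesis using True hook_const_nonzero[OF \<mu>, where 'a = 'a] by simp
  qed
  finally show ?thesis .
qed


section \<open>Class functions\<close>

definition cycles_perm :: "'b list list \<Rightarrow> 'b \<Rightarrow> 'b"
  where "cycles_perm css = foldr (\<circ>) (map cycle_of_list css) id"

lemma cycles_perm_simps [simp]:
  "cycles_perm [] = id" "cycles_perm (c # css) = cycle_of_list c \<circ> cycles_perm css"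
  by (simp_all add: cycles_perm_def)

lemma cycles_perm_outside: "x \<notin> set (concat css) \<Longrightarrow> cycles_perm css x = x"
  by (induction css) (auto simp: id_outside_supp)

lemma cycles_perm_inside:
  "distinct (concat css) \<Longrightarrow> cs \<in> set css \<Longrightarrow> x \<in> set cs \<Longrightarrow> cycles_perm css x = cycle_of_list cs x"
proof (induction css)
  case (Cons c css)
  show ?case
  proof (cases "x \<in> set c")
    case True
    then have "x \<notin> set (concat css)" using Cons.prems(1) by auto
    moreover have "cs = c" using Cons.prems True by fastforce
    ultimately show ?thesis by (simp add: cycles_perm_outside)
  next
    case False
    then have cs: "cs \<in> set css" using Cons.prems by auto
    have "cycle_of_list cs x \<in> set cs"
      using cycle_permutes[of cs] Cons.prems(3) by (simp add: permutes_in_image)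
    then have "cycle_of_list cs x \<notin> set c" using Cons.prems(1) cs by auto
    then show ?thesis using Cons cs by (simp add: id_outside_supp)
  qed
qed simp

lemma cycles_perm_cong:
  assumes "distinct (concat css)" "distinct (concat css')" "set css = set css'"
  shows "cycles_perm css = cycles_perm css'"
proof
  fix x
  show "cycles_perm css x = cycles_perm css' x"
  proof (cases "x \<in> set (concat css)")
    case True
    then obtain cs where "cs \<in> set css" "x \<in> set cs" by auto
    then show ?thesis using cycles_perm_inside assms by metis
  next
    case False
    then show ?thesis using cycles_perm_outside assms(3) by (metis set_concat)
  qed
qed

lemma cycles_perm_conj:
  assumes "bij \<pi>" "distinct (concat css)"
  shows "\<pi> \<circ> cycles_perm css \<circ> inv \<pi> = cycles_perm (map (map \<pi>) css)"
  using assms(2)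
proof (induction css)
  case Nil
  then show ?case using assms(1) by (simp add: fun_eq_iff bij_is_surj surj_f_inv_f)
next
  case (Cons c css)
  have "\<pi> \<circ> cycles_perm (c # css) \<circ> inv \<pi>
      = (\<pi> \<circ> cycle_of_list c \<circ> inv \<pi>) \<circ> (\<pi> \<circ> cycles_perm css \<circ> inv \<pi>)"
    using assms(1) by (auto simp: fun_eq_iff bij_is_inj inv_f_f)
  moreover have "\<pi> \<circ> cycles_perm css \<circ> inv \<pi> = cycles_perm (map (map \<pi>) css)"
    by (rule Cons.IH) (use Cons.prems in simp)
  moreover have "\<pi> \<circ> cycle_of_list c \<circ> inv \<pi> = cycle_of_list (map \<pi> c)"
    by (rule conjugation_of_cycle) (use Cons.prems assms(1) in auto)
  ultimately show ?case by (simp only: list.map cycles_perm_simps)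
qed

lemma cycle_list_exists:
  assumes "\<sigma> permutes S" "finite S"
  shows "\<exists>css. distinct (concat css) \<and> set (concat css) = S \<and> [] \<notin> set css \<and> \<sigma> = cycles_perm css"
  using cycle_decomposition[OF assms]
proof (induction rule: cycle_decomp.induct)
  case empty
  then show ?case by (intro exI[of _ "[]"]) auto
next
  case (comp I p cs)
  then obtain css where css: "distinct (concat css)" "set (concat css) = I" "[] \<notin> set css" "p = cycles_perm css"
    by blast
  show ?case
  proof (cases "cs = []")
    case True
    with css show ?thesis by (intro exI[of _ css]) auto
  next
    case False
    with css comp(2,3) show ?thesis by (intro exI[of _ "cs # css"]) auto
  qed
qed

definition cycle_type :: "nat \<Rightarrow> (nat \<Rightarrow> nat) \<Rightarrow> nat list \<Rightarrow> bool"
  where "cycle_type n \<sigma> \<mu> \<longleftrightarrow> \<mu> \<in> partitions n \<and>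
    (\<exists>css. distinct (concat css) \<and> set (concat css) = {1..n} \<and> \<sigma> = cycles_perm css \<and> map length css = \<mu>)"

lemma cycle_type_exists:
  assumes "\<sigma> permutes {1..n}"
  shows "\<exists>\<mu>. cycle_type n \<sigma> \<mu>"
proof -
  obtain css where css: "distinct (concat css)" "set (concat css) = {1..n}" "[] \<notin> set css" "\<sigma> = cycles_perm css"
    using cycle_list_exists[OF assms] by auto
  define css' where "css' = rev (sort_key length css)"
  have ms: "mset css' = mset css" by (simp add: css'_def)
  then have st: "set css' = set css" by (metis set_mset_mset)
  have "mset (concat css') = mset (concat css)"
    unfolding mset_concat using ms by (metis mset_map sum_mset_sum_list)
  then have d: "distinct (concat css')" and len: "length (concat css') = length (concat css)"
    using css(1) by (metis mset_eq_imp_distinct_iff, metis mset_eq_length)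
  have "sorted_wrt (\<ge>) (map length css')"
    using sorted_sort_key[of length css] by (simp add: css'_def rev_map[symmetric] sorted_wrt_rev)
  moreover have "sum_list (map length css') = n"
  proof -
    have "length (concat css) = card (set (concat css))" using css(1) by (simp only: distinct_card)
    then show ?thesis using len css(2) by (simp add: length_concat)
  qed
  moreover have "1 \<le> k" if k: "k \<in> set (map length css')" for k
  proof -
    obtain cs where "cs \<in> set css" "k = length cs" using k st by auto
    then have "cs \<noteq> []" using css(3) by auto
    with \<open>k = length cs\<close> show ?thesis by (simp add: Suc_le_eq)
  qed
  ultimately have "map length css' \<in> partitions n" by (auto simp: partitions_def)
  moreover have "\<sigma> = cycles_perm css'" using css(4) cycles_perm_cong[OF css(1) d] st by simp
  ultimately show ?thesis using d st css(2) unfolding cycle_type_def by (metis set_concat)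
qed

lemma cycle_type_conj:
  assumes "cycle_type n \<sigma> \<mu>" "cycle_type n \<tau> \<mu>"
  shows "\<exists>\<pi>. \<pi> permutes {1..n} \<and> \<tau> = \<pi> \<circ> \<sigma> \<circ> inv \<pi>"
proof -
  obtain css where css: "distinct (concat css)" "set (concat css) = {1..n}" "\<sigma> = cycles_perm css" "map length css = \<mu>"
    using assms(1) by (auto simp: cycle_type_def)
  obtain css' where css': "distinct (concat css')" "set (concat css') = {1..n}" "\<tau> = cycles_perm css'" "map length css' = \<mu>"
    using assms(2) by (auto simp: cycle_type_def)
  let ?xs = "concat css" and ?ys = "concat css'"
  have len: "length ?xs = length ?ys" using css(4) css'(4) by (simp add: length_concat)
  define \<pi> where "\<pi> x = (if x \<in> {1..n} then the (map_of (zip ?xs ?ys) x) else x)" for x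
  have map: "map \<pi> ?xs = ?ys"
  proof (rule nth_equalityI)
    fix i assume "i < length (map \<pi> ?xs)"
    then have i: "i < length ?xs" by simp
    have "?xs ! i \<in> {1..n}" using i css(2) nth_mem by blast
    then show "map \<pi> ?xs ! i = ?ys ! i"
      using i len css(1) by (simp add: \<pi>_def map_of_zip_nth)
  qed (simp add: len)
  have "inj_on \<pi> {1..n}" using css'(1) css(2) unfolding map[symmetric] by (metis distinct_map)
  moreover have "\<pi> ` {1..n} = {1..n}" using css(2) css'(2) map by (metis set_map)
  ultimately have "bij_betw \<pi> {1..n} {1..n}" by (simp add: bij_betw_def)
  then have \<pi>: "\<pi> permutes {1..n}" by (rule bij_imp_permutes) (simp only: \<pi>_def if_False)
  have "map (map \<pi>) css = css'"
  proof (rule concat_injective)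
    show "concat (map (map \<pi>) css) = concat css'" using map by (simp add: map_concat)
    show "length (map (map \<pi>) css) = length css'" using css(4) css'(4) by (metis length_map)
    have "length (css ! i) = length (css' ! i)" if "i < length css" for i
      using css(4) css'(4) that by (metis length_map nth_map)
    then show "\<forall>(x, y)\<in>set (zip (map (map \<pi>) css) css'). length x = length y"
      by (auto simp: set_zip)
  qed
  then have "\<tau> = \<pi> \<circ> \<sigma> \<circ> inv \<pi>"
    using cycles_perm_conj[OF permutes_bij[OF \<pi>] css(1)] css(3) css'(3) by simp
  with \<pi> show ?thesis by blast
qed

lemma finite_partitions: "finite (partitions n)"
proof (rule finite_subset)
  have "length \<mu> \<le> sum_list \<mu>" if "\<forall>k\<in>set \<mu>. 1 \<le> k" for \<mu> :: "nat list"
    using that by (induction \<mu>) auto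
  then show "partitions n \<subseteq> {\<mu>. set \<mu> \<subseteq> {..n} \<and> length \<mu> \<le> n}"
    by (auto simp: partitions_def member_le_sum_list)
  show "finite {\<mu> :: nat list. set \<mu> \<subseteq> {..n} \<and> length \<mu> \<le> n}"
    by (rule finite_lists_length_le) simp
qed

lemma left_inverse_imp_right_inverse:
  fixes E X :: "'p \<Rightarrow> 'p \<Rightarrow> 'a::field"
  assumes P: "finite P"
    and EX: "\<And>l m. l \<in> P \<Longrightarrow> m \<in> P \<Longrightarrow> (\<Sum>k\<in>P. E l k * X k m) = (if l = m then 1 else 0)"
    and k: "k \<in> P" and k': "k' \<in> P"
  shows "(\<Sum>m\<in>P. X k m * E m k') = (if k = k' then 1 else 0)"
proof -
  define unit where "unit j = (Poly_Mapping.single j 1 :: 'p \<Rightarrow>\<^sub>0 'a)" for j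
  define col where "col m = (\<Sum>j\<in>P. smul (X j m) (unit j))" for m
  have lookup_col: "Poly_Mapping.lookup (col m) j = X j m" if "j \<in> P" for j m
  proof -
    have "Poly_Mapping.lookup (col m) j = (\<Sum>i\<in>P. if i = j then X i m else 0)"
      unfolding col_def lookup_sum
      by (intro sum.cong refl) (auto simp: unit_def lookup_single when_def)
    then show ?thesis using P that by simp
  qed
  define row where "row l v = (\<Sum>j\<in>P. E l j * Poly_Mapping.lookup v j)" for l and v :: "'p \<Rightarrow>\<^sub>0 'a"
  have row_col: "row l (col m) = (if l = m then 1 else 0)" if "l \<in> P" "m \<in> P" for l m
    using EX[OF that] by (simp add: row_def lookup_col)
  have row_sum: "row l (\<Sum>v\<in>A. smul (c v) (f v)) = (\<Sum>v\<in>A. c v * row l (f v))" for l A c and f :: "'q \<Rightarrow> _"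
    unfolding row_def lookup_sum lookup_smul sum_distrib_left
    by (subst sum.swap) (simp add: mult.left_commute)
  have inj: "inj_on col P"
  proof (rule inj_onI)
    fix l m assume "l \<in> P" "m \<in> P" "col l = col m"
    then show "l = m" using row_col[of l l] row_col[of l m] by (auto split: if_splits)
  qed
  have ind: "smul.independent (col ` P)"
  proof (rule smul.independent_if_scalars_zero)
    fix f x assume f: "(\<Sum>v\<in>col ` P. smul (f v) v) = 0" and x: "x \<in> col ` P"
    obtain l where l: "l \<in> P" "x = col l" using x by auto
    have "(\<Sum>m\<in>P. smul (f (col m)) (col m)) = 0"
      using f by (simp add: sum.reindex[OF inj])
    then have "row l (\<Sum>m\<in>P. smul (f (col m)) (col m)) = 0" by (simp add: row_def)
    then have "(\<Sum>m\<in>P. f (col m) * row l (col m)) = 0" by (simp only: row_sum)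
    moreover have "(\<Sum>m\<in>P. f (col m) * row l (col m)) = (\<Sum>m\<in>P. if m = l then f (col m) else 0)"
      by (intro sum.cong refl) (use l row_col in auto)
    ultimately show "f x = 0" using P l by simp
  qed (use P in simp)
  have col_span: "col ` P \<subseteq> smul.span (unit ` P)"
    by (auto simp: col_def intro!: smul.span_sum smul.span_scale intro: smul.span_base)
  have "unit k' \<in> smul.span (col ` P)"
  proof (rule ccontr)
    assume no: "unit k' \<notin> smul.span (col ` P)"
    then have "smul.independent (insert (unit k') (col ` P))" using ind by (rule smul.independent_insertI)
    moreover have "insert (unit k') (col ` P) \<subseteq> smul.span (unit ` P)"
      using col_span k' by (auto intro: smul.span_base)
    ultimately have "card (insert (unit k') (col ` P)) \<le> card (unit ` P)"
      using smul.independent_span_bound[of "unit ` P"] P by blast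
    moreover have "unit k' \<notin> col ` P" using no smul.span_base by blast
    ultimately have "Suc (card (col ` P)) \<le> card (unit ` P)" using P by simp
    then show False using inj card_image_le[OF P, of unit] by (simp add: card_image)
  qed
  then obtain c where "unit k' = (\<Sum>v\<in>col ` P. smul (c v) v)"
    using smul.span_finite[of "col ` P"] P by auto
  then have u: "unit k' = (\<Sum>m\<in>P. smul (c (col m)) (col m))" by (simp add: sum.reindex[OF inj])
  have c: "c (col l) = E l k'" if l: "l \<in> P" for l
  proof -
    have "row l (unit k') = (\<Sum>m\<in>P. c (col m) * row l (col m))" unfolding u by (rule row_sum)
    also have "\<dots> = (\<Sum>m\<in>P. if m = l then c (col m) else 0)"
      by (intro sum.cong refl) (use l row_col in auto)
    finally have "row l (unit k') = c (col l)" using P l by simp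
    moreover have "row l (unit k') = (\<Sum>j\<in>P. if j = k' then E l j else 0)"
      unfolding row_def by (intro sum.cong refl) (auto simp: unit_def lookup_single when_def)
    ultimately show ?thesis using P k' by simp
  qed
  have "Poly_Mapping.lookup (unit k') k = (\<Sum>m\<in>P. c (col m) * X k m)"
    by (subst u) (simp add: lookup_sum lookup_col[OF k])
  also have "\<dots> = (\<Sum>m\<in>P. X k m * E m k')" by (intro sum.cong refl) (simp add: c)
  finally show ?thesis by (auto simp: unit_def lookup_single when_def)
qed

text \<open>
  The values of a class function depend only on the cycle type, and there are as many cycle types as irreducible characters, so that the orthogonality relations leave no room for a remainder.
\<close>

theorem class_function_expansion:
  fixes f :: "(nat \<Rightarrow> nat) \<Rightarrow> 'a::field_char_0"
  assumes cl: "\<And>t u. t \<in> Sym n \<Longrightarrow> u \<in> Sym n \<Longrightarrow> f (app (u + t - u)) = f (app t)"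
    and t: "t \<in> Sym n"
  shows "f (app t) = (\<Sum>\<mu>\<in>partitions n.
    (\<Sum>s\<in>Sym n. Poly_Mapping.lookup (esym \<mu>) s * f (app s)) / hook_const \<mu> * irr_char \<mu> (app t))"
proof -
  let ?P = "partitions n"
  define ct where "ct s = (SOME \<mu>. cycle_type n (app s) \<mu>)" for s
  have ct: "cycle_type n (app s) (ct s)" if "s \<in> Sym n" for s
    unfolding ct_def using cycle_type_exists that by (auto intro: someI_ex simp: Sym_def)
  then have ctP: "ct s \<in> ?P" if "s \<in> Sym n" for s using that by (auto simp: cycle_type_def)
  have conj: "\<exists>u\<in>Sym n. s' = u + s - u" if s: "s \<in> Sym n" "s' \<in> Sym n" "ct s = ct s'" for s s'
  proof -
    obtain \<pi> where \<pi>: "\<pi> permutes {1..n}" "app s' = \<pi> \<circ> app s \<circ> inv \<pi>"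
      using cycle_type_conj[OF ct[OF s(1)]] ct[OF s(2)] s(3) by auto
    have a: "app (Fperm \<pi>) = \<pi>" using \<pi>(1) by (rule app_Fperm)
    have "app s' = app (Fperm \<pi> + s - Fperm \<pi>)"
      unfolding \<pi>(2) diff_conv_add_uminus plus_fperm.rep_eq uminus_fperm.rep_eq a ..
    then have "s' = Fperm \<pi> + s - Fperm \<pi>" by (simp only: app_inject)
    moreover have "Fperm \<pi> \<in> Sym n" using \<pi>(1) a by (simp add: Sym_def)
    ultimately show ?thesis by blast
  qed
  define r where "r k = (SOME s. s \<in> Sym n \<and> ct s = k)" for k
  have r: "r (ct s) \<in> Sym n \<and> ct (r (ct s)) = ct s" if "s \<in> Sym n" for s
    unfolding r_def by (rule someI[of _ s]) (use that in simp)
  have class_r: "g (app (r (ct s))) = g (app s)"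
    if "s \<in> Sym n" "\<And>t u. t \<in> Sym n \<Longrightarrow> u \<in> Sym n \<Longrightarrow> g (app (u + t - u)) = g (app t)"
    for s and g :: "(nat \<Rightarrow> nat) \<Rightarrow> 'a"
    using conj[of s "r (ct s)"] r[OF that(1)] that by auto
  define E where "E l k = (\<Sum>s | s \<in> Sym n \<and> ct s = k. Poly_Mapping.lookup (esym l) s) / (hook_const l :: 'a)" for l k
  define X where "X k m = (irr_char m (app (r k)) :: 'a)" for k m
  have group: "(\<Sum>k\<in>?P. E l k * g (app (r k))) = (\<Sum>s\<in>Sym n. Poly_Mapping.lookup (esym l) s * g (app s)) / hook_const l"
    if g: "\<And>t u. t \<in> Sym n \<Longrightarrow> u \<in> Sym n \<Longrightarrow> g (app (u + t - u)) = g (app t)"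
    for l and g :: "(nat \<Rightarrow> nat) \<Rightarrow> 'a"
  proof -
    have "E l k * g (app (r k)) = (\<Sum>s | s \<in> Sym n \<and> ct s = k. Poly_Mapping.lookup (esym l) s * g (app s)) / hook_const l" for k
    proof -
      have "(\<Sum>s | s \<in> Sym n \<and> ct s = k. Poly_Mapping.lookup (esym l) s * g (app s))
          = (\<Sum>s | s \<in> Sym n \<and> ct s = k. Poly_Mapping.lookup (esym l) s * g (app (r k)))"
        using class_r[OF _ g] by (intro sum.cong) auto
      then show ?thesis by (simp add: E_def sum_distrib_right)
    qed
    then have "(\<Sum>k\<in>?P. E l k * g (app (r k)))
        = (\<Sum>k\<in>?P. \<Sum>s | s \<in> Sym n \<and> ct s = k. Poly_Mapping.lookup (esym l) s * g (app s)) / hook_const l"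
      by (simp add: sum_divide_distrib)
    also have "(\<Sum>k\<in>?P. \<Sum>s | s \<in> Sym n \<and> ct s = k. Poly_Mapping.lookup (esym l) s * g (app s))
        = (\<Sum>s\<in>Sym n. Poly_Mapping.lookup (esym l) s * g (app s))"
      by (rule sum.group) (use finite_partitions ctP in auto)
    finally show ?thesis .
  qed
  have EX: "(\<Sum>k\<in>?P. E l k * X k m) = (if l = m then 1 else 0)" if "l \<in> ?P" "m \<in> ?P" for l m
    using group[of "irr_char m" l] irr_char_conj[OF that(2), where 'a = 'a] esym_irr_char[OF that, where 'a = 'a]
      hook_const_nonzero[OF that(2), where 'a = 'a]
    by (simp add: X_def)
  let ?k = "ct t"
  have "f (app t) = f (app (r ?k))" using class_r[OF t cl] by simp
  also have "\<dots> = (\<Sum>k\<in>?P. (if ?k = k then 1 else 0) * f (app (r k)))"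
    using ctP[OF t] finite_partitions by (simp add: if_distrib[of "\<lambda>x. x * _"] cong: if_cong)
  also have "\<dots> = (\<Sum>k\<in>?P. (\<Sum>m\<in>?P. X ?k m * E m k) * f (app (r k)))"
    using left_inverse_imp_right_inverse[OF finite_partitions EX ctP[OF t]]
    by (intro sum.cong refl) simp
  also have "\<dots> = (\<Sum>m\<in>?P. (\<Sum>k\<in>?P. E m k * f (app (r k))) * X ?k m)"
    unfolding sum_distrib_right by (subst sum.swap) (simp add: mult_ac)
  also have "\<dots> = (\<Sum>m\<in>?P. (\<Sum>s\<in>Sym n. Poly_Mapping.lookup (esym m) s * f (app s)) / hook_const m * irr_char m (app t))"
  proof (intro sum.cong refl)
    fix m assume m: "m \<in> ?P"
    have "X ?k m = irr_char m (app t)"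
      unfolding X_def using t irr_char_conj[OF m] by (rule class_r)
    then show "(\<Sum>k\<in>?P. E m k * f (app (r k))) * X ?k m
      = (\<Sum>s\<in>Sym n. Poly_Mapping.lookup (esym m) s * f (app s)) / hook_const m * irr_char m (app t)"
      by (simp add: group[OF cl])
  qed
  finally show ?thesis .
qed


section \<open>Multiplicities in a permutation module of colourings\<close>

definition perm_act :: "nat \<Rightarrow> 'a::field galg \<Rightarrow> ((nat \<Rightarrow> nat) \<Rightarrow> 'a) \<Rightarrow> (nat \<Rightarrow> nat) \<Rightarrow> 'a"
  where "perm_act n x v c = (\<Sum>s\<in>Sym n. Poly_Mapping.lookup x s * v (c \<circ> app s))"

lemma bij_betw_Sym_plus: "p \<in> Sym n \<Longrightarrow> bij_betw (\<lambda>s. p + s) (Sym n) (Sym n)"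
  by (rule bij_betwI[where g = "\<lambda>s. - p + s"]) (auto simp: Sym_plus Sym_uminus add.assoc[symmetric])

lemma act_gel_times:
  assumes "p \<in> Sym n"
  shows "perm_act n (gel p * y) v c = perm_act n y v (c \<circ> app p)"
proof -
  have "perm_act n (gel p * y) v c = (\<Sum>s\<in>Sym n. Poly_Mapping.lookup (gel p * y) (p + s) * v (c \<circ> app (p + s)))"
    unfolding perm_act_def by (rule sum.reindex_bij_betw[OF bij_betw_Sym_plus[OF assms], symmetric])
  then show ?thesis
    by (simp add: perm_act_def lookup_gel_times add.assoc[symmetric] plus_fperm.rep_eq comp_assoc)
qed

lemma act_sum: "perm_act n (\<Sum>i\<in>A. smul (k i) (x i)) v c = (\<Sum>i\<in>A. k i * perm_act n (x i) v c)"
  unfolding perm_act_def lookup_sum sum_distrib_right sum_distrib_left lookup_smul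
  by (subst sum.swap) (simp add: mult.assoc)

lemma act_diff: "perm_act n (x - y) v c = perm_act n x v c - perm_act n y v c"
  by (simp add: perm_act_def lookup_minus left_diff_distrib sum_subtractf)

lemma act_smul: "perm_act n (smul k x) v c = k * perm_act n x v c"
  by (simp add: perm_act_def sum_distrib_left mult.assoc)

lemma act_zero [simp]: "perm_act n 0 v c = 0"
  by (simp add: perm_act_def)

lemma act_fun_linear:
  "perm_act n x (\<lambda>c. v c - (\<Sum>i\<in>A. k i * w i c)) c = perm_act n x v c - (\<Sum>i\<in>A. k i * perm_act n x (w i) c)"
proof -
  have "(\<Sum>s\<in>Sym n. Poly_Mapping.lookup x s * (\<Sum>i\<in>A. k i * w i (c \<circ> app s)))
      = (\<Sum>i\<in>A. k i * perm_act n x (w i) c)"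
    unfolding perm_act_def sum_distrib_left by (subst sum.swap) (simp add: mult.left_commute)
  then show ?thesis by (simp add: perm_act_def right_diff_distrib sum_subtractf)
qed

lemma act_times:
  assumes "x \<in> galg_on n"
  shows "perm_act n (x * y) v c = perm_act n x (perm_act n y v) c"
proof -
  have "x * y = (\<Sum>p\<in>Sym n. smul (Poly_Mapping.lookup x p) (gel p * y))"
    using galg_sandwich_expand[OF assms, of 1 y] by simp
  then show ?thesis by (simp only: act_sum) (simp add: act_gel_times perm_act_def[of n x])
qed

definition ysym :: "nat list \<Rightarrow> 'a::field galg"
  where "ysym \<mu> = colsym \<mu> * rowsym \<mu>"

lemma ysym_star: "ysym \<mu> = star (esym \<mu>)"
  by (simp add: ysym_def esym_def star_times star_sym)

lemma ysym_galg_on: "\<mu> \<in> partitions n \<Longrightarrow> ysym \<mu> \<in> galg_on n"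
  unfolding ysym_def using sym_galg_on[of \<mu>] by (auto simp: partitions_def intro: galg_on_times)

lemma ysym_square:
  assumes "\<mu> \<in> partitions n"
  shows "ysym \<mu> * ysym \<mu> = smul (hook_const \<mu>) (ysym \<mu> :: 'a::field_char_0 galg)"
proof -
  have "star (smul k x) = smul k (star x)" for k and x :: "'a galg"
    by (simp add: star_def smul.lext_smul)
  then show ?thesis
    unfolding ysym_star star_times[symmetric] esym_square[OF assms] .
qed

definition colourings :: "nat \<Rightarrow> (nat \<Rightarrow> nat) set"
  where "colourings n = {c. (\<forall>x. x \<notin> {1..n} \<longrightarrow> c x = 0) \<and>
    ((\<forall>x. c x = 0) \<or> (\<forall>x. c x \<le> 2) \<and> (\<exists>!x. c x = 2))}"

lemma finite_colourings: "finite (colourings n)"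
proof (rule finite_subset)
  show "colourings n \<subseteq> {c. \<forall>x. (x \<in> {1..n} \<longrightarrow> c x \<in> {..2}) \<and> (x \<notin> {1..n} \<longrightarrow> c x = 0)}"
    by (auto simp: colourings_def)
  show "finite {c :: nat \<Rightarrow> nat. \<forall>x. (x \<in> {1..n} \<longrightarrow> c x \<in> {..2}) \<and> (x \<notin> {1..n} \<longrightarrow> c x = 0)}"
    by (rule finite_set_of_finite_funs) auto
qed

lemma colourings_comp:
  assumes "c \<in> colourings n" "s \<in> Sym n"
  shows "c \<circ> app s \<in> colourings n"
proof -
  have "x \<notin> {1..n} \<Longrightarrow> app s x \<notin> {1..n}" for x using Sym_app_in[OF assms(2), of x] by blast
  moreover have "\<exists>!x. c (app s x) = 2" if "\<exists>!x. c x = 2"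
  proof -
    from that obtain x where x: "c x = 2" "\<And>y. c y = 2 \<Longrightarrow> y = x" by blast
    show ?thesis
    proof (rule ex1I[of _ "app (- s) x"])
      fix y assume "c (app s y) = 2"
      then have "app s y = x" by (rule x(2))
      then show "y = app (- s) x" by auto
    qed (simp add: x)
  qed
  moreover have "(\<forall>x. x \<notin> {1..n} \<longrightarrow> c x = 0)" "(\<forall>x. c x = 0) \<or> (\<forall>x. c x \<le> 2) \<and> (\<exists>!x. c x = 2)"
    using assms(1) unfolding colourings_def by blast+
  ultimately show ?thesis unfolding colourings_def mem_Collect_eq comp_apply by blast
qed

definition colouring_char :: "nat \<Rightarrow> (nat \<Rightarrow> nat) \<Rightarrow> 'a::field"
  where "colouring_char n \<sigma> = of_nat (card {c \<in> colourings n. c \<circ> \<sigma> = c})"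

definition point :: "(nat \<Rightarrow> nat) \<Rightarrow> (nat \<Rightarrow> nat) \<Rightarrow> 'a::field"
  where "point d c = (if c = d then 1 else 0)"

text \<open>
  The fixed points of a permutation are counted by the diagonal coefficients of its action on functions; the Young symmetrizer and its image under inversion have the same trace.
\<close>

lemma colouring_char_trace:
  "(\<Sum>s\<in>Sym n. Poly_Mapping.lookup (esym \<mu>) s * colouring_char n (app s))
    = (\<Sum>c\<in>colourings n. perm_act n (ysym \<mu> :: 'a::field galg) (point c) c)"
proof -
  have bij: "bij_betw uminus (Sym n) (Sym n)"
    by (rule bij_betwI[where g = uminus]) (auto simp: Sym_uminus)
  have eq: "c \<circ> app (- s) = c \<longleftrightarrow> c \<circ> app s = c" for s and c :: "nat \<Rightarrow> nat"
  proof
    assume "c \<circ> app (- s) = c"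
    then have "c \<circ> app (- s) \<circ> app s = c \<circ> app s" by simp
    then show "c \<circ> app s = c" by (simp add: fun_eq_iff)
  next
    assume "c \<circ> app s = c"
    then have "c \<circ> app s \<circ> app (- s) = c \<circ> app (- s)" by simp
    then show "c \<circ> app (- s) = c" by (simp add: fun_eq_iff)
  qed
  have "(\<Sum>c\<in>colourings n. perm_act n (ysym \<mu> :: 'a galg) (point c) c)
      = (\<Sum>s\<in>Sym n. \<Sum>c\<in>colourings n. Poly_Mapping.lookup (ysym \<mu>) s * point c (c \<circ> app s))"
    unfolding perm_act_def by (rule sum.swap)
  also have "\<dots> = (\<Sum>s\<in>Sym n. Poly_Mapping.lookup (ysym \<mu>) s * colouring_char n (app s))"
    using finite_colourings by (simp add: colouring_char_def point_def flip: sum_distrib_left sum.inter_filter)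
  also have "\<dots> = (\<Sum>s\<in>Sym n. Poly_Mapping.lookup (ysym \<mu>) (- s) * colouring_char n (app (- s)))"
    by (rule sum.reindex_bij_betw[OF bij, symmetric])
  also have "\<dots> = (\<Sum>s\<in>Sym n. Poly_Mapping.lookup (esym \<mu>) s * colouring_char n (app s))"
    by (simp add: ysym_star lookup_star colouring_char_def eq)
  finally show ?thesis ..
qed

text \<open>Values at few colourings determine the whole image of a Young symmetrizer; these are the points of evaluation.\<close>

lemma trace_by_evaluation:
  fixes \<mu> :: "nat list"
  assumes \<mu>: "\<mu> \<in> partitions n" and D: "D \<subseteq> colourings n"
    and inj: "\<And>(v :: (nat \<Rightarrow> nat) \<Rightarrow> 'a::field_char_0) c.
      (\<And>d. d \<in> D \<Longrightarrow> perm_act n (ysym \<mu>) v d = 0) \<Longrightarrow> c \<in> colourings n \<Longrightarrow> perm_act n (ysym \<mu>) v c = 0"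
    and sep: "\<And>d. d \<in> D \<Longrightarrow> \<exists>v :: (nat \<Rightarrow> nat) \<Rightarrow> 'a. perm_act n (ysym \<mu>) v d \<noteq> 0 \<and>
      (\<forall>d'\<in>D. d' \<noteq> d \<longrightarrow> perm_act n (ysym \<mu>) v d' = 0)"
  shows "(\<Sum>s\<in>Sym n. Poly_Mapping.lookup (esym \<mu>) s * colouring_char n (app s))
    = (hook_const \<mu> * of_nat (card D) :: 'a)"
proof -
  let ?y = "ysym \<mu> :: 'a galg"
  have fin: "finite D" using D finite_colourings by (rule finite_subset)
  obtain v where v: "\<And>d. d \<in> D \<Longrightarrow> perm_act n ?y (v d) d \<noteq> 0"
      "\<And>d d'. d \<in> D \<Longrightarrow> d' \<in> D \<Longrightarrow> d' \<noteq> d \<Longrightarrow> perm_act n ?y (v d) d' = 0"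
    using sep by metis
  define u where "u d c = perm_act n ?y (v d) c / perm_act n ?y (v d) d" for d c
  have expand: "perm_act n ?y w c = (\<Sum>d\<in>D. perm_act n ?y w d * u d c)" if c: "c \<in> colourings n" for w c
  proof -
    define k where "k d = perm_act n ?y w d / perm_act n ?y (v d) d" for d
    let ?w = "\<lambda>c. w c - (\<Sum>d\<in>D. k d * v d c)"
    have "perm_act n ?y ?w d = 0" if d: "d \<in> D" for d
    proof -
      have "(\<Sum>i\<in>D. k i * perm_act n ?y (v i) d) = (\<Sum>i\<in>D. if i = d then k i * perm_act n ?y (v i) d else 0)"
        by (intro sum.cong refl) (use v(2) d in auto)
      also have "\<dots> = perm_act n ?y w d" using fin d v(1) by (simp add: k_def)
      finally show ?thesis unfolding act_fun_linear by simp
    qed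
    then have "perm_act n ?y ?w c = 0" using c by (rule inj)
    then show ?thesis unfolding act_fun_linear by (simp add: k_def u_def)
  qed
  have "(\<Sum>c\<in>colourings n. perm_act n ?y (point c) c)
      = (\<Sum>c\<in>colourings n. \<Sum>d\<in>D. perm_act n ?y (point c) d * u d c)"
    by (intro sum.cong refl) (rule expand)
  also have "\<dots> = (\<Sum>d\<in>D. \<Sum>c\<in>colourings n. perm_act n ?y (point c) d * u d c)"
    by (rule sum.swap)
  also have "\<dots> = (\<Sum>d\<in>D. perm_act n ?y (u d) d)"
  proof (rule sum.cong[OF refl])
    fix d assume d: "d \<in> D"
    have "(\<Sum>c\<in>colourings n. point c (d \<circ> app s) * u d c) = u d (d \<circ> app s)" if "s \<in> Sym n" for s
    proof -
      have "(\<Sum>c\<in>colourings n. point c (d \<circ> app s) * u d c)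
          = (\<Sum>c\<in>colourings n. if c = d \<circ> app s then u d c else 0)"
        by (intro sum.cong refl) (auto simp: point_def)
      then show ?thesis using finite_colourings colourings_comp[OF _ that] d D by (simp add: subset_iff)
    qed
    then have "perm_act n ?y (u d) d
        = (\<Sum>s\<in>Sym n. \<Sum>c\<in>colourings n. Poly_Mapping.lookup ?y s * (point c (d \<circ> app s) * u d c))"
      by (simp add: perm_act_def flip: sum_distrib_left)
    also have "\<dots> = (\<Sum>c\<in>colourings n. perm_act n ?y (point c) d * u d c)"
      by (subst sum.swap) (simp add: perm_act_def sum_distrib_right mult.assoc)
    finally show "(\<Sum>c\<in>colourings n. perm_act n ?y (point c) d * u d c) = perm_act n ?y (u d) d" ..
  qed
  also have "\<dots> = (\<Sum>d\<in>D. hook_const \<mu>)"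
  proof (rule sum.cong[OF refl])
    fix d assume d: "d \<in> D"
    have "perm_act n ?y (u d) d = perm_act n ?y (perm_act n ?y (v d)) d / perm_act n ?y (v d) d"
      unfolding u_def perm_act_def[of n ?y "\<lambda>c. perm_act n ?y (v d) c / perm_act n ?y (v d) d"]
        perm_act_def[of n ?y "perm_act n ?y (v d)"] by (simp add: sum_divide_distrib)
    also have "perm_act n ?y (perm_act n ?y (v d)) d = hook_const \<mu> * perm_act n ?y (v d) d"
      unfolding act_times[OF ysym_galg_on[OF \<mu>], symmetric] ysym_square[OF \<mu>] by (rule act_smul)
    finally show "perm_act n ?y (u d) d = hook_const \<mu>" using v(1)[OF d] by simp
  qed
  finally show ?thesis unfolding colouring_char_trace by (simp add: mult.commute)
qed

lemma separation_by_stages: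
  fixes Y :: "((nat \<Rightarrow> nat) \<Rightarrow> 'a::field) \<Rightarrow> (nat \<Rightarrow> nat) \<Rightarrow> 'a"
  assumes Y: "\<And>v w k c. Y (\<lambda>c. v c - k * w c) c = Y v c - k * Y w c"
    and two: "d \<in> D2 \<Longrightarrow> \<exists>v. Y v d \<noteq> 0 \<and> (\<forall>d'\<in>D. d' \<noteq> d \<longrightarrow> Y v d' = 0)"
    and d: "d \<in> D" 
    and other: "d \<notin> D2 \<Longrightarrow> \<exists>v e. Y v d \<noteq> 0 \<and> e \<in> D \<and> e \<noteq> d \<and> (\<forall>d'\<in>D. d' \<noteq> d \<longrightarrow> d' \<noteq> e \<longrightarrow> Y v d' = 0) \<and>
        (\<exists>w. Y w e \<noteq> 0 \<and> (\<forall>d'\<in>D. d' \<noteq> e \<longrightarrow> Y w d' = 0))"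
  shows "\<exists>v. Y v d \<noteq> 0 \<and> (\<forall>d'\<in>D. d' \<noteq> d \<longrightarrow> Y v d' = 0)"
proof (cases "d \<in> D2")
  case False
  from other[OF this] obtain v e w where v: "Y v d \<noteq> 0" "e \<in> D" "e \<noteq> d"
      "\<forall>d'\<in>D. d' \<noteq> d \<longrightarrow> d' \<noteq> e \<longrightarrow> Y v d' = 0"
    and w: "Y w e \<noteq> 0" "\<forall>d'\<in>D. d' \<noteq> e \<longrightarrow> Y w d' = 0" by blast
  let ?k = "Y v e / Y w e"
  let ?v = "\<lambda>c. v c - ?k * w c"
  have Yv: "Y ?v c = Y v c - ?k * Y w c" for c by (rule Y)
  have "Y ?v d \<noteq> 0" unfolding Yv using v(1,3) w(2) d by simp
  moreover have "Y ?v d' = 0" if "d' \<in> D" "d' \<noteq> d" for d'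
    unfolding Yv using v(4) w that by (cases "d' = e") simp_all
  ultimately show ?thesis by blast
qed (rule two)

section \<open>Symmetries of the evaluation\<close>

lemma act_ysym:
  assumes "sum_list \<mu> = n"
  shows "perm_act n (ysym \<mu>) v c = (\<Sum>q\<in>fixing n (coli \<mu>). \<Sum>p\<in>fixing n (rowi \<mu>).
    psign q * v (c \<circ> app q \<circ> app p) :: 'a::field)"
proof -
  have "ysym \<mu> = (\<Sum>q\<in>fixing n (coli \<mu>). \<Sum>p\<in>fixing n (rowi \<mu>). Poly_Mapping.single (q + p) (psign q) :: 'a galg)"
    by (simp add: ysym_def rowsym_def colsym_def assms sum_product mult_single)
  moreover have "perm_act n (Poly_Mapping.single (q + p) k) v c = k * v (c \<circ> app q \<circ> app p)"
    if "q \<in> fixing n (coli \<mu>)" "p \<in> fixing n (rowi \<mu>)" for q p and k :: 'a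
  proof -
    have S: "q + p \<in> Sym n" using that by (auto simp: fixing_def Sym_plus)
    have "perm_act n (Poly_Mapping.single (q + p) k) v c
        = (\<Sum>s\<in>Sym n. if s = q + p then k * v (c \<circ> app s) else 0)"
      unfolding perm_act_def by (intro sum.cong refl) (auto simp: lookup_single when_def)
    then show ?thesis using S by (simp add: plus_fperm.rep_eq comp_assoc)
  qed
  moreover have "perm_act n (\<Sum>i\<in>A. f i) v c = (\<Sum>i\<in>A. perm_act n (f i) v c)" for A and f :: "fperm \<Rightarrow> 'a galg"
    using act_sum[where k = "\<lambda>_. 1"] by simp
  ultimately show ?thesis by simp
qed

lemma act_ysym_col:
  assumes "sum_list \<mu> = n" "q \<in> fixing n (coli \<mu>)"
  shows "perm_act n (ysym \<mu>) v (c \<circ> app q) = psign q * (perm_act n (ysym \<mu>) v c :: 'a::field)"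
proof -
  have "q \<in> Sym n" using assms(2) by (simp add: fixing_def)
  then have "perm_act n (ysym \<mu>) v (c \<circ> app q) = perm_act n (gel q * colsym \<mu> * rowsym \<mu>) v c"
    by (simp add: act_gel_times ysym_def mult.assoc)
  then show ?thesis
    using gel_colsym(1)[of q \<mu>, where 'a = 'a] assms by (simp add: smul_mult_left act_smul ysym_def)
qed

lemma act_ysym_repeat:
  fixes v :: "(nat \<Rightarrow> nat) \<Rightarrow> 'a::field_char_0"
  assumes n: "sum_list \<mu> = n" and xy: "x \<in> {1..n}" "y \<in> {1..n}" "x \<noteq> y" "coli \<mu> x = coli \<mu> y" "c x = c y"
  shows "perm_act n (ysym \<mu>) v c = 0"
proof -
  have "c \<circ> app (transp x y) = c"
    using xy(5) by (auto simp: fun_eq_iff app_transp Transposition.transpose_def)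
  then have "perm_act n (ysym \<mu>) v c = - perm_act n (ysym \<mu>) v c"
    using act_ysym_col[OF n transp_fixing[OF xy(1,2,4)], of v c] psign_transp[OF xy(3), where 'a = 'a] by simp
  then show ?thesis by simp
qed

definition column_perm :: "nat list \<Rightarrow> (nat \<Rightarrow> nat) \<Rightarrow> nat \<Rightarrow> nat"
  where "column_perm \<mu> \<tau> x = (if x \<in> {1..sum_list \<mu>} then tableau \<mu> (rowi \<mu> x) (\<tau> (coli \<mu> x)) else x)"

lemma column_perm_props:
  assumes \<tau>: "\<And>i j. i < length \<mu> \<Longrightarrow> j < \<mu> ! i \<Longrightarrow> \<tau> j < \<mu> ! i" and inj: "inj \<tau>"
  shows "column_perm \<mu> \<tau> permutes {1..sum_list \<mu>}"
    and "x \<in> {1..sum_list \<mu>} \<Longrightarrow> rowi \<mu> (column_perm \<mu> \<tau> x) = rowi \<mu> x"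
    and "x \<in> {1..sum_list \<mu>} \<Longrightarrow> coli \<mu> (column_perm \<mu> \<tau> x) = \<tau> (coli \<mu> x)"
proof -
  let ?n = "sum_list \<mu>" and ?\<pi> = "column_perm \<mu> \<tau>"
  have *: "?\<pi> x \<in> {1..?n} \<and> rowi \<mu> (?\<pi> x) = rowi \<mu> x \<and> coli \<mu> (?\<pi> x) = \<tau> (coli \<mu> x)" if "x \<in> {1..?n}" for x
    using tableau_rowi_coli[OF that] \<tau>[of "rowi \<mu> x" "coli \<mu> x"]
      tableau_in[of "rowi \<mu> x" \<mu> "\<tau> (coli \<mu> x)"] that
    by (simp add: column_perm_def)
  have inj': "inj_on ?\<pi> {1..?n}"
  proof (rule inj_onI)
    fix x y assume xy: "x \<in> {1..?n}" "y \<in> {1..?n}" "?\<pi> x = ?\<pi> y"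
    then have "rowi \<mu> x = rowi \<mu> y" "\<tau> (coli \<mu> x) = \<tau> (coli \<mu> y)" using * by metis+
    then show "x = y" using xy inj by (intro cell_unique[of x \<mu> y]) (auto dest: injD)
  qed
  have "?\<pi> ` {1..?n} = {1..?n}"
    by (rule card_subset_eq) (use * inj' in \<open>auto simp: card_image\<close>)
  then have "bij_betw ?\<pi> {1..?n} {1..?n}" using inj' by (simp add: bij_betw_def)
  then show "?\<pi> permutes {1..?n}" by (rule bij_imp_permutes) (simp only: column_perm_def if_False)
  show "x \<in> {1..?n} \<Longrightarrow> rowi \<mu> (?\<pi> x) = rowi \<mu> x" "x \<in> {1..?n} \<Longrightarrow> coli \<mu> (?\<pi> x) = \<tau> (coli \<mu> x)"
    using * by blast+
qed

lemma act_ysym_column_perm: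
  assumes n: "sum_list \<mu> = n" and \<tau>: "\<And>i j. i < length \<mu> \<Longrightarrow> j < \<mu> ! i \<Longrightarrow> \<tau> j < \<mu> ! i" and inj: "inj \<tau>"
  shows "perm_act n (ysym \<mu>) v (c \<circ> column_perm \<mu> \<tau>) = (perm_act n (ysym \<mu>) v c :: 'a::field)"
proof -
  have cp: "column_perm \<mu> \<tau> permutes {1..n}"
    "\<And>x. x \<in> {1..n} \<Longrightarrow> rowi \<mu> (column_perm \<mu> \<tau> x) = rowi \<mu> x"
    "\<And>x. x \<in> {1..n} \<Longrightarrow> coli \<mu> (column_perm \<mu> \<tau> x) = \<tau> (coli \<mu> x)"
    unfolding n[symmetric] by (rule column_perm_props; use \<tau> inj in blast)+
  let ?p = "Fperm (column_perm \<mu> \<tau>)" and ?C = "fixing n (coli \<mu>)"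
  have app: "app ?p = column_perm \<mu> \<tau>" using cp(1) by (rule app_Fperm)
  have pS: "?p \<in> Sym n" using cp(1) by (simp add: Sym_def app)
  have p: "?p \<in> fixing n (rowi \<mu>)" using cp(2) pS by (simp add: fixing_def app)
  have col: "coli \<mu> (app ?p x) = \<tau> (coli \<mu> x)" if "x \<in> {1..n}" for x using cp(3)[OF that] by (simp add: app)
  have conj: "- ?p + q + ?p \<in> ?C" if q: "q \<in> ?C" for q
  proof -
    have qS: "q \<in> Sym n" and qc: "\<And>x. x \<in> {1..n} \<Longrightarrow> coli \<mu> (app q x) = coli \<mu> x"
      using q by (auto simp: fixing_def)
    have S: "- ?p + q + ?p \<in> Sym n" using pS qS by (simp add: Sym_plus Sym_uminus)
    have "coli \<mu> (app (- ?p + q + ?p) x) = coli \<mu> x" if x: "x \<in> {1..n}" for x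
    proof -
      have "app (- ?p + q + ?p) x \<in> {1..n}" using Sym_app_in[OF S] x by blast
      then have "\<tau> (coli \<mu> (app (- ?p + q + ?p) x)) = coli \<mu> (app ?p (app (- ?p + q + ?p) x))"
        using col by simp
      also have "app ?p (app (- ?p + q + ?p) x) = app q (app ?p x)" by (simp add: app_plus)
      also have "coli \<mu> (app q (app ?p x)) = \<tau> (coli \<mu> x)"
        using qc[of "app ?p x"] Sym_app_in[OF pS, of x] x col by simp
      finally show ?thesis using inj by (simp add: inj_eq)
    qed
    with S show ?thesis by (simp add: fixing_def)
  qed
  have bij: "bij_betw (\<lambda>q. - ?p + q + ?p) ?C ?C"
    unfolding bij_betw_def
  proof
    show inj: "inj_on (\<lambda>q. - ?p + q + ?p) ?C" by (rule inj_onI) simp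
    show "(\<lambda>q. - ?p + q + ?p) ` ?C = ?C"
      by (rule card_subset_eq) (use conj inj in \<open>auto simp: card_image\<close>)
  qed
  have "gel ?p * colsym \<mu> * rowsym \<mu> = (\<Sum>q\<in>?C. Poly_Mapping.single (?p + (- ?p + q + ?p)) (psign (- ?p + q + ?p))) * (rowsym \<mu> :: 'a galg)"
    unfolding colsym_def n sum_distrib_left mult_single mult_1
    by (subst sum.reindex_bij_betw[OF bij, symmetric]) simp
  also have "\<dots> = (\<Sum>q\<in>?C. Poly_Mapping.single q (psign q)) * (gel ?p * rowsym \<mu>)"
  proof -
    have "psign (- ?p + q + ?p) = (psign q :: 'a)" for q
      using psign_square[of ?p, where 'a = 'a] by (simp add: psign_plus mult.commute mult.left_commute)
    then show ?thesis by (simp add: sum_distrib_right mult_single add.assoc[symmetric] flip: mult.assoc)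
  qed
  also have "\<dots> = colsym \<mu> * rowsym \<mu>" using gel_rowsym(1)[of ?p \<mu>, where 'a = 'a] p n by (simp add: colsym_def)
  finally have "gel ?p * ysym \<mu> = (ysym \<mu> :: 'a galg)" by (simp add: ysym_def mult.assoc)
  then show ?thesis using act_gel_times[OF pS, of "ysym \<mu>" v c] by (simp add: app)
qed

lemma transp_commute: "transp p q = transp q p"
  by (simp add: transp_def Transposition.transpose_commute)

lemma transp_self: "- transp p q = transp p q" "transp p q + transp p q = 0"
proof -
  have "app (transp p q + transp p q) = app 0"
    by (auto simp: fun_eq_iff app_plus app_transp zero_fperm.rep_eq)
  then show *: "transp p q + transp p q = 0" by (simp only: app_inject)
  then show "- transp p q = transp p q" by (simp add: minus_unique)
qed

lemma act_ysym_garnir: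
  fixes v :: "(nat \<Rightarrow> nat) \<Rightarrow> 'a::field_char_0"
  assumes n: "sum_list \<mu> = n" and N: "P \<in> {1..n}" "Q \<in> {1..n}" "M \<in> {1..n}"
    and dist: "P \<noteq> Q" "M \<noteq> P" "M \<noteq> Q" and col: "coli \<mu> P = coli \<mu> Q" and row: "rowi \<mu> P = rowi \<mu> M"
    and PQ: "\<And>x. x \<in> {1..n} \<Longrightarrow> coli \<mu> x = coli \<mu> P \<Longrightarrow> x = P \<or> x = Q"
    and MM: "\<And>x. x \<in> {1..n} \<Longrightarrow> coli \<mu> x = coli \<mu> M \<Longrightarrow> x = M"
  shows "perm_act n (ysym \<mu>) v c = perm_act n (ysym \<mu>) v (c \<circ> app (transp P M)) + perm_act n (ysym \<mu>) v (c \<circ> app (transp Q M))"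
proof -
  define r t u where "r = transp P M" and "t = transp P Q" and "u = transp Q M"
  let ?C = "fixing n (coli \<mu>)"
  have S: "r \<in> Sym n" "u \<in> Sym n"
    using N by (auto simp: r_def u_def Sym_def app_transp permutes_swap_id)
  have tC: "t \<in> ?C" unfolding t_def by (rule transp_fixing) (use N col in auto)
  have rR: "r \<in> fixing n (rowi \<mu>)" unfolding r_def by (rule transp_fixing) (use N row in auto)
  have inv: "- r = r" "r + r = 0" "- t = t" "t + t = 0"
    unfolding r_def t_def by (rule transp_self)+
  have "u = r + t - r" using transp_conj[of r P Q] dist
    by (simp add: r_def t_def u_def app_transp transp_commute)
  then have rt: "u + r = r + t" "r + t + r = u"
    using inv by (simp_all add: diff_conv_add_uminus add.assoc del: add_uminus_conv_diff)
  have "u = t + r - t" using transp_conj[of t P M] dist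
    by (simp add: r_def t_def u_def app_transp)
  then have tr: "u + t = t + r" using inv by (simp add: diff_conv_add_uminus add.assoc del: add_uminus_conv_diff)
  then have tr': "u + t + r = t" using inv by (simp add: add.assoc)
  define Z G where "Z = 1 - gel r - (gel u :: 'a galg)" and "G = Z * (1 - gel t)"
  have one: "gel 0 = (1 :: 'a galg)" by (simp flip: single_one)
  have Gt: "G * gel t = - G"
    by (simp add: G_def mult.assoc left_diff_distrib mult_single inv one)
      (simp add: algebra_simps)
  have Gexp: "G = 1 - gel r - gel u - gel t + gel (r + t) + gel (u + t)"
    by (simp add: G_def Z_def algebra_simps mult_single)
  have Gr: "G * gel r = - G"
    unfolding Gexp by (simp add: left_diff_distrib distrib_right mult_single inv one rt tr' tr[symmetric])
  have Ga: "G * rowsym \<mu> = 0"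
  proof -
    have "G * rowsym \<mu> = G * gel r * rowsym \<mu>" using gel_rowsym(1)[of r \<mu>, where 'a = 'a] rR n by (simp add: mult.assoc)
    then have "G * rowsym \<mu> = - (G * rowsym \<mu>)" by (simp add: Gr)
    then show ?thesis by (rule eq_uminus_imp_zero)
  qed
  have fixed: "G * gel q * rowsym \<mu> = 0" if q: "q \<in> ?C" and qP: "app q P = P" for q
  proof -
    have qin: "app q x \<in> {1..n} \<and> coli \<mu> (app q x) = coli \<mu> x" if "x \<in> {1..n}" for x
      using q that Sym_app_in[of q n x] by (simp add: fixing_def)
    have qQ: "app q Q = Q"
    proof -
      have "app q Q = P \<or> app q Q = Q" using qin[OF N(2)] PQ col by auto
      moreover have "app q Q \<noteq> app q P" using dist(1) bij_is_inj[OF bij_app, of q] by (auto dest: injD)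
      ultimately show ?thesis using qP by auto
    qed
    have qM: "app q M = M" using qin[OF N(3)] MM by auto
    have com: "q + transp x y = transp x y + q" if "app q x = x" "app q y = y" for x y
    proof -
      have "transp x y = q + transp x y - q" using transp_conj[of q x y] that by simp
      then have "transp x y + q = q + transp x y - q + q" by simp
      then show ?thesis by simp
    qed
    have "q + r = r + q" "q + t = t + q" "q + u = u + q"
      unfolding r_def t_def u_def using qP qQ qM by (auto intro: com)
    moreover from this have "q + (r + t) = r + t + q" "q + (u + t) = u + t + q" by (metis add.assoc)+
    moreover note qq = calculation
    have "G * gel q = gel q * G"
      unfolding Gexp by (simp add: left_diff_distrib right_diff_distrib distrib_left distrib_right mult_single qq)
    then show ?thesis using Ga by (simp add: mult.assoc)
  qed
  have "G * gel q * rowsym \<mu> = 0" if q: "q \<in> ?C" for q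
  proof (cases "app q P = P")
    case False
    have "app q P = P \<or> app q P = Q"
      using q N(1) Sym_app_in[of q n P] PQ by (auto simp: fixing_def)
    with False have "app (t + q) P = P" by (simp add: app_plus t_def app_transp)
    with fixed[OF fixing_plus[OF tC q]] have "G * gel (t + q) * rowsym \<mu> = 0" by simp
    moreover have "G * gel (t + q) = - (G * gel q)"
    proof -
      have "gel (t + q) = gel t * (gel q :: 'a galg)" by (simp add: mult_single)
      then have "G * gel (t + q) = (G * gel t) * gel q" by (simp only: mult.assoc)
      then show ?thesis by (simp only: Gt mult_minus_left)
    qed
    ultimately show ?thesis by simp
  qed (use fixed q in auto)
  then have "G * colsym \<mu> * rowsym \<mu> = 0"
  proof -
    assume *: "\<And>q. q \<in> ?C \<Longrightarrow> G * gel q * rowsym \<mu> = 0"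
    have "colsym \<mu> = (\<Sum>q\<in>?C. smul (psign q) (gel q) :: 'a galg)" by (simp add: colsym_def n)
    then have "G * colsym \<mu> * rowsym \<mu> = (\<Sum>q\<in>?C. smul (psign q) (G * gel q * rowsym \<mu>))"
      by (simp only: sum_distrib_left sum_distrib_right smul_mult_left smul_mult_right)
    then show ?thesis using * by simp
  qed
  moreover have "(1 - gel t) * colsym \<mu> = colsym \<mu> + (colsym \<mu> :: 'a galg)"
  proof -
    have "psign t = (- 1 :: 'a)" unfolding t_def by (rule psign_transp) (rule dist)
    moreover have "smul (- 1) x = - x" for x :: "'a galg" by (rule poly_mapping_eqI) simp
    ultimately show ?thesis using gel_colsym(1)[of t \<mu>, where 'a = 'a] tC n by (simp add: left_diff_distrib)
  qed
  ultimately have "Z * (colsym \<mu> + colsym \<mu>) * rowsym \<mu> = 0" by (simp add: G_def mult.assoc)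
  then have "Z * ysym \<mu> = - (Z * ysym \<mu>)"
    by (simp add: ysym_def distrib_left distrib_right mult.assoc add_eq_0_iff2)
  then have "Z * ysym \<mu> = 0" by (rule eq_uminus_imp_zero)
  then have "ysym \<mu> - gel r * ysym \<mu> - gel u * ysym \<mu> = (0 :: 'a galg)"
    by (simp add: Z_def left_diff_distrib)
  then have "perm_act n (ysym \<mu> - gel r * ysym \<mu> - gel u * ysym \<mu>) v c = 0" by simp
  then show ?thesis unfolding act_diff act_gel_times[OF S(1)] act_gel_times[OF S(2)]
    by (simp add: r_def u_def diff_eq_eq add.commute)
qed

section \<open>Normal forms and separation\<close>

lemma column_sort:
  fixes c d :: "nat \<Rightarrow> nat"
  assumes n: "sum_list \<mu> = n" and out: "\<And>x. x \<notin> {1..n} \<Longrightarrow> c x = 0" "\<And>x. x \<notin> {1..n} \<Longrightarrow> d x = 0"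
    and inj: "inj_on (\<lambda>x. (coli \<mu> x, d x)) {1..n}"
    and sub: "\<And>x. x \<in> {1..n} \<Longrightarrow> \<exists>y\<in>{1..n}. coli \<mu> y = coli \<mu> x \<and> c y = d x"
  shows "\<exists>q\<in>fixing n (coli \<mu>). c \<circ> app q = d"
proof -
  let ?N = "{1..n}" and ?F = "\<lambda>x. (coli \<mu> x, c x)" and ?G = "\<lambda>x. (coli \<mu> x, d x)"
  obtain g where g: "\<And>x. x \<in> ?N \<Longrightarrow> g x \<in> ?N \<and> coli \<mu> (g x) = coli \<mu> x \<and> c (g x) = d x"
    using sub by metis
  define h where "h x = (if x \<in> ?N then g x else x)" for x
  have "inj_on h ?N"
  proof (rule inj_onI)
    fix x y assume "x \<in> ?N" "y \<in> ?N" "h x = h y"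
    then have "?G x = ?G y" using g unfolding h_def by metis
    then show "x = y" using inj \<open>x \<in> ?N\<close> \<open>y \<in> ?N\<close> by (auto dest: inj_onD)
  qed
  moreover have "h ` ?N = ?N"
    by (rule card_subset_eq[OF _ _ card_image[OF \<open>inj_on h ?N\<close>]]) (use g in \<open>auto simp: h_def\<close>)
  ultimately have "bij_betw h ?N ?N" by (simp add: bij_betw_def)
  then have h: "h permutes ?N" by (rule bij_imp_permutes) (simp only: h_def if_False)
  have a: "app (Fperm h) = h" using h by (rule app_Fperm)
  have "Fperm h \<in> fixing n (coli \<mu>)"
    using h g by (simp add: fixing_def Sym_def a) (simp add: h_def)
  moreover have "c \<circ> app (Fperm h) = d"
  proof
    fix x show "(c \<circ> app (Fperm h)) x = d x"
    proof (cases "x \<in> ?N")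
      case True
      then have "h x = g x" unfolding h_def by (rule if_P)
      then show ?thesis using g[OF True] by (simp only: a comp_apply)
    next
      case False
      then have "h x = x" unfolding h_def by (rule if_not_P)
      then show ?thesis using out[OF False] by (simp only: a comp_apply)
    qed
  qed
  ultimately show ?thesis by blast
qed

lemma arrange_01:
  fixes f :: "nat \<Rightarrow> nat"
  assumes "\<And>j. j \<in> {a..<b} \<Longrightarrow> f j \<le> 1"
  shows "\<exists>\<tau> s. \<tau> permutes {a..<b} \<and> s \<le> b - a \<and> (\<forall>j\<in>{a..<b}. f (\<tau> j) = (if j < a + s then 1 else 0))"
proof -
  let ?A = "{a..<b}"
  define s where "s = card {j \<in> ?A. f j = 1}"
  define g where "g j = (if j < a + s then 1 else 0 :: nat)" for j
  have "s \<le> card ?A" unfolding s_def by (rule card_mono) auto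
  then have s: "s \<le> b - a" by simp
  have cnt: "count (image_mset h (mset_set ?A)) x = card {j \<in> ?A. h j = x}" for h :: "nat \<Rightarrow> nat" and x
    by (simp add: count_image_mset) (intro arg_cong[of _ _ card]; auto)
  have c1: "card {j \<in> ?A. g j = 1} = s"
  proof -
    have "{j \<in> ?A. g j = 1} = {a..<a + s}" using s by (auto simp: g_def)
    then show ?thesis by simp
  qed
  have c0: "card {j \<in> ?A. h j = 0} = (b - a) - card {j \<in> ?A. h j = 1}" if "\<And>j. j \<in> ?A \<Longrightarrow> h j \<le> 1" for h :: "nat \<Rightarrow> nat"
  proof -
    have "\<forall>j\<in>?A. h j = 0 \<longleftrightarrow> h j \<noteq> 1"
    proof
      fix j assume "j \<in> ?A"
      then have "h j \<le> 1" by (rule that)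
      then show "h j = 0 \<longleftrightarrow> h j \<noteq> 1" by linarith
    qed
    then have "{j \<in> ?A. h j = 0} = ?A - {j \<in> ?A. h j = 1}" by blast
    then have "card {j \<in> ?A. h j = 0} = card (?A - {j \<in> ?A. h j = 1})" by (rule arg_cong)
    also have "\<dots> = card ?A - card {j \<in> ?A. h j = 1}" by (rule card_Diff_subset) auto
    finally show ?thesis by simp
  qed
  have "image_mset g (mset_set ?A) = image_mset f (mset_set ?A)"
  proof (rule multiset_eqI)
    fix x :: nat
    consider "x = 0" | "x = 1" | "x > 1" by linarith
    then show "count (image_mset g (mset_set ?A)) x = count (image_mset f (mset_set ?A)) x"
    proof cases
      case 3
      then have "f j \<noteq> x" if "j \<in> ?A" for j using assms[OF that] by linarith
      moreover have "g j \<noteq> x" for j using 3 by (simp add: g_def)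
      ultimately have "{j \<in> ?A. g j = x} = {}" "{j \<in> ?A. f j = x} = {}" by blast+
      then show ?thesis unfolding cnt by (simp only:)
    qed (unfold cnt, use c0[of g] c0[of f] c1 assms in \<open>simp_all add: g_def s_def\<close>)
  qed
  then obtain \<tau> where "\<tau> permutes ?A" "\<forall>x\<in>?A. g x = f (\<tau> x)"
    using image_mset_eq_implies_permutes[of ?A g f] by auto
  then show ?thesis using s unfolding g_def by (intro exI[of _ \<tau>] exI[of _ s]) simp
qed

lemma comp_column_perm_colourings:
  assumes "sum_list \<mu> = n" "c \<in> colourings n" "column_perm \<mu> \<tau> permutes {1..n}"
  shows "c \<circ> column_perm \<mu> \<tau> \<in> colourings n"
  using colourings_comp[OF assms(2), of "Fperm (column_perm \<mu> \<tau>)"] app_Fperm[OF assms(3)] assms(3)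
  by (simp add: Sym_def)

lemma swap_columns:
  assumes n: "sum_list \<mu> = n" and c: "c \<in> colourings n"
    and jk: "\<And>i. i < length \<mu> \<Longrightarrow> j < \<mu> ! i \<longleftrightarrow> k < \<mu> ! i"
  shows "\<exists>c'\<in>colourings n. (\<forall>v. perm_act n (ysym \<mu>) v c' = (perm_act n (ysym \<mu>) v c :: 'a::field)) \<and>
    (\<forall>i. i < length \<mu> \<longrightarrow> j < \<mu> ! i \<longrightarrow> c' (tableau \<mu> i j) = c (tableau \<mu> i k))"
proof -
  let ?\<tau> = "Transposition.transpose j k"
  have \<tau>: "\<And>i l. i < length \<mu> \<Longrightarrow> l < \<mu> ! i \<Longrightarrow> ?\<tau> l < \<mu> ! i"
    by (metis Transposition.transpose_def jk)
  have inj: "inj ?\<tau>" by simp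
  have perm: "column_perm \<mu> ?\<tau> permutes {1..n}"
    unfolding n[symmetric] by (rule column_perm_props(1)) (use \<tau> inj in blast)+
  have "perm_act n (ysym \<mu>) v (c \<circ> column_perm \<mu> ?\<tau>) = (perm_act n (ysym \<mu>) v c :: 'a)" for v
    by (rule act_ysym_column_perm[OF n]) (use \<tau> inj in blast)+
  moreover have "(c \<circ> column_perm \<mu> ?\<tau>) (tableau \<mu> i j) = c (tableau \<mu> i k)" if "i < length \<mu>" "j < \<mu> ! i" for i
    using tableau_in[OF that] by (simp add: column_perm_def)
  ultimately show ?thesis using comp_column_perm_colourings[OF n c perm] by blast
qed

lemma sort_singles:
  assumes n: "sum_list \<mu> = n" and c: "c \<in> colourings n" and \<mu>: "\<mu> = b # \<mu>'" and a: "\<And>k. k \<in> set \<mu>' \<Longrightarrow> k \<le> a"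
    and c01: "\<And>j. a \<le> j \<Longrightarrow> j < b \<Longrightarrow> c (Suc j) \<le> 1"
  shows "\<exists>c'\<in>colourings n. \<exists>s\<le>b - a. (\<forall>v. perm_act n (ysym \<mu>) v c' = (perm_act n (ysym \<mu>) v c :: 'a::field)) \<and>
    (\<forall>j. a \<le> j \<longrightarrow> j < b \<longrightarrow> c' (Suc j) = (if j < a + s then 1 else 0)) \<and>
    (\<forall>x\<in>{1..n}. coli \<mu> x < a \<longrightarrow> c' x = c x)"
proof -
  obtain \<tau> s where \<tau>: "\<tau> permutes {a..<b}" and s: "s \<le> b - a"
    and ar: "\<And>j. j \<in> {a..<b} \<Longrightarrow> c (Suc (\<tau> j)) = (if j < a + s then 1 else 0)"
    using arrange_01[of a b "\<lambda>j. c (Suc j)"] c01 by auto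
  have le: "\<tau> l < \<mu> ! i" if i: "i < length \<mu>" "l < \<mu> ! i" for i l
  proof (cases "l \<in> {a..<b}")
    case True
    then have "\<tau> l < b" using permutes_in_image[OF \<tau>, of l] by simp
    moreover have "i = 0"
    proof (rule ccontr)
      assume "i \<noteq> 0"
      then have "\<mu> ! i \<in> set \<mu>'" using i \<mu> by (cases i) auto
      with a have "\<mu> ! i \<le> a" by blast
      with i True show False by simp
    qed
    ultimately show ?thesis using \<mu> by simp
  next
    case False
    then show ?thesis using i permutes_not_in[OF \<tau>, of l] by simp
  qed
  have inj: "inj \<tau>" using \<tau> by (rule permutes_inj)
  have perm: "column_perm \<mu> \<tau> permutes {1..n}"
    unfolding n[symmetric] by (rule column_perm_props(1)) (use le inj in blast)+
  have "perm_act n (ysym \<mu>) v (c \<circ> column_perm \<mu> \<tau>) = (perm_act n (ysym \<mu>) v c :: 'a)" for v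
    by (rule act_ysym_column_perm[OF n]) (use le inj in blast)+
  moreover have "(c \<circ> column_perm \<mu> \<tau>) (Suc j) = (if j < a + s then 1 else 0)" if "a \<le> j" "j < b" for j
  proof -
    have "column_perm \<mu> \<tau> (Suc j) = Suc (\<tau> j)"
      using that \<mu> by (auto simp: column_perm_def)
    then show ?thesis using ar[of j] that by simp
  qed
  moreover have "(c \<circ> column_perm \<mu> \<tau>) x = c x" if x: "x \<in> {1..n}" "coli \<mu> x < a" for x
  proof -
    have "\<tau> (coli \<mu> x) = coli \<mu> x" using x permutes_not_in[OF \<tau>] by simp
    then show ?thesis using tableau_rowi_coli[of x \<mu>] by (simp add: column_perm_def n)
  qed
  ultimately show ?thesis using comp_column_perm_colourings[OF n c perm] s by blast
qed

lemma evaluate_point: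
  fixes t c :: "nat \<Rightarrow> nat"
  assumes n: "sum_list \<mu> = n"
    and sgn: "\<And>q p. q \<in> fixing n (coli \<mu>) \<Longrightarrow> p \<in> fixing n (rowi \<mu>) \<Longrightarrow> c \<circ> app q \<circ> app p = t \<Longrightarrow> psign q = (\<epsilon> :: 'a::field_char_0)"
  shows "perm_act n (ysym \<mu>) (point t) c = \<epsilon> * of_nat (card {(q, p). q \<in> fixing n (coli \<mu>) \<and> p \<in> fixing n (rowi \<mu>) \<and> c \<circ> app q \<circ> app p = t})"
proof -
  let ?C = "fixing n (coli \<mu>)" and ?R = "fixing n (rowi \<mu>)"
  have "perm_act n (ysym \<mu>) (point t) c = (\<Sum>(q, p)\<in>?C \<times> ?R. if c \<circ> app q \<circ> app p = t then \<epsilon> else 0)"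
    unfolding act_ysym[OF n] sum.cartesian_product
    by (intro sum.cong refl) (auto simp: point_def sgn)
  also have "\<dots> = (\<Sum>z\<in>?C \<times> ?R. if c \<circ> app (fst z) \<circ> app (snd z) = t then \<epsilon> else 0)"
    by (simp add: case_prod_beta)
  also have "\<dots> = \<epsilon> * of_nat (card {z \<in> ?C \<times> ?R. c \<circ> app (fst z) \<circ> app (snd z) = t})"
    by (simp add: sum.If_cases mult.commute Int_def)
  also have "{z \<in> ?C \<times> ?R. c \<circ> app (fst z) \<circ> app (snd z) = t}
      = {(q, p). q \<in> ?C \<and> p \<in> ?R \<and> c \<circ> app q \<circ> app p = t}" by auto
  finally show ?thesis .
qed

lemma evaluate_point_zero:
  assumes "sum_list \<mu> = n"
    and "\<And>q p. q \<in> fixing n (coli \<mu>) \<Longrightarrow> p \<in> fixing n (rowi \<mu>) \<Longrightarrow> c \<circ> app q \<circ> app p = t \<Longrightarrow> False"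
  shows "perm_act n (ysym \<mu>) (point t) c = (0 :: 'a::field_char_0)"
  using evaluate_point[OF assms(1), of c t 0] assms(2) by fastforce

lemma evaluate_point_nonzero:
  assumes n: "sum_list \<mu> = n"
    and sgn: "\<And>q p. q \<in> fixing n (coli \<mu>) \<Longrightarrow> p \<in> fixing n (rowi \<mu>) \<Longrightarrow> c \<circ> app q \<circ> app p = t \<Longrightarrow> q = q0"
    and q0: "q0 \<in> fixing n (coli \<mu>)" "c \<circ> app q0 = t"
  shows "perm_act n (ysym \<mu>) (point t) c \<noteq> (0 :: 'a::field_char_0)"
proof -
  let ?K = "{(q, p). q \<in> fixing n (coli \<mu>) \<and> p \<in> fixing n (rowi \<mu>) \<and> c \<circ> app q \<circ> app p = t}"
  have "?K \<subseteq> fixing n (coli \<mu>) \<times> fixing n (rowi \<mu>)" by auto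
  then have "finite ?K" by (rule finite_subset) simp
  moreover have "(q0, 0) \<in> ?K" using q0 by (simp add: zero_fperm.rep_eq)
  ultimately have "card ?K \<noteq> 0" unfolding card_eq_0_iff by blast
  moreover have "psign q0 \<noteq> (0 :: 'a)" using psign_square[of q0, where 'a = 'a] by (metis mult_zero_left zero_neq_one)
  moreover have "perm_act n (ysym \<mu>) (point t) c = psign q0 * (of_nat (card ?K) :: 'a)"
    by (rule evaluate_point[OF n]) (metis sgn)
  ultimately show ?thesis by simp
qed

lemma comp_app_card:
  assumes "q \<in> Sym n" "p \<in> Sym n" "c \<circ> app q \<circ> app p = t"
  shows "card {x \<in> {1..n}. c x = k} = card {x \<in> {1..n}. t x = k}"
proof -
  have "bij_betw (app (q + p)) {x \<in> {1..n}. t x = k} {x \<in> {1..n}. c x = k}"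
  proof (rule bij_betwI[where g = "app (- (q + p))"])
    have S: "q + p \<in> Sym n" using assms by (simp add: Sym_plus)
    have t: "t x = c (app (q + p) x)" for x using assms(3) by (auto simp: app_plus)
    show "app (q + p) \<in> {x \<in> {1..n}. t x = k} \<rightarrow> {x \<in> {1..n}. c x = k}"
      using Sym_app_in[OF S] by (auto simp: t)
    show "app (- (q + p)) \<in> {x \<in> {1..n}. c x = k} \<rightarrow> {x \<in> {1..n}. t x = k}"
      using Sym_app_in[OF Sym_uminus[OF S]] by (auto simp: t simp del: minus_add)
  qed (simp_all del: minus_add)
  then show ?thesis by (simp add: bij_betw_same_card)
qed

lemma comp_app_row:
  assumes "p \<in> fixing n (rowi \<mu>)" "c \<circ> app q \<circ> app p = t" "x \<in> {1..n}"
  shows "\<exists>y\<in>{1..n}. rowi \<mu> y = rowi \<mu> x \<and> c (app q x) = t y"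
proof (rule bexI)
  have m: "- p \<in> fixing n (rowi \<mu>)" using assms(1) by (rule fixing_uminus)
  then show "app (- p) x \<in> {1..n}" using Sym_app_in[of "- p" n x] assms(3) by (simp add: fixing_def)
  show "rowi \<mu> (app (- p) x) = rowi \<mu> x \<and> c (app q x) = t (app (- p) x)"
    using m assms(2,3) by (auto simp: fixing_def)
qed


section \<open>The multiplicities, shape by shape\<close>

lemma colouring_two:
  assumes "c \<in> colourings n" "c x = 2"
  shows "y \<noteq> x \<Longrightarrow> c y \<le> 1" "x \<in> {1..n}"
proof -
  have "\<not> (\<forall>x. c x = 0)" by (metis assms(2) zero_neq_numeral)
  then have le: "\<forall>x. c x \<le> 2" and ex: "\<exists>!x. c x = 2" and out: "\<forall>x. x \<notin> {1..n} \<longrightarrow> c x = 0"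
    using assms(1) unfolding colourings_def by blast+
  show "c y \<le> 1" if "y \<noteq> x"
  proof -
    have "c y \<noteq> 2" using ex assms(2) that by blast
    moreover have "c y \<le> 2" using le by blast
    ultimately show ?thesis by linarith
  qed
  show "x \<in> {1..n}"
  proof (rule ccontr)
    assume "x \<notin> {1..n}"
    with out assms(2) show False by simp
  qed
qed

lemma colouring_out: "c \<in> colourings n \<Longrightarrow> x \<notin> {1..n} \<Longrightarrow> c x = 0"
  unfolding colourings_def by blast

lemma colouring_cases:
  assumes "c \<in> colourings n"
  obtains "c = (\<lambda>x. 0)" | x where "c x = 2" "x \<in> {1..n}"
proof -
  from assms have "(\<forall>x. c x = 0) \<or> (\<exists>!x. c x = 2)" unfolding colourings_def by blast
  then show thesis using that colouring_two(2)[OF assms] by blast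
qed

lemma colouring_le: "c \<in> colourings n \<Longrightarrow> c x \<le> 2"
proof -
  assume "c \<in> colourings n"
  then have "(\<forall>x. c x = 0) \<or> (\<forall>x. c x \<le> 2)" unfolding colourings_def by blast
  then show ?thesis by auto
qed

lemma colouringsI:
  assumes "\<And>y. y \<notin> {1..n} \<Longrightarrow> c y = 0" "c x = 2" "\<And>y. y \<noteq> x \<Longrightarrow> c y \<le> 1"
  shows "c \<in> colourings n"
proof -
  have "c y \<le> 2" for y
  proof (cases "y = x")
    case False
    then have "c y \<le> 1" by (rule assms(3))
    then show ?thesis by linarith
  qed (simp add: assms(2))
  moreover have "\<exists>!y. c y = 2"
  proof (rule ex1I[of _ x])
    fix y assume "c y = 2"
    then show "y = x" using assms(3)[of y] by (cases "y = x") auto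
  qed (rule assms(2))
  ultimately show ?thesis using assms(1) unfolding colourings_def by blast
qed

lemma not_inj_zero:
  fixes v :: "(nat \<Rightarrow> nat) \<Rightarrow> 'a::field_char_0"
  assumes "sum_list \<mu> = n" "\<not> inj_on (\<lambda>x. (coli \<mu> x, c x)) {1..n}"
  shows "perm_act n (ysym \<mu>) v c = 0"
  using assms(2) act_ysym_repeat[OF assms(1)] unfolding inj_on_def prod.inject by blast

lemma sorted_zero:
  fixes v :: "(nat \<Rightarrow> nat) \<Rightarrow> 'a::field_char_0"
  assumes n: "sum_list \<mu> = n" and "c \<in> colourings n" "d \<in> colourings n"
    and "inj_on (\<lambda>x. (coli \<mu> x, d x)) {1..n}"
    and "\<And>x. x \<in> {1..n} \<Longrightarrow> \<exists>y\<in>{1..n}. coli \<mu> y = coli \<mu> x \<and> c y = d x"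
    and "perm_act n (ysym \<mu>) v d = 0"
  shows "perm_act n (ysym \<mu>) v c = 0"
proof -
  obtain q where q: "q \<in> fixing n (coli \<mu>)" "c \<circ> app q = d"
    using column_sort[OF n colouring_out[OF assms(2)] colouring_out[OF assms(3)] assms(4,5)] by blast
  then have "psign q * perm_act n (ysym \<mu>) v c = 0"
    using act_ysym_col[OF n q(1), of v c] assms(6) by simp
  moreover have "psign q \<noteq> (0 :: 'a)" using psign_square[of q, where 'a = 'a] by (metis mult_zero_left zero_neq_one)
  ultimately show ?thesis by simp
qed

subsection \<open>Two rows\<close>

definition two_row_point :: "nat \<Rightarrow> nat \<Rightarrow> nat \<Rightarrow> nat \<Rightarrow> nat \<Rightarrow> nat"
  where "two_row_point p q a s x = (if x = p + q + 1 then 2 else if p + q < x \<and> x \<le> 2 * p + q then 1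
    else if p < x \<and> x \<le> p + s then 1 else if x = 1 then a else 0)"

context
  fixes p q n :: nat and \<mu> :: "nat list"
  assumes p: "1 \<le> p" and \<mu>: "\<mu> = [p + q, p]" and n: "n = 2 * p + q"
begin

lemma two_row_sum: "sum_list \<mu> = n"
  by (simp add: \<mu> n)

lemma two_row_partition: "\<mu> \<in> partitions n"
  using p by (auto simp: partitions_def \<mu> n)

lemma two_row_coli: "x \<in> {1..n} \<Longrightarrow> coli \<mu> x = (if x \<le> p + q then x - 1 else x - (p + q) - 1)"
  by (auto simp: \<mu> n)

lemma two_row_rowi: "x \<in> {1..n} \<Longrightarrow> rowi \<mu> x = (if x \<le> p + q then 0 else 1)"
  by (auto simp: \<mu> n)

lemma two_row_point_colouring:
  assumes "a \<le> 1" "s \<le> q"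
  shows "two_row_point p q a s \<in> colourings n"
  by (rule colouringsI[where x = "p + q + 1"]) (use p assms in \<open>auto simp: two_row_point_def n\<close>)

lemma two_row_point_inj:
  assumes "a \<le> 1"
  shows "inj_on (\<lambda>x. (coli \<mu> x, two_row_point p q a s x)) {1..n}"
proof (rule inj_onI)
  fix x y assume x: "x \<in> {1..n}" and y: "y \<in> {1..n}"
    and eq: "(coli \<mu> x, two_row_point p q a s x) = (coli \<mu> y, two_row_point p q a s y)"
  have c: "(if x \<le> p + q then x - 1 else x - (p + q) - 1) = (if y \<le> p + q then y - 1 else y - (p + q) - 1)"
    using eq two_row_coli x y by auto
  have d: "two_row_point p q a s x = two_row_point p q a s y" using eq by simp
  show "x = y"
  proof (cases "x \<le> p + q \<longleftrightarrow> y \<le> p + q")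
    case True
    then show ?thesis using c x y by (auto split: if_splits)
  next
    case False
    have *: False if "x' \<le> p + q" "\<not> y' \<le> p + q" "x' \<in> {1..n}" "y' \<in> {1..n}"
      "x' - 1 = y' - (p + q) - 1" "two_row_point p q a s x' = two_row_point p q a s y'" for x' y'
    proof -
      have "y' = x' + (p + q)" "x' \<le> p" using that n by auto
      then show False using that(3,6) assms p n by (auto simp: two_row_point_def split: if_splits)
    qed
    from False show ?thesis
      using *[of x y] *[of y x] c d x y by (cases "x \<le> p + q") auto
  qed
qed

lemma two_row_zero_double:
  fixes v :: "(nat \<Rightarrow> nat) \<Rightarrow> 'a::field_char_0"
  assumes D: "\<And>a s. a \<le> 1 \<Longrightarrow> s \<le> q \<Longrightarrow> perm_act n (ysym \<mu>) v (two_row_point p q a s) = 0"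
    and c: "c \<in> colourings n" and x0: "x0 \<in> {1..n}" "c x0 = 2" "coli \<mu> x0 < p"
  shows "perm_act n (ysym \<mu>) v c = 0"
proof -
  let ?Q = "p + q + 1" and ?j = "coli \<mu> x0"
  have "\<exists>c1\<in>colourings n. (\<forall>v. perm_act n (ysym \<mu>) v c1 = (perm_act n (ysym \<mu>) v c :: 'a)) \<and>
    (\<forall>i. i < length \<mu> \<longrightarrow> 0 < \<mu> ! i \<longrightarrow> c1 (tableau \<mu> i 0) = c (tableau \<mu> i ?j))"
    by (rule swap_columns[OF two_row_sum c]) (use x0(3) p in \<open>auto simp: \<mu> less_Suc_eq\<close>)
  then obtain c1 where c1: "c1 \<in> colourings n" "\<And>v. perm_act n (ysym \<mu>) v c1 = (perm_act n (ysym \<mu>) v c :: 'a)"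
    "\<And>i. i < length \<mu> \<Longrightarrow> 0 < \<mu> ! i \<Longrightarrow> c1 (tableau \<mu> i 0) = c (tableau \<mu> i ?j)" by blast
  have x0': "tableau \<mu> (rowi \<mu> x0) ?j = x0" "rowi \<mu> x0 < length \<mu>"
    using tableau_rowi_coli[of x0 \<mu>] x0(1) two_row_sum by auto
  have "0 < \<mu> ! rowi \<mu> x0" using x0'(2) p by (auto simp: \<mu> less_Suc_eq)
  then have "c1 (tableau \<mu> (rowi \<mu> x0) 0) = 2" using c1(3)[OF x0'(2)] x0' x0(2) by simp
  moreover have "tableau \<mu> (rowi \<mu> x0) 0 = 1 \<or> tableau \<mu> (rowi \<mu> x0) 0 = ?Q"
    using two_row_rowi[OF x0(1)] by (simp add: \<mu>)
  ultimately have two1: "c1 1 = 2 \<or> c1 ?Q = 2" by auto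
  then have le1: "c1 x \<le> 1" if "x \<noteq> 1" "x \<noteq> ?Q" for x using colouring_two(1)[OF c1(1)] that by blast
  have "\<exists>c'\<in>colourings n. \<exists>s\<le>p + q - p. (\<forall>v. perm_act n (ysym \<mu>) v c' = (perm_act n (ysym \<mu>) v c1 :: 'a)) \<and>
    (\<forall>j. p \<le> j \<longrightarrow> j < p + q \<longrightarrow> c' (Suc j) = (if j < p + s then 1 else 0)) \<and>
    (\<forall>x\<in>{1..n}. coli \<mu> x < p \<longrightarrow> c' x = c1 x)"
    by (rule sort_singles[OF two_row_sum c1(1) \<mu>]) (use le1 p in auto)
  then obtain c2 s where c2: "c2 \<in> colourings n" "s \<le> q" "\<And>v. perm_act n (ysym \<mu>) v c2 = (perm_act n (ysym \<mu>) v c :: 'a)"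
    "\<And>j. p \<le> j \<Longrightarrow> j < p + q \<Longrightarrow> c2 (Suc j) = (if j < p + s then 1 else 0)"
    "\<And>x. x \<in> {1..n} \<Longrightarrow> coli \<mu> x < p \<Longrightarrow> c2 x = c1 x" using c1(2) by auto
  have "c2 1 = c1 1" "c2 ?Q = c1 ?Q" using c2(5)[of 1] c2(5)[of ?Q] p n two_row_coli by auto
  with two1 have two2: "c2 1 = 2 \<or> c2 ?Q = 2" by simp
  then have le2: "c2 x \<le> 1" if "x \<noteq> 1" "x \<noteq> ?Q" for x using colouring_two(1)[OF c2(1)] that by blast
  have "perm_act n (ysym \<mu>) v c2 = 0"
  proof (cases "inj_on (\<lambda>x. (coli \<mu> x, c2 x)) {1..n}")
    case False
    then show ?thesis by (rule not_inj_zero[OF two_row_sum])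
  next
    case True
    have ne: "c2 x \<noteq> c2 (x + (p + q))" if x: "1 \<le> x" "x \<le> p" for x
    proof
      assume "c2 x = c2 (x + (p + q))"
      moreover have "coli \<mu> x = coli \<mu> (x + (p + q))" using x n two_row_coli by simp
      ultimately have "x = x + (p + q)" using inj_onD[OF True, of x "x + (p + q)"] x n by simp
      with p show False by simp
    qed
    define a where "a = (if c2 1 = 2 then c2 ?Q else c2 1)"
    have neQ: "c2 1 \<noteq> c2 ?Q" using ne[of 1] p by (simp add: add.commute)
    have a: "a \<le> 1" using two2 neQ colouring_le[OF c2(1), of 1] colouring_le[OF c2(1), of ?Q] by (auto simp: a_def)
    show ?thesis
    proof (rule sorted_zero[OF two_row_sum c2(1) two_row_point_colouring[OF a c2(2)] two_row_point_inj[OF a] _ D[OF a c2(2)]])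
      fix x assume x: "x \<in> {1..n}"
      have cols: "coli \<mu> 1 = 0" "coli \<mu> ?Q = 0" using two_row_coli p n by auto
      consider "x = 1" | "x = ?Q" | "1 < x" "x \<le> p" | "p < x" "x \<le> p + q" | "?Q < x" "x \<le> n" using x by fastforce
      then show "\<exists>y\<in>{1..n}. coli \<mu> y = coli \<mu> x \<and> c2 y = two_row_point p q a s x"
      proof cases
        case 1
        then have "two_row_point p q a s x = a" using p by (simp add: two_row_point_def)
        then show ?thesis using 1 cols p n by (cases "c2 1 = 2") (auto simp: a_def intro: bexI[of _ ?Q] bexI[of _ 1])
      next
        case 2
        then have "two_row_point p q a s x = 2" by (simp add: two_row_point_def)
        then show ?thesis using 2 cols p n two2 by (cases "c2 1 = 2") (auto intro: bexI[of _ ?Q] bexI[of _ 1])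
      next
        case 3
        let ?y = "x + (p + q)"
        have "c2 x \<le> 1" "c2 ?y \<le> 1" "c2 x \<noteq> c2 ?y" using le2 ne 3 by auto
        moreover have "coli \<mu> ?y = coli \<mu> x" "?y \<in> {1..n}" using 3 two_row_coli n by auto
        moreover have "two_row_point p q a s x = 0" using 3 by (simp add: two_row_point_def)
        ultimately show ?thesis using x by (cases "c2 x = 0") (auto intro: bexI[of _ x] bexI[of _ ?y])
      next
        case 4
        then have "c2 x = two_row_point p q a s x" using c2(4)[of "x - 1"] p by (auto simp: two_row_point_def)
        then show ?thesis using x by blast
      next
        case 5
        let ?y = "x - (p + q)"
        have y: "1 < ?y" "?y \<le> p" "x = ?y + (p + q)" using 5 n by auto
        have "c2 x \<le> 1" "c2 ?y \<le> 1" using le2[of x] le2[of ?y] 5 y(1,2) by auto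
        moreover have "c2 ?y \<noteq> c2 x" using ne[of ?y] y by simp
        moreover have yN: "?y \<in> {1..n}" using y n by auto
        moreover have "coli \<mu> ?y = coli \<mu> x" unfolding two_row_coli[OF x] two_row_coli[OF yN] using y 5 by auto
        moreover have "two_row_point p q a s x = 1" using 5 n by (simp add: two_row_point_def)
        ultimately show ?thesis using x by (cases "c2 x = 0") (auto intro: bexI[of _ x] bexI[of _ ?y])
      qed
    qed
  qed
  then show ?thesis by (simp add: c2(3))
qed

lemma two_row_zero:
  fixes v :: "(nat \<Rightarrow> nat) \<Rightarrow> 'a::field_char_0"
  assumes D: "\<And>a s. a \<le> 1 \<Longrightarrow> s \<le> q \<Longrightarrow> perm_act n (ysym \<mu>) v (two_row_point p q a s) = 0"
    and c: "c \<in> colourings n"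
  shows "perm_act n (ysym \<mu>) v c = 0"
  using c
proof (cases rule: colouring_cases)
  case 1
  show ?thesis
    by (rule act_ysym_repeat[OF two_row_sum, of 1 "p + q + 1"]) (use 1 p n two_row_coli in auto)
next
  case (2 M)
  show ?thesis
  proof (cases "coli \<mu> M < p")
    case True
    then show ?thesis using two_row_zero_double[OF D c] 2 by blast
  next
    case False
    let ?Q = "p + q + 1"
    have M: "p < M" "M \<le> p + q" using False two_row_coli[OF 2(2)] 2(2) n by (auto split: if_splits)
    have zero: "perm_act n (ysym \<mu>) v (c \<circ> app (transp x M)) = 0"
      if x: "x \<in> {1..n}" "coli \<mu> x < p" for x
    proof (rule two_row_zero_double[OF D])
      have "transp x M \<in> Sym n" using x 2(2) by (auto simp: Sym_def app_transp permutes_swap_id)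
      then show "c \<circ> app (transp x M) \<in> colourings n" by (rule colourings_comp[OF c])
      show "(c \<circ> app (transp x M)) x = 2" using 2 by (simp add: app_transp)
    qed (use x in auto)
    have "perm_act n (ysym \<mu>) v c = perm_act n (ysym \<mu>) v (c \<circ> app (transp 1 M)) + perm_act n (ysym \<mu>) v (c \<circ> app (transp ?Q M))"
    proof (rule act_ysym_garnir[OF two_row_sum])
      show "rowi \<mu> 1 = rowi \<mu> M" using two_row_rowi[of 1] two_row_rowi[OF 2(2)] M p n by simp
      show "x = 1 \<or> x = ?Q" if "x \<in> {1..n}" "coli \<mu> x = coli \<mu> 1" for x
        using that two_row_coli[of 1] two_row_coli[OF that(1)] p n by (auto split: if_splits)
      show "x = M" if "x \<in> {1..n}" "coli \<mu> x = coli \<mu> M" for x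
        using that two_row_coli[OF 2(2)] two_row_coli[OF that(1)] M n by (auto split: if_splits)
      show "coli \<mu> 1 = coli \<mu> ?Q" using two_row_coli[of 1] two_row_coli[of ?Q] p n by simp
    qed (use M p n in auto)
    also have "\<dots> = 0" using zero[of 1] zero[of ?Q] two_row_coli[of 1] two_row_coli[of ?Q] p n by simp
    finally show ?thesis .
  qed
qed

lemma two_row_ones:
  assumes "a \<le> 1" "s \<le> q"
  shows "card {x \<in> {1..n}. two_row_point p q a s x = 1} = a + (p - 1) + s"
proof -
  have "{x \<in> {1..n}. two_row_point p q a s x = 1}
      = {x. x = 1 \<and> a = 1} \<union> {p + q + 2..2 * p + q} \<union> {p + 1..p + s}"
    using assms p n by (auto simp: two_row_point_def split: if_splits)
  also have "card \<dots> = card ({x. x = 1 \<and> a = 1} \<union> {p + q + 2..2 * p + q}) + card {p + 1..p + s}"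
    by (rule card_Un_disjoint) (use assms p in auto)
  also have "card ({x :: nat. x = 1 \<and> a = 1} \<union> {p + q + 2..2 * p + q}) = card {x :: nat. x = 1 \<and> a = 1} + card {p + q + 2..2 * p + q}"
    by (rule card_Un_disjoint) auto
  also have "card {x :: nat. x = 1 \<and> a = 1} = a" using assms(1) by (cases "a = 1") auto
  finally show ?thesis using p by simp
qed

lemma two_row_col_eq:
  assumes "r \<in> fixing n (coli \<mu>)" "r0 \<in> fixing n (coli \<mu>)"
    and "\<And>x. p + q < x \<Longrightarrow> x \<le> n \<Longrightarrow> app r x = app r0 x"
  shows "r = r0"
proof -
  have "app r x = app r0 x" for x
  proof (cases "x \<in> {1..n}")
    case False
    then show ?thesis using assms(1,2) by (auto simp: fixing_def Sym_def permutes_not_in)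
  next
    case True
    have in_col: "app r' x \<in> {1..n}" "coli \<mu> (app r' x) = coli \<mu> x" if "r' \<in> fixing n (coli \<mu>)" for r'
      using that True Sym_app_in[of r' n x] by (auto simp: fixing_def)
    show ?thesis
    proof (cases "x \<le> p + q")
      case False
      then show ?thesis using assms(3) True by auto
    next
      case top: True
      show ?thesis
      proof (rule ccontr)
        assume ne: "app r x \<noteq> app r0 x"
        have cs: "y = x \<or> (y = x + (p + q) \<and> x \<le> p)" if "y \<in> {1..n}" "coli \<mu> y = coli \<mu> x" for y
          using that two_row_coli[OF that(1)] two_row_coli[OF True] top True n by (auto split: if_splits)
        let ?y = "x + (p + q)"
        have xp: "x \<le> p" "{app r x, app r0 x} = {x, ?y}"
          using cs[OF in_col[OF assms(1)]] cs[OF in_col[OF assms(2)]] ne by auto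
        have y: "?y \<in> {1..n}" "coli \<mu> ?y = coli \<mu> x" using xp(1) True n two_row_coli[of ?y] two_row_coli[OF True] top by auto
        have "app r ?y = app r0 ?y" using assms(3) True y by auto
        moreover have "app r ?y \<in> {x, ?y}"
          using assms(1) y Sym_app_in[of r n ?y] cs[of "app r ?y"] by (auto simp: fixing_def)
        moreover have "app r ?y \<noteq> app r x" "app r0 ?y \<noteq> app r0 x"
          using p by (simp_all add: inj_eq[OF bij_is_inj[OF bij_app]])
        ultimately show False using xp(2) by (auto simp: doubleton_eq_iff)
      qed
    qed
  qed
  then have "app r = app r0" by auto
  then show ?thesis by (simp only: app_inject)
qed

lemma two_row_bottom:
  assumes "r \<in> fixing n (coli \<mu>)" "p + q < x" "x \<le> n"
  shows "app r x = x \<or> app r x = x - (p + q)"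
proof -
  have x: "x \<in> {1..n}" using assms by auto
  have "app r x \<in> {1..n}" "coli \<mu> (app r x) = coli \<mu> x"
    using assms(1) x Sym_app_in[of r n x] by (auto simp: fixing_def)
  then show ?thesis using two_row_coli[OF x] two_row_coli[of "app r x"] assms n by (auto split: if_splits)
qed

lemma two_row_sep:
  assumes "a \<le> 1" "s \<le> q"
  shows "\<exists>v :: (nat \<Rightarrow> nat) \<Rightarrow> 'a::field_char_0. perm_act n (ysym \<mu>) v (two_row_point p q a s) \<noteq> 0 \<and>
    (\<forall>a'\<le>1. \<forall>s'\<le>q. two_row_point p q a' s' \<noteq> two_row_point p q a s \<longrightarrow>
      perm_act n (ysym \<mu>) v (two_row_point p q a' s') = 0)"
proof -
  let ?Q = "p + q + 1"
  let ?D = "{two_row_point p q a s | a s. a \<le> 1 \<and> s \<le> q}"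
  let ?Y = "perm_act n (ysym \<mu>) :: (_ \<Rightarrow> 'a) \<Rightarrow> _"
  have S: "r \<in> Sym n" if "r \<in> fixing n f" for r f using that by (simp add: fixing_def)
  have upper: "\<exists>v. ?Y v (two_row_point p q 1 s) \<noteq> 0 \<and> (\<forall>d'\<in>?D. d' \<noteq> two_row_point p q 1 s \<longrightarrow> ?Y v d' = 0)"
    if s: "s \<le> q" for s
  proof -
    let ?d = "two_row_point p q 1 s" and ?r = "transp 1 ?Q"
    let ?t = "?d \<circ> app ?r"
    have r: "?r \<in> fixing n (coli \<mu>)"
      by (rule transp_fixing) (use p n two_row_coli in auto)
    have t1: "?t y = 1" if "p + q < y" "y \<le> n" for y
      using that p n by (auto simp: app_transp Transposition.transpose_def two_row_point_def)
    have bottom: "d' (app r' x) = 1"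
      if h: "r' \<in> fixing n (coli \<mu>)" "p' \<in> fixing n (rowi \<mu>)" "d' \<circ> app r' \<circ> app p' = ?t" "p + q < x" "x \<le> n" for r' p' d' x
    proof -
      have x: "x \<in> {1..n}" using h by auto
      obtain y where y: "y \<in> {1..n}" "rowi \<mu> y = rowi \<mu> x" "d' (app r' x) = ?t y"
        using comp_app_row[OF h(2,3) x] by blast
      have "p + q < y" using y(2) h(4) unfolding two_row_rowi[OF y(1)] two_row_rowi[OF x] by (simp split: if_splits)
      then show ?thesis using y t1 by simp
    qed
    have "?Y (point ?t) ?d \<noteq> 0"
    proof (rule evaluate_point_nonzero[OF two_row_sum _ r refl])
      fix r' p' assume h: "r' \<in> fixing n (coli \<mu>)" "p' \<in> fixing n (rowi \<mu>)" "?d \<circ> app r' \<circ> app p' = ?t"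
      show "r' = ?r"
      proof (rule two_row_col_eq[OF h(1) r])
        fix x assume x: "p + q < x" "x \<le> n"
        have d: "?d (app r' x) = 1" using bottom[OF h x] .
        show "app r' x = app ?r x"
        proof (cases "x = ?Q")
          case True
          then have "?d x = 2" by (simp add: two_row_point_def)
          with d have "app r' x \<noteq> x" by (metis numeral_eq_one_iff semiring_norm(85))
          then have "app r' x = 1" using two_row_bottom[OF h(1) x] True by simp
          then show ?thesis using True by (simp add: app_transp)
        next
          case False
          then have "?d (x - (p + q)) = 0" using x n by (auto simp: two_row_point_def)
          with d have "app r' x \<noteq> x - (p + q)" by (metis zero_neq_one)
          then have "app r' x = x" using two_row_bottom[OF h(1) x] by blast
          then show ?thesis using False x p by (simp add: app_transp Transposition.transpose_def)
        qed
      qed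
    qed
    moreover have "?Y (point ?t) d' = 0" if d': "d' \<in> ?D" "d' \<noteq> ?d" for d'
    proof (rule evaluate_point_zero[OF two_row_sum])
      obtain a' s' where as: "d' = two_row_point p q a' s'" "a' \<le> 1" "s' \<le> q" using d' by blast
      fix r' p' assume h: "r' \<in> fixing n (coli \<mu>)" "p' \<in> fixing n (rowi \<mu>)" "d' \<circ> app r' \<circ> app p' = ?t"
      have "card {x \<in> {1..n}. d' x = 1} = card {x \<in> {1..n}. ?d x = 1}"
        using comp_app_card[OF S[OF h(1)] S[OF h(2)] h(3), of 1] comp_app_card[OF S[OF r] Sym_zero, of ?d ?t 1]
        by (simp add: zero_fperm.rep_eq)
      then have ones: "a' + s' = 1 + s" using two_row_ones[of a' s'] two_row_ones[of 1 s] as s by simp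
      have "d' (app r' ?Q) = 1" using bottom[OF h] p n by simp
      moreover have "app r' ?Q = ?Q \<or> app r' ?Q = 1" using two_row_bottom[OF h(1), of ?Q] p n by simp
      ultimately have "a' = 1" using as p by (auto simp: two_row_point_def split: if_splits)
      with ones d'(2) as show False by simp
    qed
    ultimately show ?thesis by blast
  qed
  let ?d = "two_row_point p q a s"
  have "\<exists>v. ?Y v ?d \<noteq> 0 \<and> (\<forall>d'\<in>?D. d' \<noteq> ?d \<longrightarrow> ?Y v d' = 0)"
  proof (rule separation_by_stages[where ?D2.0 = "{two_row_point p q 1 s | s. s \<le> q}"])
    show "?Y (\<lambda>c. v c - k * w c) c = ?Y v c - k * ?Y w c" for v w k c
      using act_fun_linear[where A = "{()}" and k = "\<lambda>_. k" and w = "\<lambda>_. w"] by simp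
    show "\<exists>v. ?Y v ?d \<noteq> 0 \<and> (\<forall>d'\<in>?D. d' \<noteq> ?d \<longrightarrow> ?Y v d' = 0)" if "?d \<in> {two_row_point p q 1 s | s. s \<le> q}"
      using that upper by force
    show "?d \<in> ?D" using assms by blast
    assume *: "?d \<notin> {two_row_point p q 1 s | s. s \<le> q}"
    have a: "a = 0"
    proof (rule ccontr)
      assume "a \<noteq> 0"
      then have "a = 1" using assms(1) by linarith
      with * assms(2) show False by blast
    qed
    let ?e = "two_row_point p q 1 (s - 1)"
    have eD: "?e \<in> ?D" using assms by (intro CollectI exI[of _ 1] exI[of _ "s - 1"]) auto
    have "?e 1 \<noteq> ?d 1" using p a by (simp add: two_row_point_def)
    then have ed: "?e \<noteq> ?d" by metis
    have "?Y (point ?d) ?d \<noteq> 0"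
    proof (rule evaluate_point_nonzero[OF two_row_sum, where ?q0.0 = 0])
      fix r' p' assume h: "r' \<in> fixing n (coli \<mu>)" "p' \<in> fixing n (rowi \<mu>)" "?d \<circ> app r' \<circ> app p' = ?d"
      show "r' = 0"
      proof (rule two_row_col_eq[OF h(1) fixing_zero])
        fix x assume x: "p + q < x" "x \<le> n"
        then have xN: "x \<in> {1..n}" by auto
        obtain y where y: "y \<in> {1..n}" "rowi \<mu> y = rowi \<mu> x" "?d (app r' x) = ?d y"
          using comp_app_row[OF h(2,3) xN] by blast
        have "p + q < y" using y(2) x(1) unfolding two_row_rowi[OF y(1)] two_row_rowi[OF xN] by (simp split: if_splits)
        then have "?d (app r' x) \<noteq> 0" using y n by (simp add: two_row_point_def)
        moreover have "?d (x - (p + q)) = 0" using x n a by (simp add: two_row_point_def)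
        ultimately have "app r' x \<noteq> x - (p + q)" by metis
        then have "app r' x = x" using two_row_bottom[OF h(1) x] by blast
        then show "app r' x = app 0 x" by (simp add: zero_fperm.rep_eq)
      qed
    qed (simp_all add: zero_fperm.rep_eq)
    moreover have "?Y (point ?d) d' = 0" if d': "d' \<in> ?D" "d' \<noteq> ?d" "d' \<noteq> ?e" for d'
    proof (rule evaluate_point_zero[OF two_row_sum])
      obtain a' s' where as: "d' = two_row_point p q a' s'" "a' \<le> 1" "s' \<le> q" using d' by blast
      fix r' p' assume h: "r' \<in> fixing n (coli \<mu>)" "p' \<in> fixing n (rowi \<mu>)" "d' \<circ> app r' \<circ> app p' = ?d"
      have "card {x \<in> {1..n}. d' x = 1} = card {x \<in> {1..n}. ?d x = 1}"
        using comp_app_card[OF S[OF h(1)] S[OF h(2)] h(3), of 1] by simp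
      then have ones: "a' + s' = s" using two_row_ones[of a' s'] two_row_ones[of a s] as assms a by simp
      show False
      proof (cases "a' = 0")
        case True
        with ones as d'(2) a show False by simp
      next
        case False
        then have "a' = 1" "s' = s - 1" using as ones by auto
        with as d'(3) show False by simp
      qed
    qed
    moreover have "\<exists>w. ?Y w ?e \<noteq> 0 \<and> (\<forall>d'\<in>?D. d' \<noteq> ?e \<longrightarrow> ?Y w d' = 0)"
      by (rule upper) (use assms in simp)
    ultimately show "\<exists>v e. ?Y v ?d \<noteq> 0 \<and> e \<in> ?D \<and> e \<noteq> ?d \<and>
        (\<forall>d'\<in>?D. d' \<noteq> ?d \<longrightarrow> d' \<noteq> e \<longrightarrow> ?Y v d' = 0) \<and> (\<exists>w. ?Y w e \<noteq> 0 \<and> (\<forall>d'\<in>?D. d' \<noteq> e \<longrightarrow> ?Y w d' = 0))"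
      using eD ed by (intro exI[of _ "point ?d"] exI[of _ ?e]) blast
  qed
  then show ?thesis by blast
qed

theorem two_row_multiplicity:
  "(\<Sum>s\<in>Sym n. Poly_Mapping.lookup (esym \<mu>) s * colouring_char n (app s))
    = (hook_const \<mu> * of_nat (2 * (q + 1)) :: 'a::field_char_0)"
proof -
  let ?D = "(\<lambda>(a, s). two_row_point p q a s) ` ({0..1} \<times> {0..q})"
  have inj: "inj_on (\<lambda>(a, s). two_row_point p q a s) ({0..1} \<times> {0..q})"
  proof (rule inj_onI)
    fix z z' assume z: "z \<in> {0..1} \<times> {0..q}" "z' \<in> {0..1} \<times> {0..q}"
      and eq: "(case z of (a, s) \<Rightarrow> two_row_point p q a s) = (case z' of (a, s) \<Rightarrow> two_row_point p q a s)"
    obtain a s a' s' where as: "z = (a, s)" "z' = (a', s')" by (cases z, cases z') auto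
    have e: "two_row_point p q a s = two_row_point p q a' s'" using eq as by simp
    have "a = a'" using fun_cong[OF e, of 1] p by (auto simp: two_row_point_def split: if_splits)
    moreover have "a + (p - 1) + s = a' + (p - 1) + s'"
      using two_row_ones[of a s] two_row_ones[of a' s'] z as e by auto
    ultimately show "z = z'" using as by simp
  qed
  have "(\<Sum>s\<in>Sym n. Poly_Mapping.lookup (esym \<mu>) s * colouring_char n (app s))
    = (hook_const \<mu> * of_nat (card ?D) :: 'a)"
  proof (rule trace_by_evaluation[OF two_row_partition])
    show "?D \<subseteq> colourings n" using two_row_point_colouring by auto
    show "perm_act n (ysym \<mu>) v c = 0" if "\<And>d. d \<in> ?D \<Longrightarrow> perm_act n (ysym \<mu>) v d = 0" "c \<in> colourings n"
      for v :: "(nat \<Rightarrow> nat) \<Rightarrow> 'a" and c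
      by (rule two_row_zero[OF _ that(2)], rule that(1)) force
    show "\<exists>v :: (nat \<Rightarrow> nat) \<Rightarrow> 'a. perm_act n (ysym \<mu>) v d \<noteq> 0 \<and> (\<forall>d'\<in>?D. d' \<noteq> d \<longrightarrow> perm_act n (ysym \<mu>) v d' = 0)"
      if d: "d \<in> ?D" for d
    proof -
      obtain a s where "d = two_row_point p q a s" "a \<le> 1" "s \<le> q" using d by auto
      then show ?thesis using two_row_sep[of a s, where 'a = 'a] by auto
    qed
  qed
  also have "card ?D = 2 * (q + 1)" using inj by (simp add: card_image)
  finally show ?thesis .
qed

end


subsection \<open>Three rows\<close>

definition three_row_point :: "nat \<Rightarrow> nat \<Rightarrow> nat \<Rightarrow> nat \<Rightarrow> nat"
  where "three_row_point p q s x = (if x = 2 * p + q + 1 then 2 else if p + q < x \<and> x \<le> 2 * p + q then 1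
    else if p < x \<and> x \<le> p + s then 1 else 0)"

context
  fixes p q n :: nat and \<mu> :: "nat list"
  assumes p: "1 \<le> p" and \<mu>: "\<mu> = [p + q, p, 1]" and n: "n = 2 * p + q + 1"
begin

lemma three_row_sum: "sum_list \<mu> = n"
  by (simp add: \<mu> n)

lemma three_row_partition: "\<mu> \<in> partitions n"
  using p by (auto simp: partitions_def \<mu> n)

lemma three_row_coli: "x \<in> {1..n} \<Longrightarrow>
    coli \<mu> x = (if x \<le> p + q then x - 1 else if x \<le> 2 * p + q then x - (p + q) - 1 else 0)"
  by (auto simp: \<mu> n)

lemma three_row_rowi: "x \<in> {1..n} \<Longrightarrow>
    rowi \<mu> x = (if x \<le> p + q then 0 else if x \<le> 2 * p + q then 1 else 2)"
  by (auto simp: \<mu> n)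

lemma three_row_point_colouring:
  assumes "s \<le> q"
  shows "three_row_point p q s \<in> colourings n"
  by (rule colouringsI[where x = n]) (use p assms in \<open>auto simp: three_row_point_def n\<close>)

lemma three_row_column:
  assumes "x \<in> {1..n}" "y \<in> {1..n}" "coli \<mu> x = coli \<mu> y" "rowi \<mu> x \<le> rowi \<mu> y" "x \<noteq> y"
  shows "x \<le> p \<and> y = x + (p + q) \<or> x = 1 \<and> y = n \<or> x = p + q + 1 \<and> y = n"
proof -
  have c: "(if x \<le> p + q then x - 1 else if x \<le> 2 * p + q then x - (p + q) - 1 else 0)
      = (if y \<le> p + q then y - 1 else if y \<le> 2 * p + q then y - (p + q) - 1 else 0)"
    using assms(3) unfolding three_row_coli[OF assms(1)] three_row_coli[OF assms(2)] .
  have r: "(if x \<le> p + q then 0 else if x \<le> 2 * p + q then 1 else 2)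
      \<le> (if y \<le> p + q then 0 else if y \<le> 2 * p + q then 1 else (2 :: nat))"
    using assms(4) unfolding three_row_rowi[OF assms(1)] three_row_rowi[OF assms(2)] .
  have x: "1 \<le> x" "x \<le> n" and y: "1 \<le> y" "y \<le> n" using assms by auto
  show ?thesis
  proof (cases "y \<le> p + q")
    case True
    then have "x = y" using r c x y by (auto split: if_splits)
    with assms(5) show ?thesis ..
  next
    case y1: False
    show ?thesis
    proof (cases "y \<le> 2 * p + q")
      case True
      then show ?thesis using y1 r c x y assms(5) n by (auto split: if_splits)
    next
      case False
      then have "y = n" using y n by simp
      moreover have "x = 1 \<or> x = p + q + 1"
        using False y1 c x assms(5) n \<open>y = n\<close> by (auto split: if_splits)
      ultimately show ?thesis by blast
    qed
  qed
qed

lemma three_row_point_inj: "s \<le> q \<Longrightarrow> inj_on (\<lambda>x. (coli \<mu> x, three_row_point p q s x)) {1..n}"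
proof (rule inj_onI)
  fix x y assume s: "s \<le> q" and x: "x \<in> {1..n}" and y: "y \<in> {1..n}"
    and eq: "(coli \<mu> x, three_row_point p q s x) = (coli \<mu> y, three_row_point p q s y)"
  have *: False if "x \<in> {1..n}" "y \<in> {1..n}" "coli \<mu> x = coli \<mu> y" "rowi \<mu> x \<le> rowi \<mu> y" "x \<noteq> y"
    "three_row_point p q s x = three_row_point p q s y" for x y
  proof -
    from three_row_column[OF that(1-5)] show False
    proof (elim disjE conjE)
      assume "x \<le> p" "y = x + (p + q)"
      then have "three_row_point p q s x = 0" "three_row_point p q s y = 1"
        using that(1) p by (auto simp: three_row_point_def)
      with that(6) show False by simp
    next
      assume "x = 1" "y = n"
      then have "three_row_point p q s x = 0" "three_row_point p q s y = 2"
        using p by (auto simp: three_row_point_def n)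
      with that(6) show False by simp
    next
      assume "x = p + q + 1" "y = n"
      then have "three_row_point p q s x = 1" "three_row_point p q s y = 2"
        using p by (auto simp: three_row_point_def n)
      with that(6) show False by simp
    qed
  qed
  show "x = y"
    using *[of x y] *[of y x] x y eq by (metis nle_le prod.inject)
qed

lemma three_row_zero:
  fixes v :: "(nat \<Rightarrow> nat) \<Rightarrow> 'a::field_char_0"
  assumes D: "\<And>s. s \<le> q \<Longrightarrow> perm_act n (ysym \<mu>) v (three_row_point p q s) = 0"
    and c: "c \<in> colourings n"
  shows "perm_act n (ysym \<mu>) v c = 0"
proof (cases "inj_on (\<lambda>x. (coli \<mu> x, c x)) {1..n}")
  case False
  then show ?thesis by (rule not_inj_zero[OF three_row_sum])
next
  case inj: True
  let ?Q = "p + q + 1"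
  have cols: "coli \<mu> 1 = 0" "coli \<mu> ?Q = 0" "coli \<mu> n = 0"
    using three_row_coli[of 1] three_row_coli[of ?Q] three_row_coli[of n] p n by auto
  have N: "1 \<in> {1..n}" "?Q \<in> {1..n}" "n \<in> {1..n}" using p n by auto
  have ne: "c 1 \<noteq> c ?Q" "c 1 \<noteq> c n" "c ?Q \<noteq> c n"
    using inj_onD[OF inj, of 1 ?Q] inj_onD[OF inj, of 1 n] inj_onD[OF inj, of ?Q n] cols N p n by auto
  have le: "c x \<le> 2" for x using c by (rule colouring_le)
  have two: "c 1 = 2 \<or> c ?Q = 2 \<or> c n = 2"
    using ne le[of 1] le[of ?Q] le[of n] by linarith
  then have le1: "c x \<le> 1" if "x \<noteq> 1" "x \<noteq> ?Q" "x \<noteq> n" for x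
    using colouring_two(1)[OF c] that by blast
  have "\<exists>c'\<in>colourings n. \<exists>s\<le>p + q - p. (\<forall>v. perm_act n (ysym \<mu>) v c' = (perm_act n (ysym \<mu>) v c :: 'a)) \<and>
    (\<forall>j. p \<le> j \<longrightarrow> j < p + q \<longrightarrow> c' (Suc j) = (if j < p + s then 1 else 0)) \<and>
    (\<forall>x\<in>{1..n}. coli \<mu> x < p \<longrightarrow> c' x = c x)"
    by (rule sort_singles[OF three_row_sum c \<mu>]) (use le1 p n in auto)
  then obtain c2 s where c2: "c2 \<in> colourings n" "s \<le> q" "\<And>v. perm_act n (ysym \<mu>) v c2 = (perm_act n (ysym \<mu>) v c :: 'a)"
    "\<And>j. p \<le> j \<Longrightarrow> j < p + q \<Longrightarrow> c2 (Suc j) = (if j < p + s then 1 else 0)"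
    "\<And>x. x \<in> {1..n} \<Longrightarrow> coli \<mu> x < p \<Longrightarrow> c2 x = c x" by auto
  have same: "c2 1 = c 1" "c2 ?Q = c ?Q" "c2 n = c n"
    using c2(5)[OF N(1)] c2(5)[OF N(2)] c2(5)[OF N(3)] cols p by auto
  have "perm_act n (ysym \<mu>) v c2 = 0"
  proof (rule sorted_zero[OF three_row_sum c2(1) three_row_point_colouring[OF c2(2)] three_row_point_inj[OF c2(2)] _ D[OF c2(2)]])
    fix x assume x: "x \<in> {1..n}"
    let ?d = "three_row_point p q s"
    have col0: "\<exists>y\<in>{1..n}. coli \<mu> y = 0 \<and> c2 y = k" if k: "k \<le> 2" for k
    proof -
      have "c2 1 = k \<or> c2 ?Q = k \<or> c2 n = k"
        unfolding same using ne le[of 1] le[of ?Q] le[of n] k by linarith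
      then show ?thesis using N cols by blast
    qed
    have "1 \<le> x" "x \<le> n" using x by auto
    then consider "x = 1 \<or> x = ?Q \<or> x = n" | "1 < x" "x \<le> p" | "p < x" "x \<le> p + q" | "?Q < x" "x < n"
      by linarith
    then show "\<exists>y\<in>{1..n}. coli \<mu> y = coli \<mu> x \<and> c2 y = ?d x"
    proof cases
      case 1
      then have "coli \<mu> x = 0" using cols by blast
      moreover have "?d x \<le> 2" by (simp add: three_row_point_def)
      ultimately show ?thesis using col0 by metis
    next
      case 2
      let ?y = "x + (p + q)"
      have y: "?y \<in> {1..n}" "coli \<mu> ?y = coli \<mu> x" "coli \<mu> x < p" "?y \<noteq> x"
        using 2 n x three_row_coli[of x] three_row_coli[of ?y] by auto
      have "c2 x = c x" "c2 ?y = c ?y" using c2(5) x y by auto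
      moreover have "c x \<le> 1" "c ?y \<le> 1" using le1[of x] le1[of ?y] 2 n p by auto
      moreover have "c x \<noteq> c ?y" using inj_onD[OF inj, of x ?y] x y by auto
      moreover have "?d x = 0" using 2 by (simp add: three_row_point_def)
      ultimately have "c2 x = ?d x \<or> c2 ?y = ?d x" by linarith
      then show ?thesis using x y by blast
    next
      case 3
      then have "c2 x = ?d x" using c2(4)[of "x - 1"] p by (auto simp: three_row_point_def)
      then show ?thesis using x by blast
    next
      case 4
      let ?y = "x - (p + q)"
      have y1: "1 < ?y" "?y \<le> p" "x = ?y + (p + q)" using 4 n by auto
      then have yN: "?y \<in> {1..n}" using n by auto
      have y: "coli \<mu> ?y = coli \<mu> x" "coli \<mu> x < p" "?y \<noteq> x"
        unfolding three_row_coli[OF x] three_row_coli[OF yN] using y1 4 n by auto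
      have "c2 x = c x" "c2 ?y = c ?y" using c2(5) x y yN by auto
      moreover have "c x \<le> 1" "c ?y \<le> 1" using le1[of x] le1[of ?y] 4 y1(1,2) n p by auto
      moreover have "c x \<noteq> c ?y" using inj_onD[OF inj, of x ?y] x y yN by auto
      moreover have "?d x = 1" using 4 n by (simp add: three_row_point_def)
      ultimately have "c2 x = ?d x \<or> c2 ?y = ?d x" by linarith
      then show ?thesis using x y yN by blast
    qed
  qed
  then show ?thesis by (simp add: c2(3))
qed

lemma three_row_ones:
  assumes "s \<le> q"
  shows "card {x \<in> {1..n}. three_row_point p q s x = 1} = p + s"
proof -
  have "{x \<in> {1..n}. three_row_point p q s x = 1} = {p + q + 1..2 * p + q} \<union> {p + 1..p + s}"
    using assms p n by (auto simp: three_row_point_def split: if_splits)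
  also have "card \<dots> = card {p + q + 1..2 * p + q} + card {p + 1..p + s}"
    by (rule card_Un_disjoint) (use assms in auto)
  finally show ?thesis by simp
qed

lemma three_row_sep:
  assumes s: "s \<le> q"
  shows "perm_act n (ysym \<mu>) (point (three_row_point p q s)) (three_row_point p q s) \<noteq> (0 :: 'a::field_char_0)"
    and "s' \<le> q \<Longrightarrow> s' \<noteq> s \<Longrightarrow> perm_act n (ysym \<mu>) (point (three_row_point p q s)) (three_row_point p q s') = (0 :: 'a)"
proof -
  let ?d = "three_row_point p q s"
  show "perm_act n (ysym \<mu>) (point ?d) ?d \<noteq> (0 :: 'a)"
  proof (rule evaluate_point_nonzero[OF three_row_sum, where ?q0.0 = 0])
    fix r p' assume h: "r \<in> fixing n (coli \<mu>)" "p' \<in> fixing n (rowi \<mu>)" "?d \<circ> app r \<circ> app p' = ?d"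
    have r: "app r x \<in> {1..n}" "coli \<mu> (app r x) = coli \<mu> x" if "x \<in> {1..n}" for x
      using h(1) that Sym_app_in[of r n x] by (auto simp: fixing_def)
    have inj: "app r x = app r y \<longleftrightarrow> x = y" for x y by (rule inj_eq[OF bij_is_inj[OF bij_app]])
    have val: "?d (app r x) = ?d x" if x: "x \<in> {1..n}" "p + q < x" for x
    proof -
      obtain y where y: "y \<in> {1..n}" "rowi \<mu> y = rowi \<mu> x" "?d (app r x) = ?d y"
        using comp_app_row[OF h(2,3) x(1)] by blast
      have "?d y = ?d x"
        using y(2) x(2) y(1) x(1) n unfolding three_row_rowi[OF y(1)] three_row_rowi[OF x(1)]
        by (auto simp: three_row_point_def split: if_splits)
      with y show ?thesis by simp
    qed
    have low: "app r x = x" if x: "x \<in> {1..n}" "p + q < x" for x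
      using inj_onD[OF three_row_point_inj[OF s], of "app r x" x] val[OF x] r[OF x(1)] x(1) by simp
    have "app r x = x" for x
    proof (cases "x \<in> {1..n}")
      case False
      then show ?thesis using h(1) by (auto simp: fixing_def Sym_def permutes_not_in)
    next
      case True
      show ?thesis
      proof (rule ccontr)
        assume ne: "app r x \<noteq> x"
        then have "x \<le> p + q" using low[OF True] by fastforce
        have "app r (app r x) \<noteq> app r x" using ne inj by simp
        then have "app r x \<le> p + q" using low[of "app r x"] r(1)[OF True] by fastforce
        with \<open>x \<le> p + q\<close> have "rowi \<mu> (app r x) = rowi \<mu> x"
          using three_row_rowi[OF True] three_row_rowi[OF r(1)[OF True]] by simp
        then show False using cell_unique[of "app r x" \<mu> x] r[OF True] True three_row_sum ne by simp
      qed
    qed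
    then have "app r = app 0" by (auto simp: zero_fperm.rep_eq)
    then show "r = 0" by (simp only: app_inject)
  qed (simp_all add: zero_fperm.rep_eq)
  assume s': "s' \<le> q" "s' \<noteq> s"
  show "perm_act n (ysym \<mu>) (point ?d) (three_row_point p q s') = (0 :: 'a)"
  proof (rule evaluate_point_zero[OF three_row_sum])
    fix r p' assume h: "r \<in> fixing n (coli \<mu>)" "p' \<in> fixing n (rowi \<mu>)" "three_row_point p q s' \<circ> app r \<circ> app p' = ?d"
    have "p + s' = p + s"
      using comp_app_card[OF _ _ h(3), of n 1] h(1,2) three_row_ones[OF s] three_row_ones[OF s'(1)]
      by (simp add: fixing_def)
    with s' show False by simp
  qed
qed

theorem three_row_multiplicity:
  "(\<Sum>s\<in>Sym n. Poly_Mapping.lookup (esym \<mu>) s * colouring_char n (app s))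
    = (hook_const \<mu> * of_nat (q + 1) :: 'a::field_char_0)"
proof -
  let ?D = "three_row_point p q ` {0..q}"
  have inj: "inj_on (three_row_point p q) {0..q}"
  proof (rule inj_onI)
    fix s s' assume s: "s \<in> {0..q}" "s' \<in> {0..q}" and eq: "three_row_point p q s = three_row_point p q s'"
    have "p + s = p + s'"
      using three_row_ones[of s] three_row_ones[of s'] s unfolding eq by simp
    then show "s = s'" by simp
  qed
  have "(\<Sum>s\<in>Sym n. Poly_Mapping.lookup (esym \<mu>) s * colouring_char n (app s))
    = (hook_const \<mu> * of_nat (card ?D) :: 'a)"
  proof (rule trace_by_evaluation[OF three_row_partition])
    show "?D \<subseteq> colourings n" using three_row_point_colouring by auto
    show "perm_act n (ysym \<mu>) v c = 0" if "\<And>d. d \<in> ?D \<Longrightarrow> perm_act n (ysym \<mu>) v d = 0" "c \<in> colourings n"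
      for v :: "(nat \<Rightarrow> nat) \<Rightarrow> 'a" and c
      by (rule three_row_zero[OF _ that(2)], rule that(1)) force
    show "\<exists>v :: (nat \<Rightarrow> nat) \<Rightarrow> 'a. perm_act n (ysym \<mu>) v d \<noteq> 0 \<and> (\<forall>d'\<in>?D. d' \<noteq> d \<longrightarrow> perm_act n (ysym \<mu>) v d' = 0)"
      if d: "d \<in> ?D" for d
    proof -
      obtain s where s: "s \<le> q" "d = three_row_point p q s" using d by auto
      have "perm_act n (ysym \<mu>) (point d) d' = (0 :: 'a)" if d': "d' \<in> ?D" "d' \<noteq> d" for d'
      proof -
        obtain s' where "s' \<le> q" "d' = three_row_point p q s'" using d' by auto
        moreover from this have "s' \<noteq> s" using s d' by blast
        ultimately show ?thesis using three_row_sep(2)[OF s(1)] s(2) by blast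
      qed
      then show ?thesis using three_row_sep(1)[OF s(1), where 'a = 'a] s(2) by blast
    qed
  qed
  also have "card ?D = q + 1" using inj by (simp add: card_image)
  finally show ?thesis .
qed

end

subsection \<open>One row\<close>

definition one_row_point :: "nat \<Rightarrow> nat \<Rightarrow> nat"
  where "one_row_point s x = (if x = 1 then 2 else if 1 < x \<and> x \<le> s + 1 then 1 else 0)"

context
  fixes n :: nat and \<mu> :: "nat list"
  assumes n: "1 \<le> n" and \<mu>: "\<mu> = [n]"
begin

lemma one_row_sum: "sum_list \<mu> = n"
  by (simp add: \<mu>)

lemma one_row_partition: "\<mu> \<in> partitions n"
  using n by (auto simp: partitions_def \<mu>)

lemma one_row_coli: "x \<in> {1..n} \<Longrightarrow> coli \<mu> x = x - 1"
  by (simp add: \<mu>)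

lemma one_row_point_colouring: "s < n \<Longrightarrow> one_row_point s \<in> colourings n"
  by (rule colouringsI[where x = 1]) (auto simp: one_row_point_def)

lemma zero_colouring: "(\<lambda>x. 0) \<in> colourings m"
  by (simp add: colourings_def)

lemma one_row_zero:
  fixes v :: "(nat \<Rightarrow> nat) \<Rightarrow> 'a::field_char_0"
  assumes D: "\<And>s. s < n \<Longrightarrow> perm_act n (ysym \<mu>) v (one_row_point s) = 0" and z: "perm_act n (ysym \<mu>) v (\<lambda>x. 0) = 0"
    and c: "c \<in> colourings n"
  shows "perm_act n (ysym \<mu>) v c = 0"
  using c
proof (cases rule: colouring_cases)
  case 1
  then show ?thesis using z by simp
next
  case (2 x)
  have "\<exists>c1\<in>colourings n. (\<forall>v. perm_act n (ysym \<mu>) v c1 = (perm_act n (ysym \<mu>) v c :: 'a)) \<and>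
    (\<forall>i. i < length \<mu> \<longrightarrow> 0 < \<mu> ! i \<longrightarrow> c1 (tableau \<mu> i 0) = c (tableau \<mu> i (x - 1)))"
    by (rule swap_columns[OF one_row_sum c]) (use 2 n in \<open>auto simp: \<mu>\<close>)
  then obtain c1 where c1: "c1 \<in> colourings n" "\<And>v. perm_act n (ysym \<mu>) v c1 = (perm_act n (ysym \<mu>) v c :: 'a)"
    and c1': "\<forall>i. i < length \<mu> \<longrightarrow> 0 < \<mu> ! i \<longrightarrow> c1 (tableau \<mu> i 0) = c (tableau \<mu> i (x - 1))" by blast
  have "c1 1 = 2" using c1'[rule_format, of 0] 2 n by (simp add: \<mu>)
  then have le1: "c1 y \<le> 1" if "y \<noteq> 1" for y using colouring_two(1)[OF c1(1)] that by blast
  have "\<exists>c'\<in>colourings n. \<exists>s\<le>n - 1. (\<forall>v. perm_act n (ysym \<mu>) v c' = (perm_act n (ysym \<mu>) v c1 :: 'a)) \<and>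
    (\<forall>j. 1 \<le> j \<longrightarrow> j < n \<longrightarrow> c' (Suc j) = (if j < 1 + s then 1 else 0)) \<and>
    (\<forall>x\<in>{1..n}. coli \<mu> x < 1 \<longrightarrow> c' x = c1 x)"
    by (rule sort_singles[OF one_row_sum c1(1) \<mu>]) (use le1 in auto)
  then obtain c2 s where c2: "c2 \<in> colourings n" "s \<le> n - 1" "\<And>v. perm_act n (ysym \<mu>) v c2 = (perm_act n (ysym \<mu>) v c :: 'a)"
    "\<And>j. 1 \<le> j \<Longrightarrow> j < n \<Longrightarrow> c2 (Suc j) = (if j < 1 + s then 1 else 0)"
    "\<And>x. x \<in> {1..n} \<Longrightarrow> coli \<mu> x < 1 \<Longrightarrow> c2 x = c1 x" using c1(2) by auto
  have "c2 y = one_row_point s y" for y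
  proof -
    consider "y = 1" | "1 < y" "y \<le> n" | "y \<notin> {1..n}" by fastforce
    then show ?thesis
    proof cases
      case 1
      then show ?thesis using c2(5)[of 1] n one_row_coli[of 1] \<open>c1 1 = 2\<close> by (simp add: one_row_point_def)
    next
      case 2
      then show ?thesis using c2(4)[of "y - 1"] by (auto simp: one_row_point_def)
    next
      case 3
      then show ?thesis using colouring_out[OF c2(1) 3] c2(2) n by (auto simp: one_row_point_def)
    qed
  qed
  then have "c2 = one_row_point s" by blast
  then show ?thesis using D[of s] c2(2,3) n by (metis One_nat_def Suc_le_lessD Suc_pred le_imp_less_Suc)
qed

lemma one_row_ones: "s < n \<Longrightarrow> card {x \<in> {1..n}. one_row_point s x = 1} = s"
proof -
  assume "s < n"
  then have "{x \<in> {1..n}. one_row_point s x = 1} = {2..s + 1}"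
    by (auto simp: one_row_point_def split: if_splits)
  then show ?thesis by simp
qed

lemma one_row_self: "perm_act n (ysym \<mu>) (point d) d \<noteq> (0 :: 'a::field_char_0)"
proof (rule evaluate_point_nonzero[OF one_row_sum, where ?q0.0 = 0])
  fix r p' assume r: "r \<in> fixing n (coli \<mu>)"
  have "app r x = x" for x
  proof (cases "x \<in> {1..n}")
    case True
    then have "app r x \<in> {1..n}" "coli \<mu> (app r x) = coli \<mu> x"
      using r Sym_app_in[of r n x] by (auto simp: fixing_def)
    then show ?thesis using one_row_coli True by auto
  qed (use r in \<open>auto simp: fixing_def Sym_def permutes_not_in\<close>)
  then have "app r = app 0" by (auto simp: zero_fperm.rep_eq)
  then show "r = 0" by (simp only: app_inject)
qed (simp_all add: zero_fperm.rep_eq)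

lemma one_row_other:
  assumes "card {x \<in> {1..n}. d' x = k} \<noteq> card {x \<in> {1..n}. d x = k}"
  shows "perm_act n (ysym \<mu>) (point d) d' = (0 :: 'a::field_char_0)"
proof (rule evaluate_point_zero[OF one_row_sum])
  fix r p' assume h: "r \<in> fixing n (coli \<mu>)" "p' \<in> fixing n (rowi \<mu>)" "d' \<circ> app r \<circ> app p' = d"
  show False using comp_app_card[OF _ _ h(3), of n k] h(1,2) assms by (simp add: fixing_def)
qed

theorem one_row_multiplicity:
  "(\<Sum>s\<in>Sym n. Poly_Mapping.lookup (esym \<mu>) s * colouring_char n (app s))
    = (hook_const \<mu> * of_nat (n + 1) :: 'a::field_char_0)"
proof -
  let ?D = "insert (\<lambda>x. 0) (one_row_point ` {..<n})"
  have inj: "inj_on one_row_point {..<n}"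
  proof (rule inj_onI)
    fix s s' assume s: "s \<in> {..<n}" "s' \<in> {..<n}" and eq: "one_row_point s = one_row_point s'"
    show "s = s'" using one_row_ones[of s] one_row_ones[of s'] s unfolding eq by simp
  qed
  have nz: "one_row_point s \<noteq> (\<lambda>x. 0)" for s
  proof
    assume "one_row_point s = (\<lambda>x. 0)"
    from fun_cong[OF this, of 1] show False by (simp add: one_row_point_def)
  qed
  have twos: "card {x \<in> {1..n}. one_row_point s x = 2} = 1" for s
  proof -
    have "{x \<in> {1..n}. one_row_point s x = 2} = {1}" using n by (auto simp: one_row_point_def)
    then show ?thesis by simp
  qed
  have "(\<Sum>s\<in>Sym n. Poly_Mapping.lookup (esym \<mu>) s * colouring_char n (app s))
    = (hook_const \<mu> * of_nat (card ?D) :: 'a)"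
  proof (rule trace_by_evaluation[OF one_row_partition])
    show "?D \<subseteq> colourings n" using one_row_point_colouring zero_colouring by auto
    show "perm_act n (ysym \<mu>) v c = 0" if "\<And>d. d \<in> ?D \<Longrightarrow> perm_act n (ysym \<mu>) v d = 0" "c \<in> colourings n"
      for v :: "(nat \<Rightarrow> nat) \<Rightarrow> 'a" and c
      by (rule one_row_zero[OF _ _ that(2)]; rule that(1)) auto
    show "\<exists>v :: (nat \<Rightarrow> nat) \<Rightarrow> 'a. perm_act n (ysym \<mu>) v d \<noteq> 0 \<and> (\<forall>d'\<in>?D. d' \<noteq> d \<longrightarrow> perm_act n (ysym \<mu>) v d' = 0)"
      if d: "d \<in> ?D" for d
    proof (intro exI[of _ "point d"] conjI ballI impI one_row_self)
      fix d' assume d': "d' \<in> ?D" "d' \<noteq> d"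
      show "perm_act n (ysym \<mu>) (point d) d' = (0 :: 'a)"
      proof (cases "d = (\<lambda>x. 0) \<or> d' = (\<lambda>x. 0)")
        case True
        then show ?thesis using d d' twos by (intro one_row_other[where k = 2]) auto
      next
        case False
        then obtain s s' where "d = one_row_point s" "d' = one_row_point s'" "s < n" "s' < n" using d d' by auto
        then show ?thesis using one_row_ones d'(2) by (intro one_row_other[where k = 1]) auto
      qed
    qed
  qed
  also have "card ?D = n + 1"
  proof -
    have "(\<lambda>x. 0) \<notin> one_row_point ` {..<n}" using nz by (metis imageE)
    then show ?thesis using inj by (simp add: card_image)
  qed
  finally show ?thesis .
qed

end

subsection \<open>Other shapes\<close>

lemma other_shape_multiplicity:
  assumes \<mu>: "\<mu> \<in> partitions n" and big: "4 \<le> length \<mu> \<or> 3 \<le> length \<mu> \<and> 2 \<le> \<mu> ! 2"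
  shows "(\<Sum>s\<in>Sym n. Poly_Mapping.lookup (esym \<mu>) s * colouring_char n (app s)) = (0 :: 'a::field_char_0)"
proof -
  have n: "sum_list \<mu> = n" and sorted: "sorted_wrt (\<ge>) \<mu>" and pos: "\<forall>k\<in>set \<mu>. 1 \<le> k"
    using \<mu> by (auto simp: partitions_def)
  have zero: "perm_act n (ysym \<mu>) v c = 0" if c: "c \<in> colourings n" for v :: "(nat \<Rightarrow> nat) \<Rightarrow> 'a" and c
  proof (rule ccontr)
    assume nz: "perm_act n (ysym \<mu>) v c \<noteq> 0"
    have diff: "c (tableau \<mu> i j) \<noteq> c (tableau \<mu> i' j)"
      if "i < length \<mu>" "i' < length \<mu>" "j < \<mu> ! i" "j < \<mu> ! i'" "i \<noteq> i'" for i i' j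
    proof
      assume eq: "c (tableau \<mu> i j) = c (tableau \<mu> i' j)"
      have "tableau \<mu> i j \<noteq> tableau \<mu> i' j" using tableau_in[of i \<mu> j] tableau_in[of i' \<mu> j] that by metis
      then have "perm_act n (ysym \<mu>) v c = 0"
        using act_ysym_repeat[OF n, of "tableau \<mu> i j" "tableau \<mu> i' j" c v] eq that n
          tableau_in[of i \<mu> j] tableau_in[of i' \<mu> j] by simp
      with nz show False ..
    qed
    have le: "c x \<le> 2" for x using c by (rule colouring_le)
    have p0: "0 < \<mu> ! i" if "i < length \<mu>" for i using pos that by (metis less_eq_Suc_le One_nat_def nth_mem)
    from big show False
    proof
      assume l: "4 \<le> length \<mu>"
      then have L: "0 < length \<mu>" "1 < length \<mu>" "2 < length \<mu>" "3 < length \<mu>" by linarith+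
      note P = L[THEN p0]
      have "c (tableau \<mu> 0 0) \<noteq> c (tableau \<mu> 1 0)" by (rule diff[OF L(1,2) P(1,2)]) simp
      moreover have "c (tableau \<mu> 0 0) \<noteq> c (tableau \<mu> 2 0)" by (rule diff[OF L(1,3) P(1,3)]) simp
      moreover have "c (tableau \<mu> 0 0) \<noteq> c (tableau \<mu> 3 0)" by (rule diff[OF L(1,4) P(1,4)]) simp
      moreover have "c (tableau \<mu> 1 0) \<noteq> c (tableau \<mu> 2 0)" by (rule diff[OF L(2,3) P(2,3)]) simp
      moreover have "c (tableau \<mu> 1 0) \<noteq> c (tableau \<mu> 3 0)" by (rule diff[OF L(2,4) P(2,4)]) simp
      moreover have "c (tableau \<mu> 2 0) \<noteq> c (tableau \<mu> 3 0)" by (rule diff[OF L(3,4) P(3,4)]) simp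
      ultimately show False using le[of "tableau \<mu> 0 0"] le[of "tableau \<mu> 1 0"] le[of "tableau \<mu> 2 0"] le[of "tableau \<mu> 3 0"]
        by linarith
    next
      assume l: "3 \<le> length \<mu> \<and> 2 \<le> \<mu> ! 2"
      have "\<mu> ! 2 \<le> \<mu> ! 1" "\<mu> ! 2 \<le> \<mu> ! 0" using sorted l by (auto simp: sorted_wrt_iff_nth_less)
      then have rows: "j < \<mu> ! i" if "i \<le> 2" "j \<le> 1" for i j
      proof -
        have "i = 0 \<or> i = 1 \<or> i = 2" using that by linarith
        then show ?thesis using that l \<open>\<mu> ! 2 \<le> \<mu> ! 1\<close> \<open>\<mu> ! 2 \<le> \<mu> ! 0\<close> by auto
      qed
      have two: "\<exists>i\<le>2. c (tableau \<mu> i j) = 2" if j: "j \<le> 1" for j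
      proof -
        have L: "0 < length \<mu>" "1 < length \<mu>" "2 < length \<mu>" using l by linarith+
        have R: "j < \<mu> ! 0" "j < \<mu> ! 1" "j < \<mu> ! 2" by (rule rows; use j in simp)+
        have "c (tableau \<mu> 0 j) \<noteq> c (tableau \<mu> 1 j)" by (rule diff[OF L(1,2) R(1,2)]) simp
        moreover have "c (tableau \<mu> 0 j) \<noteq> c (tableau \<mu> 2 j)" by (rule diff[OF L(1,3) R(1,3)]) simp
        moreover have "c (tableau \<mu> 1 j) \<noteq> c (tableau \<mu> 2 j)" by (rule diff[OF L(2,3) R(2,3)]) simp
        ultimately have "c (tableau \<mu> 0 j) = 2 \<or> c (tableau \<mu> 1 j) = 2 \<or> c (tableau \<mu> 2 j) = 2"
          using le[of "tableau \<mu> 0 j"] le[of "tableau \<mu> 1 j"] le[of "tableau \<mu> 2 j"] by linarith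
        then show ?thesis by (metis le_refl one_le_numeral zero_le)
      qed
      obtain i i' where i: "i \<le> 2" "c (tableau \<mu> i 0) = 2" "i' \<le> 2" "c (tableau \<mu> i' 1) = 2"
        using two[of 0] two[of 1] by auto
      have "coli \<mu> (tableau \<mu> i 0) = 0" "coli \<mu> (tableau \<mu> i' 1) = 1"
        using tableau_in[of i \<mu> 0] tableau_in[of i' \<mu> 1] rows i l by auto
      then have "tableau \<mu> i' 1 \<noteq> tableau \<mu> i 0" by (metis zero_neq_one)
      then have "c (tableau \<mu> i' 1) \<le> 1" using colouring_two(1)[OF c i(2)] by blast
      with i(4) show False by simp
    qed
  qed
  have "(\<Sum>s\<in>Sym n. Poly_Mapping.lookup (esym \<mu>) s * colouring_char n (app s)) = (hook_const \<mu> * of_nat (card ({} :: (nat \<Rightarrow> nat) set)) :: 'a)"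
    by (rule trace_by_evaluation[OF \<mu>]) (use zero in auto)
  then show ?thesis by simp
qed


section \<open>Identities, codimensions and cocharacter\<close>

lemma colourings_edges: "colourings n = insert (\<lambda>x. 0) (edge_colourings n)"
  "(\<lambda>x. 0) \<notin> edge_colourings n"
proof -
  have zero: "(\<lambda>x. 0) \<in> colourings n" by (simp add: colourings_def)
  have edge: "c \<in> edge_colourings n \<longleftrightarrow> (\<forall>x. x \<notin> {1..n} \<longrightarrow> c x = 0) \<and> (\<forall>x. c x \<le> 2) \<and> (\<exists>!x. c x = 2)" for c
    unfolding edge_colourings_def lattice_colourings_def by blast
  show "(\<lambda>x. 0) \<notin> edge_colourings n" by (simp add: edge_colourings_def)
  show "colourings n = insert (\<lambda>x. 0) (edge_colourings n)"
    using zero unfolding set_eq_iff insert_iff edge unfolding colourings_def mem_Collect_eq fun_eq_iff by blast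
qed

lemma colouring_char_edges: "colouring_char n \<sigma> = (of_nat (Suc (card {c \<in> edge_colourings n. c \<circ> \<sigma> = c})) :: 'a::field)"
proof -
  have "{c \<in> colourings n. c \<circ> \<sigma> = c} = insert (\<lambda>x. 0) {c \<in> edge_colourings n. c \<circ> \<sigma> = c}"
    unfolding colourings_edges(1) by auto
  then show ?thesis using finite_edge_vertex(1)[of n] colourings_edges(2)[of n] by (simp add: colouring_char_def)
qed

text \<open>
  Composition with the conjugating permutation exchanges the two sets of fixed colourings.
\<close>

lemma colouring_char_conj:
  assumes "t \<in> Sym n" "u \<in> Sym n"
  shows "colouring_char n (app (u + t - u)) = colouring_char n (app t)"
proof -
  have mu: "- u \<in> Sym n" using assms(2) by (simp add: Sym_uminus)
  have inv: "app u \<circ> app (- u) = id" "app (- u) \<circ> app u = id"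
    by (rule ext, simp)+
  have inv': "f \<circ> app u \<circ> app (- u) = f" "f \<circ> app (- u) \<circ> app u = f" for f :: "nat \<Rightarrow> nat"
    using inv by (simp_all add: comp_assoc)
  have eq: "app (u + t - u) = app u \<circ> app t \<circ> app (- u)"
    by (rule ext) (simp only: diff_conv_add_uminus app_plus comp_apply)
  have "card {c \<in> colourings n. c \<circ> app (u + t - u) = c} = card {c \<in> colourings n. c \<circ> app t = c}"
  proof (rule bij_betw_same_card[of "\<lambda>c. c \<circ> app u"], rule bij_betwI[where g = "\<lambda>c. c \<circ> app (- u)"])
    show "(\<lambda>c. c \<circ> app u) \<in> {c \<in> colourings n. c \<circ> app (u + t - u) = c} \<rightarrow> {c \<in> colourings n. c \<circ> app t = c}"
    proof
      fix c assume c: "c \<in> {c \<in> colourings n. c \<circ> app (u + t - u) = c}"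
      have "c \<circ> app u \<circ> app t \<circ> app (- u) \<circ> app u = c \<circ> app u" using c by (simp add: eq comp_assoc)
      then have "c \<circ> app u \<circ> app t = c \<circ> app u" by (simp only: inv')
      then show "c \<circ> app u \<in> {c \<in> colourings n. c \<circ> app t = c}" using c colourings_comp[OF _ assms(2)] by simp
    qed
    show "(\<lambda>c. c \<circ> app (- u)) \<in> {c \<in> colourings n. c \<circ> app t = c} \<rightarrow> {c \<in> colourings n. c \<circ> app (u + t - u) = c}"
    proof
      fix c assume c: "c \<in> {c \<in> colourings n. c \<circ> app t = c}"
      have "c \<circ> app (- u) \<circ> app (u + t - u) = c \<circ> app (- u) \<circ> app u \<circ> app t \<circ> app (- u)" by (simp only: eq comp_assoc)
      also have "\<dots> = c \<circ> app (- u)" using c by (simp add: inv')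
      finally show "c \<circ> app (- u) \<in> {c \<in> colourings n. c \<circ> app (u + t - u) = c}" using c colourings_comp[OF _ mu] by simp
    qed
  qed (simp_all only: inv')
  then show ?thesis by (simp add: colouring_char_def)
qed

definition multiplicity_at :: "nat list \<Rightarrow> nat"
  where "multiplicity_at \<mu> = (case \<mu> of [a] \<Rightarrow> a + 1 | [a, b] \<Rightarrow> 2 * (a - b + 1)
    | [a, b, c] \<Rightarrow> if c = 1 then a - b + 1 else 0 | _ \<Rightarrow> 0)"

lemma partition_shape:
  assumes "\<mu> \<in> partitions n" "1 \<le> n"
  obtains (one) "\<mu> = [n]" | (two) p q where "1 \<le> p" "\<mu> = [p + q, p]" "n = 2 * p + q"
    | (three) p q where "1 \<le> p" "\<mu> = [p + q, p, 1]" "n = 2 * p + q + 1"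
    | (other) "4 \<le> length \<mu> \<or> 3 \<le> length \<mu> \<and> 2 \<le> \<mu> ! 2"
proof -
  have m: "sorted_wrt (\<ge>) \<mu>" "\<forall>k\<in>set \<mu>. 1 \<le> k" "sum_list \<mu> = n" using assms(1) by (simp_all add: partitions_def)
  consider "\<mu> = []" | a where "\<mu> = [a]" | a b where "\<mu> = [a, b]" | a b c where "\<mu> = [a, b, c]"
    | a b c d r where "\<mu> = a # b # c # d # r"
    by (metis neq_Nil_conv)
  then show thesis
  proof cases
    case 1
    then show ?thesis using m(3) assms(2) by simp
  next
    case (2 a)
    then show ?thesis using m(3) by (intro one) simp
  next
    case (3 a b)
    then show ?thesis using m by (intro two[of b "a - b"]) auto
  next
    case (4 a b c)
    show ?thesis
    proof (cases "c = 1")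
      case True
      then show ?thesis using m 4 by (intro three[of b "a - b"]) auto
    next
      case False
      then have "2 \<le> c" using m(2) 4 by auto
      then show ?thesis using 4 by (intro other) simp
    qed
  next
    case 5
    then show ?thesis by (intro other) simp
  qed
qed

lemma colouring_multiplicity:
  assumes \<mu>: "\<mu> \<in> partitions n" and n: "1 \<le> n"
  shows "(\<Sum>s\<in>Sym n. Poly_Mapping.lookup (esym \<mu>) s * colouring_char n (app s))
    = hook_const \<mu> * (of_nat (multiplicity_at \<mu>) :: 'a::field_char_0)"
  using \<mu> n
proof (cases rule: partition_shape)
  case one
  then show ?thesis using one_row_multiplicity[where 'a = 'a, OF n one] by (simp add: multiplicity_at_def)
next
  case (two p q)
  have "multiplicity_at \<mu> = 2 * (q + 1)" unfolding two(2) by (simp add: multiplicity_at_def)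
  then show ?thesis using two_row_multiplicity[where 'a = 'a, OF two] by (simp only:)
next
  case (three p q)
  have "multiplicity_at \<mu> = q + 1" unfolding three(2) by (simp add: multiplicity_at_def)
  then show ?thesis using three_row_multiplicity[where 'a = 'a, OF three] by (simp only:)
next
  case other
  then have "multiplicity_at \<mu> = 0" by (auto simp: multiplicity_at_def split: list.splits)
  then show ?thesis using other_shape_multiplicity[where 'a = 'a, OF \<mu> other] by simp
qed

text \<open>
  Pairing with a Young symmetrizer isolates the multiplicity of its own shape; conversely the expansion of class functions reconstructs the character.
\<close>

lemma multiplicities_iff:
  assumes n: "1 \<le> n"
  shows "(\<forall>\<sigma>. \<sigma> permutes {1..n} \<longrightarrow>
      colouring_char n \<sigma> = (\<Sum>\<mu>\<in>partitions n. of_nat (m \<mu>) * (irr_char \<mu> \<sigma> :: 'a::field_char_0)))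
    \<longleftrightarrow> (\<forall>\<mu>\<in>partitions n. m \<mu> = multiplicity_at \<mu>)"
proof
  assume *: "\<forall>\<sigma>. \<sigma> permutes {1..n} \<longrightarrow>
      colouring_char n \<sigma> = (\<Sum>\<mu>\<in>partitions n. of_nat (m \<mu>) * (irr_char \<mu> \<sigma> :: 'a))"
  show "\<forall>\<mu>\<in>partitions n. m \<mu> = multiplicity_at \<mu>"
  proof
    fix \<nu> assume \<nu>: "\<nu> \<in> partitions n"
    have perm: "app s permutes {1..n}" if "s \<in> Sym n" for s
      using bij_betwE[OF bij_betw_app_Sym[of n]] that by blast
    have irr: "(\<Sum>s\<in>Sym n. Poly_Mapping.lookup (esym \<nu>) s * (irr_char \<mu> (app s) :: 'a)) = (if \<nu> = \<mu> then hook_const \<mu> else 0)"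
      if "\<mu> \<in> partitions n" for \<mu>
      by (rule esym_irr_char[OF \<nu> that])
    have "(\<Sum>s\<in>Sym n. Poly_Mapping.lookup (esym \<nu>) s * colouring_char n (app s))
        = (\<Sum>s\<in>Sym n. \<Sum>\<mu>\<in>partitions n. of_nat (m \<mu>) * (Poly_Mapping.lookup (esym \<nu>) s * (irr_char \<mu> (app s) :: 'a)))"
      using * perm by (intro sum.cong refl) (simp add: sum_distrib_left mult.left_commute)
    also have "\<dots> = (\<Sum>\<mu>\<in>partitions n. of_nat (m \<mu>) * (\<Sum>s\<in>Sym n. Poly_Mapping.lookup (esym \<nu>) s * irr_char \<mu> (app s)))"
      by (subst sum.swap) (simp add: sum_distrib_left)
    also have "\<dots> = (\<Sum>\<mu>\<in>partitions n. if \<nu> = \<mu> then of_nat (m \<mu>) * hook_const \<mu> else 0)"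
      by (intro sum.cong refl) (simp add: irr)
    also have "\<dots> = of_nat (m \<nu>) * hook_const \<nu>"
      using \<nu> finite_partitions by simp
    finally have "hook_const \<nu> * (of_nat (multiplicity_at \<nu>) :: 'a) = of_nat (m \<nu>) * hook_const \<nu>"
      using colouring_multiplicity[where 'a = 'a, OF \<nu> n] by simp
    then have "(of_nat (multiplicity_at \<nu>) :: 'a) = of_nat (m \<nu>)"
      using hook_const_nonzero[where 'a = 'a, OF \<nu>] by (simp add: mult.commute)
    then show "m \<nu> = multiplicity_at \<nu>" by simp
  qed
next
  assume m: "\<forall>\<mu>\<in>partitions n. m \<mu> = multiplicity_at \<mu>"
  show "\<forall>\<sigma>. \<sigma> permutes {1..n} \<longrightarrow>
      colouring_char n \<sigma> = (\<Sum>\<mu>\<in>partitions n. of_nat (m \<mu>) * (irr_char \<mu> \<sigma> :: 'a))"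
  proof (intro allI impI)
    fix \<sigma> :: "nat \<Rightarrow> nat" assume "\<sigma> permutes {1..n}"
    then have "\<sigma> \<in> app ` Sym n" using bij_betw_imp_surj_on[OF bij_betw_app_Sym[of n]] by blast
    then obtain t where t: "t \<in> Sym n" "\<sigma> = app t" by blast
    have "(colouring_char n (app t) :: 'a) = (\<Sum>\<mu>\<in>partitions n.
        (\<Sum>s\<in>Sym n. Poly_Mapping.lookup (esym \<mu>) s * colouring_char n (app s)) / hook_const \<mu> * irr_char \<mu> (app t))"
      by (rule class_function_expansion[OF colouring_char_conj t(1)])
    also have "\<dots> = (\<Sum>\<mu>\<in>partitions n. of_nat (m \<mu>) * irr_char \<mu> (app t))"
      using m hook_const_nonzero[where 'a = 'a] colouring_multiplicity[where 'a = 'a, OF _ n] by (intro sum.cong refl) simp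
    finally show "colouring_char n \<sigma> = (\<Sum>\<mu>\<in>partitions n. of_nat (m \<mu>) * (irr_char \<mu> \<sigma> :: 'a))"
      unfolding t(2) .
  qed
qed

lemma multiplicity_at_iff:
  assumes \<mu>: "\<mu> \<in> partitions n" and n: "1 \<le> n"
  shows "k = multiplicity_at \<mu> \<longleftrightarrow> (\<mu> = [n] \<longrightarrow> k = n + 1) \<and>
    (\<forall>p q. 1 \<le> p \<and> \<mu> = [p + q, p] \<longrightarrow> k = 2 * (q + 1)) \<and>
    (\<forall>p q. 1 \<le> p \<and> \<mu> = [p + q, p, 1] \<longrightarrow> k = q + 1) \<and>
    (\<mu> \<noteq> [n] \<and> (\<nexists>p q. 1 \<le> p \<and> (\<mu> = [p + q, p] \<or> \<mu> = [p + q, p, 1])) \<longrightarrow> k = 0)"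
  using \<mu> n
proof (cases rule: partition_shape)
  case one
  then show ?thesis by (simp add: multiplicity_at_def)
next
  case (two p q)
  then show ?thesis unfolding two(2) by (auto simp: multiplicity_at_def)
next
  case (three p q)
  then show ?thesis unfolding three(2) by (auto simp: multiplicity_at_def)
next
  case other
  then have "multiplicity_at \<mu> = 0" by (auto simp: multiplicity_at_def split: list.splits)
  moreover have "\<mu> \<noteq> [n]" "\<mu> \<noteq> [p + q, p]" "\<mu> \<noteq> [p + q, p, 1]" for p q using other by auto
  ultimately show ?thesis by (simp del: One_nat_def)
qed

theorem theorem21:
  fixes B :: "('a::field_char_0 ut2 \<Rightarrow> 'a ut2, 'a) free_alg set"
  defines "\<delta> \<equiv> letter (ut2_delta :: 'a ut2 \<Rightarrow> 'a ut2) :: ('a ut2 \<Rightarrow> 'a ut2, 'a) free_alg"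
    and "X \<equiv> dvar ut2_scale ut2_L B"
    and "act \<equiv> dpoly_act ut2_scale ut2_L B"
  assumes basis: "env_basis ut2_scale ut2_L B"
    and one: "1 \<in> B"
  shows
    "(\<forall>x y z w. distinct [x, y, z, w] \<longrightarrow>
        diff_ids ut2_scale B =
        T_ideal_gen ut2_scale ut2_L B
          {comm (X x 1) (X y 1) * comm (X z 1) (X w 1),
           act \<delta> (comm (X x 1) (X y 1)),
           X x \<delta> * comm (X y 1) (X z 1),
           X x \<delta> * X y \<delta>,
           X x (\<delta> * \<delta>)})
     \<and> (\<forall>n\<ge>1. codimension ut2_scale B n = 2 ^ (n - 1) * n + 1)
     \<and> (\<forall>n\<ge>1. \<forall>m :: nat list \<Rightarrow> nat.
        (\<forall>\<sigma>. \<sigma> permutes {1..n} \<longrightarrow>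
           cocharacter ut2_scale B n \<sigma> = (\<Sum>\<mu>\<in>partitions n. of_nat (m \<mu>) * irr_char \<mu> \<sigma>))
        \<longleftrightarrow>
        (\<forall>\<mu>\<in>partitions n.
           (\<mu> = [n] \<longrightarrow> m \<mu> = n + 1) \<and>
           (\<forall>p q. 1 \<le> p \<and> \<mu> = [p + q, p] \<longrightarrow> m \<mu> = 2 * (q + 1)) \<and>
           (\<forall>p q. 1 \<le> p \<and> \<mu> = [p + q, p, 1] \<longrightarrow> m \<mu> = q + 1) \<and>
           (\<mu> \<noteq> [n] \<and> (\<nexists>p q. 1 \<le> p \<and> (\<mu> = [p + q, p] \<or> \<mu> = [p + q, p, 1])) \<longrightarrow> m \<mu> = 0)))"
proof -
  interpret env_based B using basis one by unfold_locales
  have part1: "\<forall>x y z w. distinct [x, y, z, w] \<longrightarrow> Ids = T_ideal_gen ut2_scale ut2_L B (rels x y z w)"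
    using identities by blast
  have part2: "\<forall>n\<ge>1. codimension ut2_scale B n = 2 ^ (n - 1) * n + 1"
    by (simp add: codimension_edges card_edge_colourings)
  have part3: "(\<forall>\<sigma>. \<sigma> permutes {1..n} \<longrightarrow>
       cocharacter ut2_scale B n \<sigma> = (\<Sum>\<mu>\<in>partitions n. of_nat (m \<mu>) * irr_char \<mu> \<sigma>)) \<longleftrightarrow>
      (\<forall>\<mu>\<in>partitions n. m \<mu> = multiplicity_at \<mu>)" if "1 \<le> n" for n m
    using multiplicities_iff[where 'a = 'a, OF that, of m]
    by (simp add: cocharacter_edges[OF that] colouring_char_edges)
  show ?thesis
    unfolding \<delta>_def X_def act_def
    using part1 part2 part3 multiplicity_at_iff by (intro conjI allI impI) (blast, blast, simp)
qed

end
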